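(* Assume that $k=-3+\frac uv$ is an admissible level, where $u,v$ are coprime positive integers, $u\ge3$, and $v\geq4$. Then for each $r,s\in\mathbb Z$ and $\lambda\in\mathbb C$, $$\widetilde{\mathcal V_k}\otimes\mathcal P_s\otimes\Pi(0).e^{\frac r2d_2+\lambda c_2}$$ is a logarithmic $L_k(\mathfrak{sl}_3)$-module of $L_{sug}(0)$-nilpotent rank three.
   Context: $V^k(\mathfrak{sl}_3)$ is the universal affine vertex algebra, $L_k(\mathfrak{sl}_3)$ its simple quotient, $L_{sug}$ its Sugawara Virasoro field. Notation: $e_1=e_{1,2}$, $e_2=e_{2,3}$, $e_3=e_{1,3}$, $h_1=e_{1,1}-e_{2,2}$, $h_2=e_{2,2}-e_{3,3}$, $f_1=e_{2,1}$, $f_2=e_{3,2}$, $f_3=e_{3,1}=[f_2,f_1]$. $\mathcal W^k$ is the universal Bershadsky-Polyakov algebra, freely and strongly generated by $J,G^\pm,L^{\rm BP}$: $L^{\rm BP}$ is Virasoro of central charge $-\frac{(2k+3)(3k+1)}{k+3}$; $J$, $G^\pm$ primary of weights $1$, $\frac32$; $J(z)J(w)\sim\frac{2k+3}{3(z-w)^2}$; $J(z)G^\pm(w)\sim\frac{\pm G^\pm(w)}{z-w}$; $G^\pm G^\pm\sim0$; $G^+(z)G^-(w)\sim\frac{(k+1)(2k+3)}{(z-w)^3}+\frac{3(k+1)J(w)}{(z-w)^2}+\frac1{z-w}\big(3{:}J^2{:}+\frac{3(k+1)}2\partial J-(k+3)L^{\rm BP}\big)(w)$. $\mathcal W_k$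 is its simple quotient. Half-lattice algebras: for Heisenberg fields $c,d$ with $c(z)d(w)\sim\frac2{(z-w)^2}$, $cc\sim0\sim dd$, $\Pi(0)$ is the vertex algebra generated by $c,d,e^{\pm c}$. Two copies are used: one with generators $c,d$ inside $\mathcal V_k$ below, and one with generators $c_2,d_2$ appearing as the last tensor factor. The module $\widetilde{\mathcal V_k}$. $\mathcal Z^k=\mathcal W^k(\mathfrak{sl}_3,f_{prin})$ is the universal Zamolodchikov $W_3$ algebra with generators $T(z)=\sum T_nz^{-n-2}$ (Virasoro of central charge $-\frac{2(3k+5)(4k+9)}{k+3}$) and $W(z)=\sum W_nz^{-n-3}$ (primary of weight 3), normalized by the free field realization with $\widetilde\alpha_i(z)\widetilde\alpha_j(w)\sim\frac{(k+3)a_{ij}}{(z-w)^2}$ ($a_{ij}$ the $\mathfrak{sl}_3$ Cartan matrix): $T=\frac1{k+3}\big((k+2)\partial(\widetilde\alpha_1+\widetilde\alpha_2)+\frac13{:}\widetilde\alpha_1^2+\widetilde\alpha_1\widetilde\alpha_2+\widetilde\alpha_2^2{:}\big)$, $W=-\frac{(k+2)^2}6\partial^2(\widetilde\alpha_1-\widetilde\alpha_2)-\frac{k+2}6{:}\big((\partial\widetilde\alpha_1)(2\widetilde\alpha_1+\widetilde\alpha_2)-(\widetilde\alpha_1+2\widetilde\alpha_2)\partial\widetilde\alpha_2\big){:}-\frac1{27}{:}(2\widetilde\alpha_1^3+3\widetilde\alpha_1^2\widetilde\alpha_2-3\widetilde\alpha_1\widetilde\alpha_2^2-2\widetilde\alpha_2^3){:}$.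 $\mathcal Z_k$ is its simple quotient. $L_{11;12}$ is the irreducible highest weight $\mathcal Z^k$-module with highest weight vector $v[11;12]$, $T_0v=\frac{4k+9}3v$, $W_0v=-\frac{(k+3)(4k+9)(5k+12)}{27}v$; for the levels considered it is a $\mathcal Z_k$-module. Put $i=-\frac{2k+3}6c+\frac12d$. There is an embedding $\mathcal W_k\hookrightarrow\mathcal Z_k\otimes\Pi(0)$ (known, valid for $2k+3\notin\mathbb Z_{\ge0}$): $J\mapsto\frac{2k+3}6c+\frac12d$, $G^+\mapsto e^c$, $G^-\mapsto(W+\frac{(k+2)(k+3)}2\partial T)\otimes e^{-c}+(k+3)T\otimes i_{-1}e^{-c}-\mathbf1\otimes(i_{-1}^3+3(k+2)i_{-1}i_{-2}+2(k+2)^2i_{-3})e^{-c}$. Let $E=L_{11;12}\otimes\Pi(0)e^i$ and $\mathcal V_k=\mathcal Z_k\otimes\Pi(0)\oplus E$, a vertex algebra with $Y(u,z)a=e^{zD}Y_E(a,-z)u$ for $u\in E$, $a\in\mathcal Z_k\otimes\Pi(0)$ ($D$ the translation operator), $Y(u,z)u'=0$ for $u,u'\in E$. Put $s_0=v[11;12]\otimes e^i$, $Y(s_0,z)=\sum s_0(n)z^{-n-1}$, $\Delta(s_0,z)=z^{s_0(0)}\exp\big(\sum_{n\ge1}\frac{s_0(n)}{-n}(-z)^{-n}\big)$. $\widetilde{\mathcal V_k}$ is the vector space $\mathcal V_k$ with the $\mathcal W_k$-action $\widetilde Y(a,z)=Y(\Delta(s_0,z)a,z)$, $a\in\mathcal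 W_k$; the zero mode of $L^{\rm BP}$ acts on it as $L^{\rm BP}(0)+s_0(0)$. $\mathcal S$ is the $\beta\gamma$ vertex algebra, $\beta(z)\gamma(w)\sim\frac1{z-w}$, with Virasoro field $L^{\mathcal S}={:}(\partial\gamma)\beta{:}$. $\mathcal P_s$, $s\in\mathbb Z$, are the known logarithmic projective $\mathcal S$-modules (Allen-Wood): $\mathcal P_s$ is the projective cover, in the category of finite length weight $\mathcal S$-modules (with semisimple action of the zero mode of ${:}\gamma\beta{:}$, real weights) generated by spectral flows of $\mathcal S$ and of the relaxed modules, of the spectral flow twist $\sigma^s(\mathcal S)$. It is known that $L^{\mathcal S}(0)$ has nilpotent rank two on $\mathcal P_s$. $L_k(\mathfrak{sl}_3)$ acts through the embedding $L_k(\mathfrak{sl}_3)\hookrightarrow\mathcal W_k\otimes\mathcal S\otimes\Pi(0)$ ($\Pi(0)$ generated by $c_2,d_2,e^{\pm c_2}$), induced by $e_1\mapsto-\gamma e^{c_2}$, $e_2\mapsto\beta$, $e_3\mapsto e^{c_2}$, $h_1\mapsto-2J+{:}\gamma\beta{:}-\frac{2k+9}6c_2+\frac12d_2$, $h_2\mapsto J-2{:}\gamma\beta{:}+\frac{4k+9}6c_2+\frac12d_2$, $f_1\mapsto G^+-{:}(2J+\frac{8k+9}6c_2-\frac12d_2)\beta e^{-c_2}{:}+(k+1)(\partial\beta)e^{-c_2}$, $f_2\mapsto G^-e^{-c_2}+(J+\frac{4k+9}6c_2+\frac12d_2)\gamma+k\,\partial\gamma-{:}\gamma^2\beta{:}$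 ($f_3$ determined by $f_3=[f_2,f_1]$), under which $L_{sug}\mapsto L^{\rm BP}+\frac12\partial J+{:}(\partial\gamma)\beta{:}+\frac12{:}c_2d_2{:}+\frac k3\partial c_2-\frac12\partial d_2$. A module is logarithmic if the Virasoro zero mode $L(0)$ does not act semisimply; it has $L(0)$-nilpotent rank $r$ if the nilpotent part $N_0$ of $L(0)$ satisfies $N_0^r=0$, $N_0^{r-1}\ne0$. *)

theory Defs
  imports "HOL-Analysis.Analysis" "HOL-Library.Poly_Mapping"
begin

section \<open>Complex vector spaces\<close>

class complex_vector = ab_group_add +
  fixes scaleC :: "complex \<Rightarrow> 'a \<Rightarrow> 'a" (infixr "*\<^sub>C" 75)
  assumes scaleC_add_right: "c *\<^sub>C (x + y) = c *\<^sub>C x + c *\<^sub>C y"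
    and scaleC_add_left: "(b + c) *\<^sub>C x = b *\<^sub>C x + c *\<^sub>C x"
    and scaleC_scaleC: "b *\<^sub>C (c *\<^sub>C x) = (b * c) *\<^sub>C x"
    and scaleC_one: "1 *\<^sub>C x = x"

global_interpretation cvec: vector_space "scaleC :: complex \<Rightarrow> 'a \<Rightarrow> 'a::complex_vector"
  by unfold_locales (simp_all add: scaleC_add_right scaleC_add_left scaleC_scaleC scaleC_one)

abbreviation clinear :: "('a::complex_vector \<Rightarrow> 'b::complex_vector) \<Rightarrow> bool" where
  "clinear \<equiv> Vector_Spaces.linear scaleC scaleC"

definition cbilinear ::
  "('a::complex_vector \<Rightarrow> 'b::complex_vector \<Rightarrow> 'c::complex_vector) \<Rightarrow> bool" where
  "cbilinear f \<longleftrightarrow> (\<forall>y. clinear (\<lambda>x. f x y)) \<and> (\<forall>x. clinear (f x))"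

instantiation complex :: complex_vector
begin
definition scaleC_complex :: "complex \<Rightarrow> complex \<Rightarrow> complex" where
  "scaleC_complex c x = c * x"
instance by standard (simp_all add: scaleC_complex_def algebra_simps)
end

instantiation prod :: (complex_vector, complex_vector) complex_vector
begin
definition scaleC_prod :: "complex \<Rightarrow> 'a \<times> 'b \<Rightarrow> 'a \<times> 'b" where
  "scaleC_prod c x = (c *\<^sub>C fst x, c *\<^sub>C snd x)"
instance by standard
  (simp_all add: scaleC_prod_def plus_prod_def scaleC_add_right scaleC_add_left
    scaleC_scaleC scaleC_one)
end

instantiation poly_mapping :: (type, complex_vector) complex_vector
begin
lift_definition scaleC_poly_mapping ::
  "complex \<Rightarrow> ('a \<Rightarrow>\<^sub>0 'b) \<Rightarrow> ('a \<Rightarrow>\<^sub>0 'b)" is "\<lambda>c f a. c *\<^sub>C f a"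
  by (auto elim: finite_subset[rotated])
instance by standard
  (transfer; simp add: fun_eq_iff scaleC_add_right scaleC_add_left scaleC_scaleC scaleC_one)+
end


section \<open>Tensor products\<close>

definition tensor_relators ::
  "(('a::complex_vector \<times> 'b::complex_vector) \<Rightarrow>\<^sub>0 complex) set" where
  "tensor_relators =
     {Poly_Mapping.single (a + a', b) 1 - Poly_Mapping.single (a, b) 1
        - Poly_Mapping.single (a', b) 1 | a a' b. True}
   \<union> {Poly_Mapping.single (a, b + b') 1 - Poly_Mapping.single (a, b) 1
        - Poly_Mapping.single (a, b') 1 | a b b'. True}
   \<union> {Poly_Mapping.single (c *\<^sub>C a, b) 1 - c *\<^sub>C Poly_Mapping.single (a, b) 1 | a b c. True}
   \<union> {Poly_Mapping.single (a, c *\<^sub>C b) 1 - c *\<^sub>C Poly_Mapping.single (a, b) 1 | a b c. True}"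

definition tensor_rel ::
  "(('a::complex_vector \<times> 'b::complex_vector) \<Rightarrow>\<^sub>0 complex) \<Rightarrow> ('a \<times> 'b \<Rightarrow>\<^sub>0 complex) \<Rightarrow> bool" where
  "tensor_rel x y \<longleftrightarrow> x - y \<in> cvec.span tensor_relators"

lemma tensor_rel_refl: "tensor_rel x x"
  by (simp add: tensor_rel_def cvec.span_zero)

lemma tensor_rel_sym: "tensor_rel x y \<Longrightarrow> tensor_rel y x"
  unfolding tensor_rel_def by (drule cvec.span_neg) simp

lemma tensor_rel_trans: "tensor_rel x y \<Longrightarrow> tensor_rel y z \<Longrightarrow> tensor_rel x z"
  unfolding tensor_rel_def by (drule (1) cvec.span_add) simp

quotient_type (overloaded) ('a, 'b) tensor =
  "('a::complex_vector \<times> 'b::complex_vector) \<Rightarrow>\<^sub>0 complex" / tensor_rel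
  by (intro equivpI reflpI sympI transpI)
    (rule tensor_rel_refl, erule tensor_rel_sym, erule (1) tensor_rel_trans)

instantiation tensor :: (complex_vector, complex_vector) complex_vector
begin
lift_definition zero_tensor :: "('a, 'b) tensor" is 0 .
lift_definition plus_tensor :: "('a, 'b) tensor \<Rightarrow> ('a, 'b) tensor \<Rightarrow> ('a, 'b) tensor" is "(+)"
proof (unfold tensor_rel_def)
  fix x x' y y' :: "('a \<times> 'b) \<Rightarrow>\<^sub>0 complex"
  assume "x - x' \<in> cvec.span tensor_relators" "y - y' \<in> cvec.span tensor_relators"
  from cvec.span_add[OF this] show "x + y - (x' + y') \<in> cvec.span tensor_relators"
    by (simp add: algebra_simps)
qed
lift_definition uminus_tensor :: "('a, 'b) tensor \<Rightarrow> ('a, 'b) tensor" is uminus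
proof (unfold tensor_rel_def)
  fix x x' :: "('a \<times> 'b) \<Rightarrow>\<^sub>0 complex"
  assume "x - x' \<in> cvec.span tensor_relators"
  from cvec.span_neg[OF this] show "- x - - x' \<in> cvec.span tensor_relators"
    by (simp add: algebra_simps)
qed
lift_definition minus_tensor :: "('a, 'b) tensor \<Rightarrow> ('a, 'b) tensor \<Rightarrow> ('a, 'b) tensor" is "(-)"
proof (unfold tensor_rel_def)
  fix x x' y y' :: "('a \<times> 'b) \<Rightarrow>\<^sub>0 complex"
  assume "x - x' \<in> cvec.span tensor_relators" "y - y' \<in> cvec.span tensor_relators"
  from cvec.span_diff[OF this] show "x - y - (x' - y') \<in> cvec.span tensor_relators"
    by (simp add: algebra_simps)
qed
lift_definition scaleC_tensor :: "complex \<Rightarrow> ('a, 'b) tensor \<Rightarrow> ('a, 'b) tensor" is scaleC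
proof (unfold tensor_rel_def)
  fix s :: complex and x x' :: "('a \<times> 'b) \<Rightarrow>\<^sub>0 complex"
  assume "x - x' \<in> cvec.span tensor_relators"
  from cvec.span_scale[OF this] show "s *\<^sub>C x - s *\<^sub>C x' \<in> cvec.span tensor_relators"
    by (simp add: cvec.scale_right_diff_distrib)
qed
instance
proof
  fix a b c :: "('a, 'b) tensor" and s t :: complex
  show "a + b + c = a + (b + c)"
    by transfer (simp add: tensor_rel_refl add.assoc)
  show "a + b = b + a"
    by transfer (simp add: tensor_rel_refl add.commute)
  show "0 + a = a" by transfer (simp add: tensor_rel_refl)
  show "- a + a = 0" by transfer (simp add: tensor_rel_refl)
  show "a - b = a + - b" by transfer (simp add: tensor_rel_refl)
  show "s *\<^sub>C (a + b) = s *\<^sub>C a + s *\<^sub>C b"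
    by transfer (simp add: tensor_rel_refl scaleC_add_right)
  show "(s + t) *\<^sub>C a = s *\<^sub>C a + t *\<^sub>C a"
    by transfer (simp add: tensor_rel_refl scaleC_add_left)
  show "s *\<^sub>C t *\<^sub>C a = (s * t) *\<^sub>C a"
    by transfer (simp add: tensor_rel_refl)
  show "1 *\<^sub>C a = a" by transfer (simp add: tensor_rel_refl)
qed
end

lift_definition tensor_of :: "'a::complex_vector \<Rightarrow> 'b::complex_vector \<Rightarrow> ('a, 'b) tensor"
  (infixl "\<otimes>" 76) is "\<lambda>a b. Poly_Mapping.single (a, b) 1" .

definition tensor_lift ::
  "('a::complex_vector \<Rightarrow> 'b::complex_vector \<Rightarrow> 'c::complex_vector) \<Rightarrow> ('a, 'b) tensor \<Rightarrow> 'c" where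
  "tensor_lift f = (THE g. clinear g \<and> (\<forall>a b. g (a \<otimes> b) = f a b))"

lemma clinearI:
  assumes "\<And>x y. f (x + y) = f x + f y" "\<And>c x. f (c *\<^sub>C x) = c *\<^sub>C f x"
  shows "clinear f"
  using assms by (simp add: Vector_Spaces.linear_iff cvec.vector_space_axioms)

lemma clinear_add: "clinear f \<Longrightarrow> f (x + y) = f x + f y"
  by (simp add: Vector_Spaces.linear_iff)

lemma clinear_scaleC: "clinear f \<Longrightarrow> f (c *\<^sub>C x) = c *\<^sub>C f x"
  by (simp add: Vector_Spaces.linear_iff)

text \<open>Both defining properties of \<open>tensor_lift f\<close> hold for bilinear \<open>f\<close>.\<close>

lemma tensor_lift_ex1:
  assumes f: "cbilinear f"
  shows "\<exists>!g. clinear g \<and> (\<forall>a b. g (a \<otimes> b) = f a b)"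
proof -
  let ?h = "\<lambda>p. case p of (a, b) \<Rightarrow> f a b"
  define F where "F x = (\<Sum>p\<in>Poly_Mapping.keys x. Poly_Mapping.lookup x p *\<^sub>C ?h p)" for x
  have F_superset: "F x = (\<Sum>p\<in>A. Poly_Mapping.lookup x p *\<^sub>C ?h p)"
    if "finite A" "Poly_Mapping.keys x \<subseteq> A" for x A
    unfolding F_def by (rule sum.mono_neutral_left) (use that in \<open>auto simp: in_keys_iff\<close>)
  have F_add: "F (x + y) = F x + F y" for x y
  proof -
    let ?A = "Poly_Mapping.keys x \<union> Poly_Mapping.keys y"
    show ?thesis
      using Poly_Mapping.keys_add[of x y]
      by (simp add: F_superset[of ?A] lookup_add scaleC_add_left sum.distrib)
  qed
  have F_scale: "F (c *\<^sub>C x) = c *\<^sub>C F x" for c x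
  proof -
    have "Poly_Mapping.keys (c *\<^sub>C x) \<subseteq> Poly_Mapping.keys x"
      by (auto simp: in_keys_iff scaleC_poly_mapping.rep_eq)
    then show ?thesis
      by (simp add: F_superset[of "Poly_Mapping.keys x"] scaleC_poly_mapping.rep_eq
        cvec.scale_sum_right scaleC_complex_def)
  qed
  have F_lin: "clinear F" by (rule clinearI) (simp_all add: F_add F_scale)
  have F_diff: "F (x - y) = F x - F y" for x y
    using F_add[of "x - y" y] by simp
  have F_single: "F (Poly_Mapping.single (a, b) 1) = f a b" for a b
    by (simp add: F_def)
  have lin: "clinear (\<lambda>a. f a b)" "clinear (f a)" for a b
    using f by (simp_all add: cbilinear_def)
  note f_simps = clinear_add[OF lin(1)] clinear_add[OF lin(2)]
    clinear_scaleC[OF lin(1)] clinear_scaleC[OF lin(2)]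
  have "F x = 0" if "x \<in> cvec.span tensor_relators" for x
    using that
  proof (induction rule: cvec.span_induct_alt)
    case base
    show ?case using F_scale[of 0 0] by simp
  next
    case (step c x y)
    have "F x = 0"
      using step(1) unfolding tensor_relators_def
      by (elim UnE CollectE exE conjE) (simp_all add: F_diff F_scale F_single f_simps)
    then show ?case using step by (simp add: F_add F_scale)
  qed
  then have resp: "F x = F y" if "tensor_rel x y" for x y
    using that by (metis F_diff eq_iff_diff_eq_0 tensor_rel_def)
  define g where "g t = F (rep_tensor t)" for t
  have g_abs: "g (abs_tensor x) = F x" for x
  proof -
    have "abs_tensor (rep_tensor (abs_tensor x)) = abs_tensor x"
      by (rule Quotient3_abs_rep[OF Quotient3_tensor])
    then show ?thesis unfolding g_def by (intro resp) (simp only: tensor.abs_eq_iff)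
  qed
  have g_lin: "clinear g"
  proof (rule clinearI)
    show "g (t + w) = g t + g w" for t w
      by (induction t rule: tensor.abs_induct; induction w rule: tensor.abs_induct)
        (simp add: plus_tensor.abs_eq g_abs F_add)
    show "g (c *\<^sub>C t) = c *\<^sub>C g t" for c t
      by (induction t rule: tensor.abs_induct) (simp add: scaleC_tensor.abs_eq g_abs F_scale)
  qed
  have unique: "g' = g" if g': "clinear g'" "\<forall>a b. g' (a \<otimes> b) = f a b" for g'
  proof -
    have "g' (abs_tensor x) = F x" for x
    proof (induction x rule: update_induct)
      case const
      show ?case
        using F_scale[of 0 0] clinear_scaleC[OF g'(1), of 0 0] by (simp add: zero_tensor_def)
    next
      case (update x p c)
      obtain a b where p: "p = (a, b)" by force
      have "Poly_Mapping.update p c x = x + c *\<^sub>C Poly_Mapping.single p 1"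
        using update(1)
        by (intro poly_mapping_eqI)
          (auto simp: lookup_add lookup_update scaleC_poly_mapping.rep_eq in_keys_iff
            lookup_single scaleC_complex_def when_def)
      moreover have "g' (abs_tensor (x + c *\<^sub>C Poly_Mapping.single p 1)) = F x + c *\<^sub>C f a b"
        using update(3) g'(2)
        by (simp add: plus_tensor.abs_eq[symmetric] scaleC_tensor.abs_eq[symmetric]
          clinear_add[OF g'(1)] clinear_scaleC[OF g'(1)] p tensor_of.abs_eq[symmetric])
      ultimately show ?case by (simp add: F_add F_scale F_single p)
    qed
    then have "g' t = g t" for t
      by (induction t rule: tensor.abs_induct) (simp add: g_abs)
    then show ?thesis by blast
  qed
  show ?thesis
    by (rule ex1I[of _ g]) (auto simp: g_lin tensor_of.abs_eq g_abs F_single unique)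
qed

lemma clinear_tensor_lift: "cbilinear f \<Longrightarrow> clinear (tensor_lift f)"
  and tensor_lift_tensor_of: "cbilinear f \<Longrightarrow> tensor_lift f (a \<otimes> b) = f a b"
  unfolding tensor_lift_def using theI'[OF tensor_lift_ex1] by blast+


section \<open>Vertex algebras and their modules\<close>

text \<open>\<open>nprod V a n b\<close> is the \<open>n\<close>-th product of \<open>a\<close> and \<open>b\<close>: the coefficient of
  \<open>z ^ (- n - 1)\<close> in \<open>Y(a,z) b\<close>. Likewise \<open>act a n x\<close> for a module.  Conformal modes are shifted,
  e.g. the zero mode of a Virasoro field is \<open>act L 1\<close>.\<close>

record 'a va =
  vacuum :: 'a
  nprod :: "'a \<Rightarrow> int \<Rightarrow> 'a \<Rightarrow> 'a"

definition va_module ::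
  "'a::complex_vector va \<Rightarrow> ('a \<Rightarrow> int \<Rightarrow> 'm::complex_vector \<Rightarrow> 'm) \<Rightarrow> bool" where
  "va_module V act \<longleftrightarrow>
     (\<forall>n. cbilinear (\<lambda>a. act a n)) \<and>
     (\<forall>a x. \<exists>N. \<forall>n\<ge>N. act a n x = 0) \<and>
     (\<forall>n x. act (vacuum V) n x = (if n = - 1 then x else 0)) \<and>
     (\<forall>a b x m n q.
        Sum_any (\<lambda>j::nat. (of_int m gchoose j) *\<^sub>C
            act (nprod V a (n + int j) b) (m + q - int j) x) =
        Sum_any (\<lambda>j::nat. ((- 1) ^ j * (of_int n gchoose j)) *\<^sub>C
            (act a (m + n - int j) (act b (q + int j) x)
             - ((- 1) powi n) *\<^sub>C act b (n + q - int j) (act a (m + int j) x))))"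

definition vertex_algebra :: "'a::complex_vector va \<Rightarrow> bool" where
  "vertex_algebra V \<longleftrightarrow> va_module V (nprod V) \<and>
     (\<forall>a. nprod V a (- 1) (vacuum V) = a \<and> (\<forall>n\<ge>0. nprod V a n (vacuum V) = 0))"

abbreviation der :: "'a::complex_vector va \<Rightarrow> 'a \<Rightarrow> 'a" where
  "der V a \<equiv> nprod V a (- 2) (vacuum V)"

abbreviation nop :: "'a::complex_vector va \<Rightarrow> 'a \<Rightarrow> 'a \<Rightarrow> 'a" where
  "nop V a b \<equiv> nprod V a (- 1) b"

text \<open>\<open>ope V a b [x\<^sub>0, x\<^sub>1, \<dots>]\<close> says that \<open>a(z) b(w)\<close> has singular part
  \<open>x\<^sub>0(w) / (z - w) + x\<^sub>1(w) / (z - w)\<^sup>2 + \<dots>\<close>.\<close>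

definition ope :: "'a::complex_vector va \<Rightarrow> 'a \<Rightarrow> 'a \<Rightarrow> 'a list \<Rightarrow> bool" where
  "ope V a b xs \<longleftrightarrow> (\<forall>j::nat. nprod V a (int j) b = (if j < length xs then xs ! j else 0))"

definition virasoro :: "'a::complex_vector va \<Rightarrow> complex \<Rightarrow> 'a \<Rightarrow> bool" where
  "virasoro V cc L \<longleftrightarrow> ope V L L [der V L, 2 *\<^sub>C L, 0, (cc / 2) *\<^sub>C vacuum V]"

definition primary :: "'a::complex_vector va \<Rightarrow> 'a \<Rightarrow> complex \<Rightarrow> 'a \<Rightarrow> bool" where
  "primary V L h a \<longleftrightarrow> ope V L a [der V a, h *\<^sub>C a]"

definition va_hom :: "'a::complex_vector va \<Rightarrow> 'b::complex_vector va \<Rightarrow> ('a \<Rightarrow> 'b) \<Rightarrow> bool" where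
  "va_hom V V' f \<longleftrightarrow> clinear f \<and> f (vacuum V) = vacuum V' \<and>
     (\<forall>a n b. f (nprod V a n b) = nprod V' (f a) n (f b))"

definition module_map :: "('a \<Rightarrow> int \<Rightarrow> 'm::complex_vector \<Rightarrow> 'm) \<Rightarrow>
    ('a \<Rightarrow> int \<Rightarrow> 'n::complex_vector \<Rightarrow> 'n) \<Rightarrow> ('m \<Rightarrow> 'n) \<Rightarrow> bool" where
  "module_map act act' f \<longleftrightarrow> clinear f \<and> (\<forall>a n x. f (act a n x) = act' a n (f x))"

definition submodule :: "('a \<Rightarrow> int \<Rightarrow> 'm::complex_vector \<Rightarrow> 'm) \<Rightarrow> 'm set \<Rightarrow> bool" where
  "submodule act U \<longleftrightarrow> cvec.subspace U \<and> (\<forall>a n. \<forall>x\<in>U. act a n x \<in> U)"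

definition irreducible_module :: "('a \<Rightarrow> int \<Rightarrow> 'm::complex_vector \<Rightarrow> 'm) \<Rightarrow> bool" where
  "irreducible_module act \<longleftrightarrow> (\<exists>x::'m. x \<noteq> 0) \<and>
     (\<forall>U. submodule act U \<longrightarrow> U = {0} \<or> U = UNIV)"

definition va_ideal :: "'a::complex_vector va \<Rightarrow> 'a set \<Rightarrow> bool" where
  "va_ideal V I \<longleftrightarrow> cvec.subspace I \<and>
     (\<forall>a n. \<forall>x\<in>I. nprod V a n x \<in> I \<and> nprod V x n a \<in> I)"

definition simple_va :: "'a::complex_vector va \<Rightarrow> bool" where
  "simple_va V \<longleftrightarrow> vertex_algebra V \<and> (\<exists>x::'a. x \<noteq> 0) \<and>
     (\<forall>I. va_ideal V I \<longrightarrow> I = {0} \<or> I = UNIV)"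

definition simple_quotient ::
  "'a::complex_vector va \<Rightarrow> 'b::complex_vector va \<Rightarrow> ('a \<Rightarrow> 'b) \<Rightarrow> bool" where
  "simple_quotient V S p \<longleftrightarrow> simple_va S \<and> va_hom V S p \<and> surj p"

definition va_generated :: "'a::complex_vector va \<Rightarrow> 'a set \<Rightarrow> bool" where
  "va_generated V G \<longleftrightarrow>
     (\<forall>U. cvec.subspace U \<and> vacuum V \<in> U \<and> G \<subseteq> U \<and>
          (\<forall>a\<in>U. \<forall>b\<in>U. \<forall>n. nprod V a n b \<in> U) \<longrightarrow> U = UNIV)"

text \<open>PBW basis: a pair \<open>(n, i)\<close> stands for the mode of index \<open>- n\<close> of the \<open>i\<close>-th generator.\<close>

definition pbw_index :: "nat \<Rightarrow> (nat \<times> nat) list set" where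
  "pbw_index N = {xs. (\<forall>(n, i)\<in>set xs. 1 \<le> n \<and> i < N) \<and>
     sorted_wrt (\<lambda>(n, i) (m, j). n > m \<or> n = m \<and> i \<le> j) xs}"

definition pbw_monomial :: "'a::complex_vector va \<Rightarrow> 'a list \<Rightarrow> (nat \<times> nat) list \<Rightarrow> 'a" where
  "pbw_monomial V gs xs = foldr (\<lambda>(n, i) y. nprod V (gs ! i) (- int n) y) xs (vacuum V)"

definition freely_strongly_generated :: "'a::complex_vector va \<Rightarrow> 'a list \<Rightarrow> bool" where
  "freely_strongly_generated V gs \<longleftrightarrow>
     inj_on (pbw_monomial V gs) (pbw_index (length gs)) \<and>
     \<not> cvec.dependent (pbw_monomial V gs ` pbw_index (length gs)) \<and>
     cvec.span (pbw_monomial V gs ` pbw_index (length gs)) = UNIV"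

text \<open>\<open>(a \<otimes> b)\<^sub>(\<^sub>n\<^sub>) (x \<otimes> y)\<close> is the sum over \<open>i\<close> of \<open>a\<^sub>(\<^sub>i\<^sub>) x \<otimes> b\<^sub>(\<^sub>n\<^sub>-\<^sub>1\<^sub>-\<^sub>i\<^sub>) y\<close>.\<close>

definition tensor_act ::
  "('a::complex_vector \<Rightarrow> int \<Rightarrow> 'm::complex_vector \<Rightarrow> 'm) \<Rightarrow>
   ('b::complex_vector \<Rightarrow> int \<Rightarrow> 'n::complex_vector \<Rightarrow> 'n) \<Rightarrow>
   ('a, 'b) tensor \<Rightarrow> int \<Rightarrow> ('m, 'n) tensor \<Rightarrow> ('m, 'n) tensor" where
  "tensor_act act act' t n w =
     tensor_lift (\<lambda>a b.
       tensor_lift (\<lambda>x y. Sum_any (\<lambda>i::int. act a i x \<otimes> act' b (n - 1 - i) y)) w) t"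

definition tensor_va ::
  "'a::complex_vector va \<Rightarrow> 'b::complex_vector va \<Rightarrow> ('a, 'b) tensor va" where
  "tensor_va A B = \<lparr>vacuum = vacuum A \<otimes> vacuum B, nprod = tensor_act (nprod A) (nprod B)\<rparr>"

text \<open>The algebra \<open>A \<oplus> E\<close> for an \<open>A\<close>-module \<open>E\<close> with translation operator \<open>D\<close>, where
  \<open>Y(u,z) b = e\<^bsup>zD\<^esup> Y\<^sub>E(b,-z) u\<close> and \<open>Y(u,z) u' = 0\<close> for \<open>u, u'\<close> in \<open>E\<close> and \<open>b\<close> in \<open>A\<close>.\<close>

definition skew_prod :: "('a \<Rightarrow> int \<Rightarrow> 'm::complex_vector \<Rightarrow> 'm) \<Rightarrow> ('m \<Rightarrow> 'm) \<Rightarrow>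
    'm \<Rightarrow> int \<Rightarrow> 'a \<Rightarrow> 'm" where
  "skew_prod act D u n b =
     Sum_any (\<lambda>j::nat. ((- 1) powi (n + int j + 1) / fact j) *\<^sub>C (D ^^ j) (act b (n + int j) u))"

definition extension_va :: "'a::complex_vector va \<Rightarrow> ('a \<Rightarrow> int \<Rightarrow> 'm::complex_vector \<Rightarrow> 'm) \<Rightarrow>
    ('m \<Rightarrow> 'm) \<Rightarrow> ('a \<times> 'm) va" where
  "extension_va A act D =
     \<lparr>vacuum = (vacuum A, 0),
      nprod = (\<lambda>(a, u) n (b, w). (nprod A a n b, act a n w + skew_prod act D u n b))\<rparr>"


section \<open>Li's operator\<close>

text \<open>\<open>delta_exp V s m a\<close> is the coefficient of \<open>z ^ (- m)\<close> in
  \<open>exp (\<Sum>\<^sub>n\<^sub>\<ge>\<^sub>1 s(n) / (-n) * (-z)\<^bsup>-n\<^esup>) a\<close>; the \<open>l\<close>-th power of the exponent contributes the words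
  of length \<open>l\<close>.  With \<open>z\<^bsup>s(0)\<^esup> = exp (s(0) log z)\<close>, \<open>delta_coeff V s m j a\<close> is the
  coefficient of \<open>z ^ (- m) * (log z) ^ j\<close> in \<open>\<Delta>(s,z) a\<close>.\<close>

definition delta_exp :: "'a::complex_vector va \<Rightarrow> 'a \<Rightarrow> nat \<Rightarrow> 'a \<Rightarrow> 'a" where
  "delta_exp V s m a =
     (\<Sum>ns \<in> {ns. (\<forall>n\<in>set ns. 1 \<le> n) \<and> sum_list ns = m}.
        (1 / fact (length ns)) *\<^sub>C
        foldr (\<lambda>n y. ((- 1) ^ n / (- of_nat n)) *\<^sub>C nprod V s (int n) y) ns a)"

definition delta_coeff :: "'a::complex_vector va \<Rightarrow> 'a \<Rightarrow> nat \<Rightarrow> nat \<Rightarrow> 'a \<Rightarrow> 'a" where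
  "delta_coeff V s m j a = (1 / fact j) *\<^sub>C (nprod V s 0 ^^ j) (delta_exp V s m a)"

definition delta_log_free :: "'a::complex_vector va \<Rightarrow> 'a \<Rightarrow> 'a \<Rightarrow> bool" where
  "delta_log_free V s a \<longleftrightarrow> (\<forall>m j. 0 < j \<longrightarrow> delta_coeff V s m j a = 0)"

text \<open>The coefficient of \<open>z ^ (- n - 1)\<close> in \<open>Y(\<Delta>(s,z) a, z) b\<close>, for \<open>a\<close> with
  \<open>\<Delta>(s,z) a\<close> free of logarithms.\<close>

definition delta_act :: "'a::complex_vector va \<Rightarrow> 'a \<Rightarrow> 'a \<Rightarrow> int \<Rightarrow> 'a \<Rightarrow> 'a" where
  "delta_act V s a n b = Sum_any (\<lambda>m::nat. nprod V (delta_coeff V s m 0 a) (n - int m) b)"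


section \<open>Nilpotent rank\<close>

definition diagonalizable :: "('m::complex_vector \<Rightarrow> 'm) \<Rightarrow> bool" where
  "diagonalizable f \<longleftrightarrow> cvec.span {x. \<exists>c. f x = c *\<^sub>C x} = UNIV"

definition nilpotent_part :: "('m::complex_vector \<Rightarrow> 'm) \<Rightarrow> ('m \<Rightarrow> 'm) \<Rightarrow> bool" where
  "nilpotent_part f N \<longleftrightarrow> clinear N \<and> (\<forall>x. \<exists>n. (N ^^ n) x = 0) \<and>
     diagonalizable (\<lambda>x. f x - N x) \<and> f \<circ> N = N \<circ> f"

definition has_nilpotent_rank :: "('m::complex_vector \<Rightarrow> 'm) \<Rightarrow> nat \<Rightarrow> bool" where
  "has_nilpotent_rank f r \<longleftrightarrow> 0 < r \<and> clinear f \<and>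
     (\<exists>N. nilpotent_part f N \<and> (\<forall>x. (N ^^ r) x = 0) \<and> (\<exists>x. (N ^^ (r - 1)) x \<noteq> 0))"

text \<open>\<open>L\<close> is the Virasoro vector; its zero mode is \<open>act L 1\<close>.\<close>

definition logarithmic_module ::
  "'a::complex_vector va \<Rightarrow> 'a \<Rightarrow> ('a \<Rightarrow> int \<Rightarrow> 'm::complex_vector \<Rightarrow> 'm) \<Rightarrow> bool" where
  "logarithmic_module V L act \<longleftrightarrow> va_module V act \<and> \<not> diagonalizable (act L 1)"


section \<open>The affine vertex algebra of \<open>sl\<^sub>3\<close>\<close>

definition sl3 :: "(complex^3^3) set" where
  "sl3 = {A. trace A = 0}"

definition eM :: "3 \<Rightarrow> 3 \<Rightarrow> complex^3^3" where
  "eM i j = (\<chi> a b. if a = i \<and> b = j then 1 else 0)"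

definition h1M :: "complex^3^3" where "h1M = eM 1 1 - eM 2 2"
definition h2M :: "complex^3^3" where "h2M = eM 2 2 - eM 3 3"

text \<open>The map \<open>x\<close> sends \<open>A\<close> in \<open>sl\<^sub>3\<close> to the vector \<open>A(-1) vac\<close>; its values outside \<open>sl\<^sub>3\<close> are
  irrelevant.\<close>

definition universal_affine_sl3 ::
  "complex \<Rightarrow> 'a::complex_vector va \<Rightarrow> (complex^3^3 \<Rightarrow> 'a) \<Rightarrow> bool" where
  "universal_affine_sl3 k V x \<longleftrightarrow> vertex_algebra V \<and>
     (\<forall>A\<in>sl3. \<forall>B\<in>sl3. x (A + B) = x A + x B) \<and>
     (\<forall>A\<in>sl3. \<forall>c. x (mat c ** A) = c *\<^sub>C x A) \<and>
     (\<forall>A\<in>sl3. \<forall>B\<in>sl3.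
        ope V (x A) (x B) [x (A ** B - B ** A), (k * trace (A ** B)) *\<^sub>C vacuum V]) \<and>
     freely_strongly_generated V
       [x (eM 1 2), x (eM 2 3), x (eM 1 3), x h1M, x h2M, x (eM 2 1), x (eM 3 2), x (eM 3 1)]"

text \<open>The Cartan part uses the inverse Cartan matrix, with entries \<open>2/3\<close> and \<open>1/3\<close>.\<close>

definition sugawara :: "complex \<Rightarrow> 'a::complex_vector va \<Rightarrow> (complex^3^3 \<Rightarrow> 'a) \<Rightarrow> 'a" where
  "sugawara k V x = (1 / (2 * (k + 3))) *\<^sub>C
     ((\<Sum>(i, j) \<in> {(i, j). i \<noteq> j}. nop V (x (eM i j)) (x (eM j i)))
      + (2 / 3) *\<^sub>C nop V (x h1M) (x h1M) + (1 / 3) *\<^sub>C nop V (x h1M) (x h2M)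
      + (1 / 3) *\<^sub>C nop V (x h2M) (x h1M) + (2 / 3) *\<^sub>C nop V (x h2M) (x h2M))"


section \<open>The Bershadsky-Polyakov algebra\<close>

definition universal_bp ::
  "complex \<Rightarrow> 'a::complex_vector va \<Rightarrow> 'a \<Rightarrow> 'a \<Rightarrow> 'a \<Rightarrow> 'a \<Rightarrow> bool" where
  "universal_bp k V J Gp Gm L \<longleftrightarrow> vertex_algebra V \<and>
     freely_strongly_generated V [J, Gp, Gm, L] \<and>
     virasoro V (- ((2 * k + 3) * (3 * k + 1) / (k + 3))) L \<and>
     primary V L 1 J \<and> primary V L (3 / 2) Gp \<and> primary V L (3 / 2) Gm \<and>
     ope V J J [0, ((2 * k + 3) / 3) *\<^sub>C vacuum V] \<and>
     ope V J Gp [Gp] \<and> ope V J Gm [- Gm] \<and>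
     ope V Gp Gp [] \<and> ope V Gm Gm [] \<and>
     ope V Gp Gm
       [3 *\<^sub>C nop V J J + (3 * (k + 1) / 2) *\<^sub>C der V J - (k + 3) *\<^sub>C L,
        (3 * (k + 1)) *\<^sub>C J,
        ((k + 1) * (2 * k + 3)) *\<^sub>C vacuum V]"


section \<open>The Zamolodchikov algebra\<close>

definition heisenberg_sl3 ::
  "complex \<Rightarrow> 'a::complex_vector va \<Rightarrow> 'a \<Rightarrow> 'a \<Rightarrow> bool" where
  "heisenberg_sl3 k H a1 a2 \<longleftrightarrow> vertex_algebra H \<and> freely_strongly_generated H [a1, a2] \<and>
     ope H a1 a1 [0, (2 * (k + 3)) *\<^sub>C vacuum H] \<and>
     ope H a2 a2 [0, (2 * (k + 3)) *\<^sub>C vacuum H] \<and>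
     ope H a1 a2 [0, (- (k + 3)) *\<^sub>C vacuum H]"

definition zam_T :: "complex \<Rightarrow> 'a::complex_vector va \<Rightarrow> 'a \<Rightarrow> 'a \<Rightarrow> 'a" where
  "zam_T k H a1 a2 = (1 / (k + 3)) *\<^sub>C
     ((k + 2) *\<^sub>C der H (a1 + a2)
      + (1 / 3) *\<^sub>C (nop H a1 a1 + nop H a1 a2 + nop H a2 a2))"

definition zam_W :: "complex \<Rightarrow> 'a::complex_vector va \<Rightarrow> 'a \<Rightarrow> 'a \<Rightarrow> 'a" where
  "zam_W k H a1 a2 =
     - (((k + 2)\<^sup>2 / 6) *\<^sub>C der H (der H (a1 - a2)))
     - ((k + 2) / 6) *\<^sub>C (nop H (der H a1) (2 *\<^sub>C a1 + a2) - nop H (a1 + 2 *\<^sub>C a2) (der H a2))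
     - (1 / 27) *\<^sub>C (2 *\<^sub>C nop H a1 (nop H a1 a1) + 3 *\<^sub>C nop H a1 (nop H a1 a2)
                  - 3 *\<^sub>C nop H a1 (nop H a2 a2) - 2 *\<^sub>C nop H a2 (nop H a2 a2))"

text \<open>The principal \<open>W\<close>-algebra of \<open>sl\<^sub>3\<close> is identified, through the free field realization \<open>f\<close>,
  with the vertex subalgebra of the Heisenberg algebra generated by the two fields above.\<close>

definition universal_zamolodchikov ::
  "complex \<Rightarrow> 'h::complex_vector va \<Rightarrow> 'h \<Rightarrow> 'h \<Rightarrow> 'a::complex_vector va \<Rightarrow> 'a \<Rightarrow> 'a \<Rightarrow> ('a \<Rightarrow> 'h) \<Rightarrow> bool"
  where
  "universal_zamolodchikov k H a1 a2 V T W f \<longleftrightarrow>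
     heisenberg_sl3 k H a1 a2 \<and> vertex_algebra V \<and> va_generated V {T, W} \<and>
     virasoro V (- (2 * (3 * k + 5) * (4 * k + 9) / (k + 3))) T \<and> primary V T 3 W \<and>
     va_hom V H f \<and> inj f \<and> f T = zam_T k H a1 a2 \<and> f W = zam_W k H a1 a2"

definition zam_irreducible_hw ::
  "'a::complex_vector va \<Rightarrow> 'a \<Rightarrow> 'a \<Rightarrow> complex \<Rightarrow> complex \<Rightarrow>
   ('a \<Rightarrow> int \<Rightarrow> 'm::complex_vector \<Rightarrow> 'm) \<Rightarrow> 'm \<Rightarrow> bool" where
  "zam_irreducible_hw V T W h w act x \<longleftrightarrow>
     va_module V act \<and> irreducible_module act \<and> x \<noteq> 0 \<and>
     act T 1 x = h *\<^sub>C x \<and> act W 2 x = w *\<^sub>C x \<and>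
     (\<forall>n>0. act T (n + 1) x = 0 \<and> act W (n + 2) x = 0)"


section \<open>Half-lattice algebras\<close>

text \<open>\<open>half_lattice_module Q c d e \<mu> r act E\<close> says that \<open>act\<close> is the module
  \<open>\<Pi>(0) e\<^bsup>(r/2) d + \<mu> c\<^esup>\<close>, with \<open>e m\<close> denoting \<open>e\<^bsup>mc\<^esup>\<close> and \<open>E n\<close> denoting
  \<open>e\<^bsup>(r/2) d + (\<mu> + n) c\<^esup>\<close>.  In the normalization used the pairing of \<open>c\<close> and \<open>d\<close> is \<open>2\<close>, so
  \<open>e\<^bsup>mc\<^esup>(z)\<close> acts on \<open>E n\<close> with leading term \<open>z\<^bsup>mr\<^esup> E (m + n)\<close>.\<close>

definition half_lattice_module ::
  "'q::complex_vector va \<Rightarrow> 'q \<Rightarrow> 'q \<Rightarrow> (int \<Rightarrow> 'q) \<Rightarrow> complex \<Rightarrow> int \<Rightarrow>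
   ('q \<Rightarrow> int \<Rightarrow> 'm::complex_vector \<Rightarrow> 'm) \<Rightarrow> (int \<Rightarrow> 'm) \<Rightarrow> bool" where
  "half_lattice_module Q c d e \<mu> r act E \<longleftrightarrow> va_module Q act \<and>
     (\<forall>n. E n \<noteq> 0 \<and>
        act c 0 (E n) = of_int r *\<^sub>C E n \<and>
        act d 0 (E n) = (2 * (\<mu> + of_int n)) *\<^sub>C E n \<and>
        (\<forall>j>0. act c j (E n) = 0 \<and> act d j (E n) = 0)) \<and>
     (\<forall>m n. act (e m) (- m * r - 1) (E n) = E (m + n) \<and>
        (\<forall>j \<ge> - m * r. act (e m) j (E n) = 0)) \<and>
     (\<forall>U. cvec.subspace U \<and> range E \<subseteq> U \<and>
        (\<forall>x\<in>U. \<forall>j<0. act c j x \<in> U \<and> act d j x \<in> U) \<longrightarrow> U = UNIV)"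

text \<open>As a space \<open>\<Pi>(0)\<close> is the direct sum of the Fock modules of \<open>e\<^bsup>nc\<^esup>\<close>, \<open>n\<close> an integer; the last
  condition is \<open>\<partial>e\<^bsup>mc\<^esup> = m :c e\<^bsup>mc\<^esup>:\<close>.\<close>

definition half_lattice ::
  "'q::complex_vector va \<Rightarrow> 'q \<Rightarrow> 'q \<Rightarrow> (int \<Rightarrow> 'q) \<Rightarrow> bool" where
  "half_lattice Q c d e \<longleftrightarrow> vertex_algebra Q \<and>
     ope Q c d [0, 2 *\<^sub>C vacuum Q] \<and> ope Q c c [] \<and> ope Q d d [] \<and>
     half_lattice_module Q c d e 0 0 (nprod Q) e \<and> e 0 = vacuum Q \<and>
     (\<forall>m. der Q (e m) = of_int m *\<^sub>C nop Q c (e m))"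

text \<open>The embedding of the simple Bershadsky-Polyakov algebra \<open>A\<close> in \<open>Z \<otimes> \<Pi>(0)\<close>.\<close>

definition bp_embedding ::
  "complex \<Rightarrow> 'w::complex_vector va \<Rightarrow> 'w \<Rightarrow> 'w \<Rightarrow> 'w \<Rightarrow>
   'z::complex_vector va \<Rightarrow> 'z \<Rightarrow> 'z \<Rightarrow>
   'q::complex_vector va \<Rightarrow> 'q \<Rightarrow> 'q \<Rightarrow> (int \<Rightarrow> 'q) \<Rightarrow> ('w \<Rightarrow> ('z, 'q) tensor) \<Rightarrow> bool" where
  "bp_embedding k A J Gp Gm Z T W Q c d e f \<longleftrightarrow>
     va_hom A (tensor_va Z Q) f \<and> inj f \<and>
     f J = vacuum Z \<otimes> (((2 * k + 3) / 6) *\<^sub>C c + (1 / 2) *\<^sub>C d) \<and>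
     f Gp = vacuum Z \<otimes> e 1 \<and>
     (let i = (- ((2 * k + 3) / 6)) *\<^sub>C c + (1 / 2) *\<^sub>C d;
          i' = (\<lambda>n. nprod Q i (- n))
      in f Gm = (W + ((k + 2) * (k + 3) / 2) *\<^sub>C der Z T) \<otimes> e (- 1)
           + (k + 3) *\<^sub>C (T \<otimes> i' 1 (e (- 1)))
           - vacuum Z \<otimes> (i' 1 (i' 1 (i' 1 (e (- 1))))
                         + (3 * (k + 2)) *\<^sub>C i' 1 (i' 2 (e (- 1)))
                         + (2 * (k + 2)\<^sup>2) *\<^sub>C i' 3 (e (- 1))))"


text \<open>The vertex algebra \<open>Z \<otimes> \<Pi>(0) \<oplus> E\<close>.  On \<open>E\<close> the translation operator \<open>D\<close> is the mode
  \<open>L(-1)\<close> of the conformal vector \<open>T + 1/2 :cd:\<close>; adding derivatives of \<open>c\<close> and \<open>d\<close> to this vector does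
  not change \<open>D\<close>.\<close>

definition calV ::
  "'z::complex_vector va \<Rightarrow> 'z \<Rightarrow> 'q::complex_vector va \<Rightarrow> 'q \<Rightarrow> 'q \<Rightarrow>
   (('z, 'q) tensor \<Rightarrow> int \<Rightarrow> 'm::complex_vector \<Rightarrow> 'm) \<Rightarrow> (('z, 'q) tensor \<times> 'm) va" where
  "calV Z T Q c d actE =
     extension_va (tensor_va Z Q) actE
       (actE (T \<otimes> vacuum Q + (1 / 2) *\<^sub>C (vacuum Z \<otimes> nop Q c d)) 0)"


section \<open>The \<open>\<beta>\<gamma>\<close> vertex algebra and the modules \<open>P\<^sub>s\<close>\<close>

definition beta_gamma :: "'s::complex_vector va \<Rightarrow> 's \<Rightarrow> 's \<Rightarrow> bool" where
  "beta_gamma S b g \<longleftrightarrow> vertex_algebra S \<and> freely_strongly_generated S [b, g] \<and>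
     ope S b g [vacuum S] \<and> ope S b b [] \<and> ope S g g []"

text \<open>Isomorphism types of modules of countably infinite dimension are represented on this type.
  Every nonzero object of the category below has this dimension.\<close>

type_synonym cspace = "nat \<Rightarrow>\<^sub>0 complex"

text \<open>\<open>act'\<close> is isomorphic to the spectral flow \<open>\<sigma>\<^sup>l\<close> of \<open>act\<close>: up to a linear isomorphism the modes
  of \<open>\<beta>\<close> are shifted by \<open>- l\<close> and those of \<open>\<gamma>\<close> by \<open>l\<close>.\<close>

definition spectral_flow ::
  "'s \<Rightarrow> 's \<Rightarrow> int \<Rightarrow> ('s \<Rightarrow> int \<Rightarrow> 'm::complex_vector \<Rightarrow> 'm) \<Rightarrow>
   ('s \<Rightarrow> int \<Rightarrow> 'n::complex_vector \<Rightarrow> 'n) \<Rightarrow> bool" where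
  "spectral_flow b g l act act' \<longleftrightarrow> (\<exists>f. clinear f \<and> bij f \<and>
     (\<forall>n x. act' b n (f x) = f (act b (n - l) x) \<and> act' g n (f x) = f (act g (n + l) x)))"

text \<open>With \<open>\<beta>(z) = \<Sum> \<beta>\<^sub>n z\<^bsup>-n-1\<^esup>\<close> and \<open>\<gamma>(z) = \<Sum> \<gamma>\<^sub>n z\<^bsup>-n\<^esup>\<close>: the relaxed module with top weights in
  \<open>\<lambda> + \<int>\<close>, irreducible for real \<open>\<lambda>\<close> not in \<open>\<int>\<close>, is the one with a nonzero vector
  of weight \<open>\<lambda>\<close> annihilated by all modes of positive index.\<close>

definition relaxed_module :: "'s::complex_vector va \<Rightarrow> 's \<Rightarrow> 's \<Rightarrow> real \<Rightarrow>
    ('s \<Rightarrow> int \<Rightarrow> 'm::complex_vector \<Rightarrow> 'm) \<Rightarrow> bool" where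
  "relaxed_module S b g lam act \<longleftrightarrow> lam \<notin> \<int> \<and> va_module S act \<and> irreducible_module act \<and>
     (\<exists>x. x \<noteq> 0 \<and> (\<forall>n\<ge>1. act b n x = 0) \<and> (\<forall>n\<ge>0. act g n x = 0) \<and>
          act (nop S g b) 0 x = of_real lam *\<^sub>C x)"

text \<open>The simple objects.  The relaxed modules with integral weights are reducible and have
  spectral flows of \<open>S\<close> as composition factors.\<close>

definition ghost_simple :: "'s::complex_vector va \<Rightarrow> 's \<Rightarrow> 's \<Rightarrow>
    ('s \<Rightarrow> int \<Rightarrow> cspace \<Rightarrow> cspace) \<Rightarrow> bool" where
  "ghost_simple S b g act \<longleftrightarrow> va_module S act \<and>
     (\<exists>l. spectral_flow b g l (nprod S) act \<or>
          (\<exists>lam (act' :: 's \<Rightarrow> int \<Rightarrow> cspace \<Rightarrow> cspace).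
              relaxed_module S b g lam act' \<and> spectral_flow b g l act' act))"

text \<open>Objects of the category of finite length weight modules: a finite chain of submodules whose
  successive quotients are isomorphic to simple objects, and a diagonalizable zero mode of
  \<open>:\<gamma>\<beta>:\<close> with real eigenvalues.\<close>

definition ghost_module :: "'s::complex_vector va \<Rightarrow> 's \<Rightarrow> 's \<Rightarrow>
    ('s \<Rightarrow> int \<Rightarrow> 'm::complex_vector \<Rightarrow> 'm) \<Rightarrow> bool" where
  "ghost_module S b g act \<longleftrightarrow> va_module S act \<and>
     cvec.span {x. \<exists>t::real. act (nop S g b) 0 x = of_real t *\<^sub>C x} = UNIV \<and>
     (\<exists>(len::nat) C. C 0 = {0} \<and> C len = UNIV \<and> (\<forall>i\<le>len. submodule act (C i)) \<and>
        (\<forall>i<len. C i \<subseteq> C (Suc i) \<and>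
           (\<exists>act' f. ghost_simple S b g act' \<and> clinear f \<and>
              (\<forall>x\<in>C (Suc i). \<forall>a n. f (act a n x) = act' a n (f x)) \<and>
              f ` C (Suc i) = UNIV \<and> {x \<in> C (Suc i). f x = 0} = C i)))"

definition ghost_projective :: "'s::complex_vector va \<Rightarrow> 's \<Rightarrow> 's \<Rightarrow>
    ('s \<Rightarrow> int \<Rightarrow> 'm::complex_vector \<Rightarrow> 'm) \<Rightarrow> bool" where
  "ghost_projective S b g act \<longleftrightarrow> ghost_module S b g act \<and>
     (\<forall>(actM :: 's \<Rightarrow> int \<Rightarrow> cspace \<Rightarrow> cspace) (actN :: 's \<Rightarrow> int \<Rightarrow> cspace \<Rightarrow> cspace) p f.
        ghost_module S b g actM \<and> ghost_module S b g actN \<and>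
        module_map actM actN p \<and> surj p \<and> module_map act actN f \<longrightarrow>
        (\<exists>h. module_map act actM h \<and> p \<circ> h = f))"

definition ghost_projective_cover :: "'s::complex_vector va \<Rightarrow> 's \<Rightarrow> 's \<Rightarrow> int \<Rightarrow>
    ('s \<Rightarrow> int \<Rightarrow> 'm::complex_vector \<Rightarrow> 'm) \<Rightarrow> bool" where
  "ghost_projective_cover S b g s act \<longleftrightarrow> ghost_projective S b g act \<and>
     (\<exists>(act' :: 's \<Rightarrow> int \<Rightarrow> cspace \<Rightarrow> cspace) p.
        va_module S act' \<and> spectral_flow b g s (nprod S) act' \<and>
        module_map act act' p \<and> surj p \<and>
        (\<forall>U. submodule act U \<and> p ` U = UNIV \<longrightarrow> U = UNIV))"


section \<open>The realization of \<open>L\<^sub>k(sl\<^sub>3)\<close>\<close>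

text \<open>\<open>B = (A \<otimes> S) \<otimes> \<Pi>(0)\<close>. The image of \<open>f\<^sub>3\<close> is determined by \<open>f\<^sub>3 = [f\<^sub>2, f\<^sub>1]\<close>.\<close>

definition affine_embedding ::
  "complex \<Rightarrow> 'k::complex_vector va \<Rightarrow> (complex^3^3 \<Rightarrow> 'k) \<Rightarrow>
   'w::complex_vector va \<Rightarrow> 'w \<Rightarrow> 'w \<Rightarrow> 'w \<Rightarrow> 'w \<Rightarrow>
   's::complex_vector va \<Rightarrow> 's \<Rightarrow> 's \<Rightarrow>
   'q::complex_vector va \<Rightarrow> 'q \<Rightarrow> 'q \<Rightarrow> (int \<Rightarrow> 'q) \<Rightarrow>
   ('k \<Rightarrow> (('w, 's) tensor, 'q) tensor) \<Rightarrow> bool" where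
  "affine_embedding k V x A J Gp Gm L S b g Q c d e f \<longleftrightarrow>
     va_hom V (tensor_va (tensor_va A S) Q) f \<and> inj f \<and>
     (let vA = vacuum A; vS = vacuum S; vQ = vacuum Q;
          gb = nop S g b
      in f (x (eM 1 2)) = - (vA \<otimes> g \<otimes> e 1) \<and>
         f (x (eM 2 3)) = vA \<otimes> b \<otimes> vQ \<and>
         f (x (eM 1 3)) = vA \<otimes> vS \<otimes> e 1 \<and>
         f (x h1M) = (- 2) *\<^sub>C (J \<otimes> vS \<otimes> vQ) + vA \<otimes> gb \<otimes> vQ
           + vA \<otimes> vS \<otimes> ((- ((2 * k + 9) / 6)) *\<^sub>C c + (1 / 2) *\<^sub>C d) \<and>
         f (x h2M) = J \<otimes> vS \<otimes> vQ - 2 *\<^sub>C (vA \<otimes> gb \<otimes> vQ)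
           + vA \<otimes> vS \<otimes> (((4 * k + 9) / 6) *\<^sub>C c + (1 / 2) *\<^sub>C d) \<and>
         f (x (eM 2 1)) = Gp \<otimes> vS \<otimes> vQ
           - (2 *\<^sub>C (J \<otimes> b \<otimes> e (- 1))
              + vA \<otimes> b \<otimes> nop Q (((8 * k + 9) / 6) *\<^sub>C c - (1 / 2) *\<^sub>C d) (e (- 1)))
           + (k + 1) *\<^sub>C (vA \<otimes> der S b \<otimes> e (- 1)) \<and>
         f (x (eM 3 2)) = Gm \<otimes> vS \<otimes> e (- 1)
           + J \<otimes> g \<otimes> vQ + vA \<otimes> g \<otimes> (((4 * k + 9) / 6) *\<^sub>C c + (1 / 2) *\<^sub>C d)
           + k *\<^sub>C (vA \<otimes> der S g \<otimes> vQ) - vA \<otimes> nop S g (nop S g b) \<otimes> vQ \<and>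
         f (sugawara k V x) =
           L \<otimes> vS \<otimes> vQ + (1 / 2) *\<^sub>C (der A J \<otimes> vS \<otimes> vQ)
           + vA \<otimes> nop S (der S g) b \<otimes> vQ
           + vA \<otimes> vS \<otimes> ((1 / 2) *\<^sub>C nop Q c d + (k / 3) *\<^sub>C der Q c - (1 / 2) *\<^sub>C der Q d))"

end

theory Submission
  imports Defs
begin

text \<open>Write \<open>s\<close> for \<open>v[11;12] \<otimes> e\<^bsup>i\<^esup>\<close>. The point is that \<open>s\<^sub>(\<^sub>0\<^sub>)\<close> annihilates the image of \<open>\<W>\<^sub>k\<close>. As \<open>s\<^sub>(\<^sub>0\<^sub>)\<close> is a
  derivation, only the generators matter, and only \<open>G\<^sup>-\<close> is not immediate. There \<open>s\<^sub>(\<^sub>0\<^sub>)G\<^sup>- = 0\<close> amounts to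
  expressing \<open>W\<^sub>-\<^sub>1v\<close>, \<open>W\<^sub>-\<^sub>2v\<close>, \<open>W\<^sub>-\<^sub>3v\<close> by Virasoro descendants of \<open>v = v[11;12]\<close>. These relations hold in the
  irreducible module, since the corresponding vectors of the Verma module are singular; the operator product
  of \<open>W\<close> with itself needed to see this is read off from \<open>G\<^sup>-G\<^sup>- \<sim> 0\<close>.

  Hence \<open>\<Delta>(s, z)\<close> contains no logarithm, it is of first order in \<open>s\<close> because products of two elements of
  \<open>E\<close> vanish, and it deforms the action to that of a module. The zero mode of \<open>L\<^sub>s\<^sub>u\<^sub>g\<close> on the tensor product is
  a diagonalizable operator plus \<open>s\<^sub>(\<^sub>0\<^sub>)\<close> plus the nilpotent part of \<open>L(0)\<close> on \<open>\<P>\<^sub>s\<close>. The last two commute,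
  are nonzero and of square zero, and act on different tensor factors, so their sum has nilpotency index three.\<close>

section \<open>Linear maps and finitely supported sums\<close>

text \<open>The extension of Z tensor Pi(0) by \<open>E\<close> is never shown to be a vertex
  algebra. What the argument needs of it is the Borcherds identity for triples with one entry in
  \<open>E\<close>, in two orders (\<open>sk_jac\<close>, \<open>sk_jac_swap\<close>), and this is
  derived directly from the formula e^{zD} Y(b,-z)u. Infinite families of coefficients are handled
  through a Pascal recursion that all terms of the identity share: it reduces skew products to a
  commutator and an iterate formula, and tensor products to locality and weak associativity, whose
  exponents add. No Verma module is built either. A vector of the irreducible module that is killed
  by L_1, L_2 and W_1 and has weight above that of v generates a submodule whose weights miss that
  of v, so it is zero. The half-lattice algebra comes without a basis; its coefficients are
  functionals obtained from the independence of eigenvectors of a grading, and gradings also provide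
  the semisimple parts of the L(0) operators.\<close>

lemma clinear_0: "clinear f \<Longrightarrow> f 0 = 0"
  using clinear_scaleC[of f 0 0] by simp

lemma clinear_neg: "clinear f \<Longrightarrow> f (- x) = - f x"
  using clinear_scaleC[of f "- 1" x] by simp

lemma clinear_diff: "clinear f \<Longrightarrow> f (x - y) = f x - f y"
  using clinear_add[of f x "- y"] clinear_neg[of f y] by simp

lemma clinear_sum: "clinear f \<Longrightarrow> f (sum g A) = (\<Sum>a\<in>A. f (g a))"
  by (induction A rule: infinite_finite_induct) (simp_all add: clinear_0 clinear_add)

lemma clinear_Sum_any:
  assumes "clinear f" "finite {a. g a \<noteq> 0}"
  shows "f (Sum_any g) = Sum_any (\<lambda>a. f (g a))"
proof -
  have "{a. f (g a) \<noteq> 0} \<subseteq> {a. g a \<noteq> 0}"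
    using clinear_0[OF assms(1)] by auto
  then show ?thesis
    using assms by (subst (1 2) Sum_any.expand_superset[of "{a. g a \<noteq> 0}"]) (auto simp: clinear_sum)
qed

lemma scaleC_Sum_any:
  assumes "finite {a. g a \<noteq> 0}"
  shows "c *\<^sub>C Sum_any g = Sum_any (\<lambda>a. c *\<^sub>C g a)"
  by (rule clinear_Sum_any[OF clinearI assms])
    (simp_all add: scaleC_add_right scaleC_scaleC mult.commute)

lemma Sum_any_diff:
  fixes f g :: "'a \<Rightarrow> 'b::ab_group_add"
  assumes "finite {a. f a \<noteq> 0}" "finite {a. g a \<noteq> 0}"
  shows "Sum_any (\<lambda>a. f a - g a) = Sum_any f - Sum_any g"
proof -
  let ?A = "{a. f a \<noteq> 0} \<union> {a. g a \<noteq> 0}"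
  show ?thesis
    using assms by (subst (1 2 3) Sum_any.expand_superset[of ?A]) (auto simp: sum_subtractf)
qed

lemma clinear_id: "clinear (\<lambda>x. x)"
  by (rule clinearI) auto

lemma clinear_zero_fun: "clinear (\<lambda>x. 0)"
  by (rule clinearI) auto

lemma clinear_compose: "clinear f \<Longrightarrow> clinear g \<Longrightarrow> clinear (\<lambda>x. f (g x))"
  by (rule clinearI) (simp_all add: clinear_add clinear_scaleC)

lemma clinear_plus: "clinear f \<Longrightarrow> clinear g \<Longrightarrow> clinear (\<lambda>x. f x + g x)"
  by (rule clinearI) (simp_all add: clinear_add clinear_scaleC scaleC_add_right)

lemma clinear_minus: "clinear f \<Longrightarrow> clinear g \<Longrightarrow> clinear (\<lambda>x. f x - g x)"
  by (rule clinearI) (simp_all add: clinear_add clinear_scaleC cvec.scale_right_diff_distrib)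

lemma clinear_scale: "clinear f \<Longrightarrow> clinear (\<lambda>x. c *\<^sub>C f x)"
  by (rule clinearI) (simp_all add: clinear_add clinear_scaleC scaleC_add_right scaleC_scaleC mult.commute)

lemma clinear_funpow: "clinear (f :: 'a::complex_vector \<Rightarrow> 'a) \<Longrightarrow> clinear (f ^^ n)"
proof (induction n)
  case 0
  show ?case by (rule clinearI) simp_all
next
  case (Suc n)
  then show ?case using clinear_compose[of f "f ^^ n"] by (simp add: comp_def)
qed

lemma clinear_Sum_any_fun:
  assumes "\<And>i. clinear (f i)" "\<And>x. finite {i. f i x \<noteq> 0}"
  shows "clinear (\<lambda>x. Sum_any (\<lambda>i. f i x))"
  by (rule clinearI)
    (simp_all add: clinear_add[OF assms(1)] clinear_scaleC[OF assms(1)] assms(2)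
      Sum_any.distrib scaleC_Sum_any)

section \<open>Truncating and reordering finitely supported sums\<close>

lemma Sum_any_nat_bound:
  fixes f :: "nat \<Rightarrow> 'a::comm_monoid_add"
  assumes "\<And>j. K \<le> j \<Longrightarrow> f j = 0"
  shows "Sum_any f = sum f {..<K}"
  by (rule Sum_any.expand_superset) (use assms in \<open>auto simp: not_le[symmetric]\<close>)

lemma finite_nat_bound:
  assumes "\<And>j. (K::nat) \<le> j \<Longrightarrow> f j = 0"
  shows "finite {j. f j \<noteq> 0}"
  by (rule finite_subset[of _ "{..<K}"]) (use assms in \<open>auto simp: not_le[symmetric]\<close>)

lemma finite_int_bound:
  assumes "\<And>j. (K::int) \<le> j \<Longrightarrow> f j = 0" "\<And>j. j \<le> M \<Longrightarrow> f j = 0"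
  shows "finite {j. f j \<noteq> 0}"
proof (rule finite_subset)
  show "{j. f j \<noteq> 0} \<subseteq> {M..K}" using assms by (metis (mono_tags, lifting) atLeastAtMost_iff linear mem_Collect_eq subsetI)
qed (rule finite_atLeastAtMost_int)

lemma Sum_any_pair:
  fixes f :: "'a \<Rightarrow> 'b \<Rightarrow> 'c::comm_monoid_add"
  assumes fin: "finite {(a, b). f a b \<noteq> 0}"
  shows "Sum_any (\<lambda>a. Sum_any (f a)) = Sum_any (\<lambda>(a, b). f a b)"
proof (rule Sum_any.cartesian_product)
  let ?C = "{(a, b). f a b \<noteq> 0}"
  show "finite (fst ` ?C \<times> snd ` ?C)" using fin by simp
  show "{a. \<exists>b. f a b \<noteq> 0} \<times> {b. \<exists>a. f a b \<noteq> 0} \<subseteq> fst ` ?C \<times> snd ` ?C"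
    by (force simp: image_iff)
qed

lemma Sum_any_swap:
  fixes f :: "'a \<Rightarrow> 'b \<Rightarrow> 'c::comm_monoid_add"
  assumes fin: "finite {(a, b). f a b \<noteq> 0}"
  shows "Sum_any (\<lambda>a. Sum_any (\<lambda>b. f a b)) = Sum_any (\<lambda>b. Sum_any (\<lambda>a. f a b))"
proof (rule Sum_any.swap)
  let ?C = "{(a, b). f a b \<noteq> 0}"
  show "finite (fst ` ?C \<times> snd ` ?C)" using fin by simp
  show "{a. \<exists>b. f a b \<noteq> 0} \<times> {b. \<exists>a. f a b \<noteq> 0} \<subseteq> fst ` ?C \<times> snd ` ?C"
    by (force simp: image_iff)
qed

lemma Sum_any_antidiagonal:
  fixes f :: "nat \<Rightarrow> nat \<Rightarrow> 'c::comm_monoid_add"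
  assumes fin: "finite {(a, b). f a b \<noteq> 0}"
  shows "Sum_any (\<lambda>a. Sum_any (\<lambda>b. f a b)) = Sum_any (\<lambda>r. \<Sum>j\<le>r. f j (r - j))"
proof -
  define g where "g r j = (if j \<le> r then f j (r - j) else 0)" for r j
  have im: "{(r, j). g r j \<noteq> 0} = (\<lambda>(a, b). (a + b, a)) ` {(a, b). f a b \<noteq> 0}"
    by (force simp: g_def image_iff split: if_splits)
  have fing: "finite {(r, j). g r j \<noteq> 0}"
    unfolding im using fin by simp
  have "Sum_any (\<lambda>r. \<Sum>j\<le>r. f j (r - j)) = Sum_any (\<lambda>r. Sum_any (g r))"
  proof (rule Sum_any.cong)
    fix r
    have "Sum_any (g r) = sum (g r) {..r}"
      by (rule Sum_any.expand_superset) (auto simp: g_def)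
    then show "(\<Sum>j\<le>r. f j (r - j)) = Sum_any (g r)" by (simp add: g_def)
  qed
  also have "\<dots> = Sum_any (\<lambda>(r, j). g r j)" by (rule Sum_any_pair[OF fing])
  also have "\<dots> = sum (\<lambda>(r, j). g r j) ((\<lambda>(a, b). (a + b, a)) ` {(a, b). f a b \<noteq> 0})"
    unfolding im[symmetric] by (simp add: Sum_any.expand_set case_prod_unfold)
  also have "\<dots> = sum (\<lambda>(a, b). f a b) {(a, b). f a b \<noteq> 0}"
    by (subst sum.reindex) (auto simp: inj_on_def g_def intro!: sum.cong)
  also have "\<dots> = Sum_any (\<lambda>(a, b). f a b)"
    by (simp add: Sum_any.expand_set case_prod_unfold)
  finally show ?thesis by (simp add: Sum_any_pair[OF fin])
qed

lemma Sum_any_shift_nat: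
  fixes f :: "nat \<Rightarrow> 'a::comm_monoid_add"
  assumes "finite {j. f j \<noteq> 0}"
  shows "Sum_any f = f 0 + Sum_any (\<lambda>j. f (Suc j))"
proof -
  obtain K where "\<And>j. f j \<noteq> 0 \<Longrightarrow> j < K" using assms finite_nat_set_iff_bounded by auto
  then have "\<And>j. K \<le> j \<Longrightarrow> f j = 0" by (meson not_le)
  then show ?thesis
    by (subst Sum_any_nat_bound[of "Suc K"], simp, subst Sum_any_nat_bound[of K])
      (auto simp: sum.lessThan_Suc_shift simp del: sum.lessThan_Suc)
qed

lemma Sum_any_single:
  assumes "\<And>i. i \<noteq> a \<Longrightarrow> f i = 0"
  shows "Sum_any f = f a"
  by (subst Sum_any.expand_superset[of "{a}"]) (use assms in auto)

lemma gbinomial_Vandermonde':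
  fixes a b :: complex
  shows "(\<Sum>k\<le>n. (a gchoose k) * (b gchoose (n - k))) = (a + b) gchoose n"
  using gbinomial_Vandermonde[of a b n] by (simp add: atLeast0AtMost)

section \<open>Tensor products\<close>

lemma tensor_add_left: "(a + b) \<otimes> c = a \<otimes> c + b \<otimes> (c::'b::complex_vector)"
proof (transfer, unfold tensor_rel_def diff_diff_add[symmetric], rule cvec.span_base)
qed (unfold tensor_relators_def, blast)

lemma tensor_add_right: "c \<otimes> (a + b) = c \<otimes> a + c \<otimes> (b::'b::complex_vector)"
proof (transfer, unfold tensor_rel_def diff_diff_add[symmetric], rule cvec.span_base)
qed (unfold tensor_relators_def, blast)

lemma tensor_scale_left: "(s *\<^sub>C a) \<otimes> c = s *\<^sub>C (a \<otimes> (c::'b::complex_vector))"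
proof (transfer, unfold tensor_rel_def, rule cvec.span_base)
qed (unfold tensor_relators_def, blast)

lemma tensor_scale_right: "a \<otimes> (s *\<^sub>C c) = s *\<^sub>C (a \<otimes> (c::'b::complex_vector))"
proof (transfer, unfold tensor_rel_def, rule cvec.span_base)
qed (unfold tensor_relators_def, blast)

lemma clinear_tensor_left: "clinear (\<lambda>a. a \<otimes> b)"
  and clinear_tensor_right: "clinear (\<lambda>b. a \<otimes> b)"
  by (auto intro!: clinearI simp: tensor_add_left tensor_add_right tensor_scale_left tensor_scale_right)

lemmas tensor_0_left [simp] = clinear_0[OF clinear_tensor_left]
lemmas tensor_0_right [simp] = clinear_0[OF clinear_tensor_right]
lemmas tensor_diff_left = clinear_diff[OF clinear_tensor_left]
lemmas tensor_diff_right = clinear_diff[OF clinear_tensor_right]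
lemmas tensor_neg_left = clinear_neg[OF clinear_tensor_left]
lemmas tensor_neg_right = clinear_neg[OF clinear_tensor_right]
lemmas tensor_Sum_any_left = clinear_Sum_any[OF clinear_tensor_left]
lemmas tensor_Sum_any_right = clinear_Sum_any[OF clinear_tensor_right]

text \<open>No case for scalars arises, because a coefficient can be absorbed into the left
  factor.\<close>

lemma tensor_induct [case_names pure add]:
  assumes pure: "\<And>a b. P (a \<otimes> b)" and add: "\<And>s t. P s \<Longrightarrow> P t \<Longrightarrow> P (s + t)"
  shows "P t"
proof (induction t rule: tensor.abs_induct)
  case (1 y)
  show ?case
  proof (induction y rule: update_induct)
    case const
    show ?case using pure[of 0 0] by (metis tensor_0_left zero_tensor_def)
  next
    case (update x p c)
    obtain a b where p: "p = (a, b)" by force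
    have eq: "Poly_Mapping.update p c x = x + c *\<^sub>C Poly_Mapping.single p 1"
      using update(1)
      by (intro poly_mapping_eqI)
        (auto simp: lookup_add lookup_update scaleC_poly_mapping.rep_eq in_keys_iff
          lookup_single scaleC_complex_def when_def)
    have "abs_tensor (Poly_Mapping.update p c x) = abs_tensor x + (c *\<^sub>C a) \<otimes> b"
      unfolding eq by (simp add: plus_tensor.abs_eq[symmetric] scaleC_tensor.abs_eq[symmetric] p
        tensor_of.abs_eq[symmetric] tensor_scale_left)
    then show ?case using update(3) pure add by simp
  qed
qed

lemma clinear_tensor_eqI:
  assumes "clinear f" "clinear g" "\<And>a b. f (a \<otimes> b) = g (a \<otimes> b)"
  shows "f t = g t"
  by (induction t rule: tensor_induct) (simp_all add: assms clinear_add)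

text \<open>Linear functionals with value 1 on \<open>a\<close> and on \<open>b\<close> exist, and
  the lift of their product has value 1 on the pure tensor.\<close>

lemma tensor_nonzero:
  assumes "(a::'a::complex_vector) \<noteq> 0" "(b::'b::complex_vector) \<noteq> 0"
  shows "a \<otimes> b \<noteq> 0"
proof -
  interpret ca: vector_space_pair "scaleC :: complex \<Rightarrow> 'a \<Rightarrow> 'a" "scaleC :: complex \<Rightarrow> complex \<Rightarrow> complex" ..
  interpret cb: vector_space_pair "scaleC :: complex \<Rightarrow> 'b \<Rightarrow> 'b" "scaleC :: complex \<Rightarrow> complex \<Rightarrow> complex" ..
  obtain f :: "'a \<Rightarrow> complex" where f: "clinear f" "f a = 1"
    using ca.linear_independent_extend[of "{a}" "\<lambda>_. 1"] assms(1) by auto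
  obtain g :: "'b \<Rightarrow> complex" where g: "clinear g" "g b = 1"
    using cb.linear_independent_extend[of "{b}" "\<lambda>_. 1"] assms(2) by auto
  have bil: "cbilinear (\<lambda>x y. f x * g y)"
    by (auto simp: cbilinear_def algebra_simps scaleC_complex_def
      clinear_add[OF f(1)] clinear_add[OF g(1)] clinear_scaleC[OF f(1)] clinear_scaleC[OF g(1)]
      intro!: clinearI)
  have "tensor_lift (\<lambda>x y. f x * g y) (a \<otimes> b) = 1"
    using f g by (simp add: tensor_lift_tensor_of[OF bil])
  then show ?thesis
    using clinear_0[OF clinear_tensor_lift[OF bil]] by auto
qed

section \<open>The Jacobi identity in components\<close>

text \<open>For modes with \<open>\<alpha> i j = a\<^sub>i b\<^sub>j x\<close>, \<open>\<beta> i j = b\<^sub>i a\<^sub>j x\<close> and \<open>\<gamma> n q = (a\<^sub>n b)\<^sub>q x\<close>, the Borcherds identity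
  at \<open>(m, n, q)\<close> reads \<open>jac_l \<gamma> m n q = jac_a \<alpha> m n q - (- 1)\<^bsup>n\<^esup> jac_a \<beta> q n m\<close>.\<close>

definition jac_l :: "(int \<Rightarrow> int \<Rightarrow> 'm::complex_vector) \<Rightarrow> int \<Rightarrow> int \<Rightarrow> int \<Rightarrow> 'm" where
  "jac_l \<gamma> m n q = Sum_any (\<lambda>j::nat. (of_int m gchoose j) *\<^sub>C \<gamma> (n + int j) (m + q - int j))"

definition jac_a :: "(int \<Rightarrow> int \<Rightarrow> 'm::complex_vector) \<Rightarrow> int \<Rightarrow> int \<Rightarrow> int \<Rightarrow> 'm" where
  "jac_a \<alpha> m n q =
     Sum_any (\<lambda>j::nat. ((- 1) ^ j * (of_int n gchoose j)) *\<^sub>C \<alpha> (m + n - int j) (q + int j))"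

definition jac :: "(int \<Rightarrow> int \<Rightarrow> 'm::complex_vector) \<Rightarrow> (int \<Rightarrow> int \<Rightarrow> 'm) \<Rightarrow> (int \<Rightarrow> int \<Rightarrow> 'm) \<Rightarrow>
    int \<Rightarrow> int \<Rightarrow> int \<Rightarrow> bool" where
  "jac \<alpha> \<beta> \<gamma> m n q \<longleftrightarrow> jac_l \<gamma> m n q = jac_a \<alpha> m n q - ((- 1) powi n) *\<^sub>C jac_a \<beta> q n m"

text \<open>The uniform truncation that compositions of modes have: in a_i b_j x the last index is
  bounded above whatever \<open>i\<close> is, and in (a_n b)_q x the first index is, whatever
  \<open>q\<close> is.\<close>

definition bounded1 :: "int \<Rightarrow> (int \<Rightarrow> int \<Rightarrow> 'm::zero) \<Rightarrow> bool" where
  "bounded1 K f \<longleftrightarrow> (\<forall>i j. K \<le> i \<longrightarrow> f i j = 0)"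

definition bounded2 :: "int \<Rightarrow> (int \<Rightarrow> int \<Rightarrow> 'm::zero) \<Rightarrow> bool" where
  "bounded2 K f \<longleftrightarrow> (\<forall>i j. K \<le> j \<longrightarrow> f i j = 0)"

lemma jac_l_bound:
  assumes "bounded1 K \<gamma>" "K \<le> n + int B"
  shows "jac_l \<gamma> m n q = (\<Sum>j<B. (of_int m gchoose j) *\<^sub>C \<gamma> (n + int j) (m + q - int j))"
  unfolding jac_l_def by (rule Sum_any_nat_bound) (use assms in \<open>auto simp: bounded1_def\<close>)

lemma jac_a_bound:
  assumes "bounded2 K \<alpha>" "K \<le> q + int B"
  shows "jac_a \<alpha> m n q =
    (\<Sum>j<B. ((- 1) ^ j * (of_int n gchoose j)) *\<^sub>C \<alpha> (m + n - int j) (q + int j))"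
  unfolding jac_a_def by (rule Sum_any_nat_bound) (use assms in \<open>auto simp: bounded2_def\<close>)

section \<open>The Pascal recursion and its consequences\<close>

lemma gbinomial_Suc_int:
  "(of_int (1 + m) gchoose Suc j) = (of_int m gchoose j) + ((of_int m :: complex) gchoose Suc j)"
  using gbinomial_Suc_Suc[of "of_int m :: complex" j] by (simp add: add.commute)

lemma jac_l_rec:
  assumes "bounded1 K \<gamma>"
  shows "jac_l \<gamma> (m + 1) n q = jac_l \<gamma> m (n + 1) q + jac_l \<gamma> m n (q + 1)"
proof -
  define B where "B = nat (K - n)"
  have B: "K \<le> n + int B" by (simp add: B_def)
  have "jac_l \<gamma> (m + 1) n q =
      (\<Sum>j<Suc B. (of_int (m + 1) gchoose j) *\<^sub>C \<gamma> (n + int j) (m + 1 + q - int j))"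
    by (rule jac_l_bound[OF assms]) (use B in simp)
  moreover have "jac_l \<gamma> m (n + 1) q =
      (\<Sum>j<B. (of_int m gchoose j) *\<^sub>C \<gamma> (n + 1 + int j) (m + q - int j))"
    by (rule jac_l_bound[OF assms]) (use B in simp)
  moreover have "jac_l \<gamma> m n (q + 1) =
      (\<Sum>j<Suc B. (of_int m gchoose j) *\<^sub>C \<gamma> (n + int j) (m + (q + 1) - int j))"
    by (rule jac_l_bound[OF assms]) (use B in simp)
  ultimately show ?thesis
    by (simp add: sum.lessThan_Suc_shift gbinomial_Suc_int scaleC_add_left sum.distrib algebra_simps
        del: sum.lessThan_Suc of_int_add)
qed

lemma jac_a_rec:
  assumes "bounded2 K \<alpha>"
  shows "jac_a \<alpha> m (n + 1) q = jac_a \<alpha> (m + 1) n q - jac_a \<alpha> m n (q + 1)"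
proof -
  define B where "B = nat (K - q)"
  have B: "K \<le> q + int B" by (simp add: B_def)
  let ?c = "\<lambda>n j. (- 1) ^ j * (of_int n gchoose j) :: complex"
  have 1: "jac_a \<alpha> m (n + 1) q =
      (\<Sum>j<Suc B. ?c (n + 1) j *\<^sub>C \<alpha> (m + (n + 1) - int j) (q + int j))"
    by (rule jac_a_bound[OF assms]) (use B in simp)
  have 2: "jac_a \<alpha> (m + 1) n q =
      (\<Sum>j<Suc B. ?c n j *\<^sub>C \<alpha> (m + 1 + n - int j) (q + int j))"
    by (rule jac_a_bound[OF assms]) (use B in simp)
  have 3: "jac_a \<alpha> m n (q + 1) =
      (\<Sum>j<B. ?c n j *\<^sub>C \<alpha> (m + n - int j) (q + 1 + int j))"
    by (rule jac_a_bound[OF assms]) (use B in simp)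
  show ?thesis unfolding 1 2 3
    by (simp add: sum.lessThan_Suc_shift gbinomial_Suc_int scaleC_add_left sum.distrib algebra_simps
        sum_subtractf sum_negf cvec.scale_left_diff_distrib
        del: sum.lessThan_Suc of_int_add)
qed

lemma powi_minus_one_Suc: "(- 1 :: complex) powi (n + 1) = - ((- 1) powi n)"
  by (simp add: power_int_add)

lemma powi_minus_one_self [simp]: "(- 1 :: complex) powi n * (- 1) powi n = 1"
  by (simp add: power_int_mult_distrib[symmetric])

definition jac_defect where
  "jac_defect \<alpha> \<beta> \<gamma> m n q = jac_l \<gamma> m n q - (jac_a \<alpha> m n q - ((- 1) powi n) *\<^sub>C jac_a \<beta> q n m)"

lemma jac_iff_defect: "jac \<alpha> \<beta> \<gamma> m n q \<longleftrightarrow> jac_defect \<alpha> \<beta> \<gamma> m n q = 0"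
  by (simp add: jac_def jac_defect_def)

text \<open>By Pascal's rule all three terms of the Borcherds identity satisfy the same recursion.
  Hence of the identities at (m+1, n, q), (m, n+1, q) and (m, n, q+1) any two imply the third; the
  next three lemmas are the three cases.\<close>

lemma jac_defect_rec:
  assumes trunc: "bounded2 K \<alpha>" "bounded2 K \<beta>" "bounded1 K \<gamma>"
  shows "jac_defect \<alpha> \<beta> \<gamma> (m + 1) n q = jac_defect \<alpha> \<beta> \<gamma> m (n + 1) q + jac_defect \<alpha> \<beta> \<gamma> m n (q + 1)"
  unfolding jac_defect_def powi_minus_one_Suc jac_l_rec[OF trunc(3)] jac_a_rec[OF trunc(1)]
    jac_a_rec[OF trunc(2)]
  by (simp add: cvec.scale_right_diff_distrib)

lemma jac_rec_up:
  assumes trunc: "bounded2 K \<alpha>" "bounded2 K \<beta>" "bounded1 K \<gamma>"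
    and "jac \<alpha> \<beta> \<gamma> m (n + 1) q" "jac \<alpha> \<beta> \<gamma> m n (q + 1)"
  shows "jac \<alpha> \<beta> \<gamma> (m + 1) n q"
  using assms(4,5) jac_defect_rec[OF trunc, of m n q] by (simp add: jac_iff_defect)

lemma jac_rec_q:
  assumes trunc: "bounded2 K \<alpha>" "bounded2 K \<beta>" "bounded1 K \<gamma>"
    and "jac \<alpha> \<beta> \<gamma> (m + 1) n q" "jac \<alpha> \<beta> \<gamma> m (n + 1) q"
  shows "jac \<alpha> \<beta> \<gamma> m n (q + 1)"
  using assms(4,5) jac_defect_rec[OF trunc, of m n q] by (simp add: jac_iff_defect)

lemma jac_rec_n:
  assumes trunc: "bounded2 K \<alpha>" "bounded2 K \<beta>" "bounded1 K \<gamma>"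
    and "jac \<alpha> \<beta> \<gamma> (m + 1) n q" "jac \<alpha> \<beta> \<gamma> m n (q + 1)"
  shows "jac \<alpha> \<beta> \<gamma> m (n + 1) q"
  using assms(4,5) jac_defect_rec[OF trunc, of m n q] by (simp add: jac_iff_defect)

text \<open>Increasing \<open>m\<close> from \<open>m0\<close> needs the recursion alone. For
  decreasing \<open>m\<close> one more input is required: the identity for large \<open>n\<close>,
  which is locality. Starting from that region, a descending induction on \<open>n\<close> recovers
  all other \<open>n\<close>.\<close>

lemma jac_all:
  assumes trunc: "bounded2 K \<alpha>" "bounded2 K \<beta>" "bounded1 K \<gamma>"
    and m0: "\<And>n q. jac \<alpha> \<beta> \<gamma> m0 n q" and loc: "\<And>m n q. N \<le> n \<Longrightarrow> jac \<alpha> \<beta> \<gamma> m n q"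
  shows "jac \<alpha> \<beta> \<gamma> m n q"
proof (induction m arbitrary: n q rule: int_induct[where k = m0])
  case base
  show ?case by (rule m0)
next
  case (step1 i)
  show ?case using step1(2) by (intro jac_rec_up[OF trunc]) auto
next
  case (step2 i)
  show ?case
  proof (cases "N \<le> n")
    case True
    then show ?thesis by (rule loc)
  next
    case False
    then have "n \<le> N" by simp
    then have "\<forall>q. jac \<alpha> \<beta> \<gamma> (i - 1) n q"
    proof (induction n rule: int_le_induct)
      case base
      show ?case by (simp add: loc)
    next
      case (step n')
      show ?case
      proof
        fix q
        show "jac \<alpha> \<beta> \<gamma> (i - 1) (n' - 1) q"
          using jac_rec_q[OF trunc, where m = "i - 1" and n = "n' - 1" and q = "q - 1"] step(2) step2(2)
          by simp
      qed
    qed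
    then show ?thesis by simp
  qed
qed

text \<open>The commutator formula is the case n = 0 and the iterate formula the case m = 0. Raising
  \<open>n\<close> from 0 by the recursion yields the half space n >= 0, which then serves as the
  locality region of \<open>jac_all\<close>.\<close>

lemma jac_from_commutator_iterate:
  assumes trunc: "bounded2 K \<alpha>" "bounded2 K \<beta>" "bounded1 K \<gamma>"
    and comm: "\<And>m q. jac \<alpha> \<beta> \<gamma> m 0 q" and iter: "\<And>n q. jac \<alpha> \<beta> \<gamma> 0 n q"
  shows "jac \<alpha> \<beta> \<gamma> m n q"
proof (rule jac_all[OF trunc, where N = 0 and ?m0.0 = 0])
  show "jac \<alpha> \<beta> \<gamma> m n q" if "0 \<le> n" for m n q
    using that
  proof (induction n arbitrary: m q rule: int_ge_induct)
    case base
    show ?case by (rule comm)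
  next
    case (step n)
    show ?case by (intro jac_rec_n[OF trunc]) (use step in auto)
  qed
qed (use iter in auto)

section \<open>Modules\<close>

locale vmod =
  fixes V :: "'a::complex_vector va" and act :: "'a \<Rightarrow> int \<Rightarrow> 'm::complex_vector \<Rightarrow> 'm"
  assumes va_module: "va_module V act"
begin

lemma act_linear_left: "clinear (\<lambda>a. act a n x)"
  and act_linear_right: "clinear (act a n)"
  using va_module by (simp_all add: va_module_def cbilinear_def)

lemmas act_add_left = clinear_add[OF act_linear_left]
  and act_add_right = clinear_add[OF act_linear_right]
  and act_scale_left = clinear_scaleC[OF act_linear_left]
  and act_scale_right = clinear_scaleC[OF act_linear_right]
  and act_diff_left = clinear_diff[OF act_linear_left]
  and act_diff_right = clinear_diff[OF act_linear_right]
  and act_neg_left = clinear_neg[OF act_linear_left]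
  and act_neg_right = clinear_neg[OF act_linear_right]
  and act_sum_right = clinear_sum[OF act_linear_right]
  and act_0_left [simp] = clinear_0[OF act_linear_left]
  and act_0_right [simp] = clinear_0[OF act_linear_right]

lemmas act_lin = act_add_left act_add_right act_scale_left act_scale_right act_diff_left
  act_diff_right act_neg_left act_neg_right

lemma act_trunc: "\<exists>N. \<forall>n\<ge>N. act a n x = 0"
  using va_module by (simp add: va_module_def)

lemma act_vacuum: "act (vacuum V) n x = (if n = - 1 then x else 0)"
  using va_module by (simp add: va_module_def)

lemma act_borcherds_raw:
  "Sum_any (\<lambda>j::nat. (of_int m gchoose j) *\<^sub>C act (nprod V a (n + int j) b) (m + q - int j) x) =
   Sum_any (\<lambda>j::nat. ((- 1) ^ j * (of_int n gchoose j)) *\<^sub>C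
            (act a (m + n - int j) (act b (q + int j) x)
             - ((- 1) powi n) *\<^sub>C act b (n + q - int j) (act a (m + int j) x)))"
  using va_module by (simp add: va_module_def)

definition ord :: "'a \<Rightarrow> 'm \<Rightarrow> int" where
  "ord a x = (SOME N. \<forall>n\<ge>N. act a n x = 0)"

lemma act_ord: "ord a x \<le> n \<Longrightarrow> act a n x = 0"
  using someI_ex[OF act_trunc[of a x]] unfolding ord_def by auto

end

text \<open>The module axiom has both compositions under one sum. Once separated, each is an
  instance of \<open>jac_a\<close>, the second one with \<open>m\<close> and \<open>q\<close>
  exchanged.\<close>

lemma jac_r_split:
  fixes \<alpha> \<beta> :: "int \<Rightarrow> int \<Rightarrow> 'm::complex_vector"
  assumes "bounded2 K \<alpha>" "bounded2 K \<beta>"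
  shows "Sum_any (\<lambda>j::nat. ((- 1) ^ j * (of_int n gchoose j)) *\<^sub>C
            (\<alpha> (m + n - int j) (q + int j) - ((- 1) powi n) *\<^sub>C \<beta> (n + q - int j) (m + int j))) =
         jac_a \<alpha> m n q - ((- 1) powi n) *\<^sub>C jac_a \<beta> q n m"
proof -
  define B where "B = nat (max (K - q) (K - m))"
  have B: "K \<le> q + int B" "K \<le> m + int B" by (auto simp: B_def)
  show ?thesis
    unfolding jac_a_bound[OF assms(1) B(1)] jac_a_bound[OF assms(2) B(2)]
    apply (subst Sum_any_nat_bound[of B])
    subgoal using B assms by (auto simp: bounded2_def)
    apply (simp add: cvec.scale_sum_right sum_subtractf cvec.scale_right_diff_distrib mult_ac add_ac)
    done
qed

context vmod begin

lemma act_jac: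
  "jac (\<lambda>i j. act a i (act b j x)) (\<lambda>i j. act b i (act a j x)) (\<lambda>n q. act (nprod V a n b) q x) m n q"
proof -
  define K where "K = max (ord b x) (ord a x)"
  have "bounded2 K (\<lambda>i j. act a i (act b j x))" "bounded2 K (\<lambda>i j. act b i (act a j x))"
    by (simp_all add: bounded2_def K_def act_ord)
  from jac_r_split[OF this]
  show ?thesis
    using act_borcherds_raw[of m a n b q x] by (simp add: jac_def jac_l_def)
qed

end

locale vertex_alg =
  fixes V :: "'a::complex_vector va"
  assumes vertex_algebra: "vertex_algebra V"

sublocale vertex_alg \<subseteq> vmod V "nprod V"
  by (rule vmod.intro) (use vertex_algebra in \<open>simp add: vertex_algebra_def\<close>)

locale va_mod = vertex_alg V + M: vmod V act
  for V :: "'a::complex_vector va" and act :: "'a \<Rightarrow> int \<Rightarrow> 'm::complex_vector \<Rightarrow> 'm"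
begin

lemma prod_ord: "ord a b \<le> n \<Longrightarrow> act (nprod V a n b) q x = 0"
  by (simp add: act_ord)

end

lemma va_moduleI:
  assumes bil: "\<And>n. cbilinear (\<lambda>a. act a n)"
    and trunc: "\<And>a x. \<exists>N. \<forall>n\<ge>N. act a n x = 0"
    and vac: "\<And>n x. act (vacuum V) n x = (if n = - 1 then x else 0)"
    and jac: "\<And>a b x m n q. jac (\<lambda>i j. act a i (act b j x)) (\<lambda>i j. act b i (act a j x))
          (\<lambda>n q. act (nprod V a n b) q x) m n q"
  shows "va_module V act"
  unfolding va_module_def
proof (intro conjI allI)
  fix a b x m n q
  obtain N1 N2 where N: "\<And>n. N1 \<le> n \<Longrightarrow> act a n x = 0" "\<And>n. N2 \<le> n \<Longrightarrow> act b n x = 0"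
    using trunc[of a x] trunc[of b x] by blast
  have 0: "act a n 0 = 0" for a n using bil[of n] by (simp add: cbilinear_def clinear_0)
  define K where "K = max N1 N2"
  have "bounded2 K (\<lambda>i j. act a i (act b j x))" "bounded2 K (\<lambda>i j. act b i (act a j x))"
    using N by (simp_all add: bounded2_def K_def 0)
  from jac_r_split[OF this]
  show "Sum_any (\<lambda>j::nat. (of_int m gchoose j) *\<^sub>C act (nprod V a (n + int j) b) (m + q - int j) x) =
   Sum_any (\<lambda>j::nat. ((- 1) ^ j * (of_int n gchoose j)) *\<^sub>C
            (act a (m + n - int j) (act b (q + int j) x)
             - ((- 1) powi n) *\<^sub>C act b (n + q - int j) (act a (m + int j) x)))"
    using jac[of a b x m n q] by (simp add: jac_def jac_l_def)
qed (use bil trunc vac in auto)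

section \<open>Tensor products of modules\<close>

text \<open>The product of two series in x and y. The shifts by one come from the convention
  z^(-n-1) for modes; by \<open>act_conv\<close> this is how compositions of modes on a tensor
  product arise from those on the factors.\<close>

definition conv :: "(int \<Rightarrow> int \<Rightarrow> 'm::complex_vector) \<Rightarrow> (int \<Rightarrow> int \<Rightarrow> 'n::complex_vector) \<Rightarrow>
    int \<Rightarrow> int \<Rightarrow> ('m, 'n) tensor" where
  "conv f g i j = Sum_any (\<lambda>(p, q). f p q \<otimes> g (i - 1 - p) (j - 1 - q))"

text \<open>Exactly what makes the sums in \<open>conv\<close> finite, and what a_p b_q x satisfies:
  \<open>q\<close> is bounded above, and for fixed \<open>q\<close> so is \<open>p\<close>.\<close>

definition regular :: "(int \<Rightarrow> int \<Rightarrow> 'm::zero) \<Rightarrow> bool" where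
  "regular f \<longleftrightarrow> (\<exists>K. bounded2 K f) \<and> (\<forall>q. \<exists>P. \<forall>p\<ge>P. f p q = 0)"

lemma regular_conv_finite:
  assumes "regular f" "regular g"
  shows "finite {(p, q). f p q \<otimes> g (i - 1 - p) (j - 1 - q) \<noteq> 0}"
proof -
  obtain K L where K: "\<And>p q. K \<le> q \<Longrightarrow> f p q = 0" and L: "\<And>p q. L \<le> q \<Longrightarrow> g p q = 0"
    using assms by (auto simp: regular_def bounded2_def)
  obtain P R where P: "\<And>q p. P q \<le> p \<Longrightarrow> f p q = 0" and R: "\<And>q p. R q \<le> p \<Longrightarrow> g p q = 0"
    using assms unfolding regular_def by metis
  have "{(p, q). f p q \<otimes> g (i - 1 - p) (j - 1 - q) \<noteq> 0} \<subseteq>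
      (\<Union>q\<in>{j - 1 - L..K}. {i - 1 - R (j - 1 - q)..P q} \<times> {q})"
  proof clarsimp
    fix p q assume *: "f p q \<otimes> g (i - 1 - p) (j - 1 - q) \<noteq> 0"
    then have "f p q \<noteq> 0" "g (i - 1 - p) (j - 1 - q) \<noteq> 0" by auto
    then have "\<not> K \<le> q" "\<not> L \<le> j - 1 - q" "\<not> P q \<le> p" "\<not> R (j - 1 - q) \<le> i - 1 - p"
      using K L P R by blast+
    then show "j - 1 - L \<le> q \<and> q \<le> K \<and> i - 1 - R (j - 1 - q) \<le> p \<and> p \<le> P q" by linarith
  qed
  then show ?thesis by (rule finite_subset) auto
qed

lemma regular_shift:
  assumes "regular f"
  shows "regular (\<lambda>p q. f (p + a) (q + b))"
proof -
  obtain K where K: "\<And>p q. K \<le> q \<Longrightarrow> f p q = 0"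
    using assms by (auto simp: regular_def bounded2_def)
  obtain P where P: "\<And>q p. P q \<le> p \<Longrightarrow> f p q = 0"
    using assms unfolding regular_def by metis
  show ?thesis
    unfolding regular_def bounded2_def
  proof (intro conjI allI exI impI)
    show "K - b \<le> q \<Longrightarrow> f (p + a) (q + b) = 0" for p q by (rule K) simp
    show "P (q + b) - a \<le> p \<Longrightarrow> f (p + a) (q + b) = 0" for p q by (rule P) simp
  qed
qed

lemma regular_shift1: "regular f \<Longrightarrow> regular (\<lambda>p q. f (p + a) q)"
  using regular_shift[of f a 0] by simp

lemma regular_shift2: "regular f \<Longrightarrow> regular (\<lambda>p q. f p (q + b))"
  using regular_shift[of f 0 b] by simp

lemma regular_combine:
  assumes "regular f" "regular g" "\<And>p q. f p q = 0 \<Longrightarrow> g p q = 0 \<Longrightarrow> h p q = 0"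
  shows "regular h"
proof -
  obtain K L where K: "\<And>p q. K \<le> q \<Longrightarrow> f p q = 0" and L: "\<And>p q. L \<le> q \<Longrightarrow> g p q = 0"
    using assms by (auto simp: regular_def bounded2_def)
  obtain P R where P: "\<And>q p. P q \<le> p \<Longrightarrow> f p q = 0" and R: "\<And>q p. R q \<le> p \<Longrightarrow> g p q = 0"
    using assms(1,2) unfolding regular_def by metis
  show ?thesis
    unfolding regular_def bounded2_def
  proof (intro conjI allI exI impI)
    show "max K L \<le> j \<Longrightarrow> h i j = 0" for i j using K L assms(3) by simp
    show "max (P q) (R q) \<le> p \<Longrightarrow> h p q = 0" for p q using P R assms(3) by simp
  qed
qed

lemma conv_add_left:
  assumes "regular f" "regular f'" "regular g"
  shows "conv (\<lambda>p q. f p q + f' p q) g i j = conv f g i j + conv f' g i j"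
  using Sum_any.distrib[OF regular_conv_finite[OF assms(1,3), of i j, unfolded case_prod_unfold]
      regular_conv_finite[OF assms(2,3), of i j, unfolded case_prod_unfold]]
  by (simp add: conv_def tensor_add_left case_prod_unfold)

lemma conv_add_right:
  assumes "regular f" "regular f'" "regular g"
  shows "conv g (\<lambda>p q. f p q + f' p q) i j = conv g f i j + conv g f' i j"
  using Sum_any.distrib[OF regular_conv_finite[OF assms(3,1), of i j, unfolded case_prod_unfold]
      regular_conv_finite[OF assms(3,2), of i j, unfolded case_prod_unfold]]
  by (simp add: conv_def tensor_add_right case_prod_unfold)

lemma conv_diff_left:
  assumes "regular f" "regular f'" "regular g"
  shows "conv (\<lambda>p q. f p q - f' p q) g i j = conv f g i j - conv f' g i j"
  using Sum_any_diff[OF regular_conv_finite[OF assms(1,3), of i j, unfolded case_prod_unfold]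
      regular_conv_finite[OF assms(2,3), of i j, unfolded case_prod_unfold]]
  by (simp add: conv_def tensor_diff_left case_prod_unfold)

lemma conv_diff_right:
  assumes "regular f" "regular f'" "regular g"
  shows "conv g (\<lambda>p q. f p q - f' p q) i j = conv g f i j - conv g f' i j"
  using Sum_any_diff[OF regular_conv_finite[OF assms(3,1), of i j, unfolded case_prod_unfold]
      regular_conv_finite[OF assms(3,2), of i j, unfolded case_prod_unfold]]
  by (simp add: conv_def tensor_diff_right case_prod_unfold)

lemma conv_shift_left: "conv (\<lambda>p q. f (p + a) (q + b)) g i j = conv f g (i + a) (j + b)"
  unfolding conv_def
proof (rule sym, rule Sum_any.reindex_cong)
  show "bij (\<lambda>(p, q). (p + a, q + b))"
    by (rule bij_betw_byWitness[where f' = "\<lambda>(p, q). (p - a, q - b)"]) auto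
qed (auto simp: fun_eq_iff algebra_simps)

lemma conv_shift_right: "conv f (\<lambda>p q. g (p + a) (q + b)) i j = conv f g (i + a) (j + b)"
  by (simp add: conv_def algebra_simps)

lemmas conv_shift_left1 = conv_shift_left[where b = 0, simplified]
  and conv_shift_left2 = conv_shift_left[where a = 0, simplified]
  and conv_shift_right1 = conv_shift_right[where b = 0, simplified]
  and conv_shift_right2 = conv_shift_right[where a = 0, simplified]

lemma conv_flip: "conv (\<lambda>p q. f q p) (\<lambda>p q. g q p) i j = conv f g j i"
  unfolding conv_def
  by (rule Sum_any.reindex_cong[of prod.swap, symmetric]) (auto simp: fun_eq_iff)

text \<open>Multiplication of a series by \<open>x - y\<close> and by \<open>x + y\<close>.\<close>

definition dshift :: "(int \<Rightarrow> int \<Rightarrow> 'm::ab_group_add) \<Rightarrow> int \<Rightarrow> int \<Rightarrow> 'm" where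
  "dshift f i j = f (i + 1) j - f i (j + 1)"

definition pshift :: "(int \<Rightarrow> int \<Rightarrow> 'm::ab_group_add) \<Rightarrow> int \<Rightarrow> int \<Rightarrow> 'm" where
  "pshift f i j = f (i + 1) j + f i (j + 1)"

lemma regular_dshift: "regular f \<Longrightarrow> regular (dshift f)"
  by (rule regular_combine[OF regular_shift1[of f 1] regular_shift2[of f 1]]) (auto simp: dshift_def)

lemma regular_pshift: "regular f \<Longrightarrow> regular (pshift f)"
  by (rule regular_combine[OF regular_shift1[of f 1] regular_shift2[of f 1]]) (auto simp: pshift_def)

lemma regular_dshift_pow: "regular f \<Longrightarrow> regular ((dshift ^^ n) f)"
  by (induction n) (auto intro: regular_dshift)

lemma regular_pshift_pow: "regular f \<Longrightarrow> regular ((pshift ^^ n) f)"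
  by (induction n) (auto intro: regular_pshift)

lemma conv_dshift_left:
  assumes "regular f" "regular g"
  shows "conv (dshift f) g = dshift (conv f g)"
  using assms
  by (simp add: fun_eq_iff dshift_def[abs_def] conv_diff_left regular_shift1 regular_shift2
      conv_shift_left1 conv_shift_left2)

lemma conv_dshift_right:
  assumes "regular f" "regular g"
  shows "conv f (dshift g) = dshift (conv f g)"
  using assms
  by (simp add: fun_eq_iff dshift_def[abs_def] conv_diff_right regular_shift1 regular_shift2
      conv_shift_right1 conv_shift_right2)

lemma conv_pshift_left:
  assumes "regular f" "regular g"
  shows "conv (pshift f) g = pshift (conv f g)"
  using assms
  by (simp add: fun_eq_iff pshift_def[abs_def] conv_add_left regular_shift1 regular_shift2
      conv_shift_left1 conv_shift_left2)

lemma conv_pshift_right: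
  assumes "regular f" "regular g"
  shows "conv f (pshift g) = pshift (conv f g)"
  using assms
  by (simp add: fun_eq_iff pshift_def[abs_def] conv_add_right regular_shift1 regular_shift2
      conv_shift_right1 conv_shift_right2)

lemma conv_dshift_pow:
  assumes "regular f" "regular g"
  shows "conv ((dshift ^^ n) f) ((dshift ^^ k) g) = (dshift ^^ (n + k)) (conv f g)"
proof -
  have 1: "conv ((dshift ^^ n) f) h = (dshift ^^ n) (conv f h)" if "regular h" for h
    by (induction n) (simp_all add: conv_dshift_left assms that regular_dshift_pow)
  have 2: "conv f ((dshift ^^ k) g) = (dshift ^^ k) (conv f g)"
    by (induction k) (simp_all add: conv_dshift_right assms regular_dshift_pow)
  show ?thesis by (simp add: 1 2 assms regular_dshift_pow funpow_add)
qed

lemma conv_pshift_pow: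
  assumes "regular f" "regular g"
  shows "conv ((pshift ^^ n) f) ((pshift ^^ k) g) = (pshift ^^ (n + k)) (conv f g)"
proof -
  have 1: "conv ((pshift ^^ n) f) h = (pshift ^^ n) (conv f h)" if "regular h" for h
    by (induction n) (simp_all add: conv_pshift_left assms that regular_pshift_pow)
  have 2: "conv f ((pshift ^^ k) g) = (pshift ^^ k) (conv f g)"
    by (induction k) (simp_all add: conv_pshift_right assms regular_pshift_pow)
  show ?thesis by (simp add: 1 2 assms regular_pshift_pow funpow_add)
qed

lemma pshift_flip: "pshift (\<lambda>i j. f j i) = (\<lambda>i j. pshift f j i)"
  by (simp add: pshift_def fun_eq_iff add.commute)

lemma pshift_pow_flip: "(pshift ^^ n) (\<lambda>i j. f j i) = (\<lambda>i j. (pshift ^^ n) f j i)"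
  by (induction n) (simp_all add: pshift_flip[of "(pshift ^^ _) f"])

text \<open>The coefficients (a_n b)_q x are regular only with the two indices exchanged, hence the
  passage through \<open>conv_flip\<close>.\<close>

lemma conv_pshift_pow':
  assumes "regular (\<lambda>i j. f j i)" "regular (\<lambda>i j. g j i)"
  shows "conv ((pshift ^^ n) f) ((pshift ^^ k) g) = (pshift ^^ (n + k)) (conv f g)"
proof (intro ext)
  fix i j
  have 1: "(\<lambda>i j. conv f g j i) = conv (\<lambda>i j. f j i) (\<lambda>i j. g j i)"
    by (intro ext) (rule conv_flip[symmetric])
  have "(pshift ^^ (n + k)) (conv f g) i j = (pshift ^^ (n + k)) (\<lambda>i j. conv f g j i) j i"
    by (simp only: pshift_pow_flip[of _ "conv f g"])
  also have "\<dots> =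
      conv ((pshift ^^ n) (\<lambda>i j. f j i)) ((pshift ^^ k) (\<lambda>i j. g j i)) j i"
    by (simp only: 1 conv_pshift_pow[OF assms])
  also have "\<dots> = conv (\<lambda>i j. (pshift ^^ n) f j i) (\<lambda>i j. (pshift ^^ k) g j i) j i"
    by (simp only: pshift_pow_flip[of _ f] pshift_pow_flip[of _ g])
  also have "\<dots> = conv ((pshift ^^ n) f) ((pshift ^^ k) g) i j"
    by (rule conv_flip)
  finally show "conv ((pshift ^^ n) f) ((pshift ^^ k) g) i j = (pshift ^^ (n + k)) (conv f g) i j" ..
qed

text \<open>For nonnegative exponent the alternating sum is the binomial expansion of (x -
  y)^n.\<close>

lemma jac_a_eq_dshift:
  assumes "bounded2 K \<alpha>"
  shows "jac_a \<alpha> m (int n) q = (dshift ^^ n) \<alpha> m q"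
proof (induction n arbitrary: m q)
  case 0
  show ?case by (simp add: jac_a_def gbinomial_0_left Sum_any_single[where a = 0])
next
  case (Suc n)
  show ?case
    using jac_a_rec[OF assms, of m "int n" q] by (simp add: Suc dshift_def[of "(dshift ^^ n) \<alpha>"] add.commute)
qed

lemma jac_a_eq_dshift_flip:
  assumes "bounded2 K \<beta>"
  shows "((- 1) powi int n) *\<^sub>C jac_a \<beta> q (int n) m = (dshift ^^ n) (\<lambda>i j. \<beta> j i) m q"
proof (induction n arbitrary: m q)
  case 0
  show ?case by (simp add: jac_a_def gbinomial_0_left Sum_any_single[where a = 0])
next
  case (Suc n)
  let ?F = "\<lambda>i j. \<beta> j i" and ?s = "(- 1 :: complex) powi int n"
  have "(dshift ^^ Suc n) ?F m q = (dshift ^^ n) ?F (m + 1) q - (dshift ^^ n) ?F m (q + 1)"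
    by (simp add: dshift_def[of "(dshift ^^ n) ?F"])
  also have "\<dots> = - (?s *\<^sub>C (jac_a \<beta> (q + 1) (int n) m - jac_a \<beta> q (int n) (m + 1)))"
    by (simp only: Suc[symmetric] cvec.scale_right_diff_distrib minus_diff_eq)
  also have "\<dots> = (- ?s) *\<^sub>C jac_a \<beta> q (int n + 1) m"
    by (simp only: jac_a_rec[OF assms, of q "int n" m] cvec.scale_minus_left)
  also have "- ?s = (- 1) powi int (Suc n)"
    using powi_minus_one_Suc[of "int n"] by (simp only: of_nat_Suc add.commute)
  finally show ?case by (simp only: of_nat_Suc add.commute)
qed

lemma jac_l_eq_pshift:
  assumes "bounded1 K \<gamma>"
  shows "jac_l \<gamma> (int m) n q = (pshift ^^ m) \<gamma> n q"
proof (induction m arbitrary: n q)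
  case 0
  show ?case by (simp add: jac_l_def gbinomial_0_left Sum_any_single[where a = 0])
next
  case (Suc m)
  show ?case
    using jac_l_rec[OF assms, of "int m" n q] by (simp add: Suc pshift_def[of "(pshift ^^ m) \<gamma>"] add.commute)
qed

lemma gbinomial_neg_int: "(of_int n gchoose r :: complex) = (- 1) ^ r * (of_int (int r - n - 1) gchoose r)"
  using gbinomial_negated_upper[of "of_int n :: complex" r] by simp

text \<open>Negating the upper arguments turns them into -i-1 and R-n+i, which no longer depend on
  \<open>r\<close>, so that Vandermonde's identity applies.\<close>

lemma jac_coeff_convolution:
  fixes i n :: int
  shows "(\<Sum>r\<le>R. ((- 1) ^ r * (of_int (i + int r) gchoose r)) *
      ((- 1) ^ (R - r) * (of_int (n - 1 - i - int r) gchoose (R - r)))) =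
    (- 1) ^ R * (of_int n gchoose R :: complex)"
proof -
  have "(\<Sum>r\<le>R. ((- 1) ^ r * (of_int (i + int r) gchoose r :: complex)) *
      ((- 1) ^ (R - r) * (of_int (n - 1 - i - int r) gchoose (R - r)))) =
     (\<Sum>r\<le>R. (of_int (- i - 1) gchoose r) * (of_int (int R - n + i) gchoose (R - r)))"
  proof (rule sum.cong[OF refl])
    fix r assume "r \<in> {..R}"
    then show "((- 1) ^ r * (of_int (i + int r) gchoose r :: complex)) *
      ((- 1) ^ (R - r) * (of_int (n - 1 - i - int r) gchoose (R - r))) =
      (of_int (- i - 1) gchoose r) * (of_int (int R - n + i) gchoose (R - r))"
      by (subst gbinomial_neg_int[of "i + int r"], subst gbinomial_neg_int[of "n - 1 - i - int r"])
        (simp add: of_nat_diff power_add[symmetric] algebra_simps flip: power_mult_distrib)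
  qed
  also have "\<dots> = (of_int (int R - n - 1) gchoose R)"
    unfolding gbinomial_Vandermonde' by simp
  also have "\<dots> = (- 1) ^ R * (of_int n gchoose R)"
    by (subst (2) gbinomial_neg_int) (simp flip: power_mult_distrib mult.assoc)
  finally show ?thesis .
qed

text \<open>\<open>jac_a f 0\<close> collects the coefficients of f(x + y, y), expanded in
  nonnegative powers of y, and a substitution respects products. In coefficients this is
  \<open>jac_coeff_convolution\<close>, after the fourfold sum has been reindexed by the indices of
  \<open>f\<close>.\<close>

lemma conv_jac_a:
  fixes f :: "int \<Rightarrow> int \<Rightarrow> 'm::complex_vector" and g :: "int \<Rightarrow> int \<Rightarrow> 'n::complex_vector"
  assumes "regular f" "regular g"
  shows "conv (jac_a f 0) (jac_a g 0) n q = jac_a (conv f g) 0 n q"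
proof -
  obtain K L where K: "\<And>p q. K \<le> q \<Longrightarrow> f p q = 0" and L: "\<And>p q. L \<le> q \<Longrightarrow> g p q = 0"
    using assms by (auto simp: regular_def bounded2_def)
  obtain P R where P: "\<And>q p. P q \<le> p \<Longrightarrow> f p q = 0" and R: "\<And>q p. R q \<le> p \<Longrightarrow> g p q = 0"
    using assms unfolding regular_def by metis
  define c :: "int \<Rightarrow> nat \<Rightarrow> complex" where "c n r = (- 1) ^ r * (of_int n gchoose r)" for n r
  define F where "F = (\<lambda>i j r s. (c (i + int r) r * c (n - 1 - i - int r) s) *\<^sub>C
      (f i j \<otimes> g (n - 1 - i - int (r + s)) (q - 1 - j + int (r + s))))"
  have nz: "j < K \<and> q - 1 - j + int (r + s) < L \<and> i < P j \<and>
      n - 1 - i - int (r + s) < R (q - 1 - j + int (r + s))"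
    if "f i j \<otimes> g (n - 1 - i - int (r + s)) (q - 1 - j + int (r + s)) \<noteq> 0" for i j r s
  proof -
    from that have "f i j \<noteq> 0" "g (n - 1 - i - int (r + s)) (q - 1 - j + int (r + s)) \<noteq> 0" by auto
    then show ?thesis by (metis K L P R not_le)
  qed
  define X where "X = (\<Union>(j, r, s)\<in>{q - 1 - L..K} \<times> {..nat (L - q + 1 + K)} \<times> {..nat (L - q + 1 + K)}.
      (\<lambda>i. ((i, j), (r, s))) ` {n - 1 - R (q - 1 - j + int (r + s)) - int (r + s)..P j})"
  have finX: "finite X" unfolding X_def by auto
  have subX: "((i, j), (r, s)) \<in> X"
    if "f i j \<otimes> g (n - 1 - i - int (r + s)) (q - 1 - j + int (r + s)) \<noteq> 0" for i j r s
  proof -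
    have "(j, r, s) \<in> {q - 1 - L..K} \<times> {..nat (L - q + 1 + K)} \<times> {..nat (L - q + 1 + K)}"
      using nz[OF that] by (auto simp: nat_le_iff)
    moreover have "i \<in> {n - 1 - R (q - 1 - j + int (r + s)) - int (r + s)..P j}"
      using nz[OF that] by auto
    ultimately show ?thesis unfolding X_def by (intro UN_I[of "(j, r, s)"]) auto
  qed
  have finF: "finite {((i, j), (r, s)). F i j r s \<noteq> 0}"
    by (rule finite_subset[OF _ finX]) (auto simp: F_def intro!: subX)
  have finF1: "finite {(r, s). F i j r s \<noteq> 0}" for i j
    by (rule finite_subset[OF _ finite_imageI[OF finF, of snd]]) (force simp: image_iff)
  have fin1: "finite {r. c k r *\<^sub>C h (k' - int r) (l + int r) \<noteq> 0}"
    if "\<And>p q. B \<le> q \<Longrightarrow> h p q = 0" for B k k' l and h :: "int \<Rightarrow> int \<Rightarrow> 'z::complex_vector"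
    by (rule finite_nat_bound[of "nat (B - l)"]) (use that in auto)
  have "conv (jac_a f 0) (jac_a g 0) n q =
      Sum_any (\<lambda>(k, l). Sum_any (\<lambda>(r, s). F (k - int r) (l + int r) r s))"
    unfolding conv_def
  proof (rule Sum_any.cong, clarify)
    fix k l
    have fin2: "finite {(r, s). F (k - int r) (l + int r) r s \<noteq> 0}"
    proof (rule finite_subset[OF _ finite_imageI[OF finF, of snd]], clarify)
      fix r s assume "F (k - int r) (l + int r) r s \<noteq> 0"
      then show "(r, s) \<in> snd ` {((i, j), r, s). F i j r s \<noteq> 0}"
        by (intro image_eqI[of _ _ "((k - int r, l + int r), (r, s))"]) auto
    qed
    have "jac_a f 0 k l \<otimes> jac_a g 0 (n - 1 - k) (q - 1 - l) =
        Sum_any (\<lambda>r. Sum_any (\<lambda>s. (c k r *\<^sub>C f (k - int r) (l + int r)) \<otimes>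
          (c (n - 1 - k) s *\<^sub>C g (n - 1 - k - int s) (q - 1 - l + int s))))"
      unfolding jac_a_def c_def[symmetric] add_0
      by (subst tensor_Sum_any_left[OF fin1[OF K]], simp, subst tensor_Sum_any_right[OF fin1[OF L]]) simp_all
    also have "\<dots> = Sum_any (\<lambda>r. Sum_any (\<lambda>s. F (k - int r) (l + int r) r s))"
      by (simp add: F_def tensor_scale_left tensor_scale_right algebra_simps)
    also have "\<dots> = Sum_any (\<lambda>(r, s). F (k - int r) (l + int r) r s)"
      by (rule Sum_any_pair[OF fin2])
    finally show "jac_a f 0 k l \<otimes> jac_a g 0 (n - 1 - k) (q - 1 - l) = \<dots>" .
  qed
  also have "\<dots> = Sum_any (\<lambda>((k, l), (r, s)). F (k - int r) (l + int r) r s)"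
  proof -
    have im: "{(x, y). (case x of (k, l) \<Rightarrow> \<lambda>(r, s). F (k - int r) (l + int r) r s) y \<noteq> 0} =
        (\<lambda>((i, j), (r, s)). ((i + int r, j - int r), (r, s))) ` {((i, j), (r, s)). F i j r s \<noteq> 0}"
    proof (intro equalityI subsetI, clarsimp)
      fix k l r s assume "F (k - int r) (l + int r) r s \<noteq> 0"
      then show "((k, l), (r, s)) \<in> (\<lambda>((i, j), (r, s)). ((i + int r, j - int r), (r, s))) `
          {((i, j), (r, s)). F i j r s \<noteq> 0}"
        by (intro image_eqI[of _ _ "((k - int r, l + int r), (r, s))"]) auto
    qed auto
    show ?thesis
      using Sum_any_pair[of "\<lambda>(k, l) (r, s). F (k - int r) (l + int r) r s"] finF
      unfolding im by (simp add: case_prod_unfold)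
  qed
  also have "\<dots> = Sum_any (\<lambda>((i, j), (r, s)). F i j r s)"
  proof (rule sym, rule Sum_any.reindex_cong)
    show "bij (\<lambda>((k, l), (r, s)). ((k - int r, l + int r), (r, s)))"
      by (rule bij_betw_byWitness[where f' = "\<lambda>((i, j), (r, s)). ((i + int r, j - int r), (r, s))"]) auto
  qed (auto simp: fun_eq_iff)
  also have "\<dots> = Sum_any (\<lambda>(i, j). Sum_any (\<lambda>(r, s). F i j r s))"
    using Sum_any_pair[of "\<lambda>(i, j) (r, s). F i j r s"] finF by (simp add: case_prod_unfold)
  also have "\<dots> = Sum_any (\<lambda>(i, j). Sum_any (\<lambda>t. c n t *\<^sub>C (f i j \<otimes> g (n - 1 - i - int t) (q - 1 - j + int t))))"
  proof (rule Sum_any.cong, clarify)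
    fix i j
    have "Sum_any (\<lambda>(r, s). F i j r s) = Sum_any (\<lambda>t. \<Sum>r\<le>t. F i j r (t - r))"
      by (simp add: Sum_any_pair[OF finF1, symmetric] Sum_any_antidiagonal[OF finF1])
    also have "\<dots> = Sum_any (\<lambda>t. (\<Sum>r\<le>t. c (i + int r) r * c (n - 1 - i - int r) (t - r)) *\<^sub>C
        (f i j \<otimes> g (n - 1 - i - int t) (q - 1 - j + int t)))"
      unfolding cvec.scale_sum_left by (intro Sum_any.cong sum.cong) (auto simp: F_def of_nat_diff)
    also have "\<dots> = Sum_any (\<lambda>t. c n t *\<^sub>C (f i j \<otimes> g (n - 1 - i - int t) (q - 1 - j + int t)))"
      unfolding c_def jac_coeff_convolution ..
    finally show "Sum_any (\<lambda>(r, s). F i j r s) = \<dots>" .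
  qed
  also have "\<dots> = Sum_any (\<lambda>t. Sum_any (\<lambda>(i, j). c n t *\<^sub>C (f i j \<otimes> g (n - 1 - i - int t) (q - 1 - j + int t))))"
  proof -
    have "finite {(x, t). c n t *\<^sub>C (f (fst x) (snd x) \<otimes> g (n - 1 - fst x - int t) (q - 1 - snd x + int t)) \<noteq> 0}"
    proof (rule finite_subset[OF _ finite_imageI[OF finX, of "\<lambda>(x, (r, s)). (x, s)"]], clarsimp)
      fix i j t assume "f i j \<otimes> g (n - 1 - i - int t) (q - 1 - j + int t) \<noteq> 0"
      then have "((i, j), (0, t)) \<in> X" by (intro subX) simp
      then show "((i, j), t) \<in> (\<lambda>(x, r, s). (x, s)) ` X" by force
    qed
    from Sum_any_swap[OF this] show ?thesis by (simp add: case_prod_unfold)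
  qed
  also have "\<dots> = jac_a (conv f g) 0 n q"
    unfolding jac_a_def c_def[symmetric]
  proof (rule Sum_any.cong)
    fix t
    have "finite {(i, j). f i j \<otimes> g (n - 1 - i - int t) (q - 1 - j + int t) \<noteq> 0}"
      using regular_conv_finite[OF assms, of "n - int t" "q + int t"] by (simp add: algebra_simps)
    then show "Sum_any (\<lambda>(i, j). c n t *\<^sub>C (f i j \<otimes> g (n - 1 - i - int t) (q - 1 - j + int t))) =
        c n t *\<^sub>C conv f g (0 + n - int t) (q + int t)"
      by (simp add: conv_def scaleC_Sum_any case_prod_unfold algebra_simps)
  qed
  finally show ?thesis .
qed

lemma jac_a_shift: "jac_a f m n q = jac_a (\<lambda>i j. f (i + m) j) 0 n q"
  by (simp add: jac_a_def algebra_simps)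

text \<open>The Borcherds identity is equivalent to locality together with weak associativity. Both
  say that two series agree after multiplication by a power of x - y or of x + y, and such
  statements pass to products, the exponents being added. \<open>jac_all\<close> reassembles the
  identity.\<close>

lemma jac_conv:
  fixes \<alpha> \<beta> \<gamma> :: "int \<Rightarrow> int \<Rightarrow> 'm::complex_vector" and \<alpha>' \<beta>' \<gamma>' :: "int \<Rightarrow> int \<Rightarrow> 'n::complex_vector"
  assumes reg: "regular \<alpha>" "regular \<beta>" "regular (\<lambda>i j. \<gamma> j i)"
    and reg': "regular \<alpha>'" "regular \<beta>'" "regular (\<lambda>i j. \<gamma>' j i)"
    and jac: "\<And>m n q. jac \<alpha> \<beta> \<gamma> m n q" and jac': "\<And>m n q. jac \<alpha>' \<beta>' \<gamma>' m n q"
  shows "jac (conv \<alpha> \<alpha>') (conv \<beta> \<beta>') (conv \<gamma> \<gamma>') m n q"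
proof -
  have "\<exists>K. \<forall>k\<ge>K. bounded2 (int k) f" if "regular f" for f :: "int \<Rightarrow> int \<Rightarrow> 'z::complex_vector"
  proof -
    from that obtain K where "bounded2 K f" by (auto simp: regular_def)
    then show ?thesis by (intro exI[of _ "nat K"]) (auto simp: bounded2_def)
  qed
  note ex = this
  obtain K where K: "bounded2 (int K) \<alpha>" "bounded2 (int K) \<beta>" "bounded2 (int K) (\<lambda>i j. \<gamma> j i)"
    using ex[OF reg(1)] ex[OF reg(2)] ex[OF reg(3)] by (metis le_cases order.trans)
  obtain L where L: "bounded2 (int L) \<alpha>'" "bounded2 (int L) \<beta>'" "bounded2 (int L) (\<lambda>i j. \<gamma>' j i)"
    using ex[OF reg'(1)] ex[OF reg'(2)] ex[OF reg'(3)] by (metis le_cases order.trans)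
  have bconv: "bounded2 (int (K' + L')) (conv f g)"
    if "bounded2 (int K') f" "bounded2 (int L') g" for K' L' and f :: "int \<Rightarrow> int \<Rightarrow> 'm" and g :: "int \<Rightarrow> int \<Rightarrow> 'n"
    unfolding bounded2_def conv_def
  proof (intro allI impI)
    fix i j assume j: "int (K' + L') \<le> j"
    have "f p q \<otimes> g (i - 1 - p) (j - 1 - q) = 0" for p q
    proof (cases "int K' \<le> q")
      case True
      then show ?thesis using that(1) by (simp add: bounded2_def)
    next
      case False
      then have "int L' \<le> j - 1 - q" using j by auto
      then show ?thesis using that(2) by (simp add: bounded2_def)
    qed
    then show "Sum_any (\<lambda>(p, q). f p q \<otimes> g (i - 1 - p) (j - 1 - q)) = 0" by (simp add: case_prod_unfold)
  qed
  have b1: "bounded1 k f \<longleftrightarrow> bounded2 k (\<lambda>i j. f j i)" for k and f :: "int \<Rightarrow> int \<Rightarrow> 'z::complex_vector"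
    by (auto simp: bounded1_def bounded2_def)
  have bconv1: "bounded1 (int (K' + L')) (conv f g)"
    if "bounded1 (int K') f" "bounded1 (int L') g" for K' L' and f :: "int \<Rightarrow> int \<Rightarrow> 'm" and g :: "int \<Rightarrow> int \<Rightarrow> 'n"
    using bconv[OF that[unfolded b1]] by (simp add: bounded1_def bounded2_def conv_flip[of f g])
  have tr: "bounded2 (int (K + L)) (conv \<alpha> \<alpha>')" "bounded2 (int (K + L)) (conv \<beta> \<beta>')"
    "bounded1 (int (K + L)) (conv \<gamma> \<gamma>')"
    using bconv[OF K(1) L(1)] bconv[OF K(2) L(2)] bconv1[of K \<gamma> L \<gamma>'] K(3) L(3) by (auto simp: b1)
  \<comment> \<open>Locality: for large exponent the iterate side of the identity vanishes by
    truncation.\<close>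
  have loc1: "(dshift ^^ k) a = (dshift ^^ k) (\<lambda>i j. b j i)"
    if "K0 \<le> k" "bounded2 (int K0) a" "bounded2 (int K0) b" "bounded1 (int K0) c" "\<And>m n q. jac a b c m n q"
    for k K0 and a b c :: "int \<Rightarrow> int \<Rightarrow> 'z::complex_vector"
  proof (intro ext)
    fix m q
    have "jac_l c m (int k) q = 0"
      using that(1,4) by (simp add: jac_l_def bounded1_def)
    then show "(dshift ^^ k) a m q = (dshift ^^ k) (\<lambda>i j. b j i) m q"
      using that(5)[of m "int k" q, unfolded jac_def jac_a_eq_dshift[OF that(2)] jac_a_eq_dshift_flip[OF that(3)]]
      by simp
  qed
  \<comment> \<open>Weak associativity: with m = k at least the truncation bound of
    \<open>b\<close>, the reversed composition drops out.\<close>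
  have wa1: "(pshift ^^ k) c = jac_a (\<lambda>i j. a (i + int k) j) 0"
    if "bounded2 (int k) b" "bounded1 (int k) c" "\<And>m n q. jac a b c m n q"
    for k and a b c :: "int \<Rightarrow> int \<Rightarrow> 'z::complex_vector"
  proof (intro ext)
    fix n q
    have "jac_a b q n (int k) = 0"
      using that(1) by (simp add: jac_a_def bounded2_def)
    then show "(pshift ^^ k) c n q = jac_a (\<lambda>i j. a (i + int k) j) 0 n q"
      using that(3)[of "int k" n q] by (simp add: jac_def jac_l_eq_pshift[OF that(2)] jac_a_shift[of a "int k"])
  qed
  show ?thesis
  proof (rule jac_all[OF tr, where ?m0.0 = "int (K + L)" and N = "int (K + L)"])
    fix n q
    have "(pshift ^^ (K + L)) (conv \<gamma> \<gamma>') n q =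
        conv (jac_a (\<lambda>i j. \<alpha> (i + int K) j) 0) (jac_a (\<lambda>i j. \<alpha>' (i + int L) j) 0) n q"
      using conv_pshift_pow'[OF reg(3) reg'(3), of K L]
        wa1[OF K(2) _ jac] wa1[OF L(2) _ jac'] K(3) L(3) by (simp add: b1)
    also have "\<dots> = jac_a (conv (\<lambda>i j. \<alpha> (i + int K) j) (\<lambda>i j. \<alpha>' (i + int L) j)) 0 n q"
      by (rule conv_jac_a) (rule regular_shift1[OF reg(1)], rule regular_shift1[OF reg'(1)])
    also have "\<dots> = jac_a (conv \<alpha> \<alpha>') (int (K + L)) n q"
    proof -
      have "conv (\<lambda>i j. \<alpha> (i + int K) j) (\<lambda>i j. \<alpha>' (i + int L) j) = (\<lambda>i j. conv \<alpha> \<alpha>' (i + int (K + L)) j)"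
        unfolding conv_shift_left1[where f = \<alpha> and a = "int K" and g = "\<lambda>i j. \<alpha>' (i + int L) j", abs_def]
          conv_shift_right1[where g = \<alpha>' and a = "int L" and f = \<alpha>] by (simp add: add.assoc)
      then show ?thesis by (simp only: jac_a_shift[of "conv \<alpha> \<alpha>'" "int (K + L)"])
    qed
    finally have "jac_l (conv \<gamma> \<gamma>') (int (K + L)) n q = jac_a (conv \<alpha> \<alpha>') (int (K + L)) n q"
      by (simp only: jac_l_eq_pshift[OF tr(3)])
    moreover have "jac_a (conv \<beta> \<beta>') q n (int (K + L)) = 0"
      using tr(2) by (simp add: jac_a_def bounded2_def)
    ultimately show "jac (conv \<alpha> \<alpha>') (conv \<beta> \<beta>') (conv \<gamma> \<gamma>') (int (K + L)) n q"
      by (simp add: jac_def)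
  next
    fix m n q assume n: "int (K + L) \<le> n"
    \<comment> \<open>The exponent is split so that each factor receives at least its own locality
      exponent, \<open>k\<close> for the left one and \<open>L\<close> for the right one.\<close>
    define k where "k = nat n - L"
    have k: "n = int (k + L)" "K \<le> k" using n by (auto simp: k_def)
    have fl: "(dshift ^^ k) (\<lambda>i j. f j i) = (\<lambda>i j. ((- 1) ^ k) *\<^sub>C (dshift ^^ k) f j i)"
      for k and f :: "int \<Rightarrow> int \<Rightarrow> 'z::complex_vector"
    proof (induction k)
      case (Suc k)
      have "(dshift ^^ Suc k) (\<lambda>i j. f j i) = dshift (\<lambda>i j. ((- 1) ^ k) *\<^sub>C (dshift ^^ k) f j i)"
        using Suc by simp
      then show ?case
        by (simp add: dshift_def[abs_def] fun_eq_iff cvec.scale_right_diff_distrib add.commute)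
    qed simp
    have sc: "conv (\<lambda>i j. s *\<^sub>C f i j) (\<lambda>i j. t *\<^sub>C g i j) i j = (s * t) *\<^sub>C conv f g i j"
      if "regular f" "regular g" for s t i j and f :: "int \<Rightarrow> int \<Rightarrow> 'm" and g :: "int \<Rightarrow> int \<Rightarrow> 'n"
      using regular_conv_finite[OF that, of i j]
      by (simp add: conv_def scaleC_Sum_any case_prod_unfold tensor_scale_left tensor_scale_right mult.commute)
    have "(dshift ^^ (k + L)) (conv \<alpha> \<alpha>') m q = conv ((dshift ^^ k) \<alpha>) ((dshift ^^ L) \<alpha>') m q"
      by (simp only: conv_dshift_pow[OF reg(1) reg'(1)])
    also have "(dshift ^^ k) \<alpha> = (\<lambda>i j. ((- 1) ^ k) *\<^sub>C (dshift ^^ k) \<beta> j i)"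
      using loc1[OF k(2) K(1,2) _ jac] K(3) by (simp only: b1 fl[of k \<beta>])
    also have "(dshift ^^ L) \<alpha>' = (\<lambda>i j. ((- 1) ^ L) *\<^sub>C (dshift ^^ L) \<beta>' j i)"
      using loc1[OF order.refl L(1,2) _ jac'] L(3) by (simp only: b1 fl[of L \<beta>'])
    also have "conv (\<lambda>i j. ((- 1) ^ k) *\<^sub>C (dshift ^^ k) \<beta> j i) (\<lambda>i j. ((- 1) ^ L) *\<^sub>C (dshift ^^ L) \<beta>' j i) m q =
        conv (\<lambda>i j. ((- 1) ^ k) *\<^sub>C (dshift ^^ k) \<beta> i j) (\<lambda>i j. ((- 1) ^ L) *\<^sub>C (dshift ^^ L) \<beta>' i j) q m"
      by (rule conv_flip)
    also have "\<dots> = (((- 1) ^ k) * ((- 1) ^ L)) *\<^sub>C conv ((dshift ^^ k) \<beta>) ((dshift ^^ L) \<beta>') q m"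
      by (rule sc) (simp_all only: regular_dshift_pow reg reg')
    also have "\<dots> = ((- 1) ^ (k + L)) *\<^sub>C (dshift ^^ (k + L)) (conv \<beta> \<beta>') q m"
      by (simp add: conv_dshift_pow reg reg' power_add)
    also have "\<dots> = (dshift ^^ (k + L)) (\<lambda>i j. conv \<beta> \<beta>' j i) m q"
      unfolding fl[of "k + L" "conv \<beta> \<beta>'"] ..
    finally have "(dshift ^^ (k + L)) (conv \<alpha> \<alpha>') m q = (dshift ^^ (k + L)) (\<lambda>i j. conv \<beta> \<beta>' j i) m q" .
    moreover have "jac_l (conv \<gamma> \<gamma>') m (int (k + L)) q = 0"
      using tr(3) k n by (simp add: jac_l_def bounded1_def)
    ultimately show "jac (conv \<alpha> \<alpha>') (conv \<beta> \<beta>') (conv \<gamma> \<gamma>') m n q"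
      unfolding jac_def k(1) jac_a_eq_dshift[OF tr(1)] jac_a_eq_dshift_flip[OF tr(2)] by simp
  qed
qed

section \<open>Modes on a tensor product of modules\<close>

lemma finite_swap:
  assumes "finite {(p, q). P p q}"
  shows "finite {(q, p). P p q}"
proof -
  have "{(q, p). P p q} = prod.swap ` {(p, q). P p q}" by auto
  then show ?thesis using assms by simp
qed

lemma regular_modes:
  assumes "vmod V act"
  shows "regular (\<lambda>i j. act a i (act b j x))"
proof -
  interpret vmod V act by fact
  show ?thesis
    unfolding regular_def bounded2_def using act_trunc
    by (auto intro!: exI[of _ "ord b x"] simp: act_ord)
qed

locale tensor_pair = M: vmod A act + N: vmod B act'
  for A :: "'a::complex_vector va" and act :: "'a \<Rightarrow> int \<Rightarrow> 'm::complex_vector \<Rightarrow> 'm"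
    and B :: "'b::complex_vector va" and act' :: "'b \<Rightarrow> int \<Rightarrow> 'n::complex_vector \<Rightarrow> 'n"
begin

definition mode_sum :: "'a \<Rightarrow> 'b \<Rightarrow> int \<Rightarrow> 'm \<Rightarrow> 'n \<Rightarrow> ('m, 'n) tensor" where
  "mode_sum a b n x y = Sum_any (\<lambda>i::int. act a i x \<otimes> act' b (n - 1 - i) y)"

lemma mode_sum_finite: "finite {i. act a i x \<otimes> act' b (n - 1 - i) y \<noteq> 0}"
  by (rule finite_int_bound[of "M.ord a x" _ "n - 1 - N.ord b y"]) (auto simp: M.act_ord N.act_ord)

lemma mode_sum_linear:
  "clinear (\<lambda>a. mode_sum a b n x y)" "clinear (\<lambda>b. mode_sum a b n x y)"
  "clinear (\<lambda>x. mode_sum a b n x y)" "clinear (\<lambda>y. mode_sum a b n x y)"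
  unfolding mode_sum_def
  by (rule clinear_Sum_any_fun[OF _ mode_sum_finite], rule clinear_compose[OF clinear_tensor_left]
      clinear_compose[OF clinear_tensor_right],
      rule M.act_linear_left N.act_linear_left M.act_linear_right N.act_linear_right)+

lemma mode_sum_bilinear: "cbilinear (mode_sum a b n)" "cbilinear (\<lambda>a b. mode_sum a b n x y)"
  using mode_sum_linear by (auto simp: cbilinear_def)

lemma tensor_act_def': "tensor_act act act' t n w = tensor_lift (\<lambda>a b. tensor_lift (mode_sum a b n) w) t"
  by (simp add: tensor_act_def mode_sum_def[abs_def])

lemma lift_bilinear: "cbilinear (\<lambda>a b. tensor_lift (mode_sum a b n) w)"
proof (induction w rule: tensor_induct)
  case (pure x y)
  show ?case using mode_sum_bilinear(2) by (simp add: tensor_lift_tensor_of[OF mode_sum_bilinear(1)])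
next
  case (add s t)
  then show ?case
    by (auto simp: cbilinear_def clinear_add[OF clinear_tensor_lift[OF mode_sum_bilinear(1)]] intro: clinear_plus)
qed

lemma act_linear_left: "clinear (\<lambda>t. tensor_act act act' t n w)"
  unfolding tensor_act_def' by (rule clinear_tensor_lift[OF lift_bilinear])

lemma act_pure': "tensor_act act act' (a \<otimes> b) n w = tensor_lift (mode_sum a b n) w"
  by (simp add: tensor_act_def' tensor_lift_tensor_of[OF lift_bilinear])

lemma act_linear_right: "clinear (tensor_act act act' t n)"
proof (induction t rule: tensor_induct)
  case (pure a b)
  show ?case using clinear_tensor_lift[OF mode_sum_bilinear(1), of a b n] by (simp add: act_pure'[abs_def])
next
  case (add s t)
  then show ?case
    using clinear_plus by (simp add: clinear_add[OF act_linear_left, abs_def])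
qed

lemma act_pure: "tensor_act act act' (a \<otimes> b) n (x \<otimes> y) = Sum_any (\<lambda>i::int. act a i x \<otimes> act' b (n - 1 - i) y)"
  by (simp add: act_pure' tensor_lift_tensor_of[OF mode_sum_bilinear(1)] mode_sum_def)

lemma act_trunc_pure: "M.ord a x + N.ord b y \<le> n \<Longrightarrow> tensor_act act act' (a \<otimes> b) n (x \<otimes> y) = 0"
proof -
  assume n: "M.ord a x + N.ord b y \<le> n"
  have "act a i x \<otimes> act' b (n - 1 - i) y = 0" for i
  proof (cases "M.ord a x \<le> i")
    case False
    then have "N.ord b y \<le> n - 1 - i" using n by linarith
    then show ?thesis by (simp add: N.act_ord)
  qed (simp add: M.act_ord)
  then show ?thesis by (simp add: act_pure)
qed

lemma act_trunc: "\<exists>N. \<forall>n\<ge>N. tensor_act act act' t n w = 0"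
proof (induction t rule: tensor_induct)
  case (pure a b)
  show ?case
  proof (induction w rule: tensor_induct)
    case (pure x y)
    show ?case using act_trunc_pure by blast
  next
    case (add s t)
    then obtain N1 N2 where "\<forall>n\<ge>N1. tensor_act act act' (a \<otimes> b) n s = 0"
      "\<forall>n\<ge>N2. tensor_act act act' (a \<otimes> b) n t = 0" by blast
    then show ?case
      by (intro exI[of _ "max N1 N2"]) (simp add: clinear_add[OF act_linear_right])
  qed
next
  case (add s t)
  then obtain N1 N2 where "\<forall>n\<ge>N1. tensor_act act act' s n w = 0"
    "\<forall>n\<ge>N2. tensor_act act act' t n w = 0" by blast
  then show ?case
    by (intro exI[of _ "max N1 N2"]) (simp add: clinear_add[OF act_linear_left])
qed

lemma act_vacuum_left: "tensor_act act act' (vacuum A \<otimes> b) n (x \<otimes> y) = x \<otimes> act' b n y"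
  by (subst act_pure, subst Sum_any_single[where a = "- 1"]) (auto simp: M.act_vacuum)

lemma act_vacuum_right: "tensor_act act act' (a \<otimes> vacuum B) n (x \<otimes> y) = act a n x \<otimes> y"
  by (subst act_pure, subst Sum_any_single[where a = n]) (auto simp: N.act_vacuum)

lemma act_conv:
  "tensor_act act act' (a \<otimes> a') i (tensor_act act act' (b \<otimes> b') j (x \<otimes> y)) =
    conv (\<lambda>p q. act a p (act b q x)) (\<lambda>p q. act' a' p (act' b' q y)) i j"
proof -
  let ?f = "\<lambda>p q. act a p (act b q x)" and ?g = "\<lambda>p q. act' a' p (act' b' q y)"
  have reg: "regular ?f" "regular ?g"
    by (rule regular_modes[OF M.vmod_axioms], rule regular_modes[OF N.vmod_axioms])
  have "tensor_act act act' (a \<otimes> a') i (tensor_act act act' (b \<otimes> b') j (x \<otimes> y)) =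
      Sum_any (\<lambda>q. Sum_any (\<lambda>p. ?f p q \<otimes> ?g (i - 1 - p) (j - 1 - q)))"
    by (simp add: act_pure clinear_Sum_any[OF act_linear_right mode_sum_finite])
  also have "\<dots> = Sum_any (\<lambda>(q, p). ?f p q \<otimes> ?g (i - 1 - p) (j - 1 - q))"
    by (rule Sum_any_pair[OF finite_swap[OF regular_conv_finite[OF reg]]])
  also have "\<dots> = Sum_any (\<lambda>(p, q). ?f p q \<otimes> ?g (i - 1 - p) (j - 1 - q))"
    by (rule Sum_any.reindex_cong[of prod.swap, symmetric]) (auto simp: fun_eq_iff)
  finally show ?thesis by (simp add: conv_def)
qed

end

lemma (in va_mod) regular_product: "regular (\<lambda>q n. act (nprod V a n b) q x)"
  unfolding regular_def bounded2_def using M.act_trunc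
  by (auto intro!: exI[of _ "ord a b"] simp: act_ord)

lemma jac_add:
  assumes "jac \<alpha> \<beta> \<gamma> m n q" "jac \<alpha>' \<beta>' \<gamma>' m n q"
    and "bounded2 K \<alpha>" "bounded2 K \<beta>" "bounded1 K \<gamma>" "bounded2 K \<alpha>'" "bounded2 K \<beta>'" "bounded1 K \<gamma>'"
  shows "jac (\<lambda>i j. \<alpha> i j + \<alpha>' i j) (\<lambda>i j. \<beta> i j + \<beta>' i j) (\<lambda>i j. \<gamma> i j + \<gamma>' i j) m n q"
proof -
  have a: "jac_a (\<lambda>i j. f i j + f' i j) m n q = jac_a f m n q + jac_a f' m n q"
    if "bounded2 K f" "bounded2 K f'" for f f' :: "int \<Rightarrow> int \<Rightarrow> 'a" and m n q
    unfolding jac_a_def scaleC_add_right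
    by (rule Sum_any.distrib; rule finite_nat_bound[of "nat (K - q)"])
      (use that in \<open>auto simp: bounded2_def nat_le_iff\<close>)
  have l: "jac_l (\<lambda>i j. f i j + f' i j) m n q = jac_l f m n q + jac_l f' m n q"
    if "bounded1 K f" "bounded1 K f'" for f f' :: "int \<Rightarrow> int \<Rightarrow> 'a" and m n q
    unfolding jac_l_def scaleC_add_right
    by (rule Sum_any.distrib; rule finite_nat_bound[of "nat (K - n)"])
      (use that in \<open>auto simp: bounded1_def nat_le_iff\<close>)
  show ?thesis
    using assms by (simp add: jac_def a l scaleC_add_right)
qed

lemma bounded2_mono: "bounded2 K f \<Longrightarrow> K \<le> L \<Longrightarrow> bounded2 L f"
  by (auto simp: bounded2_def)

text \<open>The three alternatives of \<open>eq\<close> give additivity in \<open>x\<close>, \<open>a\<close> and \<open>b\<close>.\<close>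

lemma jac_additive:
  assumes lin: "\<And>n. cbilinear (\<lambda>a. act a n)" "\<And>n. cbilinear (\<lambda>a. pr a n)"
    and trunc: "\<And>a x. \<exists>N. \<forall>n\<ge>N. act a n x = 0" "\<And>a b. \<exists>N. \<forall>n\<ge>N. pr a n b = 0"
    and jac: "jac (\<lambda>i j. act a i (act b j x)) (\<lambda>i j. act b i (act a j x)) (\<lambda>n q. act (pr a n b) q x) m n q"
      "jac (\<lambda>i j. act a' i (act b' j x')) (\<lambda>i j. act b' i (act a' j x')) (\<lambda>n q. act (pr a' n b') q x') m n q"
    and eq: "a' = a \<and> b' = b \<and> x'' = x + x' \<and> a'' = a \<and> b'' = b \<or>
      a' = a \<and> x' = x \<and> b'' = b + b' \<and> a'' = a \<and> x'' = x \<or>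
      b' = b \<and> x' = x \<and> a'' = a + a' \<and> b'' = b \<and> x'' = x"
  shows "jac (\<lambda>i j. act a'' i (act b'' j x'')) (\<lambda>i j. act b'' i (act a'' j x''))
      (\<lambda>n q. act (pr a'' n b'') q x'') m n q"
proof -
  have ex: "\<exists>K. \<forall>L\<ge>K. bounded2 L (\<lambda>i j. act a i (act b j x)) \<and> bounded2 L (\<lambda>i j. act b i (act a j x)) \<and>
      bounded1 L (\<lambda>n q. act (pr a n b) q x)" for a b x
  proof -
    have z: "act a n 0 = 0" "act 0 n x = 0" for a n x
      using lin(1)[of n] clinear_0 by (auto simp: cbilinear_def)
    obtain N1 N2 N3 where "\<forall>n\<ge>N1. act a n x = 0" "\<forall>n\<ge>N2. act b n x = 0" "\<forall>n\<ge>N3. pr a n b = 0"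
      using trunc by metis
    then show ?thesis
      by (intro exI[of _ "max N1 (max N2 N3)"]) (auto simp: bounded1_def bounded2_def z)
  qed
  obtain K1 K2 where K1: "\<forall>L\<ge>K1. bounded2 L (\<lambda>i j. act a i (act b j x)) \<and> bounded2 L (\<lambda>i j. act b i (act a j x)) \<and>
      bounded1 L (\<lambda>n q. act (pr a n b) q x)"
    and K2: "\<forall>L\<ge>K2. bounded2 L (\<lambda>i j. act a' i (act b' j x')) \<and> bounded2 L (\<lambda>i j. act b' i (act a' j x')) \<and>
      bounded1 L (\<lambda>n q. act (pr a' n b') q x')"
    using ex[of a b x] ex[of a' b' x'] by blast
  have l: "clinear (\<lambda>a. act a n x)" "clinear (act a n)" "clinear (\<lambda>a. pr a n b)" "clinear (pr a n)" for a n x b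
    using lin by (auto simp: cbilinear_def)
  note ls = clinear_add[OF l(1)] clinear_add[OF l(2)] clinear_add[OF l(3)] clinear_add[OF l(4)]
  have "jac (\<lambda>i j. act a i (act b j x) + act a' i (act b' j x'))
      (\<lambda>i j. act b i (act a j x) + act b' i (act a' j x'))
      (\<lambda>n q. act (pr a n b) q x + act (pr a' n b') q x') m n q"
    by (rule jac_add[OF jac, of "max K1 K2"]) (use K1 K2 in auto)
  then show ?thesis using eq by (elim disjE conjE) (simp_all add: ls)
qed

locale tensor_mod = A: vertex_alg A + B: vertex_alg B + tensor_pair A act B act'
  for A :: "'a::complex_vector va" and act :: "'a \<Rightarrow> int \<Rightarrow> 'm::complex_vector \<Rightarrow> 'm"
    and B :: "'b::complex_vector va" and act' :: "'b \<Rightarrow> int \<Rightarrow> 'n::complex_vector \<Rightarrow> 'n"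
begin

sublocale AB: tensor_pair A "nprod A" B "nprod B" ..
sublocale MA: va_mod A act ..
sublocale MB: va_mod B act' ..

lemma product_conv:
  "tensor_act act act' (tensor_act (nprod A) (nprod B) (a \<otimes> a') n (b \<otimes> b')) q (x \<otimes> y) =
    conv (\<lambda>n q. act (nprod A a n b) q x) (\<lambda>n q. act' (nprod B a' n b') q y) n q"
proof -
  let ?f = "\<lambda>q n. act (nprod A a n b) q x" and ?g = "\<lambda>q n. act' (nprod B a' n b') q y"
  have "tensor_act act act' (tensor_act (nprod A) (nprod B) (a \<otimes> a') n (b \<otimes> b')) q (x \<otimes> y) =
      Sum_any (\<lambda>i. Sum_any (\<lambda>j. act (nprod A a i b) j x \<otimes> act' (nprod B a' (n - 1 - i) b') (q - 1 - j) y))"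
    by (simp add: AB.act_pure act_pure clinear_Sum_any[OF act_linear_left AB.mode_sum_finite])
  also have "\<dots> = Sum_any (\<lambda>(i, j). act (nprod A a i b) j x \<otimes> act' (nprod B a' (n - 1 - i) b') (q - 1 - j) y)"
    by (rule Sum_any_pair[OF finite_swap[OF regular_conv_finite[OF MA.regular_product MB.regular_product]]])
  finally show ?thesis by (simp add: conv_def)
qed

text \<open>The identity is additive in each of its three arguments, which reduces it to pure
  tensors; there all compositions are of the form \<open>conv\<close> and \<open>jac_conv\<close>
  applies.\<close>

lemma tensor_jac:
  "jac (\<lambda>i j. tensor_act act act' a i (tensor_act act act' b j x))
    (\<lambda>i j. tensor_act act act' b i (tensor_act act act' a j x))
    (\<lambda>n q. tensor_act act act' (tensor_act (nprod A) (nprod B) a n b) q x) m n q"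
proof -
  note additive = jac_additive[where act = "tensor_act act act'" and pr = "tensor_act (nprod A) (nprod B)",
      OF _ _ act_trunc AB.act_trunc]
  have bil: "cbilinear (\<lambda>a. tensor_act act act' a n)" "cbilinear (\<lambda>a. tensor_act (nprod A) (nprod B) a n)" for n
    by (auto simp: cbilinear_def act_linear_left act_linear_right AB.act_linear_left AB.act_linear_right)
  show ?thesis
  proof (induction a rule: tensor_induct)
    case (pure a a')
    show ?case
    proof (induction b rule: tensor_induct)
      case (pure b b')
      show ?case
      proof (induction x rule: tensor_induct)
        case (pure x y)
        show ?case
          unfolding act_conv product_conv
          by (rule jac_conv) (auto intro: regular_modes[OF M.vmod_axioms] regular_modes[OF N.vmod_axioms]
            MA.regular_product MB.regular_product M.act_jac N.act_jac)
      qed (rule additive[OF bil], assumption+, simp)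
    qed (rule additive[OF bil], assumption+, simp)
  qed (rule additive[OF bil], assumption+, simp)
qed

lemma tensor_act_vacuum: "tensor_act act act' (vacuum A \<otimes> vacuum B) n w = (if n = - 1 then w else 0)"
  by (rule clinear_tensor_eqI[OF act_linear_right])
    (auto simp: act_vacuum_left N.act_vacuum intro: clinearI)

lemma tensor_va_module: "va_module (tensor_va A B) (tensor_act act act')"
  by (rule va_moduleI)
    (auto simp: cbilinear_def act_linear_left act_linear_right act_trunc tensor_va_def tensor_act_vacuum
      intro: tensor_jac)

sublocale T: vmod "tensor_va A B" "tensor_act act act'"
  by (rule vmod.intro[OF tensor_va_module])

end

locale tensor_alg = A: vertex_alg A + B: vertex_alg B
  for A :: "'a::complex_vector va" and B :: "'b::complex_vector va"
begin

sublocale self: tensor_mod A "nprod A" B "nprod B" ..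

lemma tensor_vertex_algebra: "vertex_algebra (tensor_va A B)"
proof -
  have cr: "nprod A a (- 1) (vacuum A) = a" "0 \<le> n \<Longrightarrow> nprod A a n (vacuum A) = 0" for a n
    using A.vertex_algebra by (auto simp: vertex_algebra_def)
  have cr': "nprod B a (- 1) (vacuum B) = a" "0 \<le> n \<Longrightarrow> nprod B a n (vacuum B) = 0" for a n
    using B.vertex_algebra by (auto simp: vertex_algebra_def)
  have 1: "tensor_act (nprod A) (nprod B) a (- 1) (vacuum A \<otimes> vacuum B) = a" for a
  proof (rule clinear_tensor_eqI[OF self.act_linear_left clinear_id])
    fix a b
    have "nprod A a i (vacuum A) \<otimes> nprod B b (- 1 - 1 - i) (vacuum B) = 0" if "i \<noteq> - 1" for i
      using that cr(2)[of i a] cr'(2)[of "- 1 - 1 - i" b] by (cases "0 \<le> i") auto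
    then show "tensor_act (nprod A) (nprod B) (a \<otimes> b) (- 1) (vacuum A \<otimes> vacuum B) = a \<otimes> b"
      by (subst self.act_pure, subst Sum_any_single[where a = "- 1"]) (auto simp: cr cr')
  qed
  have 2: "tensor_act (nprod A) (nprod B) a n (vacuum A \<otimes> vacuum B) = 0" if "0 \<le> n" for a n
  proof (rule clinear_tensor_eqI[OF self.act_linear_left clinear_zero_fun])
    fix a b
    have "nprod A a i (vacuum A) \<otimes> nprod B b (n - 1 - i) (vacuum B) = 0" for i
      using that cr(2)[of i a] cr'(2)[of "n - 1 - i" b] by (cases "0 \<le> i") auto
    then show "tensor_act (nprod A) (nprod B) (a \<otimes> b) n (vacuum A \<otimes> vacuum B) = 0"
      by (simp add: self.act_pure)
  qed
  show ?thesis
    using self.tensor_va_module 1 2 by (simp add: vertex_algebra_def tensor_va_def)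
qed

sublocale AB: vertex_alg "tensor_va A B"
  by (rule vertex_alg.intro[OF tensor_vertex_algebra])

end

section \<open>The skew product\<close>

lemma finite_pairs_nat:
  assumes "\<And>i j. f i j \<noteq> 0 \<Longrightarrow> i < (I::nat) \<and> j < (J i::nat)"
  shows "finite {(i, j). f i j \<noteq> 0}"
  by (rule finite_subset[of _ "\<Union>i<I. {i} \<times> {..<J i}"]) (use assms in force, simp)

text \<open>The substitution x -> x - y undoes the substitution x -> x + y contained in
  \<open>jac_a\<close>. After trinomial revision the sum over \<open>j\<close> is an expansion of (1
  - 1)^r.\<close>

lemma jac_a_inverse:
  assumes "bounded2 K \<alpha>"
  shows "Sum_any (\<lambda>j::nat. (of_int n gchoose j) *\<^sub>C jac_a \<alpha> 0 (n - int j) (q + int j)) = \<alpha> n q"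
proof -
  define f where "f j i = ((of_int n gchoose j) * ((- 1) ^ i * (of_int (n - int j) gchoose i))) *\<^sub>C
      \<alpha> (n - int j - int i) (q + int j + int i)" for i j :: nat
  have fin: "finite {(j, i). f j i \<noteq> 0}"
  proof (rule finite_pairs_nat[where I = "nat (K - q)" and J = "\<lambda>_. nat (K - q)"])
    fix j i assume "f j i \<noteq> 0"
    then have "\<not> K \<le> q + int j + int i" using assms by (auto simp: f_def bounded2_def)
    then show "j < nat (K - q) \<and> i < nat (K - q)" by linarith
  qed
  have "Sum_any (\<lambda>j::nat. (of_int n gchoose j) *\<^sub>C jac_a \<alpha> 0 (n - int j) (q + int j)) =
      Sum_any (\<lambda>j. Sum_any (\<lambda>i. f j i))"
  proof (rule Sum_any.cong)
    fix j
    have "finite {i. ((- 1) ^ i * (of_int (n - int j) gchoose i) :: complex) *\<^sub>C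
        \<alpha> (0 + (n - int j) - int i) (q + int j + int i) \<noteq> 0}"
      by (rule finite_nat_bound[of "nat (K - q)"]) (use assms in \<open>auto simp: bounded2_def nat_le_iff\<close>)
    then show "(of_int n gchoose j) *\<^sub>C jac_a \<alpha> 0 (n - int j) (q + int j) = Sum_any (\<lambda>i. f j i)"
      unfolding jac_a_def by (simp add: scaleC_Sum_any f_def scaleC_scaleC)
  qed
  also have "\<dots> = Sum_any (\<lambda>r. \<Sum>j\<le>r. f j (r - j))"
    by (rule Sum_any_antidiagonal[OF fin])
  also have "\<dots> = Sum_any (\<lambda>r::nat. if r = 0 then \<alpha> n q else 0)"
  proof (rule Sum_any.cong)
    fix r
    have "(\<Sum>j\<le>r. f j (r - j)) = (\<Sum>j\<le>r. (of_int n gchoose r) * ((- 1) ^ (r - j) * of_nat (r choose j))) *\<^sub>C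
        \<alpha> (n - int r) (q + int r)"
      unfolding cvec.scale_sum_left
    proof (rule sum.cong[OF refl])
      fix j assume "j \<in> {..r}"
      then have j: "j \<le> r" by simp
      have "(of_int n gchoose j) * (of_int (n - int j) gchoose (r - j)) =
          (of_int n gchoose r) * (of_nat (r choose j) :: complex)"
        using gbinomial_trinomial_revision[OF j, of "of_int n :: complex"]
        by (simp add: binomial_gbinomial)
      then have "(of_int n gchoose j) * ((- 1) ^ (r - j) * (of_int (n - int j) gchoose (r - j))) =
          (of_int n gchoose r) * ((- 1) ^ (r - j) * (of_nat (r choose j) :: complex))"
        by (metis mult.left_commute)
      then show "f j (r - j) = ((of_int n gchoose r) * ((- 1) ^ (r - j) * of_nat (r choose j))) *\<^sub>C
          \<alpha> (n - int r) (q + int r)"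
        using j by (simp add: f_def of_nat_diff)
    qed
    also have "(\<Sum>j\<le>r. (of_int n gchoose r) * ((- 1) ^ (r - j) * of_nat (r choose j))) =
        (of_int n gchoose r) * (\<Sum>j\<le>r. (- 1) ^ (r - j) * (of_nat (r choose j) :: complex))"
      by (simp add: sum_distrib_left)
    also have "(\<Sum>j\<le>r. (- 1) ^ (r - j) * (of_nat (r choose j) :: complex)) = (if r = 0 then 1 else 0)"
      using binomial_ring[of "1::complex" "- 1" r] by (simp add: mult.commute power_0_left)
    finally show "(\<Sum>j\<le>r. f j (r - j)) = (if r = 0 then \<alpha> n q else 0)"
      by auto
  qed
  also have "\<dots> = \<alpha> n q" by simp
  finally show ?thesis .
qed

locale translation_mod = va_mod V act
  for V :: "'a::complex_vector va" and act :: "'a \<Rightarrow> int \<Rightarrow> 'm::complex_vector \<Rightarrow> 'm" +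
  fixes D :: "'m \<Rightarrow> 'm"
  assumes D_linear: "clinear D"
    and act_D: "act a n (D x) = D (act a n x) + of_int n *\<^sub>C act a (n - 1) x"
begin

lemma D_pow_linear: "clinear (\<lambda>x. (D ^^ j) x)"
  using clinear_funpow[OF D_linear] by simp

lemma D_pow_0 [simp]: "(D ^^ j) 0 = 0"
  by (rule clinear_0[OF D_pow_linear])

text \<open>The exponential e^{zD} with the signs of skew symmetry, applied to an arbitrary family.
  Only the parity of \<open>q\<close> enters, so that a shift of the mode becomes a sign in
  \<open>Dsum_sign\<close>.\<close>

definition Dsum :: "int \<Rightarrow> (nat \<Rightarrow> 'm) \<Rightarrow> 'm" where
  "Dsum q h = Sum_any (\<lambda>l. ((- 1) powi (q + int l + 1) / fact l) *\<^sub>C (D ^^ l) (h l))"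

abbreviation sk :: "'m \<Rightarrow> int \<Rightarrow> 'a \<Rightarrow> 'm" where
  "sk \<equiv> skew_prod act D"

lemma sk_Dsum: "sk u n b = Dsum n (\<lambda>l. act b (n + int l) u)"
  by (simp add: skew_prod_def Dsum_def)

lemma Dsum_finite:
  assumes "finite {l. h l \<noteq> 0}"
  shows "finite {l. ((- 1) powi (q + int l + 1) / fact l) *\<^sub>C (D ^^ l) (h l) \<noteq> 0}"
  by (rule finite_subset[OF _ assms]) auto

lemma Dsum_add:
  assumes "finite {l. h l \<noteq> 0}" "finite {l. h' l \<noteq> 0}"
  shows "Dsum q (\<lambda>l. h l + h' l) = Dsum q h + Dsum q h'"
  unfolding Dsum_def clinear_add[OF D_pow_linear] scaleC_add_right
  by (rule Sum_any.distrib[OF assms[THEN Dsum_finite]])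

lemma Dsum_diff:
  assumes "finite {l. h l \<noteq> 0}" "finite {l. h' l \<noteq> 0}"
  shows "Dsum q (\<lambda>l. h l - h' l) = Dsum q h - Dsum q h'"
  unfolding Dsum_def clinear_diff[OF D_pow_linear] cvec.scale_right_diff_distrib
  by (rule Sum_any_diff[OF assms[THEN Dsum_finite]])

lemma Dsum_scale:
  assumes "finite {l. h l \<noteq> 0}"
  shows "Dsum q (\<lambda>l. c *\<^sub>C h l) = c *\<^sub>C Dsum q h"
  unfolding Dsum_def clinear_scaleC[OF D_pow_linear]
  using scaleC_Sum_any[OF Dsum_finite[OF assms], of c q] by (simp add: scaleC_scaleC mult.commute)

lemma Dsum_Sum_any:
  assumes "finite {(i, l). g i l \<noteq> 0}"
  shows "Dsum q (\<lambda>l. Sum_any (\<lambda>i. g i l)) = Sum_any (\<lambda>i. Dsum q (g i))"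
proof -
  have fin: "finite {i. g i l \<noteq> 0}" for l
    by (rule finite_subset[OF _ finite_imageI[OF assms, of fst]]) force
  have fin': "finite {i. (D ^^ l) (g i l) \<noteq> 0}" for l
    by (rule finite_subset[OF _ fin[of l]]) auto
  have "finite {(l, i). ((- 1) powi (q + int l + 1) / fact l) *\<^sub>C (D ^^ l) (g i l) \<noteq> 0}"
    by (rule finite_subset[OF _ finite_swap[OF assms]]) auto
  from Sum_any_swap[OF this] show ?thesis
    unfolding Dsum_def clinear_Sum_any[OF D_pow_linear fin] scaleC_Sum_any[OF fin'] .
qed

lemma Dsum_shift_sign: "Dsum (q + int k) h = (- 1) ^ k *\<^sub>C Dsum q h" if "finite {l. h l \<noteq> 0}"
proof -
  have "(- 1 :: complex) powi (q + int k + int l + 1) = (- 1) ^ k * (- 1) powi (q + int l + 1)" for l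
    using power_int_add[of "- 1 :: complex" "q + int l + 1" "int k"] by (simp add: algebra_simps)
  then show ?thesis
    unfolding Dsum_def scaleC_Sum_any[OF Dsum_finite[OF that]] scaleC_scaleC by (simp add: mult.assoc)
qed

lemma Dsum_sign: "Dsum (q + p) h = ((- 1) powi p) *\<^sub>C Dsum q h" if "finite {l. h l \<noteq> 0}"
proof -
  have "(- 1 :: complex) powi (q + p + int l + 1) = (- 1) powi p * (- 1) powi (q + int l + 1)" for l
    using power_int_add[of "- 1 :: complex" "q + int l + 1" p] by (simp add: algebra_simps)
  then show ?thesis
    unfolding Dsum_def scaleC_Sum_any[OF Dsum_finite[OF that]] scaleC_scaleC by (simp add: mult.assoc)
qed

lemma act_shift_finite: "finite {l::nat. act b (n + int l) u \<noteq> 0}"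
  by (rule finite_nat_bound[of "nat (M.ord b u - n)"]) (simp add: M.act_ord)

lemma sk_linear_left: "clinear (\<lambda>u. sk u n b)"
  unfolding sk_Dsum
  by (rule clinearI)
    (simp_all add: M.act_add_right M.act_scale_right Dsum_add Dsum_scale act_shift_finite)

lemma sk_linear_right: "clinear (sk u n)"
  unfolding sk_Dsum
  by (rule clinearI)
    (simp_all add: M.act_add_left M.act_scale_left Dsum_add Dsum_scale act_shift_finite)

lemmas sk_0_left [simp] = clinear_0[OF sk_linear_left]
  and sk_0_right [simp] = clinear_0[OF sk_linear_right]

lemma sk_ord: "M.ord b u \<le> n \<Longrightarrow> sk u n b = 0"
  by (simp add: sk_Dsum Dsum_def M.act_ord)

lemma act_D_pow:
  "act a m ((D ^^ j) x) = (\<Sum>i\<le>j. (fact j / fact (j - i) * (of_int m gchoose i)) *\<^sub>C (D ^^ (j - i)) (act a (m - int i) x))"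
proof (induction j arbitrary: x)
  case 0
  show ?case by simp
next
  case (Suc j)
  let ?t = "\<lambda>j i. (D ^^ (j - i)) (act a (m - int i) x)"
  have "act a m ((D ^^ Suc j) x) = (\<Sum>i\<le>j. (fact j / fact (j - i) * (of_int m gchoose i)) *\<^sub>C
      (D ^^ (j - i)) (act a (m - int i) (D x)))"
    by (simp only: Suc funpow_Suc_right o_apply)
  also have "\<dots> = (\<Sum>i\<le>j. (fact j / fact (j - i) * (of_int m gchoose i)) *\<^sub>C ?t (Suc j) i +
      (fact j / fact (j - i) * (of_nat (Suc i) * (of_int m gchoose Suc i))) *\<^sub>C ?t (Suc j) (Suc i))"
  proof (rule sum.cong[OF refl])
    fix i assume "i \<in> {..j}"
    then have i: "i \<le> j" by simp
    have "of_int (m - int i) * (of_int m gchoose i) = (of_nat (Suc i) * (of_int m gchoose Suc i) :: complex)"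
      using gbinomial_absorb_comp[of "of_int m :: complex" i] gbinomial_absorption[of i "of_int m :: complex"] by simp
    then have co: "fact j / fact (j - i) * (of_int m gchoose i) * of_int (m - int i) =
        (fact j / fact (j - i) * (of_nat (Suc i) * (of_int m gchoose Suc i)) :: complex)"
      by (metis mult.assoc mult.commute)
    have "(D ^^ (j - i)) (act a (m - int i) (D x)) = (D ^^ (j - i)) (D (act a (m - int i) x)) +
        of_int (m - int i) *\<^sub>C (D ^^ (j - i)) (act a (m - int (Suc i)) x)"
      by (simp add: act_D clinear_add[OF D_pow_linear] clinear_scaleC[OF D_pow_linear] diff_diff_eq add.commute
        del: of_int_diff)
    also have "(D ^^ (j - i)) (D y) = (D ^^ (Suc j - i)) y" for y
      using i by (simp add: Suc_diff_le funpow_swap1)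
    finally show "(fact j / fact (j - i) * (of_int m gchoose i)) *\<^sub>C (D ^^ (j - i)) (act a (m - int i) (D x)) =
        (fact j / fact (j - i) * (of_int m gchoose i)) *\<^sub>C ?t (Suc j) i +
        (fact j / fact (j - i) * (of_nat (Suc i) * (of_int m gchoose Suc i))) *\<^sub>C ?t (Suc j) (Suc i)"
      by (simp only: scaleC_add_right scaleC_scaleC co diff_Suc_Suc)
  qed
  \<comment> \<open>Both sums are brought to the denominator (j+1-i)!, with factors j+1-i and i;
    these add up to j+1, which completes the factorial.\<close>
  also have "\<dots> = (\<Sum>i\<le>Suc j. (of_nat (Suc j - i) * fact j / fact (Suc j - i) * (of_int m gchoose i)) *\<^sub>C ?t (Suc j) i) +
      (\<Sum>i\<le>Suc j. (of_nat i * fact j / fact (Suc j - i) * (of_int m gchoose i)) *\<^sub>C ?t (Suc j) i)"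
  proof -
    have "(\<Sum>i\<le>j. (fact j / fact (j - i) * (of_int m gchoose i)) *\<^sub>C ?t (Suc j) i) =
        (\<Sum>i\<le>Suc j. (of_nat (Suc j - i) * fact j / fact (Suc j - i) * (of_int m gchoose i)) *\<^sub>C ?t (Suc j) i)"
    proof -
      have "of_nat (Suc j - i) * fact j / fact (Suc j - i) = (fact j / fact (j - i) :: complex)" if "i \<le> j" for i
        using that by (simp add: Suc_diff_le del: of_nat_Suc)
      then have "(\<Sum>i\<le>j. (fact j / fact (j - i) * (of_int m gchoose i)) *\<^sub>C ?t (Suc j) i) =
          (\<Sum>i\<le>j. (of_nat (Suc j - i) * fact j / fact (Suc j - i) * (of_int m gchoose i)) *\<^sub>C ?t (Suc j) i)"
        by (intro sum.cong[OF refl]) (simp only: atMost_iff)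
      then show ?thesis
        by (simp only: sum.atMost_Suc diff_self_eq_0 of_nat_0 mult_zero_left div_0 cvec.scale_zero_left add_0_right)
    qed
    moreover have "(\<Sum>i\<le>j. (fact j / fact (j - i) * (of_nat (Suc i) * (of_int m gchoose Suc i))) *\<^sub>C ?t (Suc j) (Suc i)) =
        (\<Sum>i\<le>Suc j. (of_nat i * fact j / fact (Suc j - i) * (of_int m gchoose i)) *\<^sub>C ?t (Suc j) i)"
      by (simp add: sum.atMost_Suc_shift mult_ac del: sum.atMost_Suc)
    ultimately show ?thesis by (simp only: sum.distrib)
  qed
  also have "\<dots> = (\<Sum>i\<le>Suc j. (fact (Suc j) / fact (Suc j - i) * (of_int m gchoose i)) *\<^sub>C ?t (Suc j) i)"
    unfolding sum.distrib[symmetric] scaleC_add_left[symmetric]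
  proof (rule sum.cong[OF refl])
    fix i assume "i \<in> {..Suc j}"
    then have "of_nat (Suc j - i) + of_nat i = (of_nat (Suc j) :: complex)"
      by (simp flip: of_nat_add)
    then have "(of_nat (Suc j - i) + of_nat i) * fact j = (fact (Suc j) :: complex)" by simp
    then show "(of_nat (Suc j - i) * fact j / fact (Suc j - i) * (of_int m gchoose i) +
        of_nat i * fact j / fact (Suc j - i) * (of_int m gchoose i)) *\<^sub>C ?t (Suc j) i =
        (fact (Suc j) / fact (Suc j - i) * (of_int m gchoose i)) *\<^sub>C ?t (Suc j) i"
      by (simp only: add_divide_distrib[symmetric] distrib_right[symmetric])
  qed
  finally show ?case .
qed

text \<open>This is \<open>a(x) e\<^bsup>yD\<^esup> = e\<^bsup>yD\<^esup> a(x - y)\<close>.\<close>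

lemma act_sk:
  "act a m (sk u n b) = Dsum n (\<lambda>l. jac_a (\<lambda>i j. act a i (act b j u)) 0 m (n + int l))"
proof -
  define f where "f i l = ((of_int m gchoose i) * (- 1) powi (n + int (i + l) + 1) / fact l) *\<^sub>C
      (D ^^ l) (act a (m - int i) (act b (n + int (i + l)) u))" for i l :: nat
  have fin: "finite {(i, l). f i l \<noteq> 0}"
  proof (rule finite_pairs_nat[where I = "nat (M.ord b u - n)" and J = "\<lambda>_. nat (M.ord b u - n)"])
    fix j i assume "f j i \<noteq> 0"
    then have "\<not> M.ord b u \<le> n + int (j + i)" using M.act_ord by (auto simp: f_def)
    then show "j < nat (M.ord b u - n) \<and> i < nat (M.ord b u - n)" by linarith
  qed
  have "act a m (sk u n b) = Sum_any (\<lambda>r. \<Sum>i\<le>r. f i (r - i))"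
    unfolding sk_Dsum Dsum_def clinear_Sum_any[OF M.act_linear_right Dsum_finite[OF act_shift_finite]]
  proof (rule Sum_any.cong)
    fix r :: nat
    show "act a m (((- 1) powi (n + int r + 1) / fact r) *\<^sub>C (D ^^ r) (act b (n + int r) u)) = (\<Sum>i\<le>r. f i (r - i))"
      unfolding M.act_scale_right act_D_pow cvec.scale_sum_right
      by (rule sum.cong) (simp_all add: f_def scaleC_scaleC)
  qed
  also have "\<dots> = Sum_any (\<lambda>i. Sum_any (\<lambda>l. f i l))"
    by (rule Sum_any_antidiagonal[OF fin, symmetric])
  also have "\<dots> = Sum_any (\<lambda>l. Sum_any (\<lambda>i. f i l))"
    by (rule Sum_any_swap[OF fin])
  also have "\<dots> = Dsum n (\<lambda>l. jac_a (\<lambda>i j. act a i (act b j u)) 0 m (n + int l))"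
    unfolding Dsum_def
  proof (rule Sum_any.cong)
    fix l :: nat
    let ?g = "\<lambda>i::nat. ((- 1) ^ i * (of_int m gchoose i)) *\<^sub>C act a (0 + m - int i) (act b (n + int l + int i) u)"
    have fing: "finite {i. ?g i \<noteq> 0}"
      by (rule finite_nat_bound[of "nat (M.ord b u - n)"]) (simp add: M.act_ord)
    then have fing': "finite {i. (D ^^ l) (?g i) \<noteq> 0}"
      by (rule finite_subset[rotated]) auto
    have e: "(- 1 :: complex) powi (n + int (i + l) + 1) = (- 1) powi (n + int l + 1) * (- 1) ^ i" for i
      using power_int_add[of "- 1 :: complex" "n + int l + 1" "int i"] by (simp add: algebra_simps)
    show "Sum_any (\<lambda>i. f i l) = ((- 1) powi (n + int l + 1) / fact l) *\<^sub>C
        (D ^^ l) (jac_a (\<lambda>i j. act a i (act b j u)) 0 m (n + int l))"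
      unfolding jac_a_def clinear_Sum_any[OF D_pow_linear fing] scaleC_Sum_any[OF fing']
      unfolding f_def e clinear_scaleC[OF D_pow_linear] scaleC_scaleC
      by (simp add: mult_ac add_ac)
  qed
  finally show ?thesis .
qed

lemma bounded2_modes: "bounded2 (max (M.ord a x) (M.ord b x)) (\<lambda>i j. act a i (act b j x))"
  by (auto simp: bounded2_def M.act_ord)

lemma jac_a_modes_finite:
  "finite {l::nat. jac_a (\<lambda>i j. act a i (act b j u)) k m (n + int l) \<noteq> 0}"
  by (rule finite_nat_bound[of "nat (M.ord b u - n)"]) (simp add: jac_a_def M.act_ord)

text \<open>Moving \<open>a\<close> past e^{yD} changes it into a(x - y). The iterate formula of the
  module splits the result into the skew product with \<open>nprod V a m c\<close> and terms in
  which \<open>a\<close> acts on \<open>u\<close>.\<close>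

lemma sk_commutator:
  "jac (\<lambda>i j. act a i (sk u j c)) (\<lambda>i j. sk u i (nprod V a j c)) (\<lambda>n q. sk (act a n u) q c) m 0 q"
proof -
  define g where "g i l = ((- 1) ^ i * (of_int m gchoose i)) *\<^sub>C act c (q + m - int i + int l) (act a (int i) u)" for i l :: nat
  have fing: "finite {(i, l). g i l \<noteq> 0}"
  proof (rule finite_pairs_nat)
    fix i l assume "g i l \<noteq> 0"
    then have "act a (int i) u \<noteq> 0" "act c (q + m - int i + int l) (act a (int i) u) \<noteq> 0"
      by (auto simp: g_def)
    then have "\<not> M.ord a u \<le> int i" "\<not> M.ord c (act a (int i) u) \<le> q + m - int i + int l"
      by (auto simp: M.act_ord)
    then show "i < nat (M.ord a u) \<and> l < nat (M.ord c (act a (int i) u) - (q + m - int i))" by linarith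
  qed
  have fing1: "finite {l. g i l \<noteq> 0}" for i
    by (rule finite_subset[OF _ finite_imageI[OF fing, of snd]]) force
  have j: "jac_a (\<lambda>i j. act a i (act c j u)) 0 m (q + int l) =
      act (nprod V a m c) (q + int l) u + ((- 1) powi m) *\<^sub>C Sum_any (\<lambda>i. g i l)" for l
  proof -
    have "jac_l (\<lambda>n q. act (nprod V a n c) q u) 0 m (q + int l) = act (nprod V a m c) (q + int l) u"
      by (simp add: jac_l_def gbinomial_0_left Sum_any_single[where a = 0])
    moreover have "jac_a (\<lambda>i j. act c i (act a j u)) (q + int l) m 0 = Sum_any (\<lambda>i. g i l)"
      by (simp add: jac_a_def g_def algebra_simps)
    ultimately show ?thesis
      using M.act_jac[of a c u 0 m "q + int l"] by (simp add: jac_def)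
  qed
  have fs: "finite {l. Sum_any (\<lambda>i. g i l) \<noteq> 0}"
    by (rule finite_subset[OF _ finite_imageI[OF fing, of snd]])
      (force elim!: Sum_any.not_neutral_obtains_not_neutral)
  have fs': "finite {l. ((- 1) powi m) *\<^sub>C Sum_any (\<lambda>i. g i l) \<noteq> 0}"
    by (rule finite_subset[OF _ fs]) auto
  have "act a m (sk u q c) = sk u q (nprod V a m c) + ((- 1) powi m) *\<^sub>C Sum_any (\<lambda>i. Dsum q (g i))"
    unfolding act_sk j Dsum_add[OF act_shift_finite fs'] Dsum_scale[OF fs] Dsum_Sum_any[OF fing]
    by (simp add: sk_Dsum)
  also have "((- 1) powi m) *\<^sub>C Sum_any (\<lambda>i. Dsum q (g i)) =
      Sum_any (\<lambda>i::nat. (of_int m gchoose i) *\<^sub>C sk (act a (int i) u) (m + q - int i) c)"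
  proof -
    have fD: "finite {i. Dsum q (g i) \<noteq> 0}"
      by (rule finite_nat_bound[of "nat (M.ord a u)"]) (simp add: g_def M.act_ord Dsum_def)
    have "((- 1) powi m) *\<^sub>C Dsum q (g i) = (of_int m gchoose i) *\<^sub>C sk (act a (int i) u) (m + q - int i) c" for i
    proof -
      let ?h = "\<lambda>l. act c (m + q - int i + int l) (act a (int i) u)"
      have "Dsum q (g i) = ((- 1) ^ i * (of_int m gchoose i)) *\<^sub>C Dsum q ?h"
        using Dsum_scale[OF act_shift_finite[of c "m + q - int i" "act a (int i) u"]]
        by (simp add: g_def[abs_def] algebra_simps)
      moreover have "Dsum (m + q - int i) ?h = ((- 1) powi m * (- 1) ^ i) *\<^sub>C Dsum q ?h"
      proof -
        have "(- 1 :: complex) powi (m - int i) = (- 1) powi m * (- 1) ^ i"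
          using power_int_diff[of "- 1 :: complex" m "int i"] by (simp add: power_int_minus divide_inverse)
            (metis inverse_minus_eq inverse_1 power_inverse)
        then show ?thesis
          using Dsum_sign[OF act_shift_finite[of c "m + q - int i" "act a (int i) u"], of q "m - int i"]
          by (simp add: algebra_simps)
      qed
      ultimately show ?thesis by (simp add: sk_Dsum scaleC_scaleC mult_ac)
    qed
    then show ?thesis by (simp add: scaleC_Sum_any[OF fD])
  qed
  finally have "act a m (sk u q c) = sk u q (nprod V a m c) + jac_l (\<lambda>n q. sk (act a n u) q c) m 0 q"
    by (simp add: jac_l_def)
  then show ?thesis
    by (simp add: jac_def jac_a_def gbinomial_0_left Sum_any_single[where a = 0])
qed

text \<open>The roles are reversed here: the commutator formula of the module gives the iterate
  formula of the skew product. The substitution produced by moving \<open>a\<close> past e^{yD} is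
  cancelled by \<open>jac_a_inverse\<close>.\<close>

lemma sk_iterate:
  "jac (\<lambda>i j. act a i (sk u j c)) (\<lambda>i j. sk u i (nprod V a j c)) (\<lambda>n q. sk (act a n u) q c) 0 n q"
proof -
  let ?\<alpha> = "\<lambda>i j. act a i (act c j u)" and ?\<beta> = "\<lambda>i j. act c i (act a j u)"
  let ?\<gamma> = "\<lambda>n q. act (nprod V a n c) q u"
  have pm: "(- 1 :: complex) ^ j * (- 1) ^ j = 1" for j by (simp flip: power_mult_distrib)
  have 1: "jac_a (\<lambda>i j. act a i (sk u j c)) 0 n q = Dsum q (\<lambda>l. ?\<alpha> n (q + int l))"
  proof -
    define g where "g j l = (of_int n gchoose j) *\<^sub>C jac_a ?\<alpha> 0 (n - int j) (q + int l + int j)" for j l :: nat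
    have fin: "finite {(j, l). g j l \<noteq> 0}"
    proof (rule finite_pairs_nat)
      fix j l assume "g j l \<noteq> 0"
      then have "\<not> M.ord c u \<le> q + int l + int j"
        by (auto simp: g_def jac_a_def M.act_ord)
      then show "j < nat (M.ord c u - q) \<and> l < nat (M.ord c u - q)" by linarith
    qed
    have "jac_a (\<lambda>i j. act a i (sk u j c)) 0 n q = Sum_any (\<lambda>j. Dsum q (g j))"
      unfolding jac_a_def[of "\<lambda>i j. act a i (sk u j c)"]
    proof (rule Sum_any.cong)
      fix j
      have f: "finite {l. jac_a ?\<alpha> 0 (n - int j) (q + int j + int l) \<noteq> 0}"
        by (rule jac_a_modes_finite)
      show "((- 1) ^ j * (of_int n gchoose j)) *\<^sub>C act a (0 + n - int j) (sk u (q + int j) c) = Dsum q (g j)"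
        using Dsum_scale[OF f, of q "of_int n gchoose j"] pm[of j] Dsum_shift_sign[OF f, of q j]
        by (simp add: act_sk scaleC_scaleC g_def[abs_def] algebra_simps)
    qed
    also have "\<dots> = Dsum q (\<lambda>l. Sum_any (\<lambda>j. g j l))"
      by (rule Dsum_Sum_any[OF fin, symmetric])
    finally show ?thesis
      unfolding g_def jac_a_inverse[OF bounded2_modes] .
  qed
  have 2: "jac_a (\<lambda>i j. sk u i (nprod V a j c)) q n 0 =
      ((- 1) powi n) *\<^sub>C Dsum q (\<lambda>l. ?\<alpha> n (q + int l) - ?\<beta> (q + int l) n)"
  proof -
    define g where "g j l = (of_int n gchoose j) *\<^sub>C ?\<gamma> (int j) (n + (q + int l) - int j)" for j l :: nat
    have fin: "finite {(j, l). g j l \<noteq> 0}"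
    proof (rule finite_pairs_nat)
      fix j l assume g: "g j l \<noteq> 0"
      have "\<not> ord a c \<le> int j" using g by (auto simp: g_def prod_ord)
      moreover have "\<not> M.ord (nprod V a (int j) c) u \<le> n + (q + int l) - int j" using g by (auto simp: g_def M.act_ord)
      ultimately show "j < nat (ord a c) \<and> l < nat (M.ord (nprod V a (int j) c) u - n - q + int j)" by linarith
    qed
    have fin1: "finite {l. g j l \<noteq> 0}" for j
      by (rule finite_subset[OF _ finite_imageI[OF fin, of snd]]) force
    have fD: "finite {j. Dsum q (g j) \<noteq> 0}"
      by (rule finite_nat_bound[of "nat (ord a c)"]) (simp add: g_def prod_ord Dsum_def)
    have l: "Sum_any (\<lambda>j. g j l) = ?\<alpha> n (q + int l) - ?\<beta> (q + int l) n" for l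
    proof -
      have "Sum_any (\<lambda>j. g j l) = jac_l ?\<gamma> n 0 (q + int l)" by (simp add: g_def jac_l_def)
      then show ?thesis
        using M.act_jac[of a c u n 0 "q + int l"]
        by (simp add: jac_def jac_a_def gbinomial_0_left Sum_any_single[where a = 0])
    qed
    have "jac_a (\<lambda>i j. sk u i (nprod V a j c)) q n 0 = Sum_any (\<lambda>j. ((- 1) powi n) *\<^sub>C Dsum q (g j))"
      unfolding jac_a_def[of "\<lambda>i j. sk u i (nprod V a j c)"]
    proof (rule Sum_any.cong)
      fix j
      let ?h = "\<lambda>l. ?\<gamma> (int j) (n + q - int j + int l)"
      have f: "finite {l. ?h l \<noteq> 0}" by (rule act_shift_finite)
      have e: "(- 1 :: complex) powi (n - int j) = (- 1) powi n * (- 1) ^ j"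
        using power_int_diff[of "- 1 :: complex" n "int j"] by (simp add: power_int_minus divide_inverse)
          (metis inverse_minus_eq inverse_1 power_inverse)
      have "Dsum (q + n - int j) ?h = ((- 1) powi n * (- 1) ^ j) *\<^sub>C Dsum q ?h"
        using Dsum_sign[OF f, of q "n - int j"] e by (simp add: algebra_simps)
      moreover have "Dsum q (g j) = (of_int n gchoose j) *\<^sub>C Dsum q ?h"
        using Dsum_scale[OF f, of q "of_int n gchoose j"] by (simp add: g_def[abs_def] algebra_simps)
      ultimately show "((- 1) ^ j * (of_int n gchoose j)) *\<^sub>C sk u (q + n - int j) (nprod V a (0 + int j) c) =
          ((- 1) powi n) *\<^sub>C Dsum q (g j)"
        using pm[of j] by (simp add: sk_Dsum scaleC_scaleC algebra_simps)
    qed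
    also have "\<dots> = ((- 1) powi n) *\<^sub>C Dsum q (\<lambda>l. Sum_any (\<lambda>j. g j l))"
      by (simp add: scaleC_Sum_any[OF fD] Dsum_Sum_any[OF fin])
    finally show ?thesis by (simp only: l)
  qed
  have fa: "finite {l::nat. ?\<alpha> n (q + int l) \<noteq> 0}"
    by (rule finite_nat_bound[of "nat (M.ord c u - q)"]) (simp add: M.act_ord)
  have "jac_l (\<lambda>n q. sk (act a n u) q c) 0 n q = sk (act a n u) q c"
    by (simp add: jac_l_def gbinomial_0_left Sum_any_single[where a = 0])
  then show ?thesis
    unfolding jac_def 1 2 scaleC_scaleC powi_minus_one_self scaleC_one
      Dsum_diff[OF fa act_shift_finite] by (simp add: sk_Dsum)
qed

lemma sk_jac:
  "jac (\<lambda>i j. act a i (sk u j c)) (\<lambda>i j. sk u i (nprod V a j c)) (\<lambda>n q. sk (act a n u) q c) m n q"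
proof (rule jac_from_commutator_iterate[where K = "max (M.ord c u) (max (ord a c) (M.ord a u))"])
qed (auto simp: bounded1_def bounded2_def sk_ord act_ord M.act_ord sk_commutator sk_iterate)

text \<open>Since D commutes with a mode up to a multiple of the preceding mode, the coefficients
  contain -(p + l). Shifting the index in the exponential series contributes +l, and only -p
  remains.\<close>

lemma sk_D: "sk (D x) p c = - (of_int p *\<^sub>C sk x (p - 1) c)"
proof -
  let ?s = "\<lambda>l::nat. (- 1 :: complex) powi (p + int l)"
  let ?t = "\<lambda>l::nat. (D ^^ l) (act c (p - 1 + int l) x)"
  define f where "f l = (?s l * of_nat l / fact l) *\<^sub>C ?t l" for l
  define g where "g l = (- ?s l * (of_int p + of_nat l) / fact l) *\<^sub>C ?t l" for l
  have fin: "finite {l. ?t l \<noteq> 0}"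
    by (rule finite_subset[OF _ act_shift_finite[of c "p - 1" x]]) auto
  have ff: "finite {l. f l \<noteq> 0}" "finite {l. g l \<noteq> 0}"
    by (rule finite_subset[OF _ fin]; auto simp: f_def g_def)+
  have ff': "finite {l. f (Suc l) \<noteq> 0}"
    by (rule finite_subset[OF _ finite_imageI[OF ff(1), of "\<lambda>x. x - 1"]]) force
  have "sk (D x) p c = Sum_any (\<lambda>l. f (Suc l) + g l)"
    unfolding sk_Dsum Dsum_def
  proof (rule Sum_any.cong)
    fix l :: nat
    have s: "(- 1 :: complex) powi (p + int l + 1) = - ?s l" by (rule powi_minus_one_Suc)
    have "of_nat (Suc l) / fact (Suc l) = (1 / fact l :: complex)"
      by (simp del: of_nat_Suc)
    moreover have "?s (Suc l) = - ?s l" using s by (simp add: add_ac)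
    ultimately have "?s (Suc l) * of_nat (Suc l) / fact (Suc l) = - ?s l / fact l"
      by (metis mult.right_neutral times_divide_eq_right)
    then have "f (Suc l) = (- ?s l / fact l) *\<^sub>C (D ^^ Suc l) (act c (p + int l) x)"
      by (simp only: f_def) simp
    moreover have "g l = (- (of_int p * ?s l) / fact l) *\<^sub>C ?t l + (- (of_nat l * ?s l) / fact l) *\<^sub>C ?t l"
      by (simp add: g_def scaleC_add_left[symmetric] add_divide_distrib[symmetric] algebra_simps)
    ultimately show "((- 1) powi (p + int l + 1) / fact l) *\<^sub>C (D ^^ l) (act c (p + int l) (D x)) = f (Suc l) + g l"
      unfolding s by (simp add: act_D clinear_add[OF D_pow_linear] clinear_scaleC[OF D_pow_linear] scaleC_add_right
        scaleC_scaleC funpow_swap1 algebra_simps)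
  qed
  also have "\<dots> = Sum_any f + Sum_any g"
    using Sum_any_shift_nat[OF ff(1)] by (simp add: Sum_any.distrib[OF ff' ff(2)] f_def[of 0])
  also have "\<dots> = Sum_any (\<lambda>l. f l + g l)"
    by (rule Sum_any.distrib[OF ff, symmetric])
  also have "\<dots> = Sum_any (\<lambda>l. (- of_int p) *\<^sub>C (((- 1) powi (p - 1 + int l + 1) / fact l) *\<^sub>C ?t l))"
    by (intro Sum_any.cong) (simp add: f_def g_def scaleC_add_left[symmetric] scaleC_scaleC add_divide_distrib[symmetric] algebra_simps)
  also have "\<dots> = (- of_int p) *\<^sub>C sk x (p - 1) c"
    unfolding sk_Dsum Dsum_def
    by (rule scaleC_Sum_any[OF Dsum_finite[OF act_shift_finite], symmetric])
  finally show ?thesis by simp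
qed

lemma sk_D_pow: "sk ((D ^^ l) x) p c = ((- 1) ^ l * fact l * (of_int p gchoose l)) *\<^sub>C sk x (p - int l) c"
proof (induction l arbitrary: p)
  case 0
  show ?case by simp
next
  case (Suc l)
  have a: "of_int p * (of_int (p - 1) gchoose l) = of_nat (Suc l) * (of_int p gchoose Suc l :: complex)"
    using gbinomial_absorption[of l "of_int p :: complex"] by simp
  have "sk ((D ^^ Suc l) x) p c = (- (of_int p * ((- 1) ^ l * fact l * (of_int (p - 1) gchoose l)))) *\<^sub>C sk x (p - 1 - int l) c"
    by (simp add: sk_D Suc scaleC_scaleC)
  also have "- (of_int p * ((- 1) ^ l * fact l * (of_int (p - 1) gchoose l))) =
      (- 1) ^ Suc l * fact l * (of_int p * (of_int (p - 1) gchoose l) :: complex)"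
    by simp
  also have "\<dots> = (- 1) ^ Suc l * fact (Suc l) * (of_int p gchoose Suc l)"
    unfolding a by simp
  finally show ?case by (simp add: algebra_simps)
qed

lemma sk_sk:
  "sk (sk u n a) q c = Sum_any (\<lambda>l::nat. (- ((- 1) powi n) * (of_int q gchoose l)) *\<^sub>C sk (act a (n + int l) u) (q - int l) c)"
proof -
  have e: "(- 1 :: complex) powi (n + int l + 1) * (- 1) ^ l = - ((- 1) powi n)" for l
  proof -
    have "(- 1 :: complex) powi (n + int l + 1) = - ((- 1) powi n * (- 1) ^ l)"
      using power_int_add[of "- 1 :: complex" n "int l"] by (simp add: powi_minus_one_Suc)
    then show ?thesis by (simp flip: power_mult_distrib)
  qed
  have "sk (sk u n a) q c = Sum_any (\<lambda>l::nat. sk (((- 1) powi (n + int l + 1) / fact l) *\<^sub>C (D ^^ l) (act a (n + int l) u)) q c)"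
    unfolding sk_Dsum[of u] Dsum_def
    by (rule clinear_Sum_any[OF sk_linear_left Dsum_finite[OF act_shift_finite]])
  also have "\<dots> = Sum_any (\<lambda>l::nat. ((- 1) powi (n + int l + 1) * (- 1) ^ l * (of_int q gchoose l)) *\<^sub>C sk (act a (n + int l) u) (q - int l) c)"
    by (simp add: clinear_scaleC[OF sk_linear_left] sk_D_pow scaleC_scaleC mult_ac)
  finally show ?thesis by (simp only: e)
qed

lemma jac_swap_coeff:
  "(\<Sum>j\<le>r. (- 1) ^ j * (of_int m gchoose j) * (of_int (m + q - int j) gchoose (r - j))) =
    (of_int q gchoose r :: complex)"
proof -
  have "(\<Sum>j\<le>r. (- 1) ^ j * (of_int m gchoose j) * (of_int (m + q - int j) gchoose (r - j)) :: complex) =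
      (- 1) ^ r * (\<Sum>j\<le>r. (of_int m gchoose j) * (of_int (int r - m - q - 1) gchoose (r - j)))"
    unfolding sum_distrib_left
  proof (rule sum.cong[OF refl])
    fix j assume "j \<in> {..r}"
    then have j: "j \<le> r" and e: "int (r - j) - (m + q - int j) - 1 = int r - m - q - 1" by auto
    have "(- 1 :: complex) ^ j * (- 1) ^ (r - j) = (- 1) ^ r"
      using j by (simp flip: power_add)
    then show "(- 1) ^ j * (of_int m gchoose j) * (of_int (m + q - int j) gchoose (r - j)) =
        (- 1) ^ r * ((of_int m gchoose j) * (of_int (int r - m - q - 1) gchoose (r - j)) :: complex)"
      unfolding gbinomial_neg_int[of "m + q - int j"] e by (metis mult.assoc mult.left_commute)
  qed
  also have "\<dots> = (- 1) ^ r * (of_int (int r - q - 1) gchoose r)"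
  proof -
    have "of_int m + of_int (int r - m - q - 1) = (of_int (int r - q - 1) :: complex)" by simp
    then show ?thesis by (simp only: gbinomial_Vandermonde')
  qed
  also have "\<dots> = of_int q gchoose r"
    by (subst (2) gbinomial_neg_int) simp
  finally show ?thesis .
qed

text \<open>By skew symmetry (\<open>sk_sk\<close>) the iterate side for the order u, a at (m, n, q)
  is -(-1)^n times the iterate side for the order a, u at (q, n, m). The claim is therefore
  \<open>sk_jac\<close> with the two terms of its right side interchanged.\<close>

lemma sk_jac_swap:
  "jac (\<lambda>i j. sk u i (nprod V a j c)) (\<lambda>i j. act a i (sk u j c)) (\<lambda>n q. sk (sk u n a) q c) m n q"
proof -
  let ?\<gamma> = "\<lambda>n q. sk (act a n u) q c"
  define f where "f j l = ((of_int m gchoose j) * (- ((- 1) powi (n + int j)) * (of_int (m + q - int j) gchoose l))) *\<^sub>C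
      ?\<gamma> (n + int j + int l) (m + q - int j - int l)" for j l :: nat
  have fin: "finite {(j, l). f j l \<noteq> 0}"
  proof (rule finite_pairs_nat)
    fix j l assume "f j l \<noteq> 0"
    then have "\<not> M.ord a u \<le> n + int j + int l" by (auto simp: f_def M.act_ord)
    then show "j < nat (M.ord a u - n) \<and> l < nat (M.ord a u - n)" by linarith
  qed
  have "jac_l (\<lambda>n q. sk (sk u n a) q c) m n q = Sum_any (\<lambda>j. Sum_any (\<lambda>l. f j l))"
    unfolding jac_l_def
  proof (rule Sum_any.cong)
    fix j
    have f: "finite {l. (- ((- 1) powi (n + int j)) * (of_int (m + q - int j) gchoose l)) *\<^sub>C
      ?\<gamma> (n + int j + int l) (m + q - int j - int l) \<noteq> 0}"
      by (rule finite_nat_bound[of "nat (M.ord a u - n)"]) (simp add: M.act_ord)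
    show "(of_int m gchoose j) *\<^sub>C sk (sk u (n + int j) a) (m + q - int j) c = Sum_any (\<lambda>l. f j l)"
      unfolding sk_sk scaleC_Sum_any[OF f] f_def scaleC_scaleC ..
  qed
  also have "\<dots> = Sum_any (\<lambda>r. \<Sum>j\<le>r. f j (r - j))"
    by (rule Sum_any_antidiagonal[OF fin])
  also have "\<dots> = Sum_any (\<lambda>r. (- ((- 1) powi n)) *\<^sub>C ((of_int q gchoose r) *\<^sub>C ?\<gamma> (n + int r) (q + m - int r)))"
  proof (rule Sum_any.cong)
    fix r
    have "(\<Sum>j\<le>r. f j (r - j)) = (\<Sum>j\<le>r. - ((- 1) powi n) * ((- 1) ^ j * (of_int m gchoose j) * (of_int (m + q - int j) gchoose (r - j)))) *\<^sub>C
        ?\<gamma> (n + int r) (q + m - int r)"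
      unfolding cvec.scale_sum_left
    proof (rule sum.cong[OF refl])
      fix j assume "j \<in> {..r}"
      then have e: "n + int j + int (r - j) = n + int r" "m + q - int j - int (r - j) = q + m - int r" by auto
      show "f j (r - j) = (- ((- 1) powi n) * ((- 1) ^ j * (of_int m gchoose j) * (of_int (m + q - int j) gchoose (r - j)))) *\<^sub>C
        ?\<gamma> (n + int r) (q + m - int r)"
        unfolding f_def e by (simp add: power_int_add mult_ac)
    qed
    then show "(\<Sum>j\<le>r. f j (r - j)) = (- ((- 1) powi n)) *\<^sub>C ((of_int q gchoose r) *\<^sub>C ?\<gamma> (n + int r) (q + m - int r))"
      unfolding sum_distrib_left[symmetric] jac_swap_coeff by (simp add: scaleC_scaleC)
  qed
  also have "\<dots> = (- ((- 1) powi n)) *\<^sub>C jac_l ?\<gamma> q n m"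
  proof -
    have "finite {r. (of_int q gchoose r) *\<^sub>C ?\<gamma> (n + int r) (q + m - int r) \<noteq> 0}"
      by (rule finite_nat_bound[of "nat (M.ord a u - n)"]) (simp add: M.act_ord)
    from scaleC_Sum_any[OF this] show ?thesis by (simp add: jac_l_def)
  qed
  also have "jac_l ?\<gamma> q n m = jac_a (\<lambda>i j. act a i (sk u j c)) q n m - ((- 1) powi n) *\<^sub>C jac_a (\<lambda>i j. sk u i (nprod V a j c)) m n q"
    using sk_jac[of a u c q n m] by (simp add: jac_def)
  finally show ?thesis
    by (simp add: jac_def cvec.scale_right_diff_distrib scaleC_scaleC)
qed

end

section \<open>Li's deformation\<close>

context translation_mod
begin

text \<open>For \<open>E\<close>-valued \<open>u\<close> the operator \<open>\<Delta>(u, z)\<close> is of first order, and \<open>psi u a n b\<close> is the coefficient of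
  \<open>z\<^bsup>-n-1\<^esup>\<close> in \<open>Y((\<Delta>(u, z) - 1) a, z) b\<close>. The summand \<open>l = 0\<close> vanishes because of \<open>1 / 0 = 0\<close>.\<close>

definition kappa :: "nat \<Rightarrow> complex" where
  "kappa l = (- 1) ^ l / (- of_nat l)"

definition psi :: "'m \<Rightarrow> 'a \<Rightarrow> int \<Rightarrow> 'a \<Rightarrow> 'm" where
  "psi u a n b = Sum_any (\<lambda>l::nat. kappa l *\<^sub>C sk (sk u (int l) a) (n - int l) b)"

lemma kappa_0 [simp]: "kappa 0 = 0"
  by (simp add: kappa_def)

text \<open>The absorption identity C(i+k, i) / (i+k) = C(i+k-1, k) / i. It makes the coefficients
  of the exponent in Delta fit into Vandermonde's identity in \<open>psi_coeff\<close>.\<close>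

lemma kappa_binomial:
  assumes "0 < i"
  shows "kappa (i + k) * (of_nat (i + k) gchoose i) = kappa i * ((- of_nat i) gchoose k)"
proof -
  have "of_nat i * (of_nat (i + k) gchoose i) = (of_nat (i + k) * (of_nat (i + k - 1) gchoose (i - 1)) :: complex)"
    using gbinomial_absorption[of "i - 1" "of_nat (i + k) :: complex"] assms
    by (simp add: of_nat_diff)
  also have "(of_nat (i + k - 1) gchoose (i - 1)) = (of_nat (i + k - 1) gchoose k :: complex)"
  proof -
    have "i - 1 \<le> i + k - 1" "i + k - 1 - (i - 1) = k" using assms by auto
    then show ?thesis using gbinomial_of_nat_symmetric[of "i - 1" "i + k - 1", where 'a = complex] by simp
  qed
  finally have 1: "of_nat i * (of_nat (i + k) gchoose i) = (of_nat (i + k) * (of_nat (i + k - 1) gchoose k) :: complex)" .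
  have 2: "((- of_nat i) gchoose k) = (- 1) ^ k * (of_nat (i + k - 1) gchoose k :: complex)"
    using gbinomial_minus[of "of_nat i :: complex" k] assms by (simp add: of_nat_diff)
  have "of_nat (i + k) \<noteq> (0 :: complex)" "of_nat i \<noteq> (0 :: complex)"
    using assms by (simp_all only: of_nat_eq_0_iff)
  then have 3: "(of_nat (i + k) gchoose i) / of_nat (i + k) = ((of_nat (i + k - 1) gchoose k) / of_nat i :: complex)"
    using 1 by (simp add: divide_simps mult.commute del: of_nat_add)
  have "kappa (i + k) * (of_nat (i + k) gchoose i) =
      - ((- 1) ^ i * (- 1) ^ k) * ((of_nat (i + k) gchoose i) / of_nat (i + k))"
    by (simp add: kappa_def power_add del: of_nat_add)
  also have "\<dots> = kappa i * ((- of_nat i) gchoose k)"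
    unfolding 3 2 by (simp add: kappa_def)
  finally show ?thesis .
qed

lemma psi_finite: "finite {l::nat. kappa l *\<^sub>C sk (sk u (int l) a) (n - int l) b \<noteq> 0}"
  by (rule finite_nat_bound[of "nat (M.ord a u)"]) (simp add: sk_ord)

lemma psi_linear_left: "clinear (\<lambda>a. psi u a n b)"
  unfolding psi_def
  by (rule clinear_Sum_any_fun[OF clinear_scale[OF clinear_compose[OF sk_linear_left sk_linear_right]] psi_finite])

lemma psi_linear_right: "clinear (psi u a n)"
  unfolding psi_def
  by (rule clinear_Sum_any_fun[OF clinear_scale[OF sk_linear_right] psi_finite])

lemma psi_sum:
  assumes "M.ord a u \<le> int B"
  shows "psi u a n b = (\<Sum>l<B. kappa l *\<^sub>C sk (sk u (int l) a) (n - int l) b)"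
  unfolding psi_def by (rule Sum_any_nat_bound) (use assms in \<open>simp add: sk_ord\<close>)

lemma psi_trunc: "\<exists>N. \<forall>n\<ge>N. psi u a n b = 0"
proof -
  define N where "N = (\<Sum>l<nat (M.ord a u). \<bar>M.ord b (sk u (int l) a)\<bar> + int l)"
  have N: "M.ord b (sk u (int l) a) + int l \<le> N" if "l < nat (M.ord a u)" for l
    unfolding N_def
    by (rule order.trans[OF _ member_le_sum[of l]]) (use that in auto)
  have "psi u a n b = 0" if "N \<le> n" for n
    unfolding psi_def
  proof (rule Sum_any_nat_bound[where K = 0, simplified])
    fix l
    show "kappa l *\<^sub>C sk (sk u (int l) a) (n - int l) b = 0"
    proof (cases "l < nat (M.ord a u)")
      case True
      then show ?thesis using N[OF True] that by (simp add: sk_ord)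
    qed (simp add: sk_ord)
  qed
  then show ?thesis by blast
qed

lemma jac_a_sum:
  assumes "\<And>l. l < (B::nat) \<Longrightarrow> \<exists>K. bounded2 K (f l)"
  shows "jac_a (\<lambda>i j. \<Sum>l<B. c l *\<^sub>C f l i j) m n q = (\<Sum>l<B. c l *\<^sub>C jac_a (f l) m n q)"
  using assms
proof (induction B)
  case 0
  show ?case by (simp add: jac_a_def)
next
  case (Suc B)
  have "\<exists>K. \<forall>l<Suc B. bounded2 K (f l)"
  proof -
    obtain K where K: "\<And>l. l < Suc B \<Longrightarrow> bounded2 (K l) (f l)" using Suc.prems by metis
    then have "bounded2 (\<Sum>l<Suc B. \<bar>K l\<bar>) (f l)" if "l < Suc B" for l
      by (rule bounded2_mono) (use that member_le_sum[of l "{..<Suc B}" "\<lambda>l. \<bar>K l\<bar>"] in auto)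
    then show ?thesis by blast
  qed
  then obtain K where K: "\<And>l. l < Suc B \<Longrightarrow> bounded2 K (f l)" by blast
  have f: "finite {j::nat. ((- 1) ^ j * (of_int n gchoose j)) *\<^sub>C (c l *\<^sub>C f l (m + n - int j) (q + int j)) \<noteq> 0}"
    "finite {j::nat. ((- 1) ^ j * (of_int n gchoose j)) *\<^sub>C f l (m + n - int j) (q + int j) \<noteq> 0}" if "l < Suc B" for l
    by (rule finite_nat_bound[of "nat (K - q)"]; use K[OF that] in \<open>auto simp: bounded2_def nat_le_iff\<close>)+
  have f2: "finite {j::nat. ((- 1) ^ j * (of_int n gchoose j)) *\<^sub>C (\<Sum>l<B. c l *\<^sub>C f l (m + n - int j) (q + int j)) \<noteq> 0}"
    by (rule finite_nat_bound[of "nat (K - q)"]) (use K in \<open>auto simp: bounded2_def nat_le_iff\<close>)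
  have "jac_a (\<lambda>i j. \<Sum>l<Suc B. c l *\<^sub>C f l i j) m n q =
      jac_a (\<lambda>i j. \<Sum>l<B. c l *\<^sub>C f l i j) m n q + jac_a (\<lambda>i j. c B *\<^sub>C f B i j) m n q"
    unfolding jac_a_def sum.lessThan_Suc scaleC_add_right
    by (rule Sum_any.distrib[OF f2 f(1)]) simp
  also have "jac_a (\<lambda>i j. c B *\<^sub>C f B i j) m n q = c B *\<^sub>C jac_a (f B) m n q"
    unfolding jac_a_def scaleC_Sum_any[OF f(2)[OF lessI]] by (simp add: scaleC_scaleC mult.commute)
  finally show ?case using Suc by simp
qed

lemma sk_product:
  "sk u (int l) (nprod V a n b) = act a n (sk u (int l) b) +
    (\<Sum>i\<le>l. of_nat (l choose i) *\<^sub>C sk (sk u (int i) a) (int l + n - int i) b)"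
proof -
  have "jac_l (\<lambda>n q. sk (sk u n a) q b) (int l) 0 n = (\<Sum>i\<le>l. of_nat (l choose i) *\<^sub>C sk (sk u (int i) a) (int l + n - int i) b)"
    unfolding jac_l_def
    by (subst Sum_any_nat_bound[of "Suc l"])
      (auto simp: lessThan_Suc_atMost binomial_gbinomial[symmetric] intro!: sum.cong)
  then show ?thesis
    using sk_jac_swap[of u a b "int l" 0 n]
    by (simp add: jac_def jac_a_def gbinomial_0_left Sum_any_single[where a = 0])
qed

lemma psi_coeff:
  assumes "0 < i"
  shows "(\<Sum>k\<le>r. (of_int m gchoose (r - k)) * (kappa (i + k) * of_nat ((i + k) choose i))) =
    kappa i * (of_int (m - int i) gchoose r)"
proof -
  have "(\<Sum>k\<le>r. (of_int m gchoose (r - k)) * (kappa (i + k) * of_nat ((i + k) choose i))) =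
      kappa i * (\<Sum>k\<le>r. ((- of_nat i) gchoose k) * (of_int m gchoose (r - k)))"
    unfolding sum_distrib_left
    by (rule sum.cong[OF refl]) (simp add: binomial_gbinomial kappa_binomial[OF assms] mult_ac del: of_nat_add)
  then show ?thesis
    unfolding gbinomial_Vandermonde' by simp
qed

text \<open>The part of first order in \<open>u\<close> of Li's relation Delta(u,z) Y(a,x) =
  Y(Delta(u,z+x) a, x) Delta(u,z). The hypothesis removes the terms with \<open>i = 0\<close>, where
  \<open>kappa_binomial\<close> fails and which would belong to a logarithm of z + x.\<close>

lemma psi_jac:
  assumes a0: "sk u 0 a = 0"
  shows "jac (\<lambda>i j. act a i (psi u b j c) + psi u a i (nprod V b j c))
    (\<lambda>i j. act b i (psi u a j c) + psi u b i (nprod V a j c)) (\<lambda>n q. psi u (nprod V a n b) q c) m n q"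
proof -
  define B where "B = nat (max (M.ord a u) (M.ord b u))"
  have B: "M.ord a u \<le> int B" "M.ord b u \<le> int B" by (auto simp: B_def)
  have SB: "sk u (int l) a = 0" "sk u (int l) b = 0" if "B \<le> l" for l
    using that B by (auto simp: sk_ord)
  let ?ga = "\<lambda>l n q. sk (act a n (sk u (int l) b)) q c" and ?gb = "\<lambda>l n q. sk (sk (sk u (int l) a) n b) q c"
  have bd: "bounded2 (max (M.ord c (sk u (int l) b) + int l) (ord b c)) (\<lambda>i j. act a i (sk (sk u (int l) b) (j - int l) c) + sk (sk u (int l) a) (i - int l) (nprod V b j c))"
    for a b l by (auto simp: bounded2_def sk_ord act_ord)
  have ja: "jac_a (\<lambda>i j. act a i (psi u b j c) + psi u a i (nprod V b j c)) m n q =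
      (\<Sum>l<B. kappa l *\<^sub>C jac_a (\<lambda>i j. act a i (sk (sk u (int l) b) (j - int l) c) + sk (sk u (int l) a) (i - int l) (nprod V b j c)) m n q)"
    if "M.ord a u \<le> int B" "M.ord b u \<le> int B" for a b m n q
    unfolding psi_sum[OF that(1)] psi_sum[OF that(2)] M.act_sum_right M.act_scale_right sum.distrib[symmetric] scaleC_add_right[symmetric]
    by (rule jac_a_sum) (use bd in blast)
  have sp: "jac_a (\<lambda>i j. act a i (sk (sk u (int l) b) (j - int l) c) + sk (sk u (int l) a) (i - int l) (nprod V b j c)) m n q =
      jac_a (\<lambda>i j. act a i (sk (sk u (int l) b) j c)) m n (q - int l) +
      jac_a (\<lambda>i j. sk (sk u (int l) a) i (nprod V b j c)) (m - int l) n q" for a b l m n q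
  proof -
    have "finite {j::nat. ((- 1) ^ j * (of_int n gchoose j)) *\<^sub>C act a (m + n - int j) (sk (sk u (int l) b) (q + int j - int l) c) \<noteq> 0}"
      by (rule finite_nat_bound[of "nat (M.ord c (sk u (int l) b) - q + int l)"]) (simp add: sk_ord nat_le_iff)
    moreover have "finite {j::nat. ((- 1) ^ j * (of_int n gchoose j)) *\<^sub>C sk (sk u (int l) a) (m + n - int j - int l) (nprod V b (q + int j) c) \<noteq> 0}"
      by (rule finite_nat_bound[of "nat (ord b c - q)"]) (simp add: act_ord nat_le_iff)
    ultimately show ?thesis
      unfolding jac_a_def scaleC_add_right
      by (subst Sum_any.distrib) (simp_all add: algebra_simps)
  qed
  \<comment> \<open>For each \<open>l\<close> two Borcherds identities occur: one for
    \<open>a\<close> and the element u_(l) b of \<open>E\<close>, which is \<open>sk_jac\<close>,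
    and one with u_(l) a in \<open>E\<close> acting on \<open>b\<close>, which is
    \<open>sk_jac_swap\<close> with \<open>m\<close> lowered by \<open>l\<close>.\<close>
  have rhs: "jac_a (\<lambda>i j. act a i (psi u b j c) + psi u a i (nprod V b j c)) m n q -
      ((- 1) powi n) *\<^sub>C jac_a (\<lambda>i j. act b i (psi u a j c) + psi u b i (nprod V a j c)) q n m =
      (\<Sum>l<B. kappa l *\<^sub>C jac_l (?ga l) m n (q - int l)) + (\<Sum>l<B. kappa l *\<^sub>C jac_l (?gb l) (m - int l) n q)"
  proof -
    have "jac_l (?ga l) m n (q - int l) + jac_l (?gb l) (m - int l) n q =
      (jac_a (\<lambda>i j. act a i (sk (sk u (int l) b) j c)) m n (q - int l) +
      jac_a (\<lambda>i j. sk (sk u (int l) a) i (nprod V b j c)) (m - int l) n q) -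
      ((- 1) powi n) *\<^sub>C (jac_a (\<lambda>i j. act b i (sk (sk u (int l) a) j c)) q n (m - int l) +
      jac_a (\<lambda>i j. sk (sk u (int l) b) i (nprod V a j c)) (q - int l) n m)" for l
      using sk_jac[of a "sk u (int l) b" c m n "q - int l"] sk_jac_swap[of "sk u (int l) a" b c "m - int l" n q]
      by (simp add: jac_def scaleC_add_right)
    moreover have "kappa l *\<^sub>C X - ((- 1) powi n) *\<^sub>C kappa l *\<^sub>C Y = kappa l *\<^sub>C (X - ((- 1) powi n) *\<^sub>C Y)" for l and X Y :: 'm
      by (simp add: scaleC_scaleC mult.commute cvec.scale_right_diff_distrib)
    ultimately show ?thesis
      unfolding ja[OF B] ja[OF B(2,1)] sp cvec.scale_sum_right sum_subtractf[symmetric] sum.distrib[symmetric]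
      by (intro sum.cong[OF refl]) (simp only: scaleC_add_right[symmetric])
  qed
  define f where "f i j k = ((of_int m gchoose j) * (kappa (i + k) * of_nat ((i + k) choose i))) *\<^sub>C
      ?gb i (n + int (j + k)) (m + q - int i - int (j + k))" for i j k :: nat
  have "jac_l (\<lambda>n q. psi u (nprod V a n b) q c) m n q =
      Sum_any (\<lambda>j. (of_int m gchoose j) *\<^sub>C (\<Sum>l<B. kappa l *\<^sub>C ?ga l (n + int j) (m + q - int j - int l)) +
        (\<Sum>i<B. Sum_any (\<lambda>k. f i j k)))"
    unfolding jac_l_def
  proof (rule Sum_any.cong)
    fix j :: nat
    define g where "g i k = (kappa (i + k) * of_nat ((i + k) choose i)) *\<^sub>C ?gb i (n + int (j + k)) (m + q - int i - int (j + k))" for i k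
    have fin: "finite {(i, k). g i k \<noteq> 0}"
    proof (rule finite_pairs_nat)
      fix i k assume nz: "g i k \<noteq> 0"
      then have "sk u (int i) a \<noteq> 0" "sk (sk u (int i) a) (n + int (j + k)) b \<noteq> 0" by (auto simp: g_def)
      then have "\<not> B \<le> i" "\<not> M.ord b (sk u (int i) a) \<le> n + int (j + k)" using SB by (auto simp: sk_ord)
      then show "i < B \<and> k < nat (M.ord b (sk u (int i) a) - n - int j)" by auto
    qed
    have fin2: "finite {k. g i k \<noteq> 0}" for i
      by (rule finite_subset[OF _ finite_imageI[OF fin, of snd]]) force
    have "finite {l. kappa l *\<^sub>C ?ga l (n + int j) (m + q - int j - int l) \<noteq> 0}"
      by (rule finite_nat_bound[of B]) (simp add: SB)
    moreover have fr: "finite {l. (\<Sum>i\<le>l. g i (l - i)) \<noteq> 0}"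
    proof -
      have "{l. (\<Sum>i\<le>l. g i (l - i)) \<noteq> 0} \<subseteq> (\<lambda>(i, k). i + k) ` {(i, k). g i k \<noteq> 0}"
      proof
        fix l assume "l \<in> {l. (\<Sum>i\<le>l. g i (l - i)) \<noteq> 0}"
        then obtain i where "i \<le> l" "g i (l - i) \<noteq> 0" by (auto elim: sum.not_neutral_contains_not_neutral)
        then show "l \<in> (\<lambda>(i, k). i + k) ` {(i, k). g i k \<noteq> 0}"
          by (intro image_eqI[of _ _ "(i, l - i)"]) auto
      qed
      then show ?thesis using fin by (rule finite_subset[OF _ finite_imageI])
    qed
    moreover have "kappa l *\<^sub>C sk (sk u (int l) (nprod V a (n + int j) b)) (m + q - int j - int l) c =
        kappa l *\<^sub>C ?ga l (n + int j) (m + q - int j - int l) + (\<Sum>i\<le>l. g i (l - i))" for l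
    proof -
      have "kappa l *\<^sub>C (\<Sum>i\<le>l. of_nat (l choose i) *\<^sub>C sk (sk (sk u (int i) a) (int l + (n + int j) - int i) b) (m + q - int j - int l) c)
          = (\<Sum>i\<le>l. g i (l - i))"
        unfolding cvec.scale_sum_right
        by (rule sum.cong[OF refl]) (simp add: g_def scaleC_scaleC of_nat_diff algebra_simps)
      then show ?thesis
        by (simp add: sk_product clinear_add[OF sk_linear_left] clinear_sum[OF sk_linear_left]
          clinear_scaleC[OF sk_linear_left] scaleC_add_right)
    qed
    ultimately have "psi u (nprod V a (n + int j) b) (m + q - int j) c =
        Sum_any (\<lambda>l. kappa l *\<^sub>C ?ga l (n + int j) (m + q - int j - int l)) + Sum_any (\<lambda>l. \<Sum>i\<le>l. g i (l - i))"
      unfolding psi_def by (simp add: Sum_any.distrib)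
    also have "Sum_any (\<lambda>l. kappa l *\<^sub>C ?ga l (n + int j) (m + q - int j - int l)) = (\<Sum>l<B. kappa l *\<^sub>C ?ga l (n + int j) (m + q - int j - int l))"
      by (rule Sum_any_nat_bound) (simp add: SB)
    also have "Sum_any (\<lambda>l. \<Sum>i\<le>l. g i (l - i)) = Sum_any (\<lambda>i. Sum_any (\<lambda>k. g i k))"
      by (rule Sum_any_antidiagonal[OF fin, symmetric])
    also have "\<dots> = (\<Sum>i<B. Sum_any (\<lambda>k. g i k))"
      by (rule Sum_any_nat_bound) (simp add: SB g_def)
    finally have psi: "psi u (nprod V a (n + int j) b) (m + q - int j) c =
        (\<Sum>l<B. kappa l *\<^sub>C ?ga l (n + int j) (m + q - int j - int l)) + (\<Sum>i<B. Sum_any (g i))" .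
    have "(of_int m gchoose j) *\<^sub>C Sum_any (g i) = Sum_any (f i j)" for i
      unfolding scaleC_Sum_any[OF fin2] by (simp add: g_def f_def scaleC_scaleC)
    then show "(of_int m gchoose j) *\<^sub>C psi u (nprod V a (n + int j) b) (m + q - int j) c =
        (of_int m gchoose j) *\<^sub>C (\<Sum>l<B. kappa l *\<^sub>C ?ga l (n + int j) (m + q - int j - int l)) + (\<Sum>i<B. Sum_any (\<lambda>k. f i j k))"
      by (simp only: psi scaleC_add_right cvec.scale_sum_right)
  qed
  also have "\<dots> = Sum_any (\<lambda>j. (of_int m gchoose j) *\<^sub>C (\<Sum>l<B. kappa l *\<^sub>C ?ga l (n + int j) (m + q - int j - int l))) +
      Sum_any (\<lambda>j. \<Sum>i<B. Sum_any (\<lambda>k. f i j k))"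
  proof (rule Sum_any.distrib)
    define N where "N = (\<Sum>l<B. \<bar>M.ord a (sk u (int l) b)\<bar>)"
    have N: "M.ord a (sk u (int l) b) \<le> N" if "l < B" for l
      unfolding N_def by (rule order.trans[OF _ member_le_sum[of l]]) (use that in auto)
    have z: "?ga l (n + int j) q' = 0" if "l < B" "nat (N - n) \<le> j" for l j q'
    proof -
      have "M.ord a (sk u (int l) b) \<le> n + int j" using N[OF that(1)] that(2) by linarith
      then show ?thesis by (simp add: M.act_ord)
    qed
    show "finite {j. (of_int m gchoose j) *\<^sub>C (\<Sum>l<B. kappa l *\<^sub>C ?ga l (n + int j) (m + q - int j - int l)) \<noteq> 0}"
      by (rule finite_nat_bound[of "nat (N - n)"]) (simp add: z)
    define N where "N = (\<Sum>l<B. \<bar>M.ord b (sk u (int l) a)\<bar>)"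
    have N: "M.ord b (sk u (int l) a) \<le> N" if "l < B" for l
      unfolding N_def by (rule order.trans[OF _ member_le_sum[of l]]) (use that in auto)
    have z: "f l j k = 0" if "l < B" "nat (N - n) \<le> j" for l j k
    proof -
      have "M.ord b (sk u (int l) a) \<le> n + int (j + k)" using N[OF that(1)] that(2) by linarith
      then show ?thesis by (simp add: sk_ord f_def)
    qed
    show "finite {j. (\<Sum>i<B. Sum_any (\<lambda>k. f i j k)) \<noteq> 0}"
      by (rule finite_nat_bound[of "nat (N - n)"]) (simp add: z)
  qed
  also have "Sum_any (\<lambda>j. (of_int m gchoose j) *\<^sub>C (\<Sum>l<B. kappa l *\<^sub>C ?ga l (n + int j) (m + q - int j - int l))) =
      (\<Sum>l<B. kappa l *\<^sub>C jac_l (?ga l) m n (q - int l))"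
  proof -
    have fin: "finite {j::nat. (of_int m gchoose j) *\<^sub>C ?ga l (n + int j) (m + q - int j - int l) \<noteq> 0}" for l
      by (rule finite_nat_bound[of "nat (M.ord a (sk u (int l) b) - n)"]) (simp add: M.act_ord nat_le_iff)
    have fin': "finite {j::nat. kappa l *\<^sub>C (of_int m gchoose j) *\<^sub>C ?ga l (n + int j) (m + q - int j - int l) \<noteq> 0}" for l
      by (rule finite_subset[OF _ fin[of l]]) auto
    have *: "Sum_any (\<lambda>j. \<Sum>l<B'. kappa l *\<^sub>C (of_int m gchoose j) *\<^sub>C ?ga l (n + int j) (m + q - int j - int l)) =
        (\<Sum>l<B'. Sum_any (\<lambda>j. kappa l *\<^sub>C (of_int m gchoose j) *\<^sub>C ?ga l (n + int j) (m + q - int j - int l)))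
        \<and> finite {j. (\<Sum>l<B'. kappa l *\<^sub>C (of_int m gchoose j) *\<^sub>C ?ga l (n + int j) (m + q - int j - int l)) \<noteq> 0}" for B'
    proof (induction B')
      case (Suc B')
      have "finite {j. (\<Sum>l<Suc B'. kappa l *\<^sub>C (of_int m gchoose j) *\<^sub>C ?ga l (n + int j) (m + q - int j - int l)) \<noteq> 0}"
        by (rule finite_subset[OF _ finite_UnI[OF conjunct2[OF Suc] fin'[of B']]]) auto
      then show ?case using Suc fin'[of B'] by (simp add: Sum_any.distrib)
    qed simp
    show ?thesis
    proof -
      have "kappa l *\<^sub>C jac_l (?ga l) m n (q - int l) =
          Sum_any (\<lambda>j. kappa l *\<^sub>C (of_int m gchoose j) *\<^sub>C ?ga l (n + int j) (m + q - int j - int l))" for l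
        using scaleC_Sum_any[OF fin[of l], of "kappa l"] by (simp add: jac_l_def algebra_simps)
      moreover have "(of_int m gchoose j) *\<^sub>C (\<Sum>l<B. kappa l *\<^sub>C ?ga l (n + int j) (m + q - int j - int l)) =
          (\<Sum>l<B. kappa l *\<^sub>C (of_int m gchoose j) *\<^sub>C ?ga l (n + int j) (m + q - int j - int l))" for j
        unfolding cvec.scale_sum_right scaleC_scaleC by (simp add: mult.commute)
      ultimately show ?thesis using conjunct1[OF *[of B]] by (simp only:)
    qed
  qed
  also have "Sum_any (\<lambda>j. \<Sum>i<B. Sum_any (\<lambda>k. f i j k)) = (\<Sum>l<B. kappa l *\<^sub>C jac_l (?gb l) (m - int l) n q)"
  proof -
    have fin: "finite {(j, k). f i j k \<noteq> 0}" for i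
    proof (rule finite_pairs_nat)
      fix j k assume "f i j k \<noteq> 0"
      then have "\<not> M.ord b (sk u (int i) a) \<le> n + int (j + k)" by (auto simp: f_def sk_ord)
      then show "j < nat (M.ord b (sk u (int i) a) - n) \<and> k < nat (M.ord b (sk u (int i) a) - n)" by linarith
    qed
    have fin': "finite {j. Sum_any (\<lambda>k. f i j k) \<noteq> 0}" for i
      by (rule finite_subset[OF _ finite_imageI[OF fin[of i], of fst]])
        (force elim!: Sum_any.not_neutral_obtains_not_neutral)
    have "Sum_any (\<lambda>j. \<Sum>i<B'. Sum_any (\<lambda>k. f i j k)) = (\<Sum>i<B'. Sum_any (\<lambda>j. Sum_any (\<lambda>k. f i j k)))
        \<and> finite {j. (\<Sum>i<B'. Sum_any (\<lambda>k. f i j k)) \<noteq> 0}" for B'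
    proof (induction B')
      case (Suc B')
      have "finite {j. (\<Sum>i<Suc B'. Sum_any (\<lambda>k. f i j k)) \<noteq> 0}"
        by (rule finite_subset[OF _ finite_UnI[OF conjunct2[OF Suc] fin'[of B']]]) auto
      then show ?case using Suc fin'[of B'] by (simp add: Sum_any.distrib)
    qed simp
    from conjunct1[OF this[of B]]
    have "Sum_any (\<lambda>j. \<Sum>i<B. Sum_any (\<lambda>k. f i j k)) = (\<Sum>i<B. Sum_any (\<lambda>j. Sum_any (\<lambda>k. f i j k)))" .
    also have "\<dots> = (\<Sum>l<B. kappa l *\<^sub>C jac_l (?gb l) (m - int l) n q)"
    proof (rule sum.cong[OF refl])
      fix i assume "i \<in> {..<B}"
      show "Sum_any (\<lambda>j. Sum_any (\<lambda>k. f i j k)) = kappa i *\<^sub>C jac_l (?gb i) (m - int i) n q"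
      proof (cases "i = 0")
        case True
        then show ?thesis by (simp add: f_def a0)
      next
        case False
        then have i: "0 < i" by simp
        have "Sum_any (\<lambda>j. Sum_any (\<lambda>k. f i j k)) = Sum_any (\<lambda>k. Sum_any (\<lambda>j. f i j k))"
          by (rule Sum_any_swap[OF fin])
        also have "\<dots> = Sum_any (\<lambda>r. \<Sum>k\<le>r. f i (r - k) k)"
          by (rule Sum_any_antidiagonal[OF finite_swap[OF fin]])
        \<comment> \<open>At fixed r = j + k the inner sum is the convolution
          \<open>psi_coeff\<close>, which replaces the upper argument \<open>m\<close> by
          \<open>m - i\<close>.\<close>
        also have "\<dots> = Sum_any (\<lambda>r. kappa i *\<^sub>C ((of_int (m - int i) gchoose r) *\<^sub>C ?gb i (n + int r) (m - int i + q - int r)))"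
        proof (rule Sum_any.cong)
          fix r
          have "(\<Sum>k\<le>r. f i (r - k) k) = (\<Sum>k\<le>r. (of_int m gchoose (r - k)) * (kappa (i + k) * of_nat ((i + k) choose i))) *\<^sub>C
              ?gb i (n + int r) (m + q - int i - int r)"
            unfolding cvec.scale_sum_left by (rule sum.cong[OF refl]) (simp add: f_def)
          then show "(\<Sum>k\<le>r. f i (r - k) k) = kappa i *\<^sub>C ((of_int (m - int i) gchoose r) *\<^sub>C ?gb i (n + int r) (m - int i + q - int r))"
            unfolding psi_coeff[OF i] by (simp add: scaleC_scaleC algebra_simps)
        qed
        also have "\<dots> = kappa i *\<^sub>C jac_l (?gb i) (m - int i) n q"
        proof -
          have "finite {r. (of_int (m - int i) gchoose r) *\<^sub>C ?gb i (n + int r) (m - int i + q - int r) \<noteq> 0}"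
            by (rule finite_nat_bound[of "nat (M.ord b (sk u (int i) a) - n)"]) (simp add: sk_ord nat_le_iff)
          from scaleC_Sum_any[OF this] show ?thesis by (simp add: jac_l_def)
        qed
        finally show ?thesis .
      qed
    qed
    finally show ?thesis .
  qed
  finally show ?thesis by (simp add: jac_def rhs)
qed

end

section \<open>The deformed action and its agreement with Delta(u, z)\<close>

locale li_deformation = translation_mod V act D + W: vertex_alg W
  for V :: "'a::complex_vector va" and act :: "'a \<Rightarrow> int \<Rightarrow> 'm::complex_vector \<Rightarrow> 'm" and D
    and W :: "'w::complex_vector va" +
  fixes iota :: "'w \<Rightarrow> 'a" and u :: 'm
  assumes hom: "va_hom W V iota" and screening: "sk u 0 (iota a) = 0"
begin

definition dact :: "'w \<Rightarrow> int \<Rightarrow> 'a \<times> 'm \<Rightarrow> 'a \<times> 'm" where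
  "dact a n x = (nprod V (iota a) n (fst x), act (iota a) n (snd x) + psi u (iota a) n (fst x))"

lemma iota_linear: "clinear iota" and iota_vacuum: "iota (vacuum W) = vacuum V"
  and iota_nprod: "iota (nprod W a n b) = nprod V (iota a) n (iota b)"
  using hom by (auto simp: va_hom_def)

lemma sk_vacuum: "sk u l (vacuum V) = 0" if "0 \<le> l"
  using that by (simp add: sk_Dsum Dsum_def M.act_vacuum)

text \<open>In the component of the algebra the action is unchanged. In the component of
  \<open>E\<close> the Borcherds identity is the sum of the one for the module and of
  \<open>psi_jac\<close>, whose hypothesis is the screening condition.\<close>

lemma dact_module: "va_module W dact"
proof (rule va_moduleI)
  have p: "clinear (fst :: 'a \<times> 'm \<Rightarrow> 'a)" "clinear (snd :: 'a \<times> 'm \<Rightarrow> 'm)"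
    by (auto intro!: clinearI simp: scaleC_prod_def)
  have pair: "clinear (\<lambda>x. (f x, g x))" if "clinear f" "clinear g" for f :: "'x::complex_vector \<Rightarrow> 'a" and g :: "'x \<Rightarrow> 'm"
    by (rule clinearI) (simp_all add: clinear_add[OF that(1)] clinear_add[OF that(2)]
      clinear_scaleC[OF that(1)] clinear_scaleC[OF that(2)] scaleC_prod_def)
  show "cbilinear (\<lambda>a. dact a n)" for n
    unfolding cbilinear_def dact_def[abs_def]
    by (intro conjI allI pair clinear_plus)
      (rule clinear_compose[OF act_linear_left iota_linear] clinear_compose[OF M.act_linear_left iota_linear]
        clinear_compose[OF psi_linear_left iota_linear] clinear_compose[OF act_linear_right p(1)]
        clinear_compose[OF M.act_linear_right p(2)] clinear_compose[OF psi_linear_right p(1)])+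
  show "\<exists>N. \<forall>n\<ge>N. dact a n x = 0" for a x
  proof -
    obtain N where "\<forall>n\<ge>N. psi u (iota a) n (fst x) = 0" using psi_trunc by blast
    then show ?thesis
      by (intro exI[of _ "max N (max (ord (iota a) (fst x)) (M.ord (iota a) (snd x)))"])
        (auto simp: dact_def act_ord M.act_ord zero_prod_def)
  qed
  show "dact (vacuum W) n x = (if n = - 1 then x else 0)" for n x
    by (simp add: dact_def iota_vacuum act_vacuum M.act_vacuum psi_def sk_vacuum zero_prod_def)
  fix a b :: 'w and x :: "'a \<times> 'm" and m n q :: int
  have pj: "jac \<alpha> \<beta> \<gamma> m n q" if "jac (\<lambda>i j. fst (\<alpha> i j)) (\<lambda>i j. fst (\<beta> i j)) (\<lambda>i j. fst (\<gamma> i j)) m n q"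
    "jac (\<lambda>i j. snd (\<alpha> i j)) (\<lambda>i j. snd (\<beta> i j)) (\<lambda>i j. snd (\<gamma> i j)) m n q"
    "bounded2 K \<alpha>" "bounded2 K \<beta>" "bounded1 K \<gamma>"
    for K and \<alpha> \<beta> \<gamma> :: "int \<Rightarrow> int \<Rightarrow> 'a \<times> 'm"
  proof -
    have fa: "finite {j::nat. ((- 1) ^ j * (of_int n gchoose j)) *\<^sub>C f (m + n - int j) (q + int j) \<noteq> 0}"
      if "bounded2 K f" for f :: "int \<Rightarrow> int \<Rightarrow> 'a \<times> 'm" and m n q
      by (rule finite_nat_bound[of "nat (K - q)"]) (use that in \<open>auto simp: bounded2_def nat_le_iff\<close>)
    have fl: "finite {j::nat. (of_int m gchoose j) *\<^sub>C f (n + int j) (m + q - int j) \<noteq> 0}"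
      if "bounded1 K f" for f :: "int \<Rightarrow> int \<Rightarrow> 'a \<times> 'm" and m n q
      by (rule finite_nat_bound[of "nat (K - n)"]) (use that in \<open>auto simp: bounded1_def nat_le_iff\<close>)
    have A: "fst (jac_a f m n q) = jac_a (\<lambda>i j. fst (f i j)) m n q" "snd (jac_a f m n q) = jac_a (\<lambda>i j. snd (f i j)) m n q"
      if "bounded2 K f" for f :: "int \<Rightarrow> int \<Rightarrow> 'a \<times> 'm" and m n q
      unfolding jac_a_def clinear_Sum_any[OF p(1) fa[OF that]] clinear_Sum_any[OF p(2) fa[OF that]]
      by (simp_all add: scaleC_prod_def)
    have L: "fst (jac_l f m n q) = jac_l (\<lambda>i j. fst (f i j)) m n q" "snd (jac_l f m n q) = jac_l (\<lambda>i j. snd (f i j)) m n q"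
      if "bounded1 K f" for f :: "int \<Rightarrow> int \<Rightarrow> 'a \<times> 'm" and m n q
      unfolding jac_l_def clinear_Sum_any[OF p(1) fl[OF that]] clinear_Sum_any[OF p(2) fl[OF that]]
      by (simp_all add: scaleC_prod_def)
    show ?thesis
      using that(1,2) unfolding jac_def
      by (intro prod_eqI) (simp_all add: A[OF that(3)] A[OF that(4)] L[OF that(5)] scaleC_prod_def)
  qed
  let ?a = "iota a" and ?b = "iota b" and ?c = "fst x" and ?w = "snd x"
  obtain N1 where N1: "\<forall>n\<ge>N1. psi u ?a n ?c = 0" using psi_trunc by blast
  obtain N2 where N2: "\<forall>n\<ge>N2. psi u ?b n ?c = 0" using psi_trunc by blast
  define K where "K = max (max N1 N2) (max (max (ord ?a ?c) (ord ?b ?c)) (max (max (M.ord ?a ?w) (M.ord ?b ?w)) (ord ?a ?b)))"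
  have K: "N1 \<le> K" "N2 \<le> K" "ord ?a ?c \<le> K" "ord ?b ?c \<le> K" "M.ord ?a ?w \<le> K" "M.ord ?b ?w \<le> K" "ord ?a ?b \<le> K"
    by (auto simp: K_def)
  note psi0 = clinear_0[OF psi_linear_left] clinear_0[OF psi_linear_right]
  have bd: "bounded2 K (\<lambda>i j. act ?a i (act ?b j ?w))" "bounded2 K (\<lambda>i j. act ?b i (act ?a j ?w))"
    "bounded1 K (\<lambda>n q. act (nprod V ?a n ?b) q ?w)"
    "bounded2 K (\<lambda>i j. act ?a i (psi u ?b j ?c) + psi u ?a i (nprod V ?b j ?c))"
    "bounded2 K (\<lambda>i j. act ?b i (psi u ?a j ?c) + psi u ?b i (nprod V ?a j ?c))"
    "bounded1 K (\<lambda>n q. psi u (nprod V ?a n ?b) q ?c)"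
    using K N1 N2 by (auto simp: bounded1_def bounded2_def act_ord M.act_ord psi0)
  have bd': "bounded2 K (\<lambda>i j. dact a i (dact b j x))" "bounded2 K (\<lambda>i j. dact b i (dact a j x))"
    "bounded1 K (\<lambda>n q. dact (nprod W a n b) q x)"
    using K N1 N2 by (auto simp: bounded1_def bounded2_def dact_def iota_nprod act_ord M.act_ord psi0 zero_prod_def)
  show "jac (\<lambda>i j. dact a i (dact b j x)) (\<lambda>i j. dact b i (dact a j x)) (\<lambda>n q. dact (nprod W a n b) q x) m n q"
  proof (rule pj[OF _ _ bd'])
    show "jac (\<lambda>i j. fst (dact a i (dact b j x))) (\<lambda>i j. fst (dact b i (dact a j x)))
       (\<lambda>n q. fst (dact (nprod W a n b) q x)) m n q"
      using act_jac[of ?a ?b ?c m n q] by (simp add: dact_def iota_nprod)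
    show "jac (\<lambda>i j. snd (dact a i (dact b j x))) (\<lambda>i j. snd (dact b i (dact a j x)))
       (\<lambda>n q. snd (dact (nprod W a n b) q x)) m n q"
      using jac_add[OF M.act_jac[of ?a ?b ?w m n q] psi_jac[OF screening] bd]
      by (simp add: dact_def iota_nprod M.act_add_right add.assoc)
  qed
qed

lemma extension_nprod_right: "nprod (extension_va V act D) (0, w) n (b, w') = (0, sk w n b)"
  by (simp add: extension_va_def)

lemma extension_nprod_left: "nprod (extension_va V act D) (a, 0) n (b, w') = (nprod V a n b, act a n w')"
  by (simp add: extension_va_def)

lemma finite_compositions: "finite {ns. (\<forall>n\<in>set ns. 1 \<le> n) \<and> sum_list ns = (m::nat)}"
proof (rule finite_subset)
  show "{ns. (\<forall>n\<in>set ns. 1 \<le> n) \<and> sum_list ns = m} \<subseteq> {ns. set ns \<subseteq> {..m} \<and> length ns \<le> m}"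
  proof clarify
    fix ns :: "nat list" assume n: "\<forall>n\<in>set ns. 1 \<le> n" and m: "m = sum_list ns"
    have "length ns \<le> sum_list ns" using n by (induction ns) auto
    moreover have "n \<le> sum_list ns" if "n \<in> set ns" for n using that by (intro member_le_sum_list) auto
    ultimately show "set ns \<subseteq> {..sum_list ns} \<and> length ns \<le> sum_list ns" by auto
  qed
qed (rule finite_lists_length_le, simp)

text \<open>A word of length at least two applies an element of \<open>E\<close> to an element of
  \<open>E\<close>, which gives zero. Only the empty word and the word \<open>[m]\<close>
  survive.\<close>

lemma delta_exp_eq:
  "delta_exp (extension_va V act D) (0, u) m (a, 0) = (if m = 0 then (a, 0) else (0, kappa m *\<^sub>C sk u (int m) a))"
proof -
  let ?V = "extension_va V act D"
  define g where "g = (\<lambda>ns. foldr (\<lambda>n y. ((- 1) ^ n / (- of_nat n)) *\<^sub>C nprod ?V (0, u) (int n) y) ns (a, 0))"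
  have g0: "g ns = (0, if length ns = 1 then kappa (hd ns) *\<^sub>C sk u (int (hd ns)) a else 0)" if "ns \<noteq> []" for ns
    using that
  proof (induction ns)
    case (Cons n ns)
    show ?case
    proof (cases "ns = []")
      case True
      then show ?thesis by (simp add: g_def extension_nprod_right scaleC_prod_def kappa_def)
    next
      case False
      then obtain w where w: "g ns = (0, w)" using Cons by blast
      have "g (n # ns) = ((- 1) ^ n / (- of_nat n)) *\<^sub>C nprod ?V (0, u) (int n) (g ns)" by (simp add: g_def)
      then show ?thesis using False by (simp add: w extension_nprod_right scaleC_prod_def)
    qed
  qed simp
  have eq: "delta_exp ?V (0, u) m (a, 0) = (\<Sum>ns \<in> {ns. (\<forall>n\<in>set ns. 1 \<le> n) \<and> sum_list ns = m}. (1 / fact (length ns)) *\<^sub>C g ns)"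
    by (simp add: delta_exp_def g_def)
  show ?thesis
  proof (cases "m = 0")
    case True
    have "{ns. (\<forall>n\<in>set ns. 1 \<le> n) \<and> sum_list ns = (0::nat)} = {[]}"
    proof -
      have "ns = []" if "\<forall>n\<in>set ns. 1 \<le> n" "sum_list ns = (0::nat)" for ns using that by (cases ns) auto
      then show ?thesis by auto
    qed
    then show ?thesis unfolding eq unfolding True by (simp only: sum.insert sum.empty) (simp add: g_def)
  next
    case False
    let ?S = "{ns. (\<forall>n\<in>set ns. 1 \<le> n) \<and> sum_list ns = m}"
    have "(\<Sum>ns \<in> ?S. (1 / fact (length ns)) *\<^sub>C g ns) = (\<Sum>ns \<in> {[m]}. (1 / fact (length ns)) *\<^sub>C g ns)"
    proof (rule sum.mono_neutral_right[OF finite_compositions])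
      show "{[m]} \<subseteq> ?S" using False by auto
      show "\<forall>ns\<in>?S - {[m]}. (1 / fact (length ns)) *\<^sub>C g ns = 0"
      proof
        fix ns assume ns: "ns \<in> ?S - {[m]}"
        have "ns \<noteq> []" using ns False by auto
        moreover have "length ns \<noteq> 1" using ns by (cases ns) auto
        ultimately show "(1 / fact (length ns)) *\<^sub>C g ns = 0" by (simp add: g0 zero_prod_def[symmetric])
      qed
    qed
    then show ?thesis using False by (simp add: eq g0)
  qed
qed

lemma delta_log_free: "delta_log_free (extension_va V act D) (0, u) (iota a, 0)"
  unfolding delta_log_free_def delta_coeff_def
proof (intro allI impI)
  fix m j :: nat assume "0 < j"
  then obtain j' where j: "j = Suc j'" by (cases j) auto
  let ?V = "extension_va V act D"
  have z: "nprod ?V (0, u) 0 (delta_exp ?V (0, u) m (iota a, 0)) = 0"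
    by (simp add: delta_exp_eq extension_nprod_right screening zero_prod_def)
  have z': "nprod ?V (0, u) 0 0 = 0" unfolding zero_prod_def by (simp add: extension_nprod_right)
  have "(nprod ?V (0, u) 0 ^^ j') 0 = 0" by (induction j') (simp_all add: z')
  then show "(1 / fact j) *\<^sub>C (nprod ?V (0, u) 0 ^^ j) (delta_exp ?V (0, u) m (iota a, 0)) = 0"
    unfolding j funpow_Suc_right o_apply z by simp
qed

lemma delta_act_eq: "delta_act (extension_va V act D) (0, u) (iota a, 0) n x = dact a n x"
proof -
  obtain b w where x: "x = (b, w)" by force
  let ?V = "extension_va V act D" and ?a = "iota a"
  let ?f = "\<lambda>m::nat. nprod ?V (delta_coeff ?V (0, u) m 0 (?a, 0)) (n - int m) x"
  have f: "?f m = (if m = 0 then (nprod V ?a n b, act ?a n w) else 0) + (0, kappa m *\<^sub>C sk (sk u (int m) ?a) (n - int m) b)" for m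
    by (simp add: delta_coeff_def delta_exp_eq x extension_nprod_right extension_nprod_left
      clinear_scaleC[OF sk_linear_left] zero_prod_def)
  have fin: "finite {m. (0::'a, kappa m *\<^sub>C sk (sk u (int m) ?a) (n - int m) b) \<noteq> 0}"
    using psi_finite[of u ?a n b] by (simp add: zero_prod_def)
  have "Sum_any ?f = (nprod V ?a n b, act ?a n w) + Sum_any (\<lambda>m. (0, kappa m *\<^sub>C sk (sk u (int m) ?a) (n - int m) b))"
    unfolding f by (subst Sum_any.distrib[OF _ fin]) auto
  also have "Sum_any (\<lambda>m. (0::'a, kappa m *\<^sub>C sk (sk u (int m) ?a) (n - int m) b)) = (0, psi u ?a n b)"
  proof -
    have "clinear (\<lambda>y::'m. (0::'a, y))" by (rule clinearI) (simp_all add: scaleC_prod_def)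
    from clinear_Sum_any[OF this psi_finite] show ?thesis by (simp add: psi_def)
  qed
  finally show ?thesis by (simp add: delta_act_def dact_def x)
qed

end

section \<open>Calculus in vertex algebras\<close>

lemma jac_a_n0: "jac_a \<alpha> m 0 q = \<alpha> m q"
  by (simp add: jac_a_def gbinomial_0_left Sum_any_single[where a = 0])

lemma jac_l_m0: "jac_l \<gamma> 0 n q = \<gamma> n q"
  by (simp add: jac_l_def gbinomial_0_left Sum_any_single[where a = 0])

lemma gbinomial_minus_one: "(- 1 :: complex) gchoose j = (- 1) ^ j"
  using gbinomial_minus[of "1 :: complex" j] gbinomial_of_nat_symmetric[of j j, where 'a = complex] by simp

lemma gbinomial_minus_two: "(- 2 :: complex) gchoose j = (- 1) ^ j * of_nat (Suc j)"
proof -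
  have "(of_nat (Suc j) gchoose j :: complex) = of_nat (Suc j)"
    using gbinomial_of_nat_symmetric[of j "Suc j", where 'a = complex] by simp
  then show ?thesis
    using gbinomial_minus[of "2 :: complex" j] by (simp add: add.commute)
qed

context vmod begin

lemma commutator:
  "act a m (act b q x) = act b q (act a m x) +
    Sum_any (\<lambda>j::nat. (of_int m gchoose j) *\<^sub>C act (nprod V a (int j) b) (m + q - int j) x)"
  using act_jac[of a b x m 0 q] by (simp add: jac_def jac_l_def jac_a_n0)

lemma commutator_ope:
  assumes "ope V a b xs"
  shows "act a m (act b q x) = act b q (act a m x) +
    (\<Sum>j<length xs. (of_int m gchoose j) *\<^sub>C act (xs ! j) (m + q - int j) x)"
proof -
  have "Sum_any (\<lambda>j::nat. (of_int m gchoose j) *\<^sub>C act (nprod V a (int j) b) (m + q - int j) x) =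
      (\<Sum>j<length xs. (of_int m gchoose j) *\<^sub>C act (nprod V a (int j) b) (m + q - int j) x)"
    by (rule Sum_any_nat_bound) (use assms in \<open>auto simp: ope_def\<close>)
  then show ?thesis using assms unfolding commutator[of a m b q x] by (simp add: ope_def)
qed

lemma iterate:
  "act (nprod V a n b) q x = jac_a (\<lambda>i j. act a i (act b j x)) 0 n q
    - ((- 1) powi n) *\<^sub>C jac_a (\<lambda>i j. act b i (act a j x)) q n 0"
  using act_jac[of a b x 0 n q] by (simp add: jac_def jac_l_m0)

lemma act_nop:
  assumes "\<And>j. B \<le> j \<Longrightarrow> act b (q + int j) x = 0" "\<And>j. B \<le> j \<Longrightarrow> act a (int j) x = 0"
  shows "act (nprod V a (- 1) b) q x =
    (\<Sum>j<B. act a (- 1 - int j) (act b (q + int j) x) + act b (q - 1 - int j) (act a (int j) x))"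
proof -
  have s: "(- 1 :: complex) ^ j * ((- 1) gchoose j) = 1" for j
    by (simp add: gbinomial_minus_one flip: power_mult_distrib)
  have "jac_a (\<lambda>i j. act a i (act b j x)) 0 (- 1) q = (\<Sum>j<B. act a (- 1 - int j) (act b (q + int j) x))"
    unfolding jac_a_def by (subst Sum_any_nat_bound[of B]) (auto simp: assms s)
  moreover have "jac_a (\<lambda>i j. act b i (act a j x)) q (- 1) 0 = (\<Sum>j<B. act b (q - 1 - int j) (act a (int j) x))"
    unfolding jac_a_def by (subst Sum_any_nat_bound[of B]) (auto simp: assms s)
  ultimately show ?thesis by (simp add: iterate sum.distrib)
qed

lemma act_prod_minus_two:
  assumes "\<And>j. B \<le> j \<Longrightarrow> act b (q + int j) x = 0" "\<And>j. B \<le> j \<Longrightarrow> act a (int j) x = 0"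
  shows "act (nprod V a (- 2) b) q x =
    (\<Sum>j<B. of_nat (Suc j) *\<^sub>C (act a (- 2 - int j) (act b (q + int j) x) - act b (q - 2 - int j) (act a (int j) x)))"
proof -
  have s: "(- 1 :: complex) ^ j * ((- 2) gchoose j) = of_nat (Suc j)" for j
    by (simp add: gbinomial_minus_two del: of_nat_Suc flip: power_mult_distrib mult.assoc)
  have "jac_a (\<lambda>i j. act a i (act b j x)) 0 (- 2) q = (\<Sum>j<B. of_nat (Suc j) *\<^sub>C act a (- 2 - int j) (act b (q + int j) x))"
    unfolding jac_a_def by (subst Sum_any_nat_bound[of B]) (auto simp: assms s simp del: of_nat_Suc)
  moreover have "jac_a (\<lambda>i j. act b i (act a j x)) q (- 2) 0 = (\<Sum>j<B. of_nat (Suc j) *\<^sub>C act b (q - 2 - int j) (act a (int j) x))"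
    unfolding jac_a_def by (subst Sum_any_nat_bound[of B]) (auto simp: assms s algebra_simps simp del: of_nat_Suc)
  ultimately show ?thesis by (simp add: iterate sum_subtractf cvec.scale_right_diff_distrib del: of_nat_Suc)
qed

lemma act_der: "act (der V a) q x = (- of_int q) *\<^sub>C act a (q - 1) x"
proof -
  define B where "B = nat (max \<bar>q\<bar> (ord a x)) + 1"
  have "act (der V a) q x = (\<Sum>j<B. of_nat (Suc j) *\<^sub>C (act a (- 2 - int j) (act (vacuum V) (q + int j) x)
      - act (vacuum V) (q - 2 - int j) (act a (int j) x)))"
    by (rule act_prod_minus_two) (auto simp: act_vacuum act_ord B_def)
  \<comment> \<open>The vacuum acts in mode -1 alone, so at most one \<open>j\<close> contributes:
    in the first term for q < 0, in the second for q > 0.\<close>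
  also have "\<dots> = (\<Sum>j<B. if int j = - q - 1 then (- of_int q) *\<^sub>C act a (q - 1) x else 0) +
      (\<Sum>j<B. if int j = q - 1 then (- of_int q) *\<^sub>C act a (q - 1) x else 0)"
    unfolding sum.distrib[symmetric]
  proof (rule sum.cong[OF refl])
    fix j
    have "of_nat (Suc j) = (- of_int q :: complex)" if "int j = - q - 1"
    proof -
      have "q = - int (Suc j)" using that by simp
      then show ?thesis by simp
    qed
    moreover have "of_nat (Suc j) = (of_int q :: complex)" if "int j = q - 1"
    proof -
      have "q = int (Suc j)" using that by simp
      then show ?thesis by simp
    qed
    ultimately show "of_nat (Suc j) *\<^sub>C (act a (- 2 - int j) (act (vacuum V) (q + int j) x)
      - act (vacuum V) (q - 2 - int j) (act a (int j) x)) =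
      (if int j = - q - 1 then (- of_int q) *\<^sub>C act a (q - 1) x else 0) +
      (if int j = q - 1 then (- of_int q) *\<^sub>C act a (q - 1) x else 0)"
      by (auto simp: act_vacuum simp del: of_nat_Suc)
  qed
  also have "\<dots> = (- of_int q) *\<^sub>C act a (q - 1) x"
  proof (cases "q = 0")
    case False
    have 1: "(\<Sum>j<B. if int j = p then y else 0) = (if 0 \<le> p then y else 0)" if "nat p < B" for p and y :: 'm
    proof (cases "0 \<le> p")
      case True
      then have "(\<Sum>j<B. if int j = p then y else 0) = (\<Sum>j<B. if j = nat p then y else 0)"
        by (intro sum.cong) auto
      then show ?thesis using that True by simp
    qed auto
    have "nat (- q - 1) < B" "nat (q - 1) < B" by (auto simp: B_def)
    then show ?thesis using False by (auto simp: 1)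
  qed simp
  finally show ?thesis .
qed

lemma iterate_closed:
  assumes U: "cvec.subspace U" and a: "\<And>n x. x \<in> U \<Longrightarrow> act a n x \<in> U" and b: "\<And>n x. x \<in> U \<Longrightarrow> act b n x \<in> U"
    and x: "x \<in> U"
  shows "act (nprod V a n b) q x \<in> U"
proof -
  have "jac_a (\<lambda>i j. act c i (act c' j x)) m n q \<in> U" if "\<And>n x. x \<in> U \<Longrightarrow> act c n x \<in> U" "\<And>n x. x \<in> U \<Longrightarrow> act c' n x \<in> U"
    for c c' m n q
    unfolding jac_a_def Sum_any.expand_set
    by (intro cvec.subspace_sum[OF U] cvec.subspace_scale[OF U] that x)
  then show ?thesis
    unfolding iterate by (intro cvec.subspace_diff[OF U] cvec.subspace_scale[OF U]) (use a b in auto)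
qed

text \<open>By the iterate formula the elements whose modes all preserve \<open>U\<close> are closed
  under every product; they form a subspace containing the vacuum and the generators.\<close>

lemma submodule_of_generators:
  assumes gen: "va_generated V G" and U: "cvec.subspace U" and G: "\<And>a n x. a \<in> G \<Longrightarrow> x \<in> U \<Longrightarrow> act a n x \<in> U"
  shows "submodule act U"
proof -
  have "{a. \<forall>n. \<forall>x\<in>U. act a n x \<in> U} = UNIV"
  proof (rule gen[unfolded va_generated_def, rule_format], intro conjI ballI allI)
    show "cvec.subspace {a. \<forall>n. \<forall>x\<in>U. act a n x \<in> U}"
      by (rule cvec.subspaceI)
        (auto simp: act_add_left act_scale_left cvec.subspace_0[OF U] intro: cvec.subspace_add[OF U] cvec.subspace_scale[OF U])
    show "vacuum V \<in> {a. \<forall>n. \<forall>x\<in>U. act a n x \<in> U}"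
      by (auto simp: act_vacuum cvec.subspace_0[OF U])
    show "nprod V a n b \<in> {a. \<forall>n. \<forall>x\<in>U. act a n x \<in> U}"
      if "a \<in> {a. \<forall>n. \<forall>x\<in>U. act a n x \<in> U}" "b \<in> {a. \<forall>n. \<forall>x\<in>U. act a n x \<in> U}" for a b n
      using that iterate_closed[OF U] by blast
  qed (use G in auto)
  then show ?thesis using U by (auto simp: submodule_def)
qed

end

context vertex_alg begin

lemma creation: "nprod V a (- 1) (vacuum V) = a" and creation_0: "0 \<le> n \<Longrightarrow> nprod V a n (vacuum V) = 0"
  using vertex_algebra by (auto simp: vertex_algebra_def)

lemma nprod_der: "nprod V a n (der V x) = der V (nprod V a n x) + of_int n *\<^sub>C nprod V a (n - 1) x"
proof -
  have "der V (nprod V a n x) = nprod V a n (der V x) - of_int n *\<^sub>C nprod V a (n - 1) x"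
  proof -
    have "jac_a (\<lambda>i j. nprod V a i (nprod V x j (vacuum V))) 0 n (- 2) =
        nprod V a n (der V x) - of_int n *\<^sub>C nprod V a (n - 1) x"
      unfolding jac_a_def
      by (subst Sum_any_nat_bound[of 2]) (auto simp: creation_0 creation numeral_2_eq_2 lessThan_Suc)
    moreover have "jac_a (\<lambda>i j. nprod V x i (nprod V a j (vacuum V))) (- 2) n 0 = 0"
      by (simp add: jac_a_def creation_0)
    ultimately show ?thesis using iterate[of a n x "- 2" "vacuum V"] by simp
  qed
  then show ?thesis by simp
qed

lemma der_linear: "clinear (der V)"
  by (rule act_linear_left)

lemmas der_add = clinear_add[OF der_linear] and der_scale = clinear_scaleC[OF der_linear]
  and der_0 = clinear_0[OF der_linear]

lemma der_vacuum: "der V (vacuum V) = 0"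
  by (simp add: act_vacuum)

text \<open>On the vacuum, the identity for (a, b) at (0, n, -1) and that for (b, a) at (-1, n, 0)
  have right sides that differ by the factor -(-1)^n. The factor e^{zD} appears as modes on the
  vacuum.\<close>

lemma skew_symmetry:
  "nprod V a n b = Sum_any (\<lambda>j::nat. (- ((- 1) powi n) * (- 1) ^ j) *\<^sub>C
     nprod V (nprod V b (n + int j) a) (- 1 - int j) (vacuum V))"
proof -
  have "nprod V a n b = jac_l (\<lambda>n q. nprod V (nprod V a n b) q (vacuum V)) 0 n (- 1)"
    by (simp add: jac_l_m0 creation)
  also have "\<dots> = jac_a (\<lambda>i j. nprod V a i (nprod V b j (vacuum V))) 0 n (- 1)
     - ((- 1) powi n) *\<^sub>C jac_a (\<lambda>i j. nprod V b i (nprod V a j (vacuum V))) (- 1) n 0"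
    using act_jac[of a b "vacuum V" 0 n "- 1"] by (simp add: jac_def)
  also have "\<dots> = - ((- 1) powi n) *\<^sub>C (jac_a (\<lambda>i j. nprod V b i (nprod V a j (vacuum V))) (- 1) n 0
     - ((- 1) powi n) *\<^sub>C jac_a (\<lambda>i j. nprod V a i (nprod V b j (vacuum V))) 0 n (- 1))"
    by (simp add: cvec.scale_right_diff_distrib scaleC_scaleC)
  also have "\<dots> = - ((- 1) powi n) *\<^sub>C jac_l (\<lambda>n q. nprod V (nprod V b n a) q (vacuum V)) (- 1) n 0"
    using act_jac[of b a "vacuum V" "- 1" n 0] by (simp add: jac_def)
  also have "jac_l (\<lambda>n q. nprod V (nprod V b n a) q (vacuum V)) (- 1) n 0 =
      Sum_any (\<lambda>j::nat. (- 1) ^ j *\<^sub>C nprod V (nprod V b (n + int j) a) (- 1 - int j) (vacuum V))"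
    by (simp add: jac_l_def gbinomial_minus_one)
  also have "- ((- 1) powi n) *\<^sub>C Sum_any (\<lambda>j::nat. (- 1) ^ j *\<^sub>C nprod V (nprod V b (n + int j) a) (- 1 - int j) (vacuum V)) =
      Sum_any (\<lambda>j::nat. (- ((- 1) powi n) * (- 1) ^ j) *\<^sub>C nprod V (nprod V b (n + int j) a) (- 1 - int j) (vacuum V))"
  proof -
    have "finite {j::nat. (- 1 :: complex) ^ j *\<^sub>C nprod V (nprod V b (n + int j) a) (- 1 - int j) (vacuum V) \<noteq> 0}"
      by (rule finite_nat_bound[of "nat (ord b a - n)"]) (simp add: act_ord)
    from scaleC_Sum_any[OF this] show ?thesis by (simp add: scaleC_scaleC)
  qed
  finally show ?thesis .
qed

text \<open>Conformal vectors have this property. It is all that the translation operators on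
  modules and the grading by mode 1 require.\<close>

definition translator :: "'a \<Rightarrow> bool" where
  "translator w \<longleftrightarrow> (\<forall>a. nprod V w 0 a = der V a)"

text \<open>The zero mode of \<open>w\<close> and the translation operator are both derivations of
  all products, so agreement on generators is enough.\<close>

lemma translatorI:
  assumes gen: "va_generated V G" and G: "\<And>a. a \<in> G \<Longrightarrow> nprod V w 0 a = der V a"
  shows "translator w"
proof -
  have "{a. nprod V w 0 a = der V a} = UNIV"
  proof (rule gen[unfolded va_generated_def, rule_format], intro conjI ballI allI)
    show "cvec.subspace {a. nprod V w 0 a = der V a}"
      by (rule cvec.subspaceI) (auto simp: act_add_right act_scale_right der_add der_scale der_0)
    show "vacuum V \<in> {a. nprod V w 0 a = der V a}" by (simp add: creation_0 der_vacuum)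
    fix a b n assume ab: "a \<in> {a. nprod V w 0 a = der V a}" "b \<in> {a. nprod V w 0 a = der V a}"
    have "nprod V w 0 (nprod V a n b) = nprod V a n (nprod V w 0 b) + nprod V (nprod V w 0 a) n b"
      unfolding commutator[of w 0 a n b] by (simp add: gbinomial_0_left Sum_any_single[where a = 0])
    also have "\<dots> = der V (nprod V a n b)"
      using ab by (simp add: nprod_der act_der)
    finally show "nprod V a n b \<in> {a. nprod V w 0 a = der V a}" by simp
  qed (use G in auto)
  then show ?thesis by (auto simp: translator_def)
qed

end

context va_mod begin

lemma translator_0:
  assumes "translator w"
  shows "act w 0 (act a n x) = act a n (act w 0 x) - of_int n *\<^sub>C act a (n - 1) x"
  unfolding M.commutator[of w 0 a n x] using assms
  by (simp add: gbinomial_0_left Sum_any_single[where a = 0] translator_def M.act_der)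

lemma translator_1:
  assumes "translator w"
  shows "act w 1 (act a n x) = act a n (act w 1 x) + act (nprod V w 1 a) n x - of_int (n + 1) *\<^sub>C act a n x"
proof -
  have "Sum_any (\<lambda>j::nat. (of_int 1 gchoose j) *\<^sub>C act (nprod V w (int j) a) (1 + n - int j) x) =
      (\<Sum>j<2. (of_int 1 gchoose j) *\<^sub>C act (nprod V w (int j) a) (1 + n - int j) x)"
  proof (rule Sum_any_nat_bound)
    fix j :: nat assume "2 \<le> j"
    then have "((1::complex) gchoose j) = 0"
      using binomial_gbinomial[of 1 j, where 'a = complex] by (simp add: binomial_eq_0)
    then show "(of_int 1 gchoose j) *\<^sub>C act (nprod V w (int j) a) (1 + n - int j) x = 0" by simp
  qed
  then show ?thesis
    unfolding M.commutator[of w 1 a n x] using assms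
    by (simp add: numeral_2_eq_2 translator_def M.act_der add.commute cvec.scale_left_diff_distrib scaleC_add_left)
qed

lemma translation_mod: "translator w \<Longrightarrow> translation_mod V act (act w 0)"
  by (intro translation_mod.intro va_mod_axioms translation_mod_axioms.intro M.act_linear_right)
    (simp add: translator_0)

end

section \<open>Independence of eigenvectors and separating functionals\<close>

lemma eigen_independent:
  fixes f :: "'m::complex_vector \<Rightarrow> 'm"
  assumes f: "clinear f" and x: "x \<in> cvec.span {y. \<exists>c. c \<in> C \<and> f y = c *\<^sub>C y}" and fx: "f x = l *\<^sub>C x" and l: "l \<notin> C"
  shows "x = 0"
proof -
  have "\<exists>F y. finite F \<and> F \<subseteq> C \<and> (\<forall>c\<in>F. f (y c) = c *\<^sub>C y c) \<and> x = (\<Sum>c\<in>F. y c)"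
    using x
  proof (induction rule: cvec.span_induct_alt)
    case base
    show ?case by (intro exI[of _ "{}"]) auto
  next
    case (step s z w)
    then obtain c F y where c: "c \<in> C" "f z = c *\<^sub>C z" and F: "finite F" "F \<subseteq> C" "\<forall>c\<in>F. f (y c) = c *\<^sub>C y c"
      and w: "w = (\<Sum>c\<in>F. y c)" by blast
    define y' where "y' = (\<lambda>d. (if d \<in> F then y d else 0) + (if d = c then s *\<^sub>C z else 0))"
    have "(\<Sum>d\<in>insert c F. y' d) = (\<Sum>d\<in>insert c F. if d \<in> F then y d else 0) + (\<Sum>d\<in>insert c F. if d = c then s *\<^sub>C z else 0)"
      by (simp add: y'_def sum.distrib)
    also have "(\<Sum>d\<in>insert c F. if d \<in> F then y d else 0) = w"
      unfolding w by (rule sum.mono_neutral_cong_right) (use F in auto)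
    also have "(\<Sum>d\<in>insert c F. if d = c then s *\<^sub>C z else 0) = s *\<^sub>C z" using F(1) by simp
    finally have "s *\<^sub>C z + w = (\<Sum>d\<in>insert c F. y' d)" by simp
    moreover have "f (y' d) = d *\<^sub>C y' d" if "d \<in> insert c F" for d
      using F(3) c that
      by (auto simp: y'_def clinear_add[OF f] clinear_scaleC[OF f] clinear_0[OF f] scaleC_add_right scaleC_scaleC mult.commute)
    ultimately show ?case using F c by (intro exI[of _ "insert c F"] exI[of _ y']) auto
  qed
  then obtain F y where F: "finite F" "F \<subseteq> C" "\<forall>c\<in>F. f (y c) = c *\<^sub>C y c" and xs: "x = (\<Sum>c\<in>F. y c)" by blast
  have indep: "\<forall>d\<in>F. y d = 0" if "finite F" "\<forall>c\<in>F. f (y c) = c *\<^sub>C y c" "(\<Sum>c\<in>F. y c) = 0" for F and y :: "complex \<Rightarrow> 'm"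
    using that
  proof (induction F arbitrary: y rule: finite_induct)
    case empty
    then show ?case by simp
  next
    case (insert a F)
    \<comment> \<open>Subtracting \<open>a\<close> times the relation from its image under
      \<open>f\<close> eliminates the eigenvector for \<open>a\<close>.\<close>
    let ?y = "\<lambda>d. (d - a) *\<^sub>C y d"
    have "(\<Sum>c\<in>insert a F. y c) = 0" by fact
    then have "f (\<Sum>c\<in>insert a F. y c) - a *\<^sub>C (\<Sum>c\<in>insert a F. y c) = 0" by (simp add: clinear_0[OF f])
    also have "f (\<Sum>c\<in>insert a F. y c) = (\<Sum>c\<in>insert a F. c *\<^sub>C y c)"
      unfolding clinear_sum[OF f] by (intro sum.cong) (use insert in auto)
    finally have "(\<Sum>c\<in>insert a F. ?y c) = 0"
      by (simp only: cvec.scale_sum_right sum_subtractf[symmetric] cvec.scale_left_diff_distrib)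
    then have "(\<Sum>c\<in>F. ?y c) = 0" using insert by simp
    then have "\<forall>d\<in>F. ?y d = 0"
      by (intro insert.IH) (use insert in \<open>auto simp: clinear_scaleC[OF f] scaleC_scaleC mult.commute\<close>)
    then have "\<forall>d\<in>F. y d = 0" using insert(2) by auto
    moreover from this insert have "y a = 0" by simp
    ultimately show ?case by simp
  qed
  define y' where "y' = (\<lambda>d. if d = l then - x else y d)"
  have "l \<notin> F" using F l by auto
  then have "(\<Sum>c\<in>insert l F. y' c) = - x + (\<Sum>c\<in>F. y c)"
    using F(1) by (auto simp: y'_def intro!: sum.cong)
  then have "(\<Sum>c\<in>insert l F. y' c) = 0" by (simp add: xs)
  then have "\<forall>d\<in>insert l F. y' d = 0"
    by (intro indep) (use F fx \<open>l \<notin> F\<close> in \<open>auto simp: y'_def clinear_neg[OF f]\<close>)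
  then show ?thesis by (simp add: y'_def)
qed

lemma linear_functional_exists:
  fixes U :: "'m::complex_vector set"
  assumes U: "cvec.subspace U" and x: "x \<notin> U"
  shows "\<exists>p :: 'm \<Rightarrow> complex. clinear p \<and> p x = 1 \<and> (\<forall>y\<in>U. p y = 0)"
proof -
  interpret vector_space_pair "scaleC :: complex \<Rightarrow> 'm \<Rightarrow> 'm" "scaleC :: complex \<Rightarrow> complex \<Rightarrow> complex" ..
  obtain B where B: "B \<subseteq> U" "cvec.independent B" "cvec.span B = U"
    using cvec.basis_exists[of U] cvec.span_subspace[OF _ _ U] by metis
  have "cvec.independent (insert x B)"
    using B x by (simp add: cvec.independent_insert)
  then obtain p :: "'m \<Rightarrow> complex" where p: "clinear p" "\<forall>y\<in>insert x B. p y = (if y = x then 1 else 0)"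
    using linear_independent_extend[of "insert x B" "\<lambda>y. if y = x then 1 else 0"] by blast
  have "p y = 0" if "y \<in> cvec.span B" for y
    using that
  proof (induction rule: cvec.span_induct_alt)
    case base
    show ?case by (simp add: clinear_0[OF p(1)])
  next
    case (step c z w)
    have "z \<noteq> x" using step B x by auto
    then show ?case using step p(2) by (simp add: clinear_add[OF p(1)] clinear_scaleC[OF p(1)])
  qed
  then show ?thesis using p B by auto
qed

section \<open>Half-lattice algebras\<close>

locale half_lattice_alg =
  fixes Q :: "'q::complex_vector va" and c d :: 'q and e :: "int \<Rightarrow> 'q"
  assumes half_lattice: "half_lattice Q c d e"
begin

sublocale vertex_alg Q
  by (rule vertex_alg.intro) (use half_lattice in \<open>simp add: half_lattice_def\<close>)

lemma ope_cd: "ope Q c d [0, 2 *\<^sub>C vacuum Q]" and ope_cc: "ope Q c c []" and ope_dd: "ope Q d d []"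
  and lattice_self: "half_lattice_module Q c d e 0 0 (nprod Q) e" and e_0: "e 0 = vacuum Q"
  and der_e: "der Q (e m) = of_int m *\<^sub>C nop Q c (e m)"
  using half_lattice by (auto simp: half_lattice_def)

lemma ope_c_e: "ope Q c (e m) []" and ope_d_e: "ope Q d (e m) [(2 * of_int m) *\<^sub>C e m]"
proof -
  have "nprod Q c (int j) (e m) = 0" for j
    using lattice_self by (cases "j = 0") (auto simp: half_lattice_module_def)
  moreover have "nprod Q d (int j) (e m) = (if j = 0 then (2 * of_int m) *\<^sub>C e m else 0)" for j
    using lattice_self by (cases "j = 0") (auto simp: half_lattice_module_def)
  ultimately show "ope Q c (e m) []" "ope Q d (e m) [(2 * of_int m) *\<^sub>C e m]" by (auto simp: ope_def)
qed

end

locale half_lattice_action = half_lattice_alg Q c d e + va_mod Q act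
  for Q :: "'q::complex_vector va" and c d e and act :: "'q \<Rightarrow> int \<Rightarrow> 'i::complex_vector \<Rightarrow> 'i"
begin

lemma cc: "act c m (act c n x) = act c n (act c m x)"
  and dd: "act d m (act d n x) = act d n (act d m x)"
  and cd: "act c m (act d n x) = act d n (act c m x) + (if m + n = 0 then (2 * of_int m) *\<^sub>C x else 0)"
  using M.commutator_ope[OF ope_cc, of m n x] M.commutator_ope[OF ope_dd, of m n x]
    M.commutator_ope[OF ope_cd, of m n x]
  by (auto simp: M.act_scale_left M.act_vacuum scaleC_scaleC mult.commute)

lemma ce: "act c m (act (e l) n x) = act (e l) n (act c m x)"
  and de: "act d m (act (e l) n x) = act (e l) n (act d m x) + (2 * of_int l) *\<^sub>C act (e l) (m + n) x"
  using M.commutator_ope[OF ope_c_e, of m l n x] M.commutator_ope[OF ope_d_e, of m l n x]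
  by (simp_all add: M.act_scale_left)

end

sublocale half_lattice_alg \<subseteq> S: half_lattice_action Q c d e "nprod Q" ..

context half_lattice_alg begin

lemma c_d: "0 \<le> j \<Longrightarrow> nprod Q c j d = (if j = 1 then 2 *\<^sub>C vacuum Q else 0)"
  and c_c: "0 \<le> j \<Longrightarrow> nprod Q c j c = 0" and d_d: "0 \<le> j \<Longrightarrow> nprod Q d j d = 0"
  and d_c: "0 \<le> j \<Longrightarrow> nprod Q d j c = (if j = 1 then 2 *\<^sub>C vacuum Q else 0)"
proof -
  show "nprod Q c j d = (if j = 1 then 2 *\<^sub>C vacuum Q else 0)" if "0 \<le> j"
    using S.cd[of j "- 1" "vacuum Q"] that by (simp add: creation creation_0)
  show "nprod Q c j c = 0" if "0 \<le> j"
    using S.cc[of j "- 1" "vacuum Q"] that by (simp add: creation creation_0)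
  show "nprod Q d j d = 0" if "0 \<le> j"
    using S.dd[of j "- 1" "vacuum Q"] that by (simp add: creation creation_0)
  show "nprod Q d j c = (if j = 1 then 2 *\<^sub>C vacuum Q else 0)" if "0 \<le> j"
    using S.cd[of "- 1" j "vacuum Q"] that by (auto simp: creation creation_0 eq_neg_iff_add_eq_0)
qed

abbreviation cd :: 'q where "cd \<equiv> nop Q c d"

lemma ope_c_cd: "ope Q c cd [0, 2 *\<^sub>C c]" and ope_d_cd: "ope Q d cd [0, 2 *\<^sub>C d]"
proof -
  have "nprod Q c (int j) cd = (if j = 1 then 2 *\<^sub>C c else 0)" for j
    using S.cc[of "int j" "- 1" d] by (simp add: c_d act_scale_right creation)
  then show "ope Q c cd [0, 2 *\<^sub>C c]" by (auto simp: ope_def less_Suc_eq)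
  have "nprod Q d (int j) cd = (if j = 1 then 2 *\<^sub>C d else 0)" for j
    using S.cd[of "- 1" "int j" d] by (auto simp: d_d scaleC_scaleC split: if_splits)
  then show "ope Q d cd [0, 2 *\<^sub>C d]" by (auto simp: ope_def less_Suc_eq)
qed

lemma generated: "va_generated Q ({c, d} \<union> range e)"
  unfolding va_generated_def
proof (intro allI impI)
  fix U assume U: "cvec.subspace U \<and> vacuum Q \<in> U \<and> {c, d} \<union> range e \<subseteq> U \<and> (\<forall>a\<in>U. \<forall>b\<in>U. \<forall>n. nprod Q a n b \<in> U)"
  then show "U = UNIV"
    using lattice_self unfolding half_lattice_module_def by (metis Un_subset_iff insert_subset)
qed

lemma cd_zero_generators: "nprod Q cd 0 c = 2 *\<^sub>C der Q c" "nprod Q cd 0 d = 2 *\<^sub>C der Q d"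
  "nprod Q cd 0 (e m) = 2 *\<^sub>C der Q (e m)"
proof -
  show "nprod Q cd 0 c = 2 *\<^sub>C der Q c"
    by (subst act_nop[where B = 2]) (auto simp: d_c c_c numeral_2_eq_2 act_scale_right)
  show "nprod Q cd 0 d = 2 *\<^sub>C der Q d"
    by (subst act_nop[where B = 2]) (auto simp: d_d c_d numeral_2_eq_2 act_scale_right)
  have "nprod Q c (int j) (e m) = 0" "nprod Q d (int j) (e m) = (if j = 0 then (2 * of_int m) *\<^sub>C e m else 0)" for j
    using ope_c_e[of m] ope_d_e[of m] by (auto simp: ope_def)
  from this this[of 0] show "nprod Q cd 0 (e m) = 2 *\<^sub>C der Q (e m)"
    by (subst act_nop[where B = 1]) (auto simp: act_scale_right der_e scaleC_scaleC)
qed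

lemma translator_cd: "translator ((1 / 2) *\<^sub>C cd)"
  by (rule translatorI[OF generated]) (auto simp: act_scale_left cd_zero_generators scaleC_scaleC)

end

context half_lattice_action begin

lemma c_cd: "act c m (act (nop Q c d) n x) = act (nop Q c d) n (act c m x) + (2 * of_int m) *\<^sub>C act c (m + n - 1) x"
  and d_cd: "act d m (act (nop Q c d) n x) = act (nop Q c d) n (act d m x) + (2 * of_int m) *\<^sub>C act d (m + n - 1) x"
  using M.commutator_ope[OF ope_c_cd, of m n x] M.commutator_ope[OF ope_d_cd, of m n x]
  by (simp_all add: M.act_scale_left scaleC_scaleC mult.commute)

text \<open>This is mode 1 of \<open>(1 / 2) cd - y der c - z der d\<close>, that is, L(0) for
  arbitrary background charges: mode 1 of \<open>der c\<close> is minus mode 0 of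
  \<open>c\<close>.\<close>

definition grading :: "complex \<Rightarrow> complex \<Rightarrow> 'i \<Rightarrow> 'i" where
  "grading y z x = (1 / 2) *\<^sub>C act (nop Q c d) 1 x + y *\<^sub>C act c 0 x + z *\<^sub>C act d 0 x"

lemma grading_linear: "clinear (grading y z)"
  unfolding grading_def[abs_def] by (intro clinear_plus clinear_scale M.act_linear_right)

lemma grading_c: "grading y z (act c j x) = act c j (grading y z x) - of_int j *\<^sub>C act c j x"
  and grading_d: "grading y z (act d j x) = act d j (grading y z x) - of_int j *\<^sub>C act d j x"
proof -
  show "grading y z (act c j x) = act c j (grading y z x) - of_int j *\<^sub>C act c j x"
    using c_cd[of j 1 x] cc[of 0 j x] cd[of j 0 x]
    by (auto simp: grading_def M.act_add_right M.act_scale_right scaleC_add_right scaleC_scaleC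
        cvec.scale_right_diff_distrib algebra_simps)
  show "grading y z (act d j x) = act d j (grading y z x) - of_int j *\<^sub>C act d j x"
    using d_cd[of j 1 x] dd[of 0 j x] cd[of 0 j x]
    by (auto simp: grading_def M.act_add_right M.act_scale_right scaleC_add_right scaleC_scaleC
        cvec.scale_right_diff_distrib algebra_simps)
qed

end

locale half_lattice_mod = half_lattice_alg Q c d e
  for Q :: "'q::complex_vector va" and c d e +
  fixes \<mu> :: complex and r :: int and act :: "'q \<Rightarrow> int \<Rightarrow> 'i::complex_vector \<Rightarrow> 'i" and E
  assumes lattice_module: "half_lattice_module Q c d e \<mu> r act E"
begin

sublocale half_lattice_action Q c d e act
  by unfold_locales (use lattice_module in \<open>simp add: half_lattice_module_def\<close>)

lemma E_nonzero: "E n \<noteq> 0" and c_0_E: "act c 0 (E n) = of_int r *\<^sub>C E n"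
  and d_0_E: "act d 0 (E n) = (2 * (\<mu> + of_int n)) *\<^sub>C E n"
  and c_E: "0 < j \<Longrightarrow> act c j (E n) = 0" and d_E: "0 < j \<Longrightarrow> act d j (E n) = 0"
  and e_E: "act (e m) (- m * r - 1) (E n) = E (m + n)"
  and e_E_0: "- m * r \<le> j \<Longrightarrow> act (e m) j (E n) = 0"
  using lattice_module by (auto simp: half_lattice_module_def)

lemma E_induct: "cvec.subspace U \<Longrightarrow> range E \<subseteq> U \<Longrightarrow>
    (\<And>x j. x \<in> U \<Longrightarrow> j < 0 \<Longrightarrow> act c j x \<in> U \<and> act d j x \<in> U) \<Longrightarrow> U = UNIV"
  using lattice_module by (auto simp: half_lattice_module_def)

lemma cd_E: "act (nop Q c d) 1 (E n) = (2 * of_int r * (\<mu> + of_int n)) *\<^sub>C E n"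
  by (subst M.act_nop[where B = 1]) (auto simp: c_E d_E c_0_E d_0_E M.act_scale_right scaleC_scaleC)

lemma cd_E_0: "act (nop Q c d) 0 (E n) = (2 * (\<mu> + of_int n)) *\<^sub>C act c (- 1) (E n) + of_int r *\<^sub>C act d (- 1) (E n)"
  by (subst M.act_nop[where B = 1]) (auto simp: c_E d_E c_0_E d_0_E M.act_scale_right scaleC_scaleC)

definition weight :: "complex \<Rightarrow> complex \<Rightarrow> int \<Rightarrow> complex" where
  "weight y z n = of_int r * (\<mu> + of_int n) + y * of_int r + z * (2 * (\<mu> + of_int n))"

lemma grading_E: "grading y z (E n) = weight y z n *\<^sub>C E n"
  by (simp add: grading_def weight_def cd_E c_0_E d_0_E scaleC_scaleC scaleC_add_left scaleC_add_right distrib_left)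

text \<open>The vectors \<open>E n\<close> are eigenvectors, and a mode of \<open>c\<close> or
  \<open>d\<close> of index j < 0 raises the eigenvalue by -j. The levels \<open>l\<close> are
  thereby natural numbers, a fact on which \<open>coeff_i\<close> relies.\<close>

lemma grading_span:
  "cvec.span {x. \<exists>n (l::nat). grading y z x = (weight y z n + of_nat l) *\<^sub>C x} = UNIV"
proof (rule E_induct)
  let ?S = "{x. \<exists>n (l::nat). grading y z x = (weight y z n + of_nat l) *\<^sub>C x}"
  show "cvec.subspace (cvec.span ?S)" by simp
  show "range E \<subseteq> cvec.span ?S"
  proof clarify
    fix n
    have "grading y z (E n) = (weight y z n + of_nat 0) *\<^sub>C E n" by (simp add: grading_E)
    then show "E n \<in> cvec.span ?S" by (intro cvec.span_base) blast
  qed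
  fix x j assume x: "x \<in> cvec.span ?S" and j: "(j::int) < 0"
  have j': "- of_int j = (of_nat (nat (- j)) :: complex)" using j by (simp add: of_nat_nat)
  have st: "act a j y' \<in> cvec.span ?S" if "y' \<in> ?S" and a: "a = c \<or> a = d" for a y'
  proof -
    from that obtain n l where "grading y z y' = (weight y z n + of_nat l) *\<^sub>C y'" by blast
    then have "grading y z (act a j y') = (weight y z n + of_nat (l + nat (- j))) *\<^sub>C act a j y'"
      using a by (auto simp: grading_c grading_d M.act_scale_right M.act_add_right j'[symmetric] scaleC_add_left cvec.scale_left_diff_distrib)
    then show ?thesis by (intro cvec.span_base) blast
  qed
  have "act a j x \<in> cvec.span ?S" if "a = c \<or> a = d" for a
    using x
  proof (induction rule: cvec.span_induct_alt)
    case base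
    show ?case by (simp add: cvec.span_zero)
  next
    case (step s z' w)
    then show ?case using st[OF step(1) that]
      by (simp add: M.act_add_right M.act_scale_right cvec.span_add cvec.span_scale)
  qed
  then show "act c j x \<in> cvec.span ?S \<and> act d j x \<in> cvec.span ?S" by blast
qed

lemma grading_diagonalizable: "diagonalizable (grading y z)"
proof -
  have "{x. \<exists>n (l::nat). grading y z x = (weight y z n + of_nat l) *\<^sub>C x} \<subseteq> {x. \<exists>c. grading y z x = c *\<^sub>C x}" by blast
  from cvec.span_mono[OF this] show ?thesis unfolding diagonalizable_def grading_span by blast
qed

end

context half_lattice_alg begin

sublocale L: half_lattice_mod Q c d e 0 0 "nprod Q" e
  by unfold_locales (rule lattice_self)

text \<open>With the imaginary unit as second parameter the eigenvalues of \<open>grading\<close> separate the levels and the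
  exponents \<open>n\<close> of \<open>e n\<close>, so the coefficient of \<open>e n\<close> is a well-defined functional.\<close>

abbreviation gr :: "'q \<Rightarrow> 'q" where "gr \<equiv> S.grading 0 \<i>"

lemma gr_weight: "L.weight 0 \<i> n = 2 * of_int n * \<i>"
  by (simp add: L.weight_def)

text \<open>By independence of eigenvectors \<open>e n\<close> lies outside the span of all
  eigenvectors with other eigenvalues, so some functional separates it from that span.\<close>

lemma coefficient_functional:
  "\<exists>p :: 'q \<Rightarrow> complex. clinear p \<and> p (e n) = 1 \<and> (\<forall>x l. gr x = l *\<^sub>C x \<and> l \<noteq> 2 * of_int n * \<i> \<longrightarrow> p x = 0)"
proof -
  let ?U = "cvec.span {x. \<exists>l. l \<in> - {2 * of_int n * \<i>} \<and> gr x = l *\<^sub>C x}"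
  have "e n \<notin> ?U"
    using eigen_independent[OF S.grading_linear, of "e n" "- {2 * of_int n * \<i>}" 0 \<i> "2 * of_int n * \<i>"] L.E_nonzero[of n]
      L.grading_E[of 0 \<i> n] by (auto simp: gr_weight)
  from linear_functional_exists[OF cvec.subspace_span this] obtain p :: "'q \<Rightarrow> complex"
    where p: "clinear p" "p (e n) = 1" "\<forall>y\<in>?U. p y = 0" by blast
  have "p x = 0" if "gr x = l *\<^sub>C x" "l \<noteq> 2 * of_int n * \<i>" for x l
    by (rule p(3)[rule_format], rule cvec.span_base) (use that in auto)
  then show ?thesis using p by blast
qed

lemma gr_nprod: "gr (nprod Q a n b) = nprod Q a n (gr b) + nprod Q (gr a) n b - of_int (n + 1) *\<^sub>C nprod Q a n b"
proof -
  have "nprod Q d 0 (nprod Q a n b) = nprod Q a n (nprod Q d 0 b) + nprod Q (nprod Q d 0 a) n b"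
    unfolding commutator[of d 0 a n b] by (simp add: gbinomial_0_left Sum_any_single[where a = 0])
  then show ?thesis
    using S.translator_1[OF translator_cd, of a n b]
    by (simp add: S.grading_def act_lin scaleC_add_right algebra_simps)
qed

end

context half_lattice_action begin

lemma ivec_act: "act (y *\<^sub>C c + (1 / 2) *\<^sub>C d) n x = y *\<^sub>C act c n x + (1 / 2) *\<^sub>C act d n x"
  by (simp add: M.act_add_left M.act_scale_left)

lemma ivec_ivec:
  "act (y *\<^sub>C c + (1 / 2) *\<^sub>C d) m (act (y *\<^sub>C c + (1 / 2) *\<^sub>C d) n x) =
   act (y *\<^sub>C c + (1 / 2) *\<^sub>C d) n (act (y *\<^sub>C c + (1 / 2) *\<^sub>C d) m x) + (if m + n = 0 then (2 * y * of_int m) *\<^sub>C x else 0)"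
proof -
  let ?i = "y *\<^sub>C c + (1 / 2) *\<^sub>C d"
  have e: "act ?i m (act ?i n x) = (y * y) *\<^sub>C act c m (act c n x) + (y / 2) *\<^sub>C act c m (act d n x)
      + ((y / 2) *\<^sub>C act d m (act c n x) + (1 / 4) *\<^sub>C act d m (act d n x))" for m n
    by (simp add: ivec_act M.act_add_right M.act_scale_right scaleC_add_right scaleC_scaleC)
  show ?thesis
  proof (cases "m + n = 0")
    case True
    then have n: "n = - m" by simp
    have 1: "act c m (act d n x) = act d n (act c m x) + (2 * of_int m) *\<^sub>C x"
      using cd[of m n x] True by simp
    have 2: "act c n (act d m x) = act d m (act c n x) + (2 * of_int n) *\<^sub>C x"
      using cd[of n m x] True by (simp add: add.commute)
    have "(y / 2) *\<^sub>C (2 * of_int m) *\<^sub>C x = (y / 2) *\<^sub>C (2 * of_int n) *\<^sub>C x + (2 * y * of_int m) *\<^sub>C x"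
      unfolding scaleC_scaleC scaleC_add_left[symmetric] by (rule arg_cong[of _ _ "\<lambda>s. s *\<^sub>C x"]) (simp add: n)
    then show ?thesis
      unfolding e[of m n] e[of n m] cc[of m n x] dd[of m n x] 1 2 using True by (simp only: scaleC_add_right if_True) simp
  next
    case False
    have 1: "act c m (act d n x) = act d n (act c m x)"
      using cd[of m n x] False by simp
    have 2: "act c n (act d m x) = act d m (act c n x)"
      using cd[of n m x] False by (simp add: add.commute)
    show ?thesis
      unfolding e[of m n] e[of n m] cc[of m n x] dd[of m n x] 1 2 using False by simp
  qed
qed

lemma ivec_e:
  "act (y *\<^sub>C c + (1 / 2) *\<^sub>C d) m (act (e l) n x) =
   act (e l) n (act (y *\<^sub>C c + (1 / 2) *\<^sub>C d) m x) + of_int l *\<^sub>C act (e l) (m + n) x"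
  by (simp add: ivec_act M.act_lin ce de scaleC_add_right scaleC_scaleC)

lemma grading_ivec:
  "grading y' z (act (y *\<^sub>C c + (1 / 2) *\<^sub>C d) n x) =
   act (y *\<^sub>C c + (1 / 2) *\<^sub>C d) n (grading y' z x) - of_int n *\<^sub>C act (y *\<^sub>C c + (1 / 2) *\<^sub>C d) n x"
  by (simp add: ivec_act clinear_add[OF grading_linear] clinear_scaleC[OF grading_linear] grading_c grading_d
      scaleC_add_right scaleC_scaleC cvec.scale_right_diff_distrib mult.commute)

end

section \<open>The vector i and the lattice factors in the image of G^-\<close>

locale bp_lattice = half_lattice_alg Q c d e
  for Q :: "'q::complex_vector va" and c d e +
  fixes k :: complex
begin

definition i :: 'q where "i = (- ((2 * k + 3) / 6)) *\<^sub>C c + (1 / 2) *\<^sub>C d"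

text \<open>The norm of \<open>i\<close>: the pairing of \<open>y c + (1/2) d\<close> with itself is
  \<open>2 y\<close>.\<close>

definition kap :: complex where "kap = - ((2 * k + 3) / 3)"

abbreviation ie :: 'q where "ie \<equiv> nprod Q i (- 1) (e (- 1))"

text \<open>The cubic term of the image of \<open>G\<^sup>-\<close>; \<open>ie\<close> is the factor of \<open>T\<close> in it.\<close>

definition pvec :: 'q where
  "pvec = nprod Q i (- 1) (nprod Q i (- 1) (nprod Q i (- 1) (e (- 1))))
    + (3 * (k + 2)) *\<^sub>C nprod Q i (- 1) (nprod Q i (- 2) (e (- 1)))
    + (2 * (k + 2)\<^sup>2) *\<^sub>C nprod Q i (- 3) (e (- 1))"

lemma i_i: "nprod Q i m (nprod Q i n x) = nprod Q i n (nprod Q i m x) + (if m + n = 0 then (kap * of_int m) *\<^sub>C x else 0)"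
  using S.ivec_ivec[of "- ((2 * k + 3) / 6)" m n x] by (simp add: i_def kap_def)

lemma i_e: "nprod Q i m (nprod Q (e l) n x) = nprod Q (e l) n (nprod Q i m x) + of_int l *\<^sub>C nprod Q (e l) (m + n) x"
  unfolding i_def by (rule S.ivec_e)

lemma i_e_pos: "0 \<le> j \<Longrightarrow> nprod Q i j (e l) = (if j = 0 then of_int l *\<^sub>C e l else 0)"
proof (cases "j = 0")
  case True
  then show ?thesis
    unfolding True i_def S.ivec_act L.c_0_E L.d_0_E by (simp add: scaleC_scaleC)
next
  case False
  moreover assume "0 \<le> j"
  ultimately show ?thesis
    unfolding i_def S.ivec_act using L.c_E[of j l] L.d_E[of j l] by simp
qed

lemma gr_i: "gr (nprod Q i n x) = nprod Q i n (gr x) - of_int n *\<^sub>C nprod Q i n x"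
  unfolding i_def by (rule S.grading_ivec)

lemma gr_e: "gr (e n) = (2 * of_int n * \<i>) *\<^sub>C e n"
  using L.grading_E[of 0 \<i> n] by (simp add: gr_weight)

lemma gr_i_eigen: "gr x = l *\<^sub>C x \<Longrightarrow> gr (nprod Q i n x) = (l - of_int n) *\<^sub>C nprod Q i n x"
  by (simp only: gr_i act_scale_right cvec.scale_left_diff_distrib)

lemma gr_ie: "gr ie = (- 2 * \<i> + 1) *\<^sub>C ie"
  using gr_i_eigen[OF gr_e, of "- 1" "- 1"] by simp

lemma gr_pvec: "gr pvec = (- 2 * \<i> + 3) *\<^sub>C pvec"
proof -
  have 1: "gr (nprod Q i (- 1) ie) = (- 2 * \<i> + 2) *\<^sub>C nprod Q i (- 1) ie"
    using gr_i_eigen[OF gr_ie, of "- 1"] by simp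
  have 2: "gr (nprod Q i (- 1) (nprod Q i (- 1) ie)) = (- 2 * \<i> + 3) *\<^sub>C nprod Q i (- 1) (nprod Q i (- 1) ie)"
    using gr_i_eigen[OF 1, of "- 1"] by simp
  have 3: "gr (nprod Q i (- 2) (e (- 1))) = (- 2 * \<i> + 2) *\<^sub>C nprod Q i (- 2) (e (- 1))"
    using gr_i_eigen[OF gr_e, of "- 2" "- 1"] by simp
  have 4: "gr (nprod Q i (- 1) (nprod Q i (- 2) (e (- 1)))) = (- 2 * \<i> + 3) *\<^sub>C nprod Q i (- 1) (nprod Q i (- 2) (e (- 1)))"
    using gr_i_eigen[OF 3, of "- 1"] by simp
  have 5: "gr (nprod Q i (- 3) (e (- 1))) = (- 2 * \<i> + 3) *\<^sub>C nprod Q i (- 3) (e (- 1))"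
    using gr_i_eigen[OF gr_e, of "- 3" "- 1"] by simp
  show ?thesis
    unfolding pvec_def clinear_add[OF S.grading_linear] clinear_scaleC[OF S.grading_linear] 2 4 5
      scaleC_add_right scaleC_scaleC by (simp only: mult.commute)
qed

definition coeff :: "'q \<Rightarrow> complex" where
  "coeff = (SOME p. clinear p \<and> p (e (- 2)) = 1 \<and> (\<forall>x l. gr x = l *\<^sub>C x \<and> l \<noteq> 2 * of_int (- 2) * \<i> \<longrightarrow> p x = 0))"

lemma coeff_linear: "clinear coeff" and coeff_e: "coeff (e (- 2)) = 1"
  and coeff_gr: "gr x = l *\<^sub>C x \<Longrightarrow> l \<noteq> - 4 * \<i> \<Longrightarrow> coeff x = 0"
proof -
  have "clinear coeff \<and> coeff (e (- 2)) = 1 \<and> (\<forall>x l. gr x = l *\<^sub>C x \<and> l \<noteq> 2 * of_int (- 2) * \<i> \<longrightarrow> coeff x = 0)"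
    unfolding coeff_def by (rule someI_ex[OF coefficient_functional[of "- 2"]])
  then show "clinear coeff" "coeff (e (- 2)) = 1" "gr x = l *\<^sub>C x \<Longrightarrow> l \<noteq> - 4 * \<i> \<Longrightarrow> coeff x = 0" by auto
qed

lemmas coeff_simps = clinear_add[OF coeff_linear] clinear_scaleC[OF coeff_linear] clinear_diff[OF coeff_linear]
  clinear_neg[OF coeff_linear] clinear_0[OF coeff_linear]

text \<open>The real part of the eigenvalue is the level. It is zero at \<open>e (- 2)\<close>, and
  a negative mode of \<open>i\<close> maps everything to positive level.\<close>

lemma coeff_i: "n < 0 \<Longrightarrow> coeff (nprod Q i n x) = 0"
proof -
  assume n: "n < 0"
  have "x \<in> cvec.span {x. \<exists>n (l::nat). gr x = (L.weight 0 \<i> n + of_nat l) *\<^sub>C x}"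
    unfolding L.grading_span by simp
  then show ?thesis
  proof (induction rule: cvec.span_induct_alt)
    case base
    show ?case by (simp add: coeff_simps)
  next
    case (step s z w)
    then obtain n' l where z: "gr z = (2 * of_int n' * \<i> + of_nat l) *\<^sub>C z" by (auto simp: gr_weight)
    have "gr (nprod Q i n z) = (2 * of_int n' * \<i> + of_nat l - of_int n) *\<^sub>C nprod Q i n z"
      unfolding gr_i z act_scale_right cvec.scale_left_diff_distrib ..
    moreover have "2 * of_int n' * \<i> + of_nat l - of_int n \<noteq> - 4 * \<i>"
    proof
      assume "2 * of_int n' * \<i> + of_nat l - of_int n = - 4 * \<i>"
      from arg_cong[OF this, of Re] have "real l = of_int n" by simp
      then show False using n by linarith
    qed
    ultimately have "coeff (nprod Q i n z) = 0" by (rule coeff_gr)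
    then show ?case using step by (simp add: act_add_right act_scale_right coeff_simps)
  qed
qed

lemma coeff_grading:
  assumes "gr q = l *\<^sub>C q" "gr q' = l' *\<^sub>C q'" "l + l' - of_int (n + 1) \<noteq> - 4 * \<i>"
  shows "coeff (nprod Q q n q') = 0"
proof (rule coeff_gr[OF _ assms(3)])
  show "gr (nprod Q q n q') = (l + l' - of_int (n + 1)) *\<^sub>C nprod Q q n q'"
    using assms(1,2) gr_nprod[of q n q']
    by (simp add: act_scale_left act_scale_right scaleC_add_left cvec.scale_left_diff_distrib)
qed

text \<open>Once \<open>i\<close> is moved to the left, where \<open>coeff\<close> kills it, only
  its contraction with e^{-c} is left.\<close>

lemma coeff_e_i: "0 < n \<Longrightarrow> coeff (nprod Q (e (- 1)) j (nprod Q i (- n) x)) = coeff (nprod Q (e (- 1)) (j - n) x)"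
proof -
  assume "0 < n"
  have "nprod Q (e (- 1)) j (nprod Q i (- n) x) = nprod Q i (- n) (nprod Q (e (- 1)) j x) + nprod Q (e (- 1)) (j - n) x"
    by (simp add: i_e)
  then show ?thesis using coeff_i[of "- n"] \<open>0 < n\<close> by (simp add: coeff_simps)
qed

text \<open>In the iterate formula for a negative mode of \<open>i\<close> on \<open>w\<close>, the
  terms with \<open>i\<close> leftmost are killed by \<open>coeff\<close>. The remaining ones have
  nonnegative modes of \<open>i\<close> acting on \<open>x\<close>.\<close>

lemma coeff_i_left:
  assumes n: "0 < n" and B: "\<And>r. B \<le> r \<Longrightarrow> nprod Q i (int r) x = 0"
  shows "coeff (nprod Q (nprod Q i (- n) w) q x) =
    (\<Sum>r<B. - ((- 1) powi n * (- 1) ^ r * (of_int (- n) gchoose r)) * coeff (nprod Q w (q - n - int r) (nprod Q i (int r) x)))"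
proof -
  have f1: "finite {j::nat. ((- 1) ^ j * (of_int (- n) gchoose j)) *\<^sub>C nprod Q i (0 + - n - int j) (nprod Q w (q + int j) x) \<noteq> 0}"
    by (rule finite_nat_bound[of "nat (ord w x - q)"]) (simp add: act_ord)
  have f2: "finite {j::nat. ((- 1) ^ j * (of_int (- n) gchoose j)) *\<^sub>C nprod Q w (q + - n - int j) (nprod Q i (0 + int j) x) \<noteq> 0}"
    by (rule finite_nat_bound[of B]) (simp add: B)
  have "coeff (jac_a (\<lambda>i' j. nprod Q i i' (nprod Q w j x)) 0 (- n) q) = 0"
    unfolding jac_a_def clinear_Sum_any[OF coeff_linear f1] using n by (simp add: coeff_simps coeff_i)
  moreover have "coeff (jac_a (\<lambda>i' j. nprod Q w i' (nprod Q i j x)) q (- n) 0) =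
      (\<Sum>r<B. ((- 1) ^ r * (of_int (- n) gchoose r)) * coeff (nprod Q w (q - n - int r) (nprod Q i (int r) x)))"
    unfolding jac_a_def clinear_Sum_any[OF coeff_linear f2]
    by (subst Sum_any_nat_bound[of B]) (simp_all add: B coeff_simps scaleC_complex_def)
  moreover have "(- 1 :: complex) powi (- n) = (- 1) powi n"
    by (cases "even n") (auto simp: power_int_minus_one_minus)
  ultimately show ?thesis
    by (simp add: iterate coeff_simps scaleC_complex_def sum_distrib_left sum_negf mult_ac)
qed

lemma i_ie: "nprod Q i 0 ie = - ie" "nprod Q i 1 ie = kap *\<^sub>C e (- 1)" "2 \<le> r \<Longrightarrow> nprod Q i r ie = 0"
  by (simp_all add: i_i[of _ "- 1"] i_e_pos act_neg_right)

lemma coeff_i_left_e: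
  "coeff (nprod Q (nprod Q i (- 1) w) q (e (- 1))) = - coeff (nprod Q w (q - 1) (e (- 1)))"
  "coeff (nprod Q (nprod Q i (- 2) w) q (e (- 1))) = coeff (nprod Q w (q - 2) (e (- 1)))"
  "coeff (nprod Q (nprod Q i (- 3) w) q (e (- 1))) = - coeff (nprod Q w (q - 3) (e (- 1)))"
  using coeff_i_left[of 1 1 "e (- 1)" w q] coeff_i_left[of 2 1 "e (- 1)" w q] coeff_i_left[of 3 1 "e (- 1)" w q]
  by (simp_all add: i_e_pos act_neg_right coeff_simps)

lemma coeff_i_left_ie:
  "coeff (nprod Q (nprod Q i (- 1) w) q ie) =
    - coeff (nprod Q w (q - 1) ie) + kap * coeff (nprod Q w (q - 2) (e (- 1)))"
  "coeff (nprod Q (nprod Q i (- 2) w) q ie) =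
    coeff (nprod Q w (q - 2) ie) - 2 * kap * coeff (nprod Q w (q - 3) (e (- 1)))"
  "coeff (nprod Q (nprod Q i (- 3) w) q ie) =
    - coeff (nprod Q w (q - 3) ie) + 3 * kap * coeff (nprod Q w (q - 4) (e (- 1)))"
  using coeff_i_left[of 1 2 ie w q] coeff_i_left[of 2 2 ie w q] coeff_i_left[of 3 2 ie w q]
  by (simp_all add: i_ie lessThan_Suc numeral_2_eq_2 act_neg_right act_scale_right coeff_simps scaleC_complex_def power3_eq_cube)

text \<open>The sum of the coefficients 1, 3(k+2) and 2(k+2)^2 of \<open>pvec\<close>: each of its
  monomials in \<open>i\<close> contracts with e^{-c} to 1.\<close>

definition fp :: complex where "fp = (k + 3) * (2 * k + 5)"

lemma coeff_e_e: "coeff (nprod Q (e (- 1)) (- 1) (e (- 1))) = 1"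
  using L.e_E[of "- 1" "- 1"] by (simp add: coeff_e)

lemma coeff_table:
  "coeff (nprod Q (e (- 1)) 0 ie) = 1" "coeff (nprod Q ie 0 (e (- 1))) = - 1"
  "coeff (nprod Q ie 1 ie) = kap - 1"
  "coeff (nprod Q (e (- 1)) 2 pvec) = fp" "coeff (nprod Q pvec 2 (e (- 1))) = - fp"
  "coeff (nprod Q ie 3 pvec) = (3 * kap - 1) * fp" "coeff (nprod Q pvec 3 ie) = (3 * kap - 1) * fp"
proof -
  show 1: "coeff (nprod Q (e (- 1)) 0 ie) = 1" using coeff_e_i[of 1] by (simp add: coeff_e_e)
  show "coeff (nprod Q ie 0 (e (- 1))) = - 1" using coeff_i_left_e by (simp add: coeff_e_e)
  show "coeff (nprod Q ie 1 ie) = kap - 1" using coeff_i_left_ie by (simp add: coeff_e_e 1)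
  have fp: "fp = 1 + 3 * (k + 2) + 2 * (k + 2)\<^sup>2" by (simp add: fp_def power2_eq_square algebra_simps)
  note ei = coeff_e_i[of 1, simplified] coeff_e_i[of 2, simplified] coeff_e_i[of 3, simplified]
  show "coeff (nprod Q (e (- 1)) 2 pvec) = fp"
    by (simp add: fp pvec_def act_add_right act_scale_right coeff_simps scaleC_complex_def ei coeff_e_e)
  show "coeff (nprod Q pvec 2 (e (- 1))) = - fp"
    by (simp add: fp pvec_def act_add_left act_scale_left coeff_simps scaleC_complex_def coeff_i_left_e coeff_e_e)
  show "coeff (nprod Q pvec 3 ie) = (3 * kap - 1) * fp"
    by (simp add: fp pvec_def act_add_left act_scale_left coeff_simps scaleC_complex_def coeff_i_left_e coeff_i_left_ie
       coeff_e_e 1 algebra_simps power2_eq_square)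
  have i0: "nprod Q i 0 (nprod Q i (- n) x) = nprod Q i (- n) (nprod Q i 0 x)" if "0 < n" for n x
    using that by (simp add: i_i[of 0])
  have B: "nprod Q i j pvec = 0" if "4 \<le> j" for j
    using that by (simp add: pvec_def act_add_right act_scale_right i_i[of j] i_e_pos)
  have "coeff (nprod Q ie 3 pvec) = (\<Sum>r<4. - (- 1 * (- 1) ^ r * ((- 1) gchoose r)) * coeff (nprod Q (e (- 1)) (2 - int r) (nprod Q i (int r) pvec)))"
    using coeff_i_left[of 1 4 pvec "e (- 1)" 3] B by simp
  also have "\<dots> = (\<Sum>r<4. coeff (nprod Q (e (- 1)) (2 - int r) (nprod Q i (int r) pvec)))"
    by (intro sum.cong) (simp_all add: gbinomial_minus_one flip: power_mult_distrib)
  also have "\<dots> = (3 * kap - 1) * fp"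
    by (simp add: numeral_eq_Suc lessThan_Suc)
       (simp add: fp pvec_def act_add_right act_scale_right act_neg_right act_diff_right i_i[of 0] i_i[of 1] i_i[of 2] i_i[of 3] i_e_pos
        coeff_simps scaleC_complex_def ei coeff_e_e algebra_simps power2_eq_square)
  finally show "coeff (nprod Q ie 3 pvec) = (3 * kap - 1) * fp" .
qed

end

text \<open>Linear functionals reduce identities between linear combinations of vectors to identities of complex
  numbers.\<close>

definition ev :: "('m::complex_vector \<Rightarrow> complex) \<Rightarrow> 'm \<Rightarrow> complex" where
  "ev p x = (if clinear p then p x else 0)"

lemma ev_add: "ev p (x + y) = ev p x + ev p y"
  and ev_diff: "ev p (x - y) = ev p x - ev p y"
  and ev_neg: "ev p (- x) = - ev p x"
  and ev_scale: "ev p (s *\<^sub>C x) = s * ev p x"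
  and ev_0: "ev p 0 = 0"
  by (auto simp: ev_def clinear_add clinear_diff clinear_neg clinear_scaleC clinear_0 scaleC_complex_def)

lemmas ev_simps = ev_add ev_diff ev_neg ev_scale ev_0

lemma ev_eqI:
  assumes "\<And>p. ev p x = ev p y"
  shows "x = y"
proof (rule ccontr)
  assume "x \<noteq> y"
  then have "x - y \<notin> {0}" by simp
  from linear_functional_exists[OF cvec.subspace_single_0 this]
  obtain p :: "'a \<Rightarrow> complex" where "clinear p" "p (x - y) = 1" by blast
  then have "ev p x - ev p y = 1" by (simp add: ev_diff[symmetric]) (simp add: ev_def)
  then show False using assms[of p] by simp
qed

lemma half_of_self_neg: "x = - x + y \<Longrightarrow> x = (1 / 2) *\<^sub>C y"
  for x y :: "'a::complex_vector"
proof -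
  assume "x = - x + y"
  then have "x + x = y" by (metis add_minus_cancel)
  then have "(1 / 2) *\<^sub>C y = (1 / 2) *\<^sub>C x + (1 / 2) *\<^sub>C x" by (simp add: scaleC_add_right flip: \<open>x + x = y\<close>)
  also have "\<dots> = x" by (simp add: scaleC_add_left[symmetric])
  finally show ?thesis ..
qed

section \<open>The Zamolodchikov algebra\<close>

locale zam_alg = vertex_alg Z
  for Z :: "'z::complex_vector va" +
  fixes T W :: 'z and cc :: complex
  assumes gen: "va_generated Z {T, W}" and vir: "virasoro Z cc T" and prim: "primary Z T 3 W"
begin

lemma T_T: "nprod Z T 0 T = der Z T" "nprod Z T 1 T = 2 *\<^sub>C T" "nprod Z T 2 T = 0"
    "nprod Z T 3 T = (cc / 2) *\<^sub>C vacuum Z" "4 \<le> n \<Longrightarrow> nprod Z T n T = 0"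
  and T_W: "nprod Z T 0 W = der Z W" "nprod Z T 1 W = 3 *\<^sub>C W" "2 \<le> n \<Longrightarrow> nprod Z T n W = 0"
proof -
  have t: "nprod Z T (int j) T = (if j < 4 then [der Z T, 2 *\<^sub>C T, 0, (cc / 2) *\<^sub>C vacuum Z] ! j else 0)" for j
    using vir by (simp add: virasoro_def ope_def)
  have w: "nprod Z T (int j) W = (if j < 2 then [der Z W, 3 *\<^sub>C W] ! j else 0)" for j
    using prim by (simp add: primary_def ope_def)
  show "nprod Z T 0 T = der Z T" "nprod Z T 1 T = 2 *\<^sub>C T" "nprod Z T 2 T = 0"
    "nprod Z T 3 T = (cc / 2) *\<^sub>C vacuum Z"
    using t[of 0] t[of 1] t[of 2] t[of 3] by simp_all
  show "nprod Z T n T = 0" if "4 \<le> n"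
  proof -
    have "\<not> nat n < 4" using that by linarith
    then show ?thesis using t[of "nat n"] that by simp
  qed
  show "nprod Z T 0 W = der Z W" "nprod Z T 1 W = 3 *\<^sub>C W" using w[of 0] w[of 1] by simp_all
  show "nprod Z T n W = 0" if "2 \<le> n"
  proof -
    have "\<not> nat n < 2" using that by linarith
    then show ?thesis using w[of "nat n"] that by simp
  qed
qed

lemma translator_T: "translator T"
  by (rule translatorI[OF gen]) (auto simp: T_T T_W)

lemma skew_bound:
  assumes "\<And>j. B \<le> j \<Longrightarrow> nprod Z b (n + int j) a = 0"
  shows "nprod Z a n b = (\<Sum>j<B. (- ((- 1) powi n) * (- 1) ^ j) *\<^sub>C
     nprod Z (nprod Z b (n + int j) a) (- 1 - int j) (vacuum Z))"
  by (subst skew_symmetry, rule Sum_any_nat_bound) (simp add: assms)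

lemma W_T: "nprod Z W 0 T = 2 *\<^sub>C der Z W" "nprod Z W 1 T = 3 *\<^sub>C W" "2 \<le> n \<Longrightarrow> nprod Z W n T = 0"
proof -
  show "nprod Z W 0 T = 2 *\<^sub>C der Z W"
  proof -
    show ?thesis
      by (subst skew_bound[of 2]) (auto simp: numeral_2_eq_2 T_W creation act_scale_left ev_simps intro: ev_eqI)
  qed
  show "nprod Z W 1 T = 3 *\<^sub>C W"
    by (subst skew_bound[of 1]) (auto simp: T_W creation)
  show "2 \<le> n \<Longrightarrow> nprod Z W n T = 0"
    by (subst skew_bound[of 0]) (auto simp: T_W)
qed

lemma vac_minus3: "nprod Z x (- 3) (vacuum Z) = (1 / 2) *\<^sub>C der Z (der Z x)"
  using act_der[of x "- 2" "vacuum Z"] by (simp add: scaleC_scaleC)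

lemma vac_minus4: "nprod Z x (- 4) (vacuum Z) = (1 / 6) *\<^sub>C der Z (der Z (der Z x))"
  using act_der[of x "- 3" "vacuum Z"] act_der[of "der Z x" "- 2" "vacuum Z"]
  by (simp add: scaleC_scaleC)

end

section \<open>The coefficient of e^{-2c} in the products of G^- with itself\<close>

locale w3_bp = zam_alg Z T W cc + lat: bp_lattice Q c d e k
  for Z :: "'z::complex_vector va" and T W cc and Q :: "'q::complex_vector va" and c d e k +
  assumes k3: "k + 3 \<noteq> 0"
begin

sublocale ZQ: tensor_alg Z Q ..

abbreviation prodZQ :: "('z, 'q) tensor \<Rightarrow> int \<Rightarrow> ('z, 'q) tensor \<Rightarrow> ('z, 'q) tensor" where
  "prodZQ \<equiv> tensor_act (nprod Z) (nprod Q)"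

definition rho :: complex where "rho = (k + 2) * (k + 3) / 2"

definition W' :: 'z where "W' = W + rho *\<^sub>C der Z T"

definition G :: "('z, 'q) tensor" where
  "G = W' \<otimes> e (- 1) + (k + 3) *\<^sub>C (T \<otimes> lat.ie) - vacuum Z \<otimes> lat.pvec"

text \<open>Extracts the coefficient of e^{-2c}; the products of the image of G^- with itself have
  exponent -2.\<close>

definition proj :: "('z, 'q) tensor \<Rightarrow> 'z" where
  "proj = tensor_lift (\<lambda>z q. lat.coeff q *\<^sub>C z)"

lemma proj_bilinear: "cbilinear (\<lambda>z q. lat.coeff q *\<^sub>C z)"
  unfolding cbilinear_def
  by (auto intro!: clinearI simp: lat.coeff_simps scaleC_add_left scaleC_add_right scaleC_scaleC scaleC_complex_def mult.commute)

lemma proj_linear: "clinear proj" and proj_pure: "proj (z \<otimes> q) = lat.coeff q *\<^sub>C z"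
  unfolding proj_def by (rule clinear_tensor_lift[OF proj_bilinear], rule tensor_lift_tensor_of[OF proj_bilinear])

text \<open>For vectors of levels \<open>a\<close> and \<open>b\<close> only the mode a + b - 1
  lands in level zero, so the sum over modes in the tensor product has a single term.\<close>

lemma proj_pair:
  assumes "lat.gr q = (- 2 * \<i> + of_int a) *\<^sub>C q" "lat.gr q' = (- 2 * \<i> + of_int b) *\<^sub>C q'"
  shows "proj (prodZQ (z \<otimes> q) n (z' \<otimes> q')) = lat.coeff (nprod Q q (a + b - 1) q') *\<^sub>C nprod Z z (n - a - b) z'"
proof -
  have z: "lat.coeff (nprod Q q j q') = 0" if "j \<noteq> a + b - 1" for j
  proof (rule lat.coeff_grading[OF assms])
    show "- 2 * \<i> + of_int a + (- 2 * \<i> + of_int b) - of_int (j + 1) \<noteq> - 4 * \<i>"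
    proof
      assume "- 2 * \<i> + of_int a + (- 2 * \<i> + of_int b) - of_int (j + 1) = - 4 * \<i>"
      from arg_cong[OF this, of Re] have "real_of_int (a + b - 1) = real_of_int j" by simp
      then show False using that by linarith
    qed
  qed
  have "proj (prodZQ (z \<otimes> q) n (z' \<otimes> q')) = Sum_any (\<lambda>i. lat.coeff (nprod Q q (n - 1 - i) q') *\<^sub>C nprod Z z i z')"
    unfolding ZQ.self.act_pure clinear_Sum_any[OF proj_linear ZQ.self.mode_sum_finite] proj_pure ..
  also have "\<dots> = lat.coeff (nprod Q q (n - 1 - (n - a - b)) q') *\<^sub>C nprod Z z (n - a - b) z'"
    by (rule Sum_any_single) (simp add: z)
  also have "n - 1 - (n - a - b) = a + b - 1" by simp
  finally show ?thesis .
qed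

lemma G_G_proj:
  "proj (prodZQ G n G) = nprod Z W' n W' + (k + 3) *\<^sub>C (nprod Z W' (n - 1) T - nprod Z T (n - 1) W')
     + ((k + 3)\<^sup>2 * (lat.kap - 1)) *\<^sub>C nprod Z T (n - 2) T
     - lat.fp *\<^sub>C (nprod Z W' (n - 3) (vacuum Z) - nprod Z (vacuum Z) (n - 3) W')
     - ((k + 3) * (3 * lat.kap - 1) * lat.fp) *\<^sub>C (nprod Z T (n - 4) (vacuum Z) + nprod Z (vacuum Z) (n - 4) T)
     + lat.coeff (nprod Q lat.pvec 5 lat.pvec) *\<^sub>C nprod Z (vacuum Z) (n - 6) (vacuum Z)"
proof -
  have g: "lat.gr (e (- 1)) = (- 2 * \<i> + of_int 0) *\<^sub>C e (- 1)" "lat.gr lat.ie = (- 2 * \<i> + of_int 1) *\<^sub>C lat.ie"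
    "lat.gr lat.pvec = (- 2 * \<i> + of_int 3) *\<^sub>C lat.pvec"
    using lat.gr_e[of "- 1"] lat.gr_ie lat.gr_pvec by simp_all
  note pp = g(1)[THEN proj_pair, OF g(1)] g(1)[THEN proj_pair, OF g(2)] g(1)[THEN proj_pair, OF g(3)]
    g(2)[THEN proj_pair, OF g(1)] g(2)[THEN proj_pair, OF g(2)] g(2)[THEN proj_pair, OF g(3)]
    g(3)[THEN proj_pair, OF g(1)] g(3)[THEN proj_pair, OF g(2)] g(3)[THEN proj_pair, OF g(3)]
  note lin = clinear_add[OF ZQ.self.act_linear_left] clinear_diff[OF ZQ.self.act_linear_left]
    clinear_scaleC[OF ZQ.self.act_linear_left] clinear_add[OF ZQ.self.act_linear_right]
    clinear_diff[OF ZQ.self.act_linear_right] clinear_scaleC[OF ZQ.self.act_linear_right]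
    clinear_add[OF proj_linear] clinear_diff[OF proj_linear] clinear_scaleC[OF proj_linear]
  show ?thesis
    unfolding G_def lin pp
    by (rule ev_eqI) (simp add: ev_simps lat.coeff_table lat.coeff_e_e power2_eq_square algebra_simps)
qed

text \<open>\<open>2 lam\<close> is the coefficient of T in the fourth-order pole of W with itself;
  \<open>bet\<close> and \<open>x1\<close> are the coefficients of :TT: and of the second derivative
  of T in the second-order pole.\<close>

definition lam :: complex where "lam = - ((k + 3)\<^sup>2 * (3 * k + 4) * (5 * k + 12) / 6)"

definition bet :: complex where "bet = 2 / 3 * (k + 3) ^ 3"

definition x1 :: complex where "x1 = 3 / 10 * (lam - bet)"

end

text \<open>The hypothesis is the image of \<open>G\<^sup>-G\<^sup>- \<sim> 0\<close>. Its coefficient of \<open>e\<^bsup>-2c\<^esup>\<close> expresses the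
  operator product of \<open>W\<close> with itself through known ones.\<close>

locale w3_ope = w3_bp Z T W cc Q c d e k
  for Z :: "'z::complex_vector va" and T W cc and Q :: "'q::complex_vector va" and c d e k +
  assumes G_G: "0 \<le> n \<Longrightarrow> tensor_act (nprod Z) (nprod Q) G n G = 0"
begin

lemma W'_W': "0 \<le> n \<Longrightarrow> nprod Z W' n W' = - ((k + 3) *\<^sub>C (nprod Z W' (n - 1) T - nprod Z T (n - 1) W'))
     + bet *\<^sub>C nprod Z T (n - 2) T
     + lat.fp *\<^sub>C (nprod Z W' (n - 3) (vacuum Z) - nprod Z (vacuum Z) (n - 3) W')
     + ((k + 3) * (3 * lat.kap - 1) * lat.fp) *\<^sub>C (nprod Z T (n - 4) (vacuum Z) + nprod Z (vacuum Z) (n - 4) T)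
     - lat.coeff (nprod Q lat.pvec 5 lat.pvec) *\<^sub>C nprod Z (vacuum Z) (n - 6) (vacuum Z)"
proof -
  assume n: "0 \<le> n"
  have "(k + 3)\<^sup>2 * (lat.kap - 1) = - bet"
    unfolding bet_def lat.kap_def by algebra
  note 1 = this
  have 2: "proj (prodZQ G n G) = 0" by (simp add: G_G[OF n] clinear_0[OF proj_linear])
  show ?thesis
  proof (rule ev_eqI)
    fix p
    show "ev p (nprod Z W' n W') = ev p (- ((k + 3) *\<^sub>C (nprod Z W' (n - 1) T - nprod Z T (n - 1) W'))
     + bet *\<^sub>C nprod Z T (n - 2) T
     + lat.fp *\<^sub>C (nprod Z W' (n - 3) (vacuum Z) - nprod Z (vacuum Z) (n - 3) W')
     + ((k + 3) * (3 * lat.kap - 1) * lat.fp) *\<^sub>C (nprod Z T (n - 4) (vacuum Z) + nprod Z (vacuum Z) (n - 4) T)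
     - lat.coeff (nprod Q lat.pvec 5 lat.pvec) *\<^sub>C nprod Z (vacuum Z) (n - 6) (vacuum Z))"
      using arg_cong[OF 2[unfolded G_G_proj 1], of "ev p"] by (simp add: ev_simps algebra_simps)
  qed
qed

lemma W_W_expand: "nprod Z W n W = nprod Z W' n W' - rho *\<^sub>C (nprod Z W n (der Z T) + nprod Z (der Z T) n W)
    - (rho * rho) *\<^sub>C nprod Z (der Z T) n (der Z T)"
  by (simp add: W'_def act_lin scaleC_add_right scaleC_scaleC)

lemma W_W: "0 \<le> n \<Longrightarrow> nprod Z W n W = - ((k + 3) *\<^sub>C (nprod Z W (n - 1) T + rho *\<^sub>C nprod Z (der Z T) (n - 1) T
       - nprod Z T (n - 1) W - rho *\<^sub>C nprod Z T (n - 1) (der Z T)))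
     + bet *\<^sub>C nprod Z T (n - 2) T
     + lat.fp *\<^sub>C (nprod Z W (n - 3) (vacuum Z) + rho *\<^sub>C nprod Z (der Z T) (n - 3) (vacuum Z)
       - nprod Z (vacuum Z) (n - 3) W - rho *\<^sub>C nprod Z (vacuum Z) (n - 3) (der Z T))
     + ((k + 3) * (3 * lat.kap - 1) * lat.fp) *\<^sub>C (nprod Z T (n - 4) (vacuum Z) + nprod Z (vacuum Z) (n - 4) T)
     - lat.coeff (nprod Q lat.pvec 5 lat.pvec) *\<^sub>C nprod Z (vacuum Z) (n - 6) (vacuum Z)
     - rho *\<^sub>C (nprod Z W n (der Z T) + nprod Z (der Z T) n W)
     - (rho * rho) *\<^sub>C nprod Z (der Z T) n (der Z T)"
  unfolding W_W_expand W'_W' unfolding W'_def act_add_left act_add_right act_scale_left act_scale_right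
  by (simp only: diff_diff_eq add.commute add.left_commute)

lemma W_W_3: "nprod Z W 3 W = (2 * lam) *\<^sub>C T"
proof -
  have "12 * rho * rho + 8 * (k + 3) * rho + 2 * bet + 2 * (k + 3) * (3 * lat.kap - 1) * lat.fp = 2 * lam"
    unfolding rho_def bet_def lat.fp_def lat.kap_def lam_def by algebra
  note e = this[symmetric]
  show ?thesis
    unfolding e
    by (rule ev_eqI) (simp add: W_W act_lin act_der nprod_der T_T T_W W_T creation creation_0 act_vacuum
      der_scale der_0 ev_simps algebra_simps)
qed

lemma W_W_1: "nprod Z W 1 W = x1 *\<^sub>C der Z (der Z T) + bet *\<^sub>C nprod Z T (- 1) T"
proof (rule ev_eqI)
  fix p
  show "ev p (nprod Z W 1 W) = ev p (x1 *\<^sub>C der Z (der Z T) + bet *\<^sub>C nprod Z T (- 1) T)"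
    apply (simp add: W_W act_lin act_der nprod_der T_T T_W W_T creation creation_0 act_vacuum
        der_add der_scale der_0 ev_simps)
    unfolding rho_def lat.fp_def lat.kap_def lam_def bet_def x1_def
    apply (simp add: algebra_simps add_divide_distrib diff_divide_distrib power2_eq_square power3_eq_cube)
    done
qed

text \<open>The shape of the central term suffices: modes of the vacuum do not lengthen words, and
  the binomial coefficient of 3 over 5 removes the term from \<open>W3_W\<close>.\<close>

lemma W_W_5: "\<exists>s. nprod Z W 5 W = s *\<^sub>C vacuum Z"
proof -
  have "nprod Z W 5 W \<in> cvec.span {vacuum Z}"
    by (simp add: W_W act_lin act_der nprod_der T_T T_W W_T creation creation_0 act_vacuum
      der_scale der_0 cvec.span_neg cvec.span_add cvec.span_diff cvec.span_scale cvec.span_base cvec.span_zero)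
  then show ?thesis by (auto simp: cvec.span_singleton)
qed

lemma W_W_6: "6 \<le> n \<Longrightarrow> nprod Z W n W = 0"
  by (simp add: W_W act_lin act_der nprod_der T_T T_W W_T creation creation_0 act_vacuum
      der_scale der_0)

text \<open>For even \<open>n\<close> skew symmetry expresses the product of W with itself as minus
  itself plus derivatives of higher products. So the products of index 4, 2 and 0 follow from those
  of odd index; here the only higher one is a multiple of the vacuum, whose derivative is
  zero.\<close>

lemma W_W_4: "nprod Z W 4 W = 0"
proof -
  obtain s where s: "nprod Z W 5 W = s *\<^sub>C vacuum Z" using W_W_5 by blast
  have "nprod Z W 4 W = - nprod Z W 4 W"
    by (subst skew_bound[of 2]) (auto simp: W_W_6 s lessThan_nat_numeral lessThan_Suc creation act_scale_left act_vacuum minus_one_power_iff)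
  then have "nprod Z W 4 W + nprod Z W 4 W = 0" by (metis add.right_inverse)
  then have "(2 :: complex) *\<^sub>C nprod Z W 4 W = 0" by (metis one_add_one scaleC_add_left scaleC_one)
  then show ?thesis by simp
qed

lemma W_W_2: "nprod Z W 2 W = lam *\<^sub>C der Z T"
proof -
  obtain s where s: "nprod Z W 5 W = s *\<^sub>C vacuum Z" using W_W_5 by blast
  have "nprod Z W 2 W = (\<Sum>j<4. (- ((- 1) powi 2) * (- 1) ^ j) *\<^sub>C
     nprod Z (nprod Z W (2 + int j) W) (- 1 - int j) (vacuum Z))"
    by (rule skew_bound) (simp add: W_W_6)
  also have "\<dots> = - nprod Z W 2 W + (2 * lam) *\<^sub>C der Z T"
    apply (simp add: lessThan_nat_numeral lessThan_Suc)
    apply (simp only: W_W_4 W_W_3 s)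
    apply (simp add: act_scale_left act_vacuum)
    apply (simp only: creation)
    done
  finally have "nprod Z W 2 W = - nprod Z W 2 W + (2 * lam) *\<^sub>C der Z T" .
  then have "nprod Z W 2 W = (1 / 2) *\<^sub>C (2 * lam) *\<^sub>C der Z T" by (rule half_of_self_neg)
  then show ?thesis by (simp add: scaleC_scaleC)
qed

lemma W_W_0: "nprod Z W 0 W = (x1 / 2 - lam / 12) *\<^sub>C der Z (der Z (der Z T)) + (bet / 2) *\<^sub>C der Z (nprod Z T (- 1) T)"
proof -
  obtain s where s: "nprod Z W 5 W = s *\<^sub>C vacuum Z" using W_W_5 by blast
  have "nprod Z W 0 W = (\<Sum>j<6. (- ((- 1) powi 0) * (- 1) ^ j) *\<^sub>C
     nprod Z (nprod Z W (0 + int j) W) (- 1 - int j) (vacuum Z))"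
    by (rule skew_bound) (simp add: W_W_6)
  also have "\<dots> = - nprod Z W 0 W + der Z (nprod Z W 1 W) - nprod Z (nprod Z W 2 W) (- 3) (vacuum Z)
      + nprod Z (nprod Z W 3 W) (- 4) (vacuum Z)"
    apply (simp add: lessThan_nat_numeral lessThan_Suc)
    apply (simp only: W_W_4 s)
    apply (simp add: act_scale_left act_vacuum)
    apply (simp only: creation)
    done
  finally have "nprod Z W 0 W = - nprod Z W 0 W + der Z (nprod Z W 1 W) - (1 / 2) *\<^sub>C der Z (der Z (nprod Z W 2 W))
      + (1 / 6) *\<^sub>C der Z (der Z (der Z (nprod Z W 3 W)))"
    by (simp only: vac_minus3 vac_minus4)
  then have "nprod Z W 0 W = - nprod Z W 0 W + (der Z (nprod Z W 1 W) - (1 / 2) *\<^sub>C der Z (der Z (nprod Z W 2 W))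
      + (1 / 6) *\<^sub>C der Z (der Z (der Z (nprod Z W 3 W))))" by (simp only: diff_conv_add_uminus add.assoc)
  then have "nprod Z W 0 W = (1 / 2) *\<^sub>C (der Z (nprod Z W 1 W) - (1 / 2) *\<^sub>C der Z (der Z (nprod Z W 2 W))
      + (1 / 6) *\<^sub>C der Z (der Z (der Z (nprod Z W 3 W))))" by (rule half_of_self_neg)
  also have "\<dots> = (x1 / 2 - lam / 12) *\<^sub>C der Z (der Z (der Z T)) + (bet / 2) *\<^sub>C der Z (nprod Z T (- 1) T)"
    unfolding W_W_1 W_W_2 W_W_3 der_add der_scale by (rule ev_eqI) (simp add: ev_simps field_simps)
  finally show ?thesis .
qed

end

section \<open>Commutation relations of modes and filtered words on modules\<close>

locale w3_module = w3_ope Z T W cc Q c d e k + M: va_mod Z act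
  for Z :: "'z::complex_vector va" and T W cc and Q :: "'q::complex_vector va" and c d e k
    and act :: "'z \<Rightarrow> int \<Rightarrow> 'l::complex_vector \<Rightarrow> 'l"
begin

abbreviation Lm :: "int \<Rightarrow> 'l \<Rightarrow> 'l" where "Lm n x \<equiv> act T (n + 1) x"
abbreviation Wm :: "int \<Rightarrow> 'l \<Rightarrow> 'l" where "Wm n x \<equiv> act W (n + 2) x"

lemma ope_TT: "ope Z T T [der Z T, 2 *\<^sub>C T, 0, (cc / 2) *\<^sub>C vacuum Z]"
  and ope_TW: "ope Z T W [der Z W, 3 *\<^sub>C W]"
  using vir prim by (simp_all add: virasoro_def primary_def)

lemma gchoose_3: "(x :: complex) gchoose 3 = x * (x - 1) * (x - 2) / 6"
  by (simp add: numeral_3_eq_3 gbinomial_Suc fact_numeral atLeast0_lessThan_Suc atLeast0_atMost_Suc)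

lemma TT: "act T m (act T n x) = act T n (act T m x) + (of_int (m - n)) *\<^sub>C act T (m + n - 1) x
    + (if m + n = 2 then (cc / 12 * of_int (m * (m - 1) * (m - 2))) *\<^sub>C x else 0)"
proof -
  have 1: "(\<Sum>j<length [der Z T, 2 *\<^sub>C T, 0, (cc / 2) *\<^sub>C vacuum Z]. (of_int m gchoose j) *\<^sub>C
      act ([der Z T, 2 *\<^sub>C T, 0, (cc / 2) *\<^sub>C vacuum Z] ! j) (m + n - int j) x) =
      (- of_int (m + n)) *\<^sub>C act T (m + n - 1) x + (2 * of_int m) *\<^sub>C act T (m + n - 1) x
      + ((of_int m gchoose 3) * (cc / 2)) *\<^sub>C (if m + n - 3 = - 1 then x else 0)"
    by (simp add: lessThan_nat_numeral lessThan_Suc numeral_3_eq_3 M.M.act_der M.M.act_scale_left M.M.act_vacuum scaleC_scaleC mult.commute)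
  have 2: "(of_int m gchoose 3) * (cc / 2) = cc / 12 * of_int (m * (m - 1) * (m - 2))"
    by (simp add: gchoose_3)
  have 3: "m + n - 3 = - 1 \<longleftrightarrow> m + n = 2" by arith
  have 4: "(- of_int (m + n)) *\<^sub>C y + (2 * of_int m) *\<^sub>C y = of_int (m - n) *\<^sub>C y" for y :: 'l
    unfolding scaleC_add_left[symmetric] by simp
  have 5: "s *\<^sub>C (if P then x else 0) = (if P then s *\<^sub>C x else 0)" for s P by simp
  show ?thesis
    unfolding M.M.commutator_ope[OF ope_TT, of m n x] 1 2 3 4 5 by (simp only: add.assoc)
qed

lemma TW: "act T m (act W n x) = act W n (act T m x) + (of_int (2 * m - n)) *\<^sub>C act W (m + n - 1) x"
proof -
  have 1: "(\<Sum>j<length [der Z W, 3 *\<^sub>C W]. (of_int m gchoose j) *\<^sub>C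
      act ([der Z W, 3 *\<^sub>C W] ! j) (m + n - int j) x) =
      (- of_int (m + n)) *\<^sub>C act W (m + n - 1) x + (3 * of_int m) *\<^sub>C act W (m + n - 1) x"
    by (simp add: lessThan_Suc M.M.act_der M.M.act_scale_left scaleC_scaleC mult.commute)
  have 4: "(- of_int (m + n)) *\<^sub>C y + (3 * of_int m) *\<^sub>C y = of_int (2 * m - n) *\<^sub>C y" for y :: 'l
    unfolding scaleC_add_left[symmetric] by simp
  show ?thesis
    unfolding M.M.commutator_ope[OF ope_TW, of m n x] 1 4 ..
qed

lemma L_L: "Lm m (Lm n x) = Lm n (Lm m x) + (of_int (m - n)) *\<^sub>C Lm (m + n) x
    + (if m + n = 0 then (cc / 12 * of_int ((m + 1) * m * (m - 1))) *\<^sub>C x else 0)"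
  using TT[of "m + 1" "n + 1" x] by (simp add: algebra_simps)

lemma L_W: "Lm m (Wm n x) = Wm n (Lm m x) + (of_int (2 * m - n)) *\<^sub>C Wm (m + n) x"
  using TW[of "m + 1" "n + 2" x] by (simp add: algebra_simps)

lemma WW: "act W m (act W n x) = act W n (act W m x) + (\<Sum>j<6. (of_int m gchoose j) *\<^sub>C act (nprod Z W (int j) W) (m + n - int j) x)"
proof -
  have "Sum_any (\<lambda>j::nat. (of_int m gchoose j) *\<^sub>C act (nprod Z W (int j) W) (m + n - int j) x) =
      (\<Sum>j<6. (of_int m gchoose j) *\<^sub>C act (nprod Z W (int j) W) (m + n - int j) x)"
    by (rule Sum_any_nat_bound) (simp add: W_W_6)
  then show ?thesis using M.M.commutator[of W m W n x] by simp
qed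

text \<open>The submodule generated by a singular vector is spanned by words in modes of nonpositive index. In the
  commutator of two modes of \<open>W\<close> only words in modes of \<open>T\<close> occur, so that, with degree 2 for modes of \<open>T\<close> and
  degree 3 for modes of \<open>W\<close>, reordering does not raise the degree.\<close>

inductive words :: "'l \<Rightarrow> nat \<Rightarrow> 'l \<Rightarrow> bool" for u where
  base: "words u n u"
| modeT: "words u m y \<Longrightarrow> j \<le> 0 \<Longrightarrow> m + 2 \<le> n \<Longrightarrow> words u n (Lm j y)"
| modeW: "words u m y \<Longrightarrow> j \<le> 0 \<Longrightarrow> m + 3 \<le> n \<Longrightarrow> words u n (Wm j y)"
| add: "words u n x \<Longrightarrow> words u n y \<Longrightarrow> words u n (x + y)"
| scale: "words u n x \<Longrightarrow> words u n (s *\<^sub>C x)"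

lemma words_mono: "words u m x \<Longrightarrow> m \<le> n \<Longrightarrow> words u n x"
proof (induction arbitrary: n rule: words.induct)
  case (modeT m y j k)
  show ?case by (rule words.modeT[OF modeT(1,2)]) (use modeT in simp)
next
  case (modeW m y j k)
  show ?case by (rule words.modeW[OF modeW(1,2)]) (use modeW in simp)
qed (auto intro: words.intros)

lemma words_0: "words u n 0"
  using words.scale[OF words.base[of u n], of 0] by simp

lemma words_subspace: "cvec.subspace {x. words u n x}"
  by (rule cvec.subspaceI) (auto intro: words.intros words_0)

lemma words_product:
  assumes "\<And>j. words u n' (act b j y)" "\<And>j. words u n' (act a j y)"
    "\<And>j x. words u n' x \<Longrightarrow> words u n (act a j x)" "\<And>j x. words u n' x \<Longrightarrow> words u n (act b j x)"
  shows "words u n (act (nprod Z a i b) q y)"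
proof -
  let ?U = "{x. words u n x}"
  have "jac_a (\<lambda>i j. act s i (act s' j y)) m i q \<in> ?U"
    if "\<And>j. words u n' (act s' j y)" "\<And>j x. words u n' x \<Longrightarrow> words u n (act s j x)" for s s' m i q
    unfolding jac_a_def Sum_any.expand_set
    by (intro cvec.subspace_sum[OF words_subspace] cvec.subspace_scale[OF words_subspace]) (simp add: that)
  then have "act (nprod Z a i b) q y \<in> ?U"
    unfolding M.M.iterate
    by (intro cvec.subspace_diff[OF words_subspace] cvec.subspace_scale[OF words_subspace]) (use assms in auto)
  then show ?thesis by simp
qed

text \<open>The outer induction is on the degree, and the inner one peels off the leading mode of a
  word. A new mode is moved past this leading mode; what it does to the shorter rest, and the
  commutator, are covered by the outer hypothesis.\<close>

lemma words_closed:
  assumes L: "Lm 1 u = 0" "Lm 2 u = 0" and W1: "Wm 1 u = 0"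
  shows "words u n y \<Longrightarrow> words u (n + 2) (act T j y) \<and> words u (n + 3) (act W j y)"
proof (induction n arbitrary: y j rule: less_induct)
  case (less n)
  \<comment> \<open>L_1 and L_2 generate all positive modes of T, as the factor 1 - m in [L_1, L_m]
    vanishes only at m = 1.\<close>
  have Lu: "Lm (int m + 1) u = 0" for m
  proof (induction m)
    case (Suc m)
    show ?case
    proof (cases m)
      case 0
      then show ?thesis using L(2) by simp
    next
      case (Suc m')
      have "of_int (1 - (int m + 1)) *\<^sub>C Lm (1 + (int m + 1)) u = 0"
        using L_L[of 1 "int m + 1" u] L(1) Suc.IH by simp
      moreover have "of_int (1 - (int m + 1)) \<noteq> (0 :: complex)"
        using Suc by (simp only: of_int_eq_0_iff)
      ultimately have "Lm (1 + (int m + 1)) u = 0" using cvec.scale_eq_0_iff by blast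
      then show ?thesis by (simp add: add_ac)
    qed
  qed (use L in simp)
  \<comment> \<open>The factor 2 - m in [L_1, W_m] breaks the chain at m = 2; there W_3 is obtained
    from [L_2, W_1] = 3 W_3.\<close>
  have Wu: "Wm (int m + 1) u = 0" for m
  proof (induction m)
    case (Suc m)
    have 2: "Wm 2 u = 0" using L_W[of 1 1 u] L W1 by simp
    show ?case
    proof (cases "m = 1")
      case True
      then show ?thesis using L_W[of 2 1 u] L W1 by simp
    next
      case False
      have "of_int (2 * 1 - (int m + 1)) *\<^sub>C Wm (1 + (int m + 1)) u = 0"
        using L_W[of 1 "int m + 1" u] L Suc.IH by simp
      moreover have "of_int (2 * 1 - (int m + 1)) \<noteq> (0 :: complex)"
        using False by (simp only: of_int_eq_0_iff)
      ultimately have "Wm (1 + (int m + 1)) u = 0" using cvec.scale_eq_0_iff by blast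
      then show ?thesis by (simp add: add_ac)
    qed
  qed (use W1 in simp)
  have T0: "words u (n + 2) (act T j u)" for n j
  proof (cases "j \<le> 1")
    case True
    then show ?thesis using words.modeT[OF words.base, of "j - 1" 0 "n + 2"] by simp
  next
    case False
    then show ?thesis using Lu[of "nat (j - 2)"] by (simp add: words_0)
  qed
  have W0: "words u (n + 3) (act W j u)" for n j
  proof (cases "j \<le> 2")
    case True
    then show ?thesis using words.modeW[OF words.base, of "j - 2" 0 "n + 3"] by simp
  next
    case False
    then show ?thesis using Wu[of "nat (j - 3)"] by (simp add: words_0)
  qed
  have IHT: "words u (m + 2) (act T j x)" and IHW: "words u (m + 3) (act W j x)" if "words u m x" "m < n" for m x j
    using less.IH[OF that(2,1)] by auto
  have "words u m y \<Longrightarrow> m \<le> n \<Longrightarrow> \<forall>j. words u (m + 2) (act T j y) \<and> words u (m + 3) (act W j y)" for m y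
  proof (induction rule: words.induct)
    case (base n)
    then show ?case using T0 W0 by blast
  next
    case (modeT m0 y i m)
    then have m0: "m0 < n" and y: "words u m0 y" by auto
    have T: "words u k (act T j y)" if "m0 + 2 \<le> k" for j k
      using words_mono[OF IHT[OF y m0] that] .
    have W: "words u k (act W j y)" if "m0 + 3 \<le> k" for j k
      using words_mono[OF IHW[OF y m0] that] .
    have Y: "words u k y" if "m0 \<le> k" for k using words_mono[OF y that] .
    have 1: "words u (m + 2) (act T (i + 1) (act T j y))" "words u (m + 3) (act T (i + 1) (act W j y))" for j
      using words.modeT[OF T[OF order.refl] modeT(2), of "m + 2" j] words.modeT[OF W[OF order.refl] modeT(2), of "m + 3" j] modeT(3)
      by auto
    show ?case
    proof (intro allI conjI)
      fix j
      show "words u (m + 2) (act T j (Lm i y))"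
        unfolding TT[of j "i + 1" y] using 1 T Y modeT(3)
        by (auto intro!: words.add words.scale words_0 simp del: of_int_diff)
      have "act W j (Lm i y) = act T (i + 1) (act W j y) + (- of_int (2 * (i + 1) - j)) *\<^sub>C act W (i + 1 + j - 1) y"
        using TW[of "i + 1" j y] by (simp add: algebra_simps)
      then show "words u (m + 3) (act W j (Lm i y))"
        using words.add[OF 1(2)[of j] words.scale[OF W]] modeT(3) by simp
    qed
  next
    case (modeW m0 y i m)
    then have m0: "m0 < n" and m02: "m0 + 2 < n" and y: "words u m0 y" by auto
    have T: "words u k (act T j y)" if "m0 + 2 \<le> k" for j k
      using words_mono[OF IHT[OF y m0] that] .
    have W: "words u k (act W j y)" if "m0 + 3 \<le> k" for j k
      using words_mono[OF IHW[OF y m0] that] .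
    have Y: "words u k y" if "m0 \<le> k" for k using words_mono[OF y that] .
    have 1: "words u (m + 2) (act W (i + 2) (act T j y))" "words u (m + 3) (act W (i + 2) (act W j y))" for j
      using words.modeW[OF T[OF order.refl] modeW(2), of "m + 2" j] words.modeW[OF W[OF order.refl] modeW(2), of "m + 3" j] modeW(3)
      by auto
    \<comment> \<open>The commutator of two modes of W adds at most two modes of T to
      \<open>y\<close>, so its degree is at most m0 + 6. This is within m + 3, since the leading
      mode of W accounts for three of the m.\<close>
    have "words u (m0 + 6) (act T j x)" if "words u (m0 + 2) x" for j x
      by (rule words_mono[OF IHT[OF that m02]]) simp
    then have TT': "words u (m0 + 6) (act (nprod Z T j T) p y)" for j p
      by (intro words_product[of u "m0 + 2"]) (auto intro: T)
    obtain s where s: "nprod Z W 5 W = s *\<^sub>C vacuum Z" using W_W_5 by blast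
    have "words u (m0 + 6) (act (nprod Z W (int j) W) p y)" if "j < 6" for j p
    proof -
      from that consider "j = 0" | "j = 1" | "j = 2" | "j = 3" | "j = 4" | "j = 5" by linarith
      then show ?thesis
        by cases (simp_all add: W_W_0 W_W_1 W_W_2 W_W_3 W_W_4 s M.M.act_add_left M.M.act_scale_left M.M.act_der M.M.act_vacuum
          words_0 words.add words.scale T TT' Y del: of_int_minus cvec.scale_minus_left)
    qed
    then have WW': "words u (m + 3) (act (nprod Z W (int j) W) p y)" if "j < 6" for j p
      using words_mono[of u "m0 + 6" _ "m + 3"] that modeW(3) by simp
    show ?case
    proof (intro allI conjI)
      fix j
      show "words u (m + 2) (act T j (Wm i y))"
        unfolding TW[of j "i + 2" y] using 1 W modeW(3)
        by (auto intro!: words.add words.scale simp del: of_int_diff)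
      have "(\<Sum>j'<6. (of_int j gchoose j') *\<^sub>C act (nprod Z W (int j') W) (j + (i + 2) - int j') y) \<in> {x. words u (m + 3) x}"
        by (intro cvec.subspace_sum[OF words_subspace] cvec.subspace_scale[OF words_subspace]) (simp add: WW')
      then show "words u (m + 3) (act W j (Wm i y))"
        unfolding WW[of j "i + 2" y] using 1 by (auto intro!: words.add)
    qed
  next
    case (add n x y)
    then show ?case by (simp add: M.M.act_add_right words.add)
  next
    case (scale n x s)
    then show ?case by (simp add: M.M.act_scale_right words.scale)
  qed
  then show ?case using less.prems by blast
qed

end

lemma gchoose_three: "(3 :: complex) gchoose 0 = 1" "(3 :: complex) gchoose Suc 0 = 3" "(3 :: complex) gchoose 2 = 3"
  "(3 :: complex) gchoose 3 = 1" "(3 :: complex) gchoose 4 = 0" "(3 :: complex) gchoose 5 = 0"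
  by (simp_all add: eval_nat_numeral gbinomial_Suc atLeast0_lessThan_Suc atLeast0_atMost_Suc)

section \<open>Singular vectors in the irreducible highest weight module\<close>

locale w3_hw = w3_module Z T W cc Q c d e k act
  for Z :: "'z::complex_vector va" and T W cc and Q :: "'q::complex_vector va" and c d e k
    and act :: "'z \<Rightarrow> int \<Rightarrow> 'l::complex_vector \<Rightarrow> 'l" +
  fixes v :: 'l and h w :: complex
  assumes irred: "irreducible_module act" and v: "v \<noteq> 0"
    and L0: "Lm 0 v = h *\<^sub>C v" and W0: "Wm 0 v = w *\<^sub>C v"
    and Lpos: "0 < n \<Longrightarrow> Lm n v = 0" and Wpos: "0 < n \<Longrightarrow> Wm n v = 0"
    and h: "h = (4 * k + 9) / 3" and w: "w = - ((k + 3) * (4 * k + 9) * (5 * k + 12) / 27)"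
    and cc: "cc = - (2 * (3 * k + 5) * (4 * k + 9) / (k + 3))"
begin

lemma words_eigen:
  assumes u: "Lm 0 u = hu *\<^sub>C u" and x: "words u n x"
  shows "x \<in> cvec.span {y. \<exists>c. c \<in> {hu + of_nat m | m. True} \<and> Lm 0 y = c *\<^sub>C y}"
    (is "x \<in> cvec.span ?S")
proof -
  have st: "a y \<in> cvec.span ?S" if "y \<in> cvec.span ?S" and lin: "clinear a"
    and c: "\<And>y. Lm 0 (a y) = a (Lm 0 y) + of_nat m *\<^sub>C a y" for a y m
    using that(1)
  proof (induction rule: cvec.span_induct_alt)
    case base
    then show ?case by (simp add: clinear_0[OF lin] cvec.span_zero)
  next
    case (step s z y)
    then obtain m' where "Lm 0 z = (hu + of_nat m') *\<^sub>C z" by blast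
    then have "Lm 0 (a z) = (hu + of_nat (m' + m)) *\<^sub>C a z"
      using clinear_scaleC[OF lin, of "hu + of_nat m'" z] by (simp only: c scaleC_add_left of_nat_add add.assoc)
    then have "a z \<in> cvec.span ?S" by (intro cvec.span_base) blast
    then show ?case using step
      by (simp add: clinear_add[OF lin] clinear_scaleC[OF lin] cvec.span_add cvec.span_scale)
  qed
  show ?thesis
    using x
  proof (induction rule: words.induct)
    case (base n)
    have "Lm 0 u = (hu + of_nat 0) *\<^sub>C u" using u by simp
    then show ?case by (intro cvec.span_base) blast
  next
    case (modeT m y j n)
    show ?case
      by (rule st[OF _ M.M.act_linear_right, of _ _ _ "nat (- j)"]) (use modeT L_L[of 0 j] in auto)
  next
    case (modeW m y j n)
    show ?case
      by (rule st[OF _ M.M.act_linear_right, of _ _ _ "nat (- j)"]) (use modeW L_W[of 0 j] in auto)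
  qed (auto intro: cvec.span_add cvec.span_scale)
qed

text \<open>The words in \<open>u\<close> form a submodule whose weights are at least that of
  \<open>u\<close>. It cannot contain \<open>v\<close>, whose weight is lower by \<open>N\<close>,
  and irreducibility leaves only the zero submodule.\<close>

lemma singular_zero:
  assumes u: "Lm 0 u = (h + of_nat N) *\<^sub>C u" "0 < N" and sing: "Lm 1 u = 0" "Lm 2 u = 0" "Wm 1 u = 0"
  shows "u = 0"
proof -
  let ?U = "{x. \<exists>n. words u n x}"
  have U: "cvec.subspace ?U"
  proof (rule cvec.subspaceI)
    fix x y assume "x \<in> ?U" "y \<in> ?U"
    then obtain n m where "words u n x" "words u m y" by blast
    then have "words u (max n m) x" "words u (max n m) y" by (auto intro: words_mono)
    then show "x + y \<in> ?U" by (auto intro: words.add)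
  qed (auto intro: words_0 words.scale)
  have "submodule act ?U"
    by (rule M.M.submodule_of_generators[OF gen U]) (use words_closed[OF sing] in blast)
  then consider "?U = {0}" | "?U = UNIV" using irred by (auto simp: irreducible_module_def)
  then show ?thesis
  proof cases
    case 1
    have "u \<in> ?U" using words.base by blast
    then show ?thesis using 1 by simp
  next
    case 2
    then obtain n where "words u n v" by blast
    from words_eigen[OF u(1) this]
    have "v = 0"
    proof (rule eigen_independent[OF M.M.act_linear_right _ L0])
      show "h \<notin> {h + of_nat N + of_nat m |m. True}"
      proof
        assume "h \<in> {h + of_nat N + of_nat m |m. True}"
        then obtain m where "of_nat (N + m) = (0 :: complex)" by auto
        then show False using u(2) by (simp only: of_nat_eq_0_iff)
      qed
    qed
    then show ?thesis using v by simp
  qed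
qed

text \<open>In terms of the modes \<open>T\<^sub>(\<^sub>n\<^sub>) = L\<^sub>n\<^sub>-\<^sub>1\<close> and \<open>W\<^sub>(\<^sub>n\<^sub>) = W\<^sub>n\<^sub>-\<^sub>2\<close>.\<close>

lemma T_v: "act T 1 v = h *\<^sub>C v" "2 \<le> n \<Longrightarrow> act T n v = 0" and W_v: "act W 2 v = w *\<^sub>C v" "3 \<le> n \<Longrightarrow> act W n v = 0"
  using L0 W0 Lpos[of "n - 1"] Wpos[of "n - 2"] by simp_all

abbreviation (input) TT' :: 'z where "TT' \<equiv> nprod Z T (- 1) T"

lemma TT_v: "act TT' 3 v = (2 * h + h * h) *\<^sub>C v" "act TT' 2 v = (2 * h + 1) *\<^sub>C act T 0 v"
  "act TT' 1 v = (2 * h) *\<^sub>C act T (- 1) v + act T 0 (act T 0 v)"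
proof -
  have nop: "act TT' q v = act T (- 1) (act T q v) + act T (q - 1) (act T 0 v) + (act T (- 2) (act T (q + 1) v) + act T (q - 2) (act T 1 v))"
    if "0 < q" for q
  proof -
    have "act T (q + int j) v = 0" "act T (int j) v = 0" if "2 \<le> j" for j
      using that \<open>0 < q\<close> by (simp_all add: T_v)
    then show ?thesis
      by (subst M.M.act_nop[where B = 2]) (simp_all add: lessThan_nat_numeral lessThan_Suc)
  qed
  show "act TT' 3 v = (2 * h + h * h) *\<^sub>C v"
    by (rule ev_eqI) (simp add: TT[of 2 0 v] nop T_v M.M.act_scale_right ev_simps algebra_simps)
  show "act TT' 2 v = (2 * h + 1) *\<^sub>C act T 0 v"
    by (rule ev_eqI) (simp add: TT[of 1 0 v] nop T_v M.M.act_scale_right ev_simps algebra_simps)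
  show "act TT' 1 v = (2 * h) *\<^sub>C act T (- 1) v + act T 0 (act T 0 v)"
    by (rule ev_eqI) (simp add: nop T_v M.M.act_scale_right ev_simps algebra_simps)
qed

text \<open>W_1 kills \<open>v\<close>, so only the commutator remains. This evaluates W_1 on
  descendants under W, as the last singularity condition demands.\<close>

lemma W3_W: "act W 3 (act W n v) =
    ((x1 / 2 - lam / 12) * - of_int ((n + 3) * (n + 2) * (n + 1)) + 3 * x1 * of_int ((n + 2) * (n + 1)) - 3 * lam * of_int (n + 1) + 2 * lam) *\<^sub>C act T n v
    + (bet * (3 - of_int (n + 3) / 2)) *\<^sub>C act TT' (n + 2) v"
proof -
  have "act W 3 (act W n v) = act (nprod Z W 0 W) (n + 3) v + 3 *\<^sub>C act (nprod Z W 1 W) (n + 2) v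
      + 3 *\<^sub>C act (nprod Z W 2 W) (n + 1) v + act (nprod Z W 3 W) n v"
    using WW[of 3 n v] by (simp add: W_v lessThan_nat_numeral lessThan_Suc gchoose_three algebra_simps)
  also have "\<dots> = ((x1 / 2 - lam / 12) * - of_int ((n + 3) * (n + 2) * (n + 1)) + 3 * x1 * of_int ((n + 2) * (n + 1)) - 3 * lam * of_int (n + 1) + 2 * lam) *\<^sub>C act T n v
    + (bet * (3 - of_int (n + 3) / 2)) *\<^sub>C act TT' (n + 2) v"
    by (rule ev_eqI) (simp add: W_W_0 W_W_1 W_W_2 W_W_3 M.M.act_lin M.M.act_der ev_simps algebra_simps add_divide_distrib diff_divide_distrib)
  finally show ?thesis .
qed

text \<open>The side conditions orient this and the following commutators into rewrite rules that
  carry positive modes to the right, towards \<open>v\<close>.\<close>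

lemma T_pos: "1 \<le> m \<Longrightarrow> n \<le> 0 \<Longrightarrow> act T m (act T n x) = act T n (act T m x) + (of_int (m - n)) *\<^sub>C act T (m + n - 1) x
    + (if m + n = 2 then (cc / 12 * of_int (m * (m - 1) * (m - 2))) *\<^sub>C x else 0)"
  by (rule TT)

lemma T_pos_W: "1 \<le> m \<Longrightarrow> n \<le> 1 \<Longrightarrow> act T m (act W n x) = act W n (act T m x) + (of_int (2 * m - n)) *\<^sub>C act W (m + n - 1) x"
  by (rule TW)

lemma W_pos_T: "2 \<le> n \<Longrightarrow> m \<le> 0 \<Longrightarrow> act W n (act T m x) = act T m (act W n x) - (of_int (2 * m - n)) *\<^sub>C act W (m + n - 1) x"
  using TW[of m n x] by simp

lemma cc': "(k + 3) * cc = - (2 * (3 * k + 5) * (4 * k + 9))"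
  using k3 by (simp add: cc)

text \<open>In each of the three relations the difference of the two sides is a singular vector of positive degree.\<close>

lemma W_minus1: "act W 1 v = (- ((k + 3) * (5 * k + 12) / 6)) *\<^sub>C act T 0 v"
proof -
  \<comment> \<open>The coefficient is 3w/(2h) with the factor 4k + 9 cancelled, as the condition
    from L_1 demands.\<close>
  have "act W 1 v - (- ((k + 3) * (5 * k + 12) / 6)) *\<^sub>C act T 0 v = 0" (is "?u = 0")
  proof (rule singular_zero[where N = 1])
    show "Lm 0 ?u = (h + of_nat 1) *\<^sub>C ?u"
      by (rule ev_eqI) (simp add: M.M.act_lin T_pos T_pos_W T_v ev_simps algebra_simps add_divide_distrib diff_divide_distrib)
    show "Lm 1 ?u = 0"
      by (rule ev_eqI) (simp add: M.M.act_lin T_pos T_pos_W T_v W_v ev_simps,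
        simp add: h w algebra_simps add_divide_distrib diff_divide_distrib power2_eq_square power3_eq_cube)
    show "Lm 2 ?u = 0"
      by (rule ev_eqI) (simp add: M.M.act_lin T_pos T_pos_W T_v W_v ev_simps)
    show "Wm 1 ?u = 0"
      by (rule ev_eqI) (simp add: M.M.act_lin W_pos_T W3_W TT_v T_v W_v ev_simps,
        simp add: x1_def lam_def bet_def h w algebra_simps add_divide_distrib diff_divide_distrib power2_eq_square power3_eq_cube)
  qed simp
  then show ?thesis by (simp only: right_minus_eq)
qed

lemma W_minus2: "act W 0 v = (- (k + 3)) *\<^sub>C act T 0 (act T 0 v) + (2 / 3 * (k + 3)\<^sup>2) *\<^sub>C act T (- 1) v"
proof -
  \<comment> \<open>The two coefficients are chosen to meet the conditions from L_1 and L_2; that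
    W_1 also kills the difference is then a polynomial identity in \<open>k\<close>.\<close>
  have "act W 0 v - ((- (k + 3)) *\<^sub>C act T 0 (act T 0 v) + (2 / 3 * (k + 3)\<^sup>2) *\<^sub>C act T (- 1) v) = 0" (is "?u = 0")
  proof (rule singular_zero[where N = 2])
    show "Lm 0 ?u = (h + of_nat 2) *\<^sub>C ?u"
      by (rule ev_eqI) (simp add: M.M.act_lin T_pos T_pos_W T_v ev_simps algebra_simps add_divide_distrib diff_divide_distrib)
    show "Lm 1 ?u = 0"
      by (rule ev_eqI) (simp add: M.M.act_lin T_pos T_pos_W T_v W_v W_minus1 ev_simps,
        simp add: h w algebra_simps add_divide_distrib diff_divide_distrib power2_eq_square power3_eq_cube)
    \<comment> \<open>The central charge has denominator k + 3. It occurs only multiplied by a power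
      of k + 3, which leaves a polynomial identity.\<close>
    have c: "(k + 3)\<^sup>2 * cc = - (2 * (k + 3) * (3 * k + 5) * (4 * k + 9))"
      using cc' by algebra
    show "Lm 2 ?u = 0"
    proof (rule ev_eqI)
      fix p
      have "ev p (Lm 2 ?u) = (6 * w + (k + 3) * 6 * h - 2 / 3 * (k + 3)\<^sup>2 * (4 * h) - (k + 3)\<^sup>2 * cc / 3) * ev p v"
        by (simp add: M.M.act_lin T_pos T_pos_W T_v W_v ev_simps algebra_simps add_divide_distrib diff_divide_distrib)
      also have "6 * w + (k + 3) * 6 * h - 2 / 3 * (k + 3)\<^sup>2 * (4 * h) - (k + 3)\<^sup>2 * cc / 3 = 0"
        unfolding c h w by algebra
      finally show "ev p (Lm 2 ?u) = ev p 0" by (simp add: ev_simps)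
    qed
    show "Wm 1 ?u = 0"
      by (rule ev_eqI) (simp add: M.M.act_lin W_pos_T W3_W TT_v T_v W_v W_minus1 ev_simps,
        simp add: x1_def lam_def bet_def h w algebra_simps add_divide_distrib diff_divide_distrib power2_eq_square power3_eq_cube)
  qed simp
  then show ?thesis by (simp only: right_minus_eq)
qed

lemma W_minus3: "act W (- 1) v = (k * (k + 3) / 6) *\<^sub>C act T (- 2) v + (k + 3) *\<^sub>C act T 0 (act T (- 1) v)
    - act T 0 (act T 0 (act T 0 v))"
proof -
  have "act W (- 1) v - ((k * (k + 3) / 6) *\<^sub>C act T (- 2) v + (k + 3) *\<^sub>C act T 0 (act T (- 1) v)
    - act T 0 (act T 0 (act T 0 v))) = 0" (is "?u = 0")
  proof (rule singular_zero[where N = 3])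
    \<comment> \<open>Passing L_{-1} twice lowers W_1 to W_{-1}, which is outside the range of
      \<open>W_pos_T\<close>.\<close>
    have WT: "act W 1 (act T 0 v) = act T 0 (act W 1 v) + act W 0 v"
      using TW[of 0 1 v] by simp
    show "Lm 0 ?u = (h + of_nat 3) *\<^sub>C ?u"
      by (rule ev_eqI) (simp add: M.M.act_lin T_pos T_pos_W T_v ev_simps algebra_simps add_divide_distrib diff_divide_distrib)
    show "Lm 1 ?u = 0"
      by (rule ev_eqI) (simp add: M.M.act_lin T_pos T_pos_W T_v W_v W_minus2 ev_simps,
        simp add: h w algebra_simps add_divide_distrib diff_divide_distrib power2_eq_square power3_eq_cube)
    show "Lm 2 ?u = 0"
    proof (rule ev_eqI)
      fix p
      have "ev p (Lm 2 ?u) = (7 * (- ((k + 3) * (5 * k + 12) / 6)) - k * (k + 3) / 6 * 5 - (k + 3) * (4 * h + 9) + 6 * (3 * h + 1) - (k + 3) * cc / 2) * ev p (act T 0 v)"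
        by (simp add: M.M.act_lin T_pos T_pos_W T_v W_v W_minus1 ev_simps algebra_simps add_divide_distrib diff_divide_distrib)
      also have "7 * (- ((k + 3) * (5 * k + 12) / 6)) - k * (k + 3) / 6 * 5 - (k + 3) * (4 * h + 9) + 6 * (3 * h + 1) - (k + 3) * cc / 2 = 0"
        unfolding cc' h by algebra
      finally show "ev p (Lm 2 ?u) = ev p 0" by (simp add: ev_simps)
    qed
    show "Wm 1 ?u = 0"
      by (rule ev_eqI) (simp add: M.M.act_lin W_pos_T W3_W TT_v T_v W_v WT W_minus1 W_minus2 ev_simps,
        simp add: x1_def lam_def bet_def h w algebra_simps add_divide_distrib diff_divide_distrib power2_eq_square power3_eq_cube)
  qed simp
  then show ?thesis by (simp only: right_minus_eq)
qed

end

section \<open>Translation operators on tensor products\<close>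

lemma Sum_any_shift_int: "Sum_any (\<lambda>p::int. f (p + i)) = Sum_any f"
  by (rule Sum_any.reindex_cong[symmetric, where l = "\<lambda>p. p + i"]) (auto simp: bij_def inj_def surj_def intro: exI[of _ "y - i" for y])

lemma Sum_any_sum_swap:
  fixes f :: "'a \<Rightarrow> 'b \<Rightarrow> 'c::comm_monoid_add"
  assumes "finite A" "\<And>i. finite {p. f i p \<noteq> 0}"
  shows "Sum_any (\<lambda>p. \<Sum>i\<in>A. f i p) = (\<Sum>i\<in>A. Sum_any (f i))"
  using assms(1)
proof (induction A rule: finite_induct)
  case (insert i A)
  have "{p. (\<Sum>i\<in>A. f i p) \<noteq> 0} \<subseteq> (\<Union>i\<in>A. {p. f i p \<noteq> 0})"
    by (auto elim: contrapos_np intro!: sum.neutral)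
  from finite_subset[OF this] have "finite {p. (\<Sum>i\<in>A. f i p) \<noteq> 0}" using insert assms(2) by simp
  then show ?case using insert by (simp add: Sum_any.distrib assms(2))
qed simp

lemma derivation_pow_tensor:
  assumes D: "clinear D" "clinear D1" "clinear D2" "\<And>x y. D (x \<otimes> y) = D1 x \<otimes> y + x \<otimes> D2 y"
  shows "(D ^^ j) (x \<otimes> y) = (\<Sum>i\<le>j. of_nat (j choose i) *\<^sub>C ((D1 ^^ i) x \<otimes> (D2 ^^ (j - i)) y))"
proof (induction j)
  case (Suc j)
  let ?t = "\<lambda>i l. (D1 ^^ i) x \<otimes> (D2 ^^ l) y"
  have "(D ^^ Suc j) (x \<otimes> y) = (\<Sum>i\<le>j. of_nat (j choose i) *\<^sub>C ?t (Suc i) (j - i)) + (\<Sum>i\<le>j. of_nat (j choose i) *\<^sub>C ?t i (Suc j - i))"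
    by (simp add: Suc clinear_sum[OF D(1)] clinear_scaleC[OF D(1)] D(4) scaleC_add_right sum.distrib Suc_diff_le)
  also have "(\<Sum>i\<le>j. of_nat (j choose i) *\<^sub>C ?t (Suc i) (j - i)) =
      (\<Sum>i\<le>Suc j. (if i = 0 then 0 else of_nat (j choose (i - 1))) *\<^sub>C ?t i (Suc j - i))"
    unfolding sum.atMost_Suc_shift by simp
  also have "(\<Sum>i\<le>j. of_nat (j choose i) *\<^sub>C ?t i (Suc j - i)) = (\<Sum>i\<le>Suc j. of_nat (j choose i) *\<^sub>C ?t i (Suc j - i))"
    by simp
  also have "(\<Sum>i\<le>Suc j. (if i = 0 then 0 else of_nat (j choose (i - 1))) *\<^sub>C ?t i (Suc j - i)) + \<dots> =
      (\<Sum>i\<le>Suc j. of_nat (Suc j choose i) *\<^sub>C ?t i (Suc j - i))"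
    unfolding sum.distrib[symmetric]
  proof (rule sum.cong[OF refl])
    fix i
    show "(if i = 0 then 0 else of_nat (j choose (i - 1))) *\<^sub>C ?t i (Suc j - i) + of_nat (j choose i) *\<^sub>C ?t i (Suc j - i)
        = of_nat (Suc j choose i) *\<^sub>C ?t i (Suc j - i)"
      by (cases i) (simp_all add: scaleC_add_left)
  qed
  finally show ?case .
qed simp

text \<open>As D acts by the Leibniz rule, e^{zD} is the tensor product of the exponentials of
  \<open>D1\<close> and \<open>D2\<close>. The sign exponent n+j+1 splits accordingly into (p+i+1) +
  (n-1-p+(j-i)+1), once the mode index has been shifted by \<open>i\<close>.\<close>

lemma (in tensor_pair) skew_prod_tensor:
  assumes D: "clinear D" "clinear D1" "clinear D2" "\<And>x y. D (x \<otimes> y) = D1 x \<otimes> y + x \<otimes> D2 y"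
  shows "skew_prod (tensor_act act act') D (x \<otimes> u) n (a \<otimes> b) =
    Sum_any (\<lambda>p. skew_prod act D1 x p a \<otimes> skew_prod act' D2 u (n - 1 - p) b)"
proof -
  define f g where "f i p = ((- 1) powi (p + int i + 1) / fact i) *\<^sub>C (D1 ^^ i) (act a (p + int i) x)"
    and "g l p = ((- 1) powi (n - 1 - p + int l + 1) / fact l) *\<^sub>C (D2 ^^ l) (act' b (n - 1 - p + int l) u)" for i l p
  define F where "F i l p = f i p \<otimes> g l p" for i l p
  have lin: "clinear (D ^^ j)" "clinear (D1 ^^ j)" "clinear (D2 ^^ j)" for j
    using D by (auto intro: clinear_funpow)
  note D0 = clinear_0[OF lin(2)] clinear_0[OF lin(3)]
  define oa ob where "oa = M.ord a x" and "ob = N.ord b u"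
  have f0: "f i p = 0" if "oa \<le> p + int i" for i p
    using that by (simp add: f_def M.act_ord oa_def D0)
  have g0: "g l p = 0" if "ob \<le> n - 1 - p + int l" for l p
    using that by (simp add: g_def N.act_ord ob_def D0)
  have F0: "n - 1 - ob < p \<and> p < oa \<and> int i + int l < oa + ob - n + 1" if "F i l p \<noteq> 0" for i l p
  proof -
    have "\<not> oa \<le> p + int i" "\<not> ob \<le> n - 1 - p + int l" using that f0[of p i] g0[of p l] by (auto simp: F_def)
    then show ?thesis by linarith
  qed
  have finF: "finite {p. F i l p \<noteq> 0}" for i l
    by (rule finite_subset[of _ "{n - 1 - ob..oa}"]) (use F0 in force)+
  have tm: "((- 1) powi (n + int j + 1) / fact j) *\<^sub>C (D ^^ j) (tensor_act act act' (a \<otimes> b) (n + int j) (x \<otimes> u)) =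
      (\<Sum>i\<le>j. Sum_any (F i (j - i)))" for j
  proof -
    define c where "c = ((- 1) powi (n + int j + 1) / fact j :: complex)"
    define h where "h i p = (c * of_nat (j choose i)) *\<^sub>C ((D1 ^^ i) (act a p x) \<otimes> (D2 ^^ (j - i)) (act' b (n + int j - 1 - p) u))" for i p
    have h: "h i (p + int i) = F i (j - i) p" if "i \<le> j" for i p
    proof -
      have "(of_nat (j choose i) :: complex) = fact j / (fact i * fact (j - i))"
        using that by (rule binomial_fact)
      moreover have "(- 1 :: complex) powi (n + int j + 1) = (- 1) powi (p + int i + 1) * (- 1) powi (n - 1 - p + int (j - i) + 1)"
        using that by (simp add: of_nat_diff add_ac flip: power_int_add)
      ultimately have "c * of_nat (j choose i) = ((- 1) powi (p + int i + 1) / fact i) * ((- 1) powi (n - 1 - p + int (j - i) + 1) / fact (j - i))"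
        by (simp add: c_def)
      then show ?thesis
        using that by (simp add: h_def F_def f_def g_def tensor_scale_left tensor_scale_right scaleC_scaleC of_nat_diff mult.commute algebra_simps)
    qed
    have fin: "finite {p. h i p \<noteq> 0}" if "i \<le> j" for i
    proof -
      have "{p. h i p \<noteq> 0} \<subseteq> (\<lambda>p. p + int i) ` {p. F i (j - i) p \<noteq> 0}"
      proof
        fix p assume "p \<in> {p. h i p \<noteq> 0}"
        then show "p \<in> (\<lambda>p. p + int i) ` {p. F i (j - i) p \<noteq> 0}"
          using h[OF that, of "p - int i"] by (intro image_eqI[of _ _ "p - int i"]) auto
      qed
      then show ?thesis using finF finite_surj by blast
    qed
    define h' where "h' i = (if i \<le> j then h i else (\<lambda>p. 0))" for i
    have "c *\<^sub>C (D ^^ j) (tensor_act act act' (a \<otimes> b) (n + int j) (x \<otimes> u)) =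
        c *\<^sub>C Sum_any (\<lambda>p. (D ^^ j) (act a p x \<otimes> act' b (n + int j - 1 - p) u))"
      unfolding act_pure clinear_Sum_any[OF lin(1) mode_sum_finite] ..
    also have "\<dots> = Sum_any (\<lambda>p. c *\<^sub>C (D ^^ j) (act a p x \<otimes> act' b (n + int j - 1 - p) u))"
    proof (rule scaleC_Sum_any)
      have "{p. (D ^^ j) (act a p x \<otimes> act' b (n + int j - 1 - p) u) \<noteq> 0} \<subseteq> {p. act a p x \<otimes> act' b (n + int j - 1 - p) u \<noteq> 0}"
        by (auto simp: clinear_0[OF lin(1)])
      then show "finite {p. (D ^^ j) (act a p x \<otimes> act' b (n + int j - 1 - p) u) \<noteq> 0}"
        by (rule finite_subset) (rule mode_sum_finite)
    qed
    also have "\<dots> = Sum_any (\<lambda>p. \<Sum>i\<le>j. h' i p)"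
      unfolding derivation_pow_tensor[OF D] cvec.scale_sum_right h'_def h_def
      by (intro Sum_any.cong sum.cong) (auto simp: scaleC_scaleC)
    also have "\<dots> = (\<Sum>i\<le>j. Sum_any (h' i))"
      by (rule Sum_any_sum_swap) (auto simp: h'_def fin)
    also have "\<dots> = (\<Sum>i\<le>j. Sum_any (F i (j - i)))"
    proof (rule sum.cong[OF refl])
      fix i assume "i \<in> {..j}"
      then have i: "i \<le> j" by simp
      then have "Sum_any (h' i) = Sum_any (\<lambda>p. h i (p + int i))" by (simp add: h'_def Sum_any_shift_int)
      then show "Sum_any (h' i) = Sum_any (F i (j - i))" unfolding h[OF i] .
    qed
    finally show ?thesis unfolding c_def .
  qed
  have "skew_prod (tensor_act act act') D (x \<otimes> u) n (a \<otimes> b) = Sum_any (\<lambda>j. \<Sum>i\<le>j. Sum_any (F i (j - i)))"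
    unfolding skew_prod_def tm ..
  also have "\<dots> = Sum_any (\<lambda>j. Sum_any (\<lambda>p. \<Sum>i\<le>j. F i (j - i) p))"
    by (simp add: Sum_any_sum_swap finF)
  also have "\<dots> = Sum_any (\<lambda>p. Sum_any (\<lambda>j. \<Sum>i\<le>j. F i (j - i) p))"
  proof (rule Sum_any_swap)
    have B: "(n - 1 - ob < p \<and> p < oa) \<and> int j < oa + ob - n + 1" if "(\<Sum>i\<le>j. F i (j - i) p) \<noteq> 0" for j p
    proof -
      obtain i where "i \<in> {..j}" "F i (j - i) p \<noteq> 0" using \<open>(\<Sum>i\<le>j. F i (j - i) p) \<noteq> 0\<close> by (rule sum.not_neutral_contains_not_neutral)
      then show ?thesis using F0[of i "j - i" p] by (auto simp: of_nat_diff)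
    qed
    have "(j, p) \<in> {..nat (oa + ob - n + 1)} \<times> {n - 1 - ob..oa}" if "(\<Sum>i\<le>j. F i (j - i) p) \<noteq> 0" for j p
      using B[OF that] by auto
    then have "{(j, p). (\<Sum>i\<le>j. F i (j - i) p) \<noteq> 0} \<subseteq> {..nat (oa + ob - n + 1)} \<times> {n - 1 - ob..oa}" by auto
    then show "finite {(j, p). (\<Sum>i\<le>j. F i (j - i) p) \<noteq> 0}" by (rule finite_subset) simp
  qed
  also have "\<dots> = Sum_any (\<lambda>p. Sum_any (\<lambda>i. Sum_any (\<lambda>l. F i l p)))"
  proof (rule Sum_any.cong)
    fix p
    have "finite {(i, l). F i l p \<noteq> 0}"
      proof (rule finite_pairs_nat)
      fix i l assume "F i l p \<noteq> 0"
      from F0[OF this] show "i < nat (oa + ob - n + 1) \<and> l < nat (oa + ob - n + 1)" by linarith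
    qed
    from Sum_any_antidiagonal[OF this] show "Sum_any (\<lambda>j. \<Sum>i\<le>j. F i (j - i) p) = Sum_any (\<lambda>i. Sum_any (\<lambda>l. F i l p))" ..
  qed
  also have "\<dots> = Sum_any (\<lambda>p. skew_prod act D1 x p a \<otimes> skew_prod act' D2 u (n - 1 - p) b)"
  proof (rule Sum_any.cong)
    fix p
    have ff: "finite {i. f i p \<noteq> 0}" by (rule finite_nat_bound[of "nat (oa - p)"]) (auto intro: f0)
    have fg: "finite {l. g l p \<noteq> 0}" by (rule finite_nat_bound[of "nat (ob - (n - 1 - p))"]) (auto intro: g0)
    have "skew_prod act D1 x p a \<otimes> skew_prod act' D2 u (n - 1 - p) b = Sum_any (\<lambda>i. f i p) \<otimes> Sum_any (\<lambda>l. g l p)"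
      by (simp add: skew_prod_def f_def g_def)
    also have "\<dots> = Sum_any (\<lambda>i. Sum_any (\<lambda>l. F i l p))"
      unfolding tensor_Sum_any_left[OF ff] unfolding tensor_Sum_any_right[OF fg] F_def ..
    finally show "Sum_any (\<lambda>i. Sum_any (\<lambda>l. F i l p)) = skew_prod act D1 x p a \<otimes> skew_prod act' D2 u (n - 1 - p) b" ..
  qed
  finally show ?thesis .
qed

lemma (in tensor_alg) translator_tensor:
  assumes "A.translator s" "B.translator t"
  shows "AB.translator (s \<otimes> vacuum B + vacuum A \<otimes> t)"
  unfolding AB.translator_def
proof
  fix w
  have 1: "nprod A s 0 a = der A a" "nprod B t 0 b = der B b" for a b
    using assms by (auto simp: A.translator_def B.translator_def)
  show "nprod (tensor_va A B) (s \<otimes> vacuum B + vacuum A \<otimes> t) 0 w = der (tensor_va A B) w"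
  proof (rule clinear_tensor_eqI[OF AB.act_linear_right AB.act_linear_left])
    fix a b
    have z: "nprod A a i (vacuum A) \<otimes> nprod B b (- 2 - 1 - i) (vacuum B) = 0" if "i \<noteq> - 1" "i \<noteq> - 2" for i
      using that A.creation_0[of i a] B.creation_0[of "- 2 - 1 - i" b] by (cases "0 \<le> i") auto
    have "der (tensor_va A B) (a \<otimes> b) = Sum_any (\<lambda>i. nprod A a i (vacuum A) \<otimes> nprod B b (- 2 - 1 - i) (vacuum B))"
      by (simp add: tensor_va_def self.act_pure)
    also have "\<dots> = (\<Sum>i\<in>{- 1, - 2}. nprod A a i (vacuum A) \<otimes> nprod B b (- 2 - 1 - i) (vacuum B))"
      by (rule Sum_any.expand_superset) (use z in auto)
    finally show "nprod (tensor_va A B) (s \<otimes> vacuum B + vacuum A \<otimes> t) 0 (a \<otimes> b) = der (tensor_va A B) (a \<otimes> b)"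
      by (simp add: tensor_va_def clinear_add[OF self.act_linear_left] self.act_vacuum_left self.act_vacuum_right 1
        A.creation B.creation)
  qed
qed

section \<open>The screening operator\<close>

context translation_mod begin

lemma sk_commutator_sum:
  assumes "\<And>j. B \<le> j \<Longrightarrow> act a (int j) u = 0"
  shows "sk u q (nprod V a m c) = act a m (sk u q c) - (\<Sum>j<B. (of_int m gchoose j) *\<^sub>C sk (act a (int j) u) (m + q - int j) c)"
proof -
  have "jac_l (\<lambda>n q. sk (act a n u) q c) m 0 q = (\<Sum>j<B. (of_int m gchoose j) *\<^sub>C sk (act a (int j) u) (m + q - int j) c)"
    unfolding jac_l_def by (subst Sum_any_nat_bound[of B]) (auto simp: assms)
  then show ?thesis
    using sk_jac[of a u c m 0 q] by (simp add: jac_def jac_a_n0)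
qed

lemma sk_nop:
  assumes "\<And>j. B \<le> j \<Longrightarrow> sk u (q + int j) c = 0" "\<And>j. B \<le> j \<Longrightarrow> nprod V a (int j) c = 0"
  shows "sk (act a (- 1) u) q c = (\<Sum>j<B. act a (- 1 - int j) (sk u (q + int j) c) + sk u (q - 1 - int j) (nprod V a (int j) c))"
proof -
  have s: "(- 1 :: complex) ^ j * ((- 1) gchoose j) = 1" for j
    by (simp add: gbinomial_minus_one flip: power_mult_distrib)
  have "jac_a (\<lambda>i j. act a i (sk u j c)) 0 (- 1) q = (\<Sum>j<B. act a (- 1 - int j) (sk u (q + int j) c))"
    unfolding jac_a_def by (subst Sum_any_nat_bound[of B]) (auto simp: assms s)
  moreover have "jac_a (\<lambda>i j. sk u i (nprod V a j c)) q (- 1) 0 = (\<Sum>j<B. sk u (q - 1 - int j) (nprod V a (int j) c))"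
    unfolding jac_a_def by (subst Sum_any_nat_bound[of B]) (auto simp: assms s clinear_0[OF sk_linear_right])
  ultimately show ?thesis using sk_jac[of a u c 0 "- 1" q] by (simp add: jac_def jac_l_m0 sum.distrib)
qed

lemma sk_bound:
  assumes "\<And>j. B \<le> j \<Longrightarrow> act b (n + int j) u = 0"
  shows "sk u n b = (\<Sum>j<B. ((- 1) powi (n + int j + 1) / fact j) *\<^sub>C (D ^^ j) (act b (n + int j) u))"
  unfolding skew_prod_def by (rule Sum_any_nat_bound) (simp add: assms)

lemma sk_zero: "(\<And>j. n \<le> j \<Longrightarrow> act b j u = 0) \<Longrightarrow> sk u n b = 0"
  by (subst sk_bound[of 0]) auto

lemma sk_vac: "sk u (- 1 - int j) (vacuum V) = (1 / fact j) *\<^sub>C (D ^^ j) u"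
proof -
  have "sk u (- 1 - int j) (vacuum V) = Sum_any (\<lambda>l. ((- 1) powi (- 1 - int j + int l + 1) / fact l) *\<^sub>C (D ^^ l) (act (vacuum V) (- 1 - int j + int l) u))"
    by (simp add: skew_prod_def)
  also have "\<dots> = (1 / fact j) *\<^sub>C (D ^^ j) u"
    by (subst Sum_any_single[where a = j]) (auto simp: M.act_vacuum)
  finally show ?thesis .
qed

end

section \<open>Skew products of v tensor e^i with the image of G^-\<close>

locale w3_screening = w3_hw Z T W cc Q c d e k act v h w + I: half_lattice_mod Q c d e "- ((2 * k + 3) / 6)" 1 actI EI
  for Z :: "'z::complex_vector va" and T W cc and Q :: "'q::complex_vector va" and c d e k
    and act :: "'z \<Rightarrow> int \<Rightarrow> 'l::complex_vector \<Rightarrow> 'l" and v h w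
    and actI :: "'q \<Rightarrow> int \<Rightarrow> 'i::complex_vector \<Rightarrow> 'i" and EI
begin

sublocale E: tensor_mod Z act Q actI ..

abbreviation actE :: "('z, 'q) tensor \<Rightarrow> int \<Rightarrow> ('l, 'i) tensor \<Rightarrow> ('l, 'i) tensor" where
  "actE \<equiv> tensor_act act actI"

definition omega :: "('z, 'q) tensor" where
  "omega = T \<otimes> vacuum Q + (1 / 2) *\<^sub>C (vacuum Z \<otimes> lat.cd)"

lemma translator_omega: "ZQ.AB.translator omega"
  using ZQ.translator_tensor[OF translator_T lat.translator_cd] by (simp add: omega_def tensor_scale_right)

sublocale TL: translation_mod Z act "act T 0"
  by (rule M.translation_mod[OF translator_T])

sublocale TI: translation_mod Q actI "actI ((1 / 2) *\<^sub>C lat.cd) 0"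
  by (rule I.translation_mod[OF lat.translator_cd])

sublocale EM: va_mod "tensor_va Z Q" actE ..

sublocale TE: translation_mod "tensor_va Z Q" actE "actE omega 0"
  by (rule EM.translation_mod[OF translator_omega])

abbreviation s0 :: "('l, 'i) tensor" where "s0 \<equiv> v \<otimes> EI 0"

lemma sk_pure: "TE.sk (x \<otimes> y) n (a \<otimes> b) = Sum_any (\<lambda>p. TL.sk x p a \<otimes> TI.sk y (n - 1 - p) b)"
proof (rule E.skew_prod_tensor)
  show "actE omega 0 (x \<otimes> y) = act T 0 x \<otimes> y + x \<otimes> actI ((1 / 2) *\<^sub>C lat.cd) 0 y" for x y
    by (simp add: omega_def tensor_scale_right[symmetric] E.T.act_add_left E.act_vacuum_left E.act_vacuum_right)
qed (rule E.T.act_linear_right M.M.act_linear_right I.M.act_linear_right)+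

lemma sk_pure_sum:
  assumes "finite P" "\<And>p. p \<notin> P \<Longrightarrow> TL.sk x p a = 0 \<or> TI.sk y (n - 1 - p) b = 0"
  shows "TE.sk (x \<otimes> y) n (a \<otimes> b) = (\<Sum>p\<in>P. TL.sk x p a \<otimes> TI.sk y (n - 1 - p) b)"
  unfolding sk_pure by (rule Sum_any.expand_superset[OF assms(1)]) (use assms(2) in force)

lemma i_EI: "actI lat.i 0 (EI 0) = lat.kap *\<^sub>C EI 0" "0 < j \<Longrightarrow> actI lat.i j (EI 0) = 0"
  unfolding lat.i_def I.ivec_act lat.kap_def
  by (rule ev_eqI, simp add: I.c_0_E I.d_0_E ev_simps algebra_simps add_divide_distrib diff_divide_distrib)
    (simp add: I.c_E I.d_E)

text \<open>\<open>EI 0\<close> stands for e^i, and this is the rule that its derivative is i_{-1}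
  e^i.\<close>

lemma D_EI: "actI ((1 / 2) *\<^sub>C lat.cd) 0 (EI 0) = actI lat.i (- 1) (EI 0)"
  unfolding lat.i_def I.ivec_act
  by (rule ev_eqI) (simp add: I.M.act_scale_left I.cd_E_0 ev_simps algebra_simps add_divide_distrib diff_divide_distrib)

lemma ii: "actI lat.i m (actI lat.i n x) = actI lat.i n (actI lat.i m x) + (if m + n = 0 then (lat.kap * of_int m) *\<^sub>C x else 0)"
  using I.ivec_ivec[of "- ((2 * k + 3) / 6)" m n x] by (simp add: lat.i_def lat.kap_def)

lemma sk_i: "TI.sk (EI 0) q (nprod Q lat.i m b) = actI lat.i m (TI.sk (EI 0) q b) - lat.kap *\<^sub>C TI.sk (EI 0) (m + q) b"
  by (subst TI.sk_commutator_sum[of 1]) (auto simp: i_EI clinear_scaleC[OF TI.sk_linear_left])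

text \<open>The modes of e^i on e^{-c}. Up to the sign in \<open>F_0\<close> they are Schur
  polynomials in the creation modes of \<open>i\<close> applied to e^{i-c}; \<open>F_1\<close>,
  \<open>F_2\<close> and \<open>F_3\<close> are the instances that occur.\<close>

abbreviation F :: "int \<Rightarrow> 'i" where "F n \<equiv> TI.sk (EI 0) n (e (- 1))"

lemma F_pos: "0 < n \<Longrightarrow> F n = 0"
  by (rule TI.sk_zero) (use I.e_E_0[of "- 1" _ 0] in auto)

lemma F_0: "F 0 = - EI (- 1)"
  by (subst TI.sk_bound[of 1]) (use I.e_E_0[of "- 1" _ 0] I.e_E[of "- 1" 0] in auto)

text \<open>The modes of the derivative of e^i are computed in two ways, by translation covariance
  and as modes of i_{-1} e^i. The contraction of \<open>i\<close> with e^{-c} contributes -F(q-1).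
  The result is Newton's recursion for Schur polynomials.\<close>

lemma F_rec: "of_int (1 - q) *\<^sub>C F (q - 1) = (\<Sum>j<nat (1 - q). actI lat.i (- 1 - int j) (F (q + int j)))" if "q \<le> 0"
proof -
  let ?B = "nat (1 - q)"
  have "- (of_int q *\<^sub>C F (q - 1)) = TI.sk (actI lat.i (- 1) (EI 0)) q (e (- 1))"
    using TI.sk_D[of "EI 0" q "e (- 1)"] unfolding D_EI by simp
  also have "\<dots> = (\<Sum>j<?B. actI lat.i (- 1 - int j) (F (q + int j)) + TI.sk (EI 0) (q - 1 - int j) (nprod Q lat.i (int j) (e (- 1))))"
    by (rule TI.sk_nop) (use that in \<open>auto simp: F_pos lat.i_e_pos\<close>)
  also have "\<dots> = (\<Sum>j<?B. actI lat.i (- 1 - int j) (F (q + int j))) + (\<Sum>j<?B. if j = 0 then - F (q - 1) else 0)"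
    by (simp add: sum.distrib lat.i_e_pos clinear_neg[OF TI.sk_linear_right] if_distrib[of "TI.sk _ _"] clinear_0[OF TI.sk_linear_right] cong: if_cong)
  also have "(\<Sum>j<?B. if j = 0 then - F (q - 1) else 0) = - F (q - 1)"
    using that by simp
  finally have "- (of_int q *\<^sub>C F (q - 1)) + F (q - 1) = (\<Sum>j<?B. actI lat.i (- 1 - int j) (F (q + int j)))"
    by simp
  then show ?thesis by (simp add: cvec.scale_left_diff_distrib)
qed

abbreviation ia :: "int \<Rightarrow> 'i \<Rightarrow> 'i" where "ia n \<equiv> actI lat.i (- n)"

lemma F_1: "F (- 1) = ia 1 (F 0)"
  using F_rec[of 0] by simp

lemma F_2: "F (- 2) = (1 / 2) *\<^sub>C (ia 1 (ia 1 (F 0)) + ia 2 (F 0))"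
proof -
  have "F (- 2) = (1 / 2) *\<^sub>C (2 *\<^sub>C F (- 2))" by (simp add: scaleC_scaleC)
  also have "2 *\<^sub>C F (- 2) = ia 1 (ia 1 (F 0)) + ia 2 (F 0)"
    using F_rec[of "- 1"] by (simp add: lessThan_nat_numeral lessThan_Suc F_1 add.commute)
  finally show ?thesis .
qed

lemma F_3: "F (- 3) = (1 / 6) *\<^sub>C ia 1 (ia 1 (ia 1 (F 0))) + (1 / 2) *\<^sub>C ia 1 (ia 2 (F 0)) + (1 / 3) *\<^sub>C ia 3 (F 0)"
proof -
  have "F (- 3) = (1 / 3) *\<^sub>C (3 *\<^sub>C F (- 3))" by (simp add: scaleC_scaleC)
  also have "3 *\<^sub>C F (- 3) = ia 1 (F (- 2)) + (ia 2 (F (- 1)) + ia 3 (F 0))"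
    using F_rec[of "- 2"] by (simp add: lessThan_nat_numeral lessThan_Suc add_ac)
  finally have 3: "F (- 3) = (1 / 3) *\<^sub>C (ia 1 (F (- 2)) + (ia 2 (F (- 1)) + ia 3 (F 0)))" .
  show ?thesis
    unfolding 3 by (rule ev_eqI) (simp add: ii[of "- 2" "- 1" "F 0"] F_1 F_2 I.M.act_scale_right I.M.act_add_right ev_simps algebra_simps)
qed

lemmas small_sums = lessThan_nat_numeral lessThan_Suc eval_nat_numeral

text \<open>Positive modes kill \<open>v\<close>, so the exponential of D = L_{-1} stops after at
  most four terms. The same holds for the values on T and its derivative below.\<close>

lemma sk_W: "TL.sk v 2 W = - w *\<^sub>C v" "TL.sk v 1 W = act W 1 v - w *\<^sub>C act T 0 v"
  "TL.sk v 0 W = - act W 0 v + act T 0 (act W 1 v) - (w / 2) *\<^sub>C act T 0 (act T 0 v)"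
  "TL.sk v (- 1) W = act W (- 1) v - act T 0 (act W 0 v) + (1 / 2) *\<^sub>C act T 0 (act T 0 (act W 1 v)) - (w / 6) *\<^sub>C act T 0 (act T 0 (act T 0 v))"
  "3 \<le> p \<Longrightarrow> TL.sk v p W = 0"
proof -
  show "TL.sk v 2 W = - w *\<^sub>C v"
    by (subst TL.sk_bound[of 1]) (auto simp: W_v minus_one_power_iff intro: ev_eqI)
  show "TL.sk v 1 W = act W 1 v - w *\<^sub>C act T 0 v"
    by (subst TL.sk_bound[of 2]) (auto simp: W_v small_sums M.M.act_scale_right)
  show "TL.sk v 0 W = - act W 0 v + act T 0 (act W 1 v) - (w / 2) *\<^sub>C act T 0 (act T 0 v)"
    by (subst TL.sk_bound[of 3]) (auto simp: W_v small_sums M.M.act_scale_right)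
  show "TL.sk v (- 1) W = act W (- 1) v - act T 0 (act W 0 v) + (1 / 2) *\<^sub>C act T 0 (act T 0 (act W 1 v)) - (w / 6) *\<^sub>C act T 0 (act T 0 (act T 0 v))"
    by (subst TL.sk_bound[of 4]) (auto simp: W_v small_sums M.M.act_scale_right)
  show "3 \<le> p \<Longrightarrow> TL.sk v p W = 0"
    by (rule TL.sk_zero) (simp add: W_v)
qed

lemma sk_T: "TL.sk v 1 T = h *\<^sub>C v" "TL.sk v 0 T = (h - 1) *\<^sub>C act T 0 v"
  "TL.sk v (- 1) T = act T (- 1) v + (h / 2 - 1) *\<^sub>C act T 0 (act T 0 v)"
  "TL.sk v (- 2) T = - act T (- 2) v + act T 0 (act T (- 1) v) + (h / 6 - 1 / 2) *\<^sub>C act T 0 (act T 0 (act T 0 v))"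
  "2 \<le> p \<Longrightarrow> TL.sk v p T = 0"
proof -
  show "TL.sk v 1 T = h *\<^sub>C v"
    by (subst TL.sk_bound[of 1]) (auto simp: T_v minus_one_power_iff)
  show "TL.sk v 0 T = (h - 1) *\<^sub>C act T 0 v"
    by (subst TL.sk_bound[of 2]) (auto simp: T_v small_sums M.M.act_scale_right ev_simps algebra_simps intro: ev_eqI)
  show "TL.sk v (- 1) T = act T (- 1) v + (h / 2 - 1) *\<^sub>C act T 0 (act T 0 v)"
    by (subst TL.sk_bound[of 3]) (auto simp: T_v small_sums M.M.act_scale_right ev_simps algebra_simps intro: ev_eqI)
  show "TL.sk v (- 2) T = - act T (- 2) v + act T 0 (act T (- 1) v) + (h / 6 - 1 / 2) *\<^sub>C act T 0 (act T 0 (act T 0 v))"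
    by (subst TL.sk_bound[of 4]) (auto simp: T_v small_sums M.M.act_scale_right ev_simps algebra_simps intro: ev_eqI)
  show "2 \<le> p \<Longrightarrow> TL.sk v p T = 0"
    by (rule TL.sk_zero) (simp add: T_v)
qed

lemma sk_der_T: "TL.sk v 2 (der Z T) = (2 * h) *\<^sub>C v" "TL.sk v 1 (der Z T) = (2 * h - 1) *\<^sub>C act T 0 v"
  "TL.sk v 0 (der Z T) = (h - 1) *\<^sub>C act T 0 (act T 0 v)"
  "TL.sk v (- 1) (der Z T) = act T (- 2) v + (h / 3 - 1 / 2) *\<^sub>C act T 0 (act T 0 (act T 0 v))"
  "3 \<le> p \<Longrightarrow> TL.sk v p (der Z T) = 0"
proof -
  show "TL.sk v 2 (der Z T) = (2 * h) *\<^sub>C v"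
    by (subst TL.sk_bound[of 1]) (auto simp: M.M.act_der T_v minus_one_power_iff mult.commute)
  show "TL.sk v 1 (der Z T) = (2 * h - 1) *\<^sub>C act T 0 v"
    by (subst TL.sk_bound[of 2]) (auto simp: M.M.act_der T_v small_sums M.M.act_lin ev_simps algebra_simps intro: ev_eqI)
  show "TL.sk v 0 (der Z T) = (h - 1) *\<^sub>C act T 0 (act T 0 v)"
    by (subst TL.sk_bound[of 3]) (auto simp: M.M.act_der T_v small_sums M.M.act_lin ev_simps algebra_simps intro: ev_eqI)
  show "TL.sk v (- 1) (der Z T) = act T (- 2) v + (h / 3 - 1 / 2) *\<^sub>C act T 0 (act T 0 (act T 0 v))"
    by (subst TL.sk_bound[of 4]) (auto simp: M.M.act_der T_v small_sums M.M.act_lin ev_simps algebra_simps intro: ev_eqI)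
  show "3 \<le> p \<Longrightarrow> TL.sk v p (der Z T) = 0"
    by (rule TL.sk_zero) (simp add: M.M.act_der T_v)
qed

lemma sk_vacuum_L: "TL.sk v (- 1) (vacuum Z) = v" "TL.sk v (- 2) (vacuum Z) = act T 0 v"
  "TL.sk v (- 3) (vacuum Z) = (1 / 2) *\<^sub>C act T 0 (act T 0 v)" "TL.sk v (- 4) (vacuum Z) = (1 / 6) *\<^sub>C act T 0 (act T 0 (act T 0 v))"
  using TL.sk_vac[of v 0] TL.sk_vac[of v 1] TL.sk_vac[of v 2] TL.sk_vac[of v 3] by (simp_all add: eval_nat_numeral)

lemma sk_vacuum_0: "0 \<le> p \<Longrightarrow> TL.sk v p (vacuum Z) = 0"
  by (rule TL.sk_zero) (simp add: M.M.act_vacuum)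

lemma sk_linear_simps: "TI.sk u n (x + y) = TI.sk u n x + TI.sk u n y" "TI.sk u n (s *\<^sub>C x) = s *\<^sub>C TI.sk u n x"
  "TL.sk u' n (a + b) = TL.sk u' n a + TL.sk u' n b" "TL.sk u' n (s *\<^sub>C a) = s *\<^sub>C TL.sk u' n a"
  by (simp_all add: clinear_add[OF TI.sk_linear_right] clinear_scaleC[OF TI.sk_linear_right]
    clinear_add[OF TL.sk_linear_right] clinear_scaleC[OF TL.sk_linear_right])

text \<open>By \<open>skew_prod_tensor\<close> the screening of the image of \<open>G\<^sup>-\<close> is a combination of
  tensors \<open>L\<^sub>-\<^sub>n v \<otimes> i\<^sub>n\<^sub>-\<^sub>3 e\<^bsup>i-c\<^esup>\<close>; it vanishes precisely because of the relations for \<open>W\<^sub>-\<^sub>1\<close>, \<open>W\<^sub>-\<^sub>2\<close>, \<open>W\<^sub>-\<^sub>3\<close>.\<close>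

lemma sk_G: "TE.sk s0 0 G = (\<Sum>p\<in>{- 1, 0, 1, 2}. TL.sk v p W' \<otimes> F (- 1 - p))
    + (k + 3) *\<^sub>C (\<Sum>p\<in>{- 2, - 1, 0, 1}. TL.sk v p T \<otimes> TI.sk (EI 0) (- 1 - p) lat.ie)
    - (\<Sum>p\<in>{- 4, - 3, - 2, - 1}. TL.sk v p (vacuum Z) \<otimes> TI.sk (EI 0) (- 1 - p) lat.pvec)"
proof -
  have "TE.sk s0 0 (W' \<otimes> e (- 1)) = (\<Sum>p\<in>{- 1, 0, 1, 2}. TL.sk v p W' \<otimes> TI.sk (EI 0) (0 - 1 - p) (e (- 1)))"
  proof (rule sk_pure_sum)
    fix p :: int assume "p \<notin> {- 1, 0, 1, 2}"
    then have "3 \<le> p \<or> 0 < - 1 - p" by auto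
    then show "TL.sk v p W' = 0 \<or> TI.sk (EI 0) (0 - 1 - p) (e (- 1)) = 0"
      by (auto simp: W'_def sk_linear_simps sk_W sk_der_T F_pos)
  qed simp
  moreover have "TE.sk s0 0 (T \<otimes> lat.ie) = (\<Sum>p\<in>{- 2, - 1, 0, 1}. TL.sk v p T \<otimes> TI.sk (EI 0) (0 - 1 - p) lat.ie)"
  proof (rule sk_pure_sum)
    fix p :: int assume "p \<notin> {- 2, - 1, 0, 1}"
    then have "2 \<le> p \<or> 1 < - 1 - p" by auto
    then show "TL.sk v p T = 0 \<or> TI.sk (EI 0) (0 - 1 - p) lat.ie = 0"
      by (auto simp: sk_T sk_i F_pos)
  qed simp
  moreover have "TE.sk s0 0 (vacuum Z \<otimes> lat.pvec) = (\<Sum>p\<in>{- 4, - 3, - 2, - 1}. TL.sk v p (vacuum Z) \<otimes> TI.sk (EI 0) (0 - 1 - p) lat.pvec)"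
  proof (rule sk_pure_sum)
    fix p :: int assume "p \<notin> {- 4, - 3, - 2, - 1}"
    then have "0 \<le> p \<or> 3 < - 1 - p" by auto
    then show "TL.sk v p (vacuum Z) = 0 \<or> TI.sk (EI 0) (0 - 1 - p) lat.pvec = 0"
      by (auto simp: lat.pvec_def sk_linear_simps sk_vacuum_0 sk_i F_pos)
  qed simp
  ultimately show ?thesis
    unfolding G_def clinear_add[OF TE.sk_linear_right] clinear_diff[OF TE.sk_linear_right] clinear_scaleC[OF TE.sk_linear_right]
    by simp
qed

lemma screening_G: "TE.sk s0 0 G = 0"
proof -
  \<comment> \<open>Products of creation modes of \<open>i\<close> are put into one fixed order, so
    that equal monomials are recognized.\<close>
  have i21: "ia 2 (ia 1 x) = ia 1 (ia 2 x)" for x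
    using ii[of "- 2" "- 1" x] by simp
  show ?thesis
    unfolding sk_G
    by (rule ev_eqI) (simp add: W'_def lat.pvec_def sk_linear_simps sk_W sk_T sk_der_T sk_vacuum_L sk_i F_pos F_1 F_2 F_3
      I.M.act_lin i21 M.M.act_lin W_minus1 W_minus2 W_minus3
      tensor_add_left tensor_add_right tensor_scale_left tensor_scale_right tensor_diff_left tensor_diff_right tensor_neg_left tensor_neg_right
      ev_simps,
      simp add: h w lat.kap_def rho_def algebra_simps add_divide_distrib diff_divide_distrib power2_eq_square power3_eq_cube)
qed

end

section \<open>The image of the Bershadsky-Polyakov algebra\<close>

lemma va_hom_linear: "va_hom V V' f \<Longrightarrow> clinear f"
  and va_hom_vacuum: "va_hom V V' f \<Longrightarrow> f (vacuum V) = vacuum V'"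
  and va_hom_nprod: "va_hom V V' f \<Longrightarrow> f (nprod V a n b) = nprod V' (f a) n (f b)"
  by (simp_all add: va_hom_def)

lemma ope_image:
  assumes "va_hom V V' f" "ope V a b xs"
  shows "ope V' (f a) (f b) (map f xs)"
  using assms(2) va_hom_nprod[OF assms(1), of a _ b] clinear_0[OF va_hom_linear[OF assms(1)]]
  unfolding ope_def by (metis length_map nth_map)

lemma va_generated_image:
  assumes f: "va_hom V V' f" "surj f" and G: "va_generated V G"
  shows "va_generated V' (f ` G)"
  unfolding va_generated_def
proof (intro allI impI)
  fix U assume U: "cvec.subspace U \<and> vacuum V' \<in> U \<and> f ` G \<subseteq> U \<and> (\<forall>a\<in>U. \<forall>b\<in>U. \<forall>n. nprod V' a n b \<in> U)"
  have "f -` U = UNIV"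
  proof (rule G[unfolded va_generated_def, rule_format], intro conjI ballI allI)
    show "cvec.subspace (f -` U)"
      using U by (auto intro!: cvec.subspaceI simp: clinear_0[OF va_hom_linear[OF f(1)]] clinear_add[OF va_hom_linear[OF f(1)]]
        clinear_scaleC[OF va_hom_linear[OF f(1)]] cvec.subspace_0 cvec.subspace_add cvec.subspace_scale)
  qed (use U in \<open>auto simp: va_hom_vacuum[OF f(1)] va_hom_nprod[OF f(1)]\<close>)
  then show "U = UNIV" using f(2) by (metis UNIV_I surj_def vimageE UNIV_eq_I)
qed

lemma freely_strongly_generated_imp_generated:
  assumes "freely_strongly_generated V gs"
  shows "va_generated V (set gs)"
  unfolding va_generated_def
proof (intro allI impI)
  fix U assume U: "cvec.subspace U \<and> vacuum V \<in> U \<and> set gs \<subseteq> U \<and> (\<forall>a\<in>U. \<forall>b\<in>U. \<forall>n. nprod V a n b \<in> U)"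
  have "gs ! i \<in> U" if "i < length gs" for i using that U nth_mem by blast
  then have "pbw_monomial V gs xs \<in> U" if "\<forall>(n, i)\<in>set xs. i < length gs" for xs
    using that by (induction xs) (use U in \<open>auto simp: pbw_monomial_def\<close>)
  then have "pbw_monomial V gs ` pbw_index (length gs) \<subseteq> U" by (force simp: pbw_index_def)
  from cvec.span_minimal[OF this] show "U = UNIV"
    using U assms by (auto simp: freely_strongly_generated_def)
qed

lemma (in translation_mod) sk_derivation: "sk u 0 (nprod V a q c) = sk (sk u 0 a) q c + act a q (sk u 0 c)"
proof -
  have "sk (sk u 0 a) q c = sk u 0 (nprod V a q c) - act a q (sk u 0 c)"
    using sk_jac_swap[of u a c 0 0 q] by (simp add: jac_def jac_a_n0 jac_l_m0)
  then show ?thesis by simp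
qed

context half_lattice_alg begin

text \<open>The modes of e^c on e^{-c} are Schur polynomials in \<open>c\<close>; the recursion
  \<open>r\<close> expresses that the derivative of e^c is :c e^c:.\<close>

lemma e_1_e_minus_1:
  "0 \<le> n \<Longrightarrow> nprod Q (e 1) n (e (- 1)) = 0" "nprod Q (e 1) (- 1) (e (- 1)) = vacuum Q"
  "nprod Q (e 1) (- 2) (e (- 1)) = c"
  "nprod Q (e 1) (- 3) (e (- 1)) = (1 / 2) *\<^sub>C (nprod Q c (- 1) c + der Q c)"
proof -
  show 0: "0 \<le> n \<Longrightarrow> nprod Q (e 1) n (e (- 1)) = 0" for n using L.e_E_0[of 1 n "- 1"] by simp
  show 1: "nprod Q (e 1) (- 1) (e (- 1)) = vacuum Q" using L.e_E[of 1 "- 1"] by (simp add: e_0)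
  have cz: "nprod Q c (int j) (e (- 1)) = 0" for j
    using L.c_0_E[of "- 1"] L.c_E[of "int j" "- 1"] by (cases "j = 0") auto
  have r: "(- of_int q) *\<^sub>C nprod Q (e 1) (q - 1) (e (- 1)) =
      (\<Sum>j<nat (- q). nprod Q c (- 1 - int j) (nprod Q (e 1) (q + int j) (e (- 1))))" if "q < 0" for q
  proof -
    have "(- of_int q) *\<^sub>C nprod Q (e 1) (q - 1) (e (- 1)) = nprod Q (nop Q c (e 1)) q (e (- 1))"
      using act_der[of "e 1" q "e (- 1)"] by (simp add: der_e)
    also have "\<dots> = (\<Sum>j<nat (- q). nprod Q c (- 1 - int j) (nprod Q (e 1) (q + int j) (e (- 1))))"
      using that by (subst act_nop[of "nat (- q)"]) (auto simp: 0 cz)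
    finally show ?thesis .
  qed
  show 2: "nprod Q (e 1) (- 2) (e (- 1)) = c"
    using r[of "- 1"] by (simp add: 1 creation)
  have "nprod Q (e 1) (- 3) (e (- 1)) = (1 / 2) *\<^sub>C (2 *\<^sub>C nprod Q (e 1) (- 3) (e (- 1)))" by (simp add: scaleC_scaleC)
  also have "2 *\<^sub>C nprod Q (e 1) (- 3) (e (- 1)) = nprod Q c (- 1) c + der Q c"
    using r[of "- 2"] by (simp add: 1 2 lessThan_nat_numeral lessThan_Suc)
  finally show "nprod Q (e 1) (- 3) (e (- 1)) = (1 / 2) *\<^sub>C (nprod Q c (- 1) c + der Q c)" .
qed

end

context bp_lattice begin

definition j :: 'q where "j = ((2 * k + 3) / 6) *\<^sub>C c + (1 / 2) *\<^sub>C d"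

lemma e_i: "nprod Q (e l) n (nprod Q i m x) = nprod Q i m (nprod Q (e l) n x) - of_int l *\<^sub>C nprod Q (e l) (m + n) x"
  using i_e[of m l n x] by simp

lemma e_1_ie: "nprod Q (e 1) 0 ie = - vacuum Q"
  by (simp add: e_i e_1_e_minus_1)

text \<open>The lattice part of the image of L^BP, see \<open>iota_L\<close>.\<close>

definition qL :: 'q where
  "qL = (1 / 2) *\<^sub>C cd + ((2 * k + 3) / 4) *\<^sub>C der Q c - (3 / 4) *\<^sub>C der Q d"

lemma d_minus_1_c: "nprod Q d (- 1) c = cd"
  using S.cd[of "- 1" "- 1" "vacuum Q"] by (simp add: creation)

text \<open>The left side is the lattice part of 3:J^2: + (3/2)(k+1) dJ - G^+_(0) G^-, which equals
  (k+3) L^BP by the simple pole of G^+ with G^-. The sign of \<open>pvec\<close> is positive because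
  it enters G^- with a minus.\<close>

lemma e_1_pvec: "3 *\<^sub>C nprod Q j (- 1) j + (3 * (k + 1) / 2) *\<^sub>C der Q j + nprod Q (e 1) 0 pvec = (k + 3) *\<^sub>C qL"
  by (rule ev_eqI) (simp add: pvec_def e_i e_1_e_minus_1 act_lin ev_simps, simp add: j_def i_def qL_def act_lin der_add der_scale creation creation_0 d_minus_1_c ev_simps,
    simp add: algebra_simps add_divide_distrib diff_divide_distrib power2_eq_square)

end

section \<open>Diagonalizable operators on tensor products and direct sums\<close>

lemma tensor_span:
  assumes "cvec.span A = UNIV" "cvec.span B = UNIV"
  shows "cvec.span {x \<otimes> y | x y. x \<in> A \<and> y \<in> B} = UNIV"
proof -
  let ?S = "{x \<otimes> y | x y. x \<in> A \<and> y \<in> B}"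
  have 1: "x \<otimes> y \<in> cvec.span ?S" if x: "x \<in> A" for x y
  proof -
    have "y \<in> cvec.span B" using assms(2) by simp
    then show ?thesis
    proof (induction rule: cvec.span_induct_alt)
      case (step c z y)
      then have "x \<otimes> z \<in> cvec.span ?S" using x by (intro cvec.span_base) blast
      then show ?case using step by (simp add: tensor_add_right tensor_scale_right cvec.span_add cvec.span_scale)
    qed (simp add: cvec.span_zero)
  qed
  have 2: "x \<otimes> y \<in> cvec.span ?S" for x y
  proof -
    have "x \<in> cvec.span A" using assms(1) by simp
    then show ?thesis
      by (induction rule: cvec.span_induct_alt)
        (use 1 in \<open>auto simp: cvec.span_zero tensor_add_left tensor_scale_left intro!: cvec.span_add cvec.span_scale\<close>)
  qed
  have "t \<in> cvec.span ?S" for t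
    by (induction t rule: tensor_induct) (use 2 in \<open>auto intro: cvec.span_add\<close>)
  then show ?thesis by blast
qed

lemma diagonalizable_tensor:
  assumes f: "diagonalizable f" and g: "diagonalizable g" and h: "\<And>x y. h (x \<otimes> y) = f x \<otimes> y + x \<otimes> g y"
  shows "diagonalizable h"
proof -
  have "{x \<otimes> y | x y. x \<in> {x. \<exists>c. f x = c *\<^sub>C x} \<and> y \<in> {y. \<exists>c. g y = c *\<^sub>C y}} \<subseteq> {x. \<exists>c. h x = c *\<^sub>C x}"
    by (auto simp: h tensor_scale_left tensor_scale_right scaleC_add_left[symmetric])
  from cvec.span_mono[OF this] show ?thesis
    using tensor_span[OF f[unfolded diagonalizable_def] g[unfolded diagonalizable_def]] by (auto simp: diagonalizable_def)
qed

lemma diagonalizable_prod: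
  assumes f: "diagonalizable f" "f 0 = 0" and g: "diagonalizable g" "g 0 = 0"
  shows "diagonalizable (\<lambda>(x, y). (f x, g y))"
proof -
  let ?S = "{x. \<exists>c. (case x of (x, y) \<Rightarrow> (f x, g y)) = c *\<^sub>C x}"
  have "(x, 0) \<in> cvec.span ?S" for x
  proof -
    have "x \<in> cvec.span {x. \<exists>c. f x = c *\<^sub>C x}" using f(1) by (simp add: diagonalizable_def)
    then show ?thesis
    proof (induction rule: cvec.span_induct_alt)
      case (step c x y)
      have 1: "(x, 0) \<in> ?S" using step(1) g(2) by (auto simp: scaleC_prod_def)
      have 2: "(c *\<^sub>C x + y, 0) = c *\<^sub>C (x, 0) + (y, 0)" by (simp add: scaleC_prod_def plus_prod_def)
      show ?case unfolding 2 by (intro cvec.span_add cvec.span_scale cvec.span_base 1 step)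
    qed (simp add: cvec.span_zero flip: zero_prod_def)
  qed
  moreover have "(0, y) \<in> cvec.span ?S" for y
  proof -
    have "y \<in> cvec.span {x. \<exists>c. g x = c *\<^sub>C x}" using g(1) by (simp add: diagonalizable_def)
    then show ?thesis
    proof (induction rule: cvec.span_induct_alt)
      case (step c x y)
      have 1: "(0, x) \<in> ?S" using step(1) f(2) by (auto simp: scaleC_prod_def)
      have 2: "(0, c *\<^sub>C x + y) = c *\<^sub>C (0, x) + (0, y)" by (simp add: scaleC_prod_def plus_prod_def)
      show ?case unfolding 2 by (intro cvec.span_add cvec.span_scale cvec.span_base 1 step)
    qed (simp add: cvec.span_zero flip: zero_prod_def)
  qed
  ultimately have "(x, 0) + (0, y) \<in> cvec.span ?S" for x y by (intro cvec.span_add)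
  then have "(x, y) \<in> cvec.span ?S" for x y by (simp add: plus_prod_def)
  then show ?thesis by (auto simp: diagonalizable_def)
qed

context w3_module begin

text \<open>T and W are homogeneous, so their modes send eigenvectors of L_0 to eigenvectors. The
  span is thus a submodule, and one nonzero or generating vector in it shows that L_0 is
  diagonalizable.\<close>

lemma eigenspan_closed: "submodule act (cvec.span {x. \<exists>c. act T 1 x = c *\<^sub>C x})" (is "submodule act (cvec.span ?S)")
proof (rule M.M.submodule_of_generators[OF gen])
  fix a n x assume "a \<in> {T, W}" "x \<in> cvec.span ?S"
  then obtain wt :: complex where wt: "nprod Z T 1 a = wt *\<^sub>C a" 
    using T_T(2) T_W(2) by auto
  have "act a n y \<in> ?S" if "y \<in> ?S" for y
  proof -
    obtain c where c: "act T 1 y = c *\<^sub>C y" using \<open>y \<in> ?S\<close> by blast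
    have "act T 1 (act a n y) = (c + wt - of_int (n + 1)) *\<^sub>C act a n y"
      unfolding M.translator_1[OF translator_T] wt c
      by (simp add: M.M.act_scale_left M.M.act_scale_right scaleC_add_left cvec.scale_left_diff_distrib)
    then show ?thesis by blast
  qed
  with \<open>x \<in> cvec.span ?S\<close> show "act a n x \<in> cvec.span ?S"
  proof (induction rule: cvec.span_induct_alt)
    case (step s y z)
    then have "act a n y \<in> cvec.span ?S" by (intro cvec.span_base) blast
    then show ?case using step by (simp add: M.M.act_add_right M.M.act_scale_right cvec.span_add cvec.span_scale)
  qed (simp add: cvec.span_zero)
qed simp

end

lemma (in w3_ope) diagonalizable_T: "diagonalizable (nprod Z T 1)"
proof -
  interpret self: w3_module Z T W cc Q c d e k "nprod Z" ..
  let ?U = "cvec.span {x. \<exists>c. nprod Z T 1 x = c *\<^sub>C x}"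
  have "vacuum Z \<in> ?U" by (intro cvec.span_base) (auto simp: creation_0 intro: exI[of _ 0])
  then have "nprod Z a (- 1) (vacuum Z) \<in> ?U" for a using self.eigenspan_closed by (auto simp: submodule_def)
  then show ?thesis by (auto simp: diagonalizable_def creation)
qed

lemma (in w3_hw) diagonalizable_T_act: "diagonalizable (act T 1)"
proof -
  let ?U = "cvec.span {x. \<exists>c. act T 1 x = c *\<^sub>C x}"
  have "v \<in> ?U" by (intro cvec.span_base) (use T_v in auto)
  then have "?U \<noteq> {0}" using v by blast
  then have "?U = UNIV" using eigenspan_closed irred by (auto simp: irreducible_module_def)
  then show ?thesis by (simp add: diagonalizable_def)
qed

section \<open>The screening condition and the deformed zero mode\<close>

locale bp_screening = w3_screening Z T W cc Q c d e k act v h w actI EI + BP: vertex_alg A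
  for Z :: "'z::complex_vector va" and T W cc and Q :: "'q::complex_vector va" and c d e k
    and act :: "'z \<Rightarrow> int \<Rightarrow> 'l::complex_vector \<Rightarrow> 'l" and v h w
    and actI :: "'q \<Rightarrow> int \<Rightarrow> 'i::complex_vector \<Rightarrow> 'i" and EI
    and A :: "'w::complex_vector va" +
  fixes J Gp Gm L :: 'w and iota :: "'w \<Rightarrow> ('z, 'q) tensor"
  assumes hom: "va_hom A (tensor_va Z Q) iota" and iota_J: "iota J = vacuum Z \<otimes> lat.j"
    and iota_Gp: "iota Gp = vacuum Z \<otimes> e 1" and iota_Gm: "iota Gm = G"
    and genA: "va_generated A {J, Gp, Gm, L}"
    and Gp_Gm: "nprod A Gp 0 Gm = 3 *\<^sub>C nop A J J + (3 * (k + 1) / 2) *\<^sub>C der A J - (k + 3) *\<^sub>C L"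
begin

lemma prodZQ_eq: "nprod (tensor_va Z Q) = prodZQ" and vacuum_ZQ: "vacuum (tensor_va Z Q) = vacuum Z \<otimes> vacuum Q"
  by (simp_all add: tensor_va_def)

lemmas iota_simps = clinear_add[OF va_hom_linear[OF hom]] clinear_scaleC[OF va_hom_linear[OF hom]]
  clinear_diff[OF va_hom_linear[OF hom]] va_hom_nprod[OF hom] va_hom_vacuum[OF hom]

text \<open>The embedding is prescribed on J and G^+, G^- only. The image of L^BP is recovered from
  the simple pole of G^+ with G^-, where it carries the nonzero factor k + 3.\<close>

lemma iota_L: "iota L = T \<otimes> vacuum Q + vacuum Z \<otimes> lat.qL"
proof -
  let ?R = "3 *\<^sub>C nop A J J + (3 * (k + 1) / 2) *\<^sub>C der A J"
  have "iota (?R - nprod A Gp 0 Gm) = vacuum Z \<otimes> (3 *\<^sub>C nprod Q lat.j (- 1) lat.j + (3 * (k + 1) / 2) *\<^sub>C der Q lat.j + nprod Q (e 1) 0 lat.pvec)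
      + (k + 3) *\<^sub>C (T \<otimes> vacuum Q)"
    by (simp add: iota_simps prodZQ_eq vacuum_ZQ iota_J iota_Gp iota_Gm G_def ZQ.self.act_vacuum_left
      clinear_add[OF ZQ.self.act_linear_right] clinear_diff[OF ZQ.self.act_linear_right] clinear_scaleC[OF ZQ.self.act_linear_right]
      lat.e_1_ie lat.e_1_e_minus_1 tensor_add_right tensor_scale_right tensor_neg_right)
  also have "\<dots> = (k + 3) *\<^sub>C (T \<otimes> vacuum Q + vacuum Z \<otimes> lat.qL)"
    unfolding lat.e_1_pvec by (simp add: tensor_scale_right scaleC_add_right)
  finally have "(k + 3) *\<^sub>C iota L = (k + 3) *\<^sub>C (T \<otimes> vacuum Q + vacuum Z \<otimes> lat.qL)"
    by (simp add: Gp_Gm iota_simps)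
  then show ?thesis using k3 by simp
qed

lemma sk_vacuum_tensor:
  assumes "\<And>j. 0 \<le> j \<Longrightarrow> actI b j (EI 0) = 0" and "0 \<le> n"
  shows "TE.sk s0 n (vacuum Z \<otimes> b) = 0"
  by (rule TE.sk_zero) (use assms in \<open>auto simp: E.act_vacuum_left\<close>)

lemma j_EI: "0 \<le> n \<Longrightarrow> actI lat.j n (EI 0) = 0"
  by (cases "n = 0") (auto simp: lat.j_def I.ivec_act I.c_0_E I.d_0_E I.c_E I.d_E scaleC_scaleC scaleC_add_left[symmetric])

lemma screening: "TE.sk s0 0 (iota a) = 0"
proof -
  let ?K = "{a. TE.sk s0 0 (iota a) = 0}"
  note sk = clinear_add[OF TE.sk_linear_right] clinear_scaleC[OF TE.sk_linear_right] clinear_diff[OF TE.sk_linear_right]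
    clinear_0[OF TE.sk_linear_right]
  have sub: "cvec.subspace ?K"
    by (rule cvec.subspaceI) (auto simp: sk iota_simps clinear_0[OF va_hom_linear[OF hom]])
  have prod: "nprod A a n b \<in> ?K" if "a \<in> ?K" "b \<in> ?K" for a b n
    using that by (simp add: va_hom_nprod[OF hom] TE.sk_derivation clinear_0[OF TE.sk_linear_left])
  have vac: "vacuum A \<in> ?K"
    by (simp add: va_hom_vacuum[OF hom] vacuum_ZQ sk_vacuum_tensor I.M.act_vacuum)
  have JG: "J \<in> ?K" "Gp \<in> ?K" "Gm \<in> ?K"
    using sk_vacuum_tensor[of lat.j 0] sk_vacuum_tensor[of "e 1" 0] I.e_E_0[of 1 _ 0]
    by (auto simp: iota_J iota_Gp iota_Gm screening_G j_EI)
  \<comment> \<open>L^BP lies in the vertex algebra generated by J, G^+ and G^-, so it need not be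
    screened separately.\<close>
  have "L = (1 / (k + 3)) *\<^sub>C (3 *\<^sub>C nop A J J + (3 * (k + 1) / 2) *\<^sub>C der A J - nprod A Gp 0 Gm)"
    using k3 by (simp add: Gp_Gm scaleC_scaleC)
  moreover have "(1 / (k + 3)) *\<^sub>C (3 *\<^sub>C nop A J J + (3 * (k + 1) / 2) *\<^sub>C der A J - nprod A Gp 0 Gm) \<in> ?K"
    by (intro cvec.subspace_scale[OF sub] cvec.subspace_diff[OF sub] cvec.subspace_add[OF sub] prod JG vac)
  ultimately have "L \<in> ?K" by simp
  then have "?K = UNIV"
    by (intro genA[unfolded va_generated_def, rule_format]) (use JG vac prod sub in blast)
  then show ?thesis by blast
qed

sublocale li: li_deformation "tensor_va Z Q" actE "actE omega 0" A iota s0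
  by unfold_locales (rule hom, rule screening)

text \<open>The Bershadsky-Polyakov part of the image of L_sug.\<close>

definition X :: 'w where "X = L + (1 / 2) *\<^sub>C der A J"

definition qX :: 'q where "qX = (1 / 2) *\<^sub>C lat.cd + ((2 * k + 3) / 3) *\<^sub>C der Q c - (1 / 2) *\<^sub>C der Q d"

lemma iota_X: "iota X = T \<otimes> vacuum Q + vacuum Z \<otimes> qX"
proof -
  have "lat.qL + (1 / 2) *\<^sub>C der Q lat.j = qX"
    by (rule ev_eqI) (simp add: lat.qL_def lat.j_def qX_def lat.der_add lat.der_scale ev_simps,
      simp add: algebra_simps add_divide_distrib diff_divide_distrib)
  then show ?thesis
    by (simp add: X_def iota_simps iota_L iota_J prodZQ_eq vacuum_ZQ ZQ.self.act_vacuum_left add.assoc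
      flip: tensor_scale_right tensor_add_right)
qed

lemma qX_1: "actI qX 1 x = I.grading (- ((2 * k + 3) / 3)) (1 / 2) x" "nprod Q qX 1 y = lat.S.grading (- ((2 * k + 3) / 3)) (1 / 2) y"
  by (simp_all add: qX_def I.grading_def lat.S.grading_def I.M.act_lin lat.act_lin I.M.act_der lat.act_der)

text \<open>\<open>s0\<close> behaves as a primary vector of weight one for \<open>X\<close>: the
  weight (4k+9)/3 of \<open>v\<close> and the weight -(4k+6)/3 of e^i add up to 1.\<close>

lemma X_s0: "actE (iota X) 0 s0 = actE omega 0 s0" "actE (iota X) 1 s0 = s0" "2 \<le> n \<Longrightarrow> actE (iota X) n s0 = 0"
proof -
  have X: "actE (iota X) n s0 = act T n v \<otimes> EI 0 + v \<otimes> actI qX n (EI 0)" for n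
    by (simp add: iota_X E.T.act_add_left E.act_vacuum_left E.act_vacuum_right)
  show "actE (iota X) 0 s0 = actE omega 0 s0"
    by (simp add: X omega_def qX_def I.M.act_lin I.M.act_der E.T.act_lin E.act_vacuum_left E.act_vacuum_right tensor_scale_right)
  have "h + I.weight (- ((2 * k + 3) / 3)) (1 / 2) 0 = 1"
    unfolding h I.weight_def by (simp add: field_simps)
  then show "actE (iota X) 1 s0 = s0"
    by (simp add: X T_v qX_1 I.grading_E tensor_scale_left tensor_scale_right flip: scaleC_add_left)
  assume n: "2 \<le> n"
  then have "actI lat.cd n (EI 0) = 0"
    by (subst I.M.act_nop[of 1]) (auto simp: I.c_E I.d_E I.c_0_E I.M.act_scale_right)
  then show "actE (iota X) n s0 = 0"
    using n by (simp add: X T_v qX_def I.M.act_lin I.M.act_der I.c_E I.d_E)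
qed

text \<open>Skew symmetry with \<open>X_s0\<close> gives s_(1) X = s for s = \<open>s0\<close>,
  while all other nonnegative modes of s kill X. Hence Delta(s,z) X = X + z^{-1} s, and mode 1 of X
  acquires the summand s_(0); the sign is right because \<open>kappa 1 = 1\<close>.\<close>

lemma dact_X: "li.dact X 1 (b, y) = (prodZQ (iota X) 1 b, actE (iota X) 1 y + TE.sk s0 0 b)"
proof -
  have "TE.sk s0 0 (iota X) = 0" by (rule screening)
  moreover have "TE.sk s0 1 (iota X) = s0"
    by (subst TE.sk_bound[of 1]) (auto simp: X_s0)
  moreover have "TE.sk s0 n (iota X) = 0" if "2 \<le> n" for n
    by (rule TE.sk_zero) (use that X_s0 in auto)
  ultimately have z: "TE.kappa l *\<^sub>C TE.sk (TE.sk s0 (int l) (iota X)) (1 - int l) b = (if l = 1 then TE.sk s0 0 b else 0)" for l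
    by (cases "l = 0"; cases "l = 1") (auto simp: TE.kappa_def)
  have "TE.psi s0 (iota X) 1 b = TE.sk s0 0 b"
    unfolding TE.psi_def z by (subst Sum_any_single[where a = 1]) auto
  then show ?thesis by (simp add: li.dact_def prodZQ_eq)
qed

end

section \<open>Nilpotent ranks\<close>

lemma tensor_map_exists:
  assumes "clinear f" "clinear g"
  shows "\<exists>m. clinear m \<and> (\<forall>x y. m (x \<otimes> y) = f x \<otimes> g y)"
proof -
  have b: "cbilinear (\<lambda>x y. f x \<otimes> g y)"
    unfolding cbilinear_def
    by (simp add: clinear_compose[OF clinear_tensor_left assms(1)] clinear_compose[OF clinear_tensor_right assms(2)])
  show ?thesis
    by (intro exI[of _ "tensor_lift (\<lambda>x y. f x \<otimes> g y)"]) (simp add: clinear_tensor_lift[OF b] tensor_lift_tensor_of[OF b])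
qed

text \<open>The nilpotent part is N tensor 1 + 1 tensor N'. In its power r + s - 1 every term of the
  binomial expansion vanishes, and in the power r + s - 2 exactly one survives, with a nonzero
  binomial coefficient.\<close>

lemma has_nilpotent_rank_tensor:
  fixes f :: "'m::complex_vector \<Rightarrow> 'm" and g :: "'n::complex_vector \<Rightarrow> 'n"
  assumes f: "has_nilpotent_rank f r" and g: "has_nilpotent_rank g s"
    and h: "clinear h" "\<And>x y. h (x \<otimes> y) = f x \<otimes> y + x \<otimes> g y"
  shows "has_nilpotent_rank h (r + s - 1)"
proof -
  from f obtain N x0 where r: "0 < r" and N: "nilpotent_part f N" "\<And>x. (N ^^ r) x = 0" and x0: "(N ^^ (r - 1)) x0 \<noteq> 0"
    by (auto simp: has_nilpotent_rank_def)
  from g obtain N' y0 where s: "0 < s" and N': "nilpotent_part g N'" "\<And>x. (N' ^^ s) x = 0" and y0: "(N' ^^ (s - 1)) y0 \<noteq> 0"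
    by (auto simp: has_nilpotent_rank_def)
  have lin: "clinear N" "clinear N'" using N N' by (auto simp: nilpotent_part_def)
  have comm: "f (N x) = N (f x)" "g (N' y) = N' (g y)" for x y
    using N(1) N'(1) by (auto simp: nilpotent_part_def dest: fun_cong[where x = x] fun_cong[where x = y])
  obtain m1 :: "('m, 'n) tensor \<Rightarrow> ('m, 'n) tensor" where m1: "clinear m1" "\<And>x y. m1 (x \<otimes> y) = N x \<otimes> y"
    using tensor_map_exists[OF lin(1) clinear_id] by blast
  obtain m2 :: "('m, 'n) tensor \<Rightarrow> ('m, 'n) tensor" where m2: "clinear m2" "\<And>x y. m2 (x \<otimes> y) = x \<otimes> N' y"
    using tensor_map_exists[OF clinear_id lin(2)] by blast
  define M where "M t = m1 t + m2 t" for t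
  have M: "clinear M" unfolding M_def[abs_def] by (rule clinear_plus[OF m1(1) m2(1)])
  have Mp: "M (x \<otimes> y) = N x \<otimes> y + x \<otimes> N' y" for x y by (simp add: M_def m1 m2)
  note pow = derivation_pow_tensor[OF M lin Mp]
  have Nz: "(N ^^ i) x = 0" if "r \<le> i" for i x
  proof -
    have "(N ^^ i) x = (N ^^ (i - r)) ((N ^^ r) x)" using that by (simp flip: funpow_add comp_apply[of "N ^^ (i - r)"])
    then show ?thesis by (simp add: N(2) clinear_0[OF clinear_funpow[OF lin(1)]])
  qed
  have Nz': "(N' ^^ i) x = 0" if "s \<le> i" for i x
  proof -
    have "(N' ^^ i) x = (N' ^^ (i - s)) ((N' ^^ s) x)" using that by (simp flip: funpow_add comp_apply[of "N' ^^ (i - s)"])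
    then show ?thesis by (simp add: N'(2) clinear_0[OF clinear_funpow[OF lin(2)]])
  qed
  have zero: "(M ^^ (r + s - 1)) t = 0" for t
  proof (rule clinear_tensor_eqI[OF clinear_funpow[OF M] clinear_zero_fun])
    fix x y
    have "(N ^^ i) x \<otimes> (N' ^^ (r + s - 1 - i)) y = 0" for i
      by (cases "r \<le> i") (simp_all add: Nz Nz')
    then show "(M ^^ (r + s - 1)) (x \<otimes> y) = 0" by (simp add: pow)
  qed
  have "(M ^^ (r + s - 2)) (x0 \<otimes> y0) \<noteq> 0"
  proof -
    have le: "r - 1 \<le> r + s - 2" using r s by linarith
    \<comment> \<open>Any index other than r - 1 makes one of the two powers reach its nilpotency
      index.\<close>
    have z: "of_nat ((r + s - 2) choose i) *\<^sub>C ((N ^^ i) x0 \<otimes> (N' ^^ (r + s - 2 - i)) y0) =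
        (if i = r - 1 then of_nat ((r + s - 2) choose i) *\<^sub>C ((N ^^ (r - 1)) x0 \<otimes> (N' ^^ (s - 1)) y0) else 0)" for i
    proof (cases "i = r - 1")
      case True
      then have "r + s - 2 - i = s - 1" using r s by simp
      then show ?thesis using True by simp
    next
      case False
      then have "r \<le> i \<or> s \<le> r + s - 2 - i" using r s by linarith
      then show ?thesis using False by (auto simp: Nz Nz')
    qed
    have "(M ^^ (r + s - 2)) (x0 \<otimes> y0) = of_nat ((r + s - 2) choose (r - 1)) *\<^sub>C ((N ^^ (r - 1)) x0 \<otimes> (N' ^^ (s - 1)) y0)"
      unfolding pow z using le by simp
    moreover have "(of_nat ((r + s - 2) choose (r - 1)) :: complex) \<noteq> 0" using le by simp
    ultimately show ?thesis using tensor_nonzero[OF x0 y0] by simp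
  qed
  moreover have "nilpotent_part h M"
    unfolding nilpotent_part_def
  proof (intro conjI allI)
    show "\<exists>n. (M ^^ n) x = 0" for x using zero by blast
    show "diagonalizable (\<lambda>t. h t - M t)"
      by (rule diagonalizable_tensor[of "\<lambda>x. f x - N x" "\<lambda>x. g x - N' x"])
        (use N(1) N'(1) in \<open>auto simp: nilpotent_part_def h(2) Mp tensor_diff_left tensor_diff_right\<close>)
    show "h \<circ> M = M \<circ> h"
    proof
      fix t
      show "(h \<circ> M) t = (M \<circ> h) t"
        unfolding comp_def
        by (rule clinear_tensor_eqI[OF clinear_compose[OF h(1) M] clinear_compose[OF M h(1)]])
          (simp add: Mp h(2) clinear_add[OF M] clinear_add[OF h(1)] comm)
    qed
  qed (rule M)
  ultimately show ?thesis
    using zero r s h(1) by (auto simp: has_nilpotent_rank_def numeral_2_eq_2 intro!: exI[of _ M])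
qed

lemma diagonalizable_has_nilpotent_rank:
  fixes x :: "'m::complex_vector" and f :: "'m \<Rightarrow> 'm"
  assumes "clinear f" "diagonalizable f" "x \<noteq> 0"
  shows "has_nilpotent_rank f 1"
  unfolding has_nilpotent_rank_def
proof (intro conjI exI[of _ "\<lambda>x. 0"])
  show "nilpotent_part f (\<lambda>x. 0)"
    using assms by (auto simp: nilpotent_part_def clinear_zero_fun clinear_0 intro: exI[of _ 1])
qed (use assms in auto)

text \<open>A diagonalizable operator has no generalized eigenvectors of rank two: S x - c x lies in
  the span of eigenvectors for eigenvalues other than c, and by assumption it is itself an
  eigenvector for c or zero.\<close>

lemma diagonalizable_kernel_pow:
  assumes S: "clinear S" "diagonalizable S" and x: "S (S x - c *\<^sub>C x) - c *\<^sub>C (S x - c *\<^sub>C x) = 0"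
  shows "S x = c *\<^sub>C x"
proof -
  let ?U = "cvec.span {y. \<exists>l. l \<in> - {c} \<and> S y = l *\<^sub>C y}"
  have "S y - c *\<^sub>C y \<in> ?U" for y
  proof -
    have "y \<in> cvec.span {x. \<exists>c. S x = c *\<^sub>C x}" using S(2) by (simp add: diagonalizable_def)
    then show ?thesis
    proof (induction rule: cvec.span_induct_alt)
      case base
      then show ?case by (simp add: clinear_0[OF S(1)] cvec.span_zero)
    next
      case (step s z y)
      then obtain l where l: "S z = l *\<^sub>C z" by blast
      have "S z - c *\<^sub>C z \<in> ?U"
      proof (cases "l = c")
        case False
        then have "z \<in> ?U" using l by (intro cvec.span_base) blast
        then show ?thesis by (simp add: l cvec.span_scale cvec.span_diff)
      qed (simp add: l cvec.span_zero)
      then have "s *\<^sub>C (S z - c *\<^sub>C z) + (S y - c *\<^sub>C y) \<in> ?U"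
        using step by (intro cvec.span_add cvec.span_scale)
      then show ?case
        by (simp add: clinear_add[OF S(1)] clinear_scaleC[OF S(1)] scaleC_add_right cvec.scale_right_diff_distrib scaleC_scaleC
          mult.commute algebra_simps)
    qed
  qed
  from eigen_independent[OF S(1) this[of x], of c] x have "S x - c *\<^sub>C x = 0" by simp
  then show ?thesis by simp
qed

text \<open>If the operator were diagonalizable, its nilpotent part would vanish on every
  eigenvector, hence everywhere. No uniqueness of the Jordan decomposition is invoked.\<close>

lemma has_nilpotent_rank_not_diagonalizable:
  assumes f: "has_nilpotent_rank f r" "2 \<le> r"
  shows "\<not> diagonalizable f"
proof
  assume d: "diagonalizable f"
  from f obtain N x0 where N: "nilpotent_part f N" "\<And>x. (N ^^ r) x = 0" and x0: "(N ^^ (r - 1)) x0 \<noteq> 0" and lin: "clinear f"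
    by (auto simp: has_nilpotent_rank_def)
  define S where "S x = f x - N x" for x
  have NN: "clinear N" "\<And>x. f (N x) = N (f x)" "diagonalizable S"
    using N(1) by (auto simp: nilpotent_part_def S_def[abs_def] dest: fun_cong)
  have S: "clinear S" unfolding S_def[abs_def] by (rule clinear_minus[OF lin NN(1)])
  have "N x = 0" if fx: "f x = c *\<^sub>C x" for x c
  proof -
    have e: "S y - c *\<^sub>C y = - N y" if "f y = c *\<^sub>C y" for y using that by (simp add: S_def)
    have ev: "f ((N ^^ n) x) = c *\<^sub>C (N ^^ n) x" for n
      by (induction n) (auto simp: NN fx clinear_scaleC[OF NN(1)])
    have "N ((N ^^ n) x) = 0 \<Longrightarrow> N x = 0" for n
    proof (induction n)
      case (Suc n)
      let ?y = "(N ^^ n) x"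
      \<comment> \<open>N preserves the eigenspace of \<open>f\<close> for c, and S - c is -N there.
        So N (N y) = 0 forces N y = 0 by \<open>diagonalizable_kernel_pow\<close>, and the power of
        N is lowered one step at a time.\<close>
      have "S (S ?y - c *\<^sub>C ?y) - c *\<^sub>C (S ?y - c *\<^sub>C ?y) = - (S (N ?y) - c *\<^sub>C N ?y)"
        unfolding e[OF ev] clinear_neg[OF S] by simp
      also have "\<dots> = N (N ?y)" using e[OF ev[of "Suc n"]] by simp
      also have "\<dots> = 0" using Suc.prems by simp
      finally have "S ?y = c *\<^sub>C ?y" by (rule diagonalizable_kernel_pow[OF S NN(3)])
      then have "N ?y = 0" using e[OF ev[of n]] by simp
      then show ?case by (rule Suc.IH)
    qed simp
    from this[of r] show "N x = 0" using N(2) by (simp add: clinear_0[OF NN(1)])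
  qed
  then have "cvec.span {x. \<exists>c. f x = c *\<^sub>C x} \<subseteq> {x. N x = 0}"
    by (intro cvec.span_minimal cvec.subspaceI)
      (auto simp: clinear_0[OF NN(1)] clinear_add[OF NN(1)] clinear_scaleC[OF NN(1)])
  then have "N x = 0" for x using d by (auto simp: diagonalizable_def)
  moreover obtain m where "r - 1 = Suc m" using f(2) by (cases "r - 1") auto
  ultimately show False using x0 by simp
qed

context bp_screening begin

definition NA :: "('z, 'q) tensor \<times> ('l, 'i) tensor \<Rightarrow> ('z, 'q) tensor \<times> ('l, 'i) tensor" where
  "NA = (\<lambda>(b, y). (0, TE.sk s0 0 b))"

text \<open>The nilpotent part is s_(0): it maps the algebra into \<open>E\<close> and kills
  \<open>E\<close>, so its square is zero. It commutes with the zero mode of X because it is a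
  derivation that annihilates X. The undeformed zero mode is diagonalizable on both
  summands.\<close>

lemma has_nilpotent_rank_X: "has_nilpotent_rank (li.dact X 1) 2"
proof -
  have D: "li.dact X 1 x = (case x of (b, y) \<Rightarrow> (prodZQ (iota X) 1 b, actE (iota X) 1 y)) + NA x" for x
    by (cases x) (simp add: dact_X NA_def)
  have "va_module A li.dact" by (rule li.dact_module)
  then have lin: "clinear (li.dact X 1)" by (simp add: va_module_def cbilinear_def)
  have linN: "clinear NA"
    by (rule clinearI) (auto simp: NA_def plus_prod_def scaleC_prod_def clinear_add[OF TE.sk_linear_right]
      clinear_scaleC[OF TE.sk_linear_right] split: prod.split)
  have NN: "(NA ^^ 2) x = 0" for x
    by (cases x) (simp add: NA_def numeral_2_eq_2 clinear_0[OF TE.sk_linear_right] zero_prod_def)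
  \<comment> \<open>A witness must lie outside the image of the Bershadsky-Polyakov algebra, which
    s_(0) annihilates; e^{-c} is sent to -v tensor e^{i-c}.\<close>
  have "NA (vacuum Z \<otimes> e (- 1), 0) \<noteq> 0"
  proof -
    have "TE.sk s0 0 (vacuum Z \<otimes> e (- 1)) = (\<Sum>p\<in>{- 1}. TL.sk v p (vacuum Z) \<otimes> F (0 - 1 - p))"
    proof (rule sk_pure_sum)
      fix p :: int assume "p \<notin> {- 1}"
      then have "0 \<le> p \<or> 0 < 0 - 1 - p" by auto
      then show "TL.sk v p (vacuum Z) = 0 \<or> F (0 - 1 - p) = 0" using sk_vacuum_0 F_pos by blast
    qed simp
    then have "TE.sk s0 0 (vacuum Z \<otimes> e (- 1)) = - (v \<otimes> EI (- 1))"
      by (simp add: sk_vacuum_L F_0 tensor_neg_right)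
    then show ?thesis using tensor_nonzero[OF v I.E_nonzero[of "- 1"]] by (simp add: NA_def zero_prod_def)
  qed
  moreover have "nilpotent_part (li.dact X 1) NA"
    unfolding nilpotent_part_def
  proof (intro conjI allI)
    show "\<exists>n. (NA ^^ n) x = 0" for x using NN by blast
    have "diagonalizable (\<lambda>(b, y). (prodZQ (iota X) 1 b, actE (iota X) 1 y))"
    proof (rule diagonalizable_prod)
      show "diagonalizable (prodZQ (iota X) 1)"
        by (rule diagonalizable_tensor[OF diagonalizable_T lat.L.grading_diagonalizable[of "- ((2 * k + 3) / 3)" "1 / 2"]])
          (simp add: iota_X clinear_add[OF ZQ.self.act_linear_left] ZQ.self.act_vacuum_left ZQ.self.act_vacuum_right qX_1)
      show "diagonalizable (actE (iota X) 1)"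
        by (rule diagonalizable_tensor[OF diagonalizable_T_act I.grading_diagonalizable[of "- ((2 * k + 3) / 3)" "1 / 2"]])
          (simp add: iota_X E.T.act_add_left E.act_vacuum_left E.act_vacuum_right qX_1)
    qed (simp_all add: clinear_0[OF ZQ.self.act_linear_right] clinear_0[OF E.act_linear_right])
    then show "diagonalizable (\<lambda>x. li.dact X 1 x - NA x)" by (simp add: D)
    show "li.dact X 1 \<circ> NA = NA \<circ> li.dact X 1"
    proof
      fix x :: "('z, 'q) tensor \<times> ('l, 'i) tensor"
      obtain b y where x: "x = (b, y)" by force
      have "TE.sk s0 0 (prodZQ (iota X) 1 b) = actE (iota X) 1 (TE.sk s0 0 b)"
        using TE.sk_derivation[of s0 "iota X" 1 b] by (simp add: screening prodZQ_eq)
      then show "(li.dact X 1 \<circ> NA) x = (NA \<circ> li.dact X 1) x"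
        by (simp add: x dact_X NA_def clinear_0[OF ZQ.self.act_linear_right] clinear_0[OF TE.sk_linear_right])
    qed
  qed (rule linN)
  ultimately show ?thesis
    using NN lin by (auto simp: has_nilpotent_rank_def intro!: exI[of _ NA])
qed

end

lemma va_module_pullback:
  assumes f: "va_hom V V' f" and act: "va_module V' act"
  shows "va_module V (\<lambda>a. act (f a))"
  using act unfolding va_module_def va_hom_nprod[OF f] va_hom_vacuum[OF f] cbilinear_def
  using clinear_compose[OF _ va_hom_linear[OF f]] by blast

lemma simple_quotientD:
  assumes "simple_quotient V S p"
  shows "vertex_algebra S" "va_hom V S p" "surj p"
  using assms by (auto simp: simple_quotient_def simple_va_def)

text \<open>Operator products of the universal algebras pass to the simple quotients, and those of
  G^- further along the embedding. Generating sets pass to the quotients because the quotient maps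
  are surjective.\<close>

lemma bp_screeningI:
  assumes k3: "k + 3 \<noteq> 0"
    and bp: "universal_bp k BPk J Gp Gm LBP" "simple_quotient BPk Wk pW"
    and zam: "universal_zamolodchikov k H a1 a2 Zuniv T W miura" "simple_quotient Zuniv Zk pZ"
    and half: "half_lattice Q c d e"
    and hw: "zam_irreducible_hw Zk (pZ T) (pZ W) ((4 * k + 9) / 3)
          (- ((k + 3) * (4 * k + 9) * (5 * k + 12) / 27)) actL hw"
    and I: "half_lattice_module Q c d e (- ((2 * k + 3) / 6)) 1 actI EI"
    and iota: "bp_embedding k Wk (pW J) (pW Gp) (pW Gm) Zk (pZ T) (pZ W) Q c d e iota"
  shows "bp_screening Zk (pZ T) (pZ W) (- (2 * (3 * k + 5) * (4 * k + 9) / (k + 3))) Q c d e k actL hw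
    ((4 * k + 9) / 3) (- ((k + 3) * (4 * k + 9) * (5 * k + 12) / 27)) actI EI Wk (pW J) (pW Gp) (pW Gm) (pW LBP) iota"
proof -
  let ?cc = "- (2 * (3 * k + 5) * (4 * k + 9) / (k + 3))"
  note pZ = simple_quotientD[OF zam(2)] and pW = simple_quotientD[OF bp(2)]
  have Z: "va_generated Zuniv {T, W}" "virasoro Zuniv ?cc T" "primary Zuniv T 3 W"
    using zam(1) by (auto simp: universal_zamolodchikov_def)
  note B = bp(1)[unfolded universal_bp_def]
  note Zs = va_hom_nprod[OF pZ(2)] va_hom_vacuum[OF pZ(2)] clinear_scaleC[OF va_hom_linear[OF pZ(2)]] clinear_0[OF va_hom_linear[OF pZ(2)]]
    clinear_neg[OF va_hom_linear[OF pZ(2)]]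
  interpret Zk: vertex_alg Zk by (rule vertex_alg.intro[OF pZ(1)])
  interpret Wk: vertex_alg Wk by (rule vertex_alg.intro[OF pW(1)])
  interpret zam_alg Zk "pZ T" "pZ W" ?cc
  proof
    show "va_generated Zk {pZ T, pZ W}"
      using va_generated_image[OF pZ(2,3), of "{T, W}"] Z(1) by simp
    show "virasoro Zk ?cc (pZ T)"
      using ope_image[OF pZ(2) Z(2)[unfolded virasoro_def]] by (simp add: virasoro_def Zs)
    show "primary Zk (pZ T) 3 (pZ W)"
      using ope_image[OF pZ(2) Z(3)[unfolded primary_def]] by (simp add: primary_def Zs)
  qed
  interpret lat: bp_lattice Q c d e k
    by unfold_locales (rule half)
  interpret w3_bp Zk "pZ T" "pZ W" ?cc Q c d e k
    by unfold_locales (rule k3)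
  have hom: "va_hom Wk (tensor_va Zk Q) iota" and iJ: "iota (pW J) = vacuum Zk \<otimes> lat.j" and iGp: "iota (pW Gp) = vacuum Zk \<otimes> e 1"
    and iGm: "iota (pW Gm) = G"
    using iota by (auto simp: bp_embedding_def Let_def G_def W'_def rho_def lat.pvec_def lat.i_def lat.j_def)
  interpret w3_ope Zk "pZ T" "pZ W" ?cc Q c d e k
  proof
    fix n :: int assume n: "0 \<le> n"
    have "ope Wk (pW Gm) (pW Gm) []" using ope_image[OF pW(2), of Gm Gm "[]"] B by simp
    then have "ope (tensor_va Zk Q) G G []" using ope_image[OF hom, of "pW Gm" "pW Gm" "[]"] by (simp add: iGm)
    then show "prodZQ G n G = 0" using n unfolding ope_def by (auto simp: tensor_va_def dest: spec[of _ "nat n"])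
  qed
  interpret w3_hw Zk "pZ T" "pZ W" ?cc Q c d e k actL hw "(4 * k + 9) / 3" "- ((k + 3) * (4 * k + 9) * (5 * k + 12) / 27)"
    by unfold_locales (use hw in \<open>auto simp: zam_irreducible_hw_def\<close>)
  interpret I: half_lattice_mod Q c d e "- ((2 * k + 3) / 6)" 1 actI EI
    by unfold_locales (rule I)
  interpret w3_screening Zk "pZ T" "pZ W" ?cc Q c d e k actL hw "(4 * k + 9) / 3" "- ((k + 3) * (4 * k + 9) * (5 * k + 12) / 27)" actI EI ..
  show ?thesis
  proof
    show "va_generated Wk {pW J, pW Gp, pW Gm, pW LBP}"
      using va_generated_image[OF pW(2,3) freely_strongly_generated_imp_generated, of "[J, Gp, Gm, LBP]"] B by simp
    have "ope BPk Gp Gm [3 *\<^sub>C nop BPk J J + (3 * (k + 1) / 2) *\<^sub>C der BPk J - (k + 3) *\<^sub>C LBP,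
        (3 * (k + 1)) *\<^sub>C J, ((k + 1) * (2 * k + 3)) *\<^sub>C vacuum BPk]" using B by simp
    then have "nprod BPk Gp 0 Gm = 3 *\<^sub>C nop BPk J J + (3 * (k + 1) / 2) *\<^sub>C der BPk J - (k + 3) *\<^sub>C LBP"
      unfolding ope_def by (auto dest: spec[of _ 0])
    from arg_cong[OF this, of pW]
    show "nprod Wk (pW Gp) 0 (pW Gm) = 3 *\<^sub>C nop Wk (pW J) (pW J) + (3 * (k + 1) / 2) *\<^sub>C der Wk (pW J) - (k + 3) *\<^sub>C pW LBP"
      by (simp add: va_hom_nprod[OF pW(2)] va_hom_vacuum[OF pW(2)] clinear_scaleC[OF va_hom_linear[OF pW(2)]]
        clinear_add[OF va_hom_linear[OF pW(2)]] clinear_diff[OF va_hom_linear[OF pW(2)]])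
  qed (rule hom iJ iGp iGm)+
qed

section \<open>The nilpotent rank on the full tensor product\<close>

theorem proposition11p2:
  fixes u v :: nat and k lam :: complex and r s :: int
    and Vk :: "'a::complex_vector va" and x :: "complex^3^3 \<Rightarrow> 'a"
    and Lk :: "'b::complex_vector va" and pL :: "'a \<Rightarrow> 'b"
    and BPk :: "'c::complex_vector va" and J Gp Gm LBP :: 'c
    and Wk :: "'w::complex_vector va" and pW :: "'c \<Rightarrow> 'w"
    and H :: "'h::complex_vector va" and a1 a2 :: 'h
    and Zuniv :: "'y::complex_vector va" and T W :: 'y and miura :: "'y \<Rightarrow> 'h"
    and Zk :: "'z::complex_vector va" and pZ :: "'y \<Rightarrow> 'z"
    and Q :: "'q::complex_vector va" and c d :: 'q and e :: "int \<Rightarrow> 'q"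
    and actL :: "'z \<Rightarrow> int \<Rightarrow> 'l::complex_vector \<Rightarrow> 'l" and hw :: 'l
    and actI :: "'q \<Rightarrow> int \<Rightarrow> 'i::complex_vector \<Rightarrow> 'i" and EI :: "int \<Rightarrow> 'i"
    and iota :: "'w \<Rightarrow> ('z, 'q) tensor"
    and S :: "'s::complex_vector va" and b g :: 's
    and actP :: "'s \<Rightarrow> int \<Rightarrow> 'p::complex_vector \<Rightarrow> 'p"
    and actF :: "'q \<Rightarrow> int \<Rightarrow> 'f::complex_vector \<Rightarrow> 'f" and EF :: "int \<Rightarrow> 'f"
    and phi :: "'b \<Rightarrow> (('w, 's) tensor, 'q) tensor"
  assumes level: "k = - 3 + of_nat u / of_nat v" "coprime u v" "3 \<le> u" "4 \<le> v"
    and affine: "universal_affine_sl3 k Vk x" "simple_quotient Vk Lk pL"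
    and bp: "universal_bp k BPk J Gp Gm LBP" "simple_quotient BPk Wk pW"
    and zam: "universal_zamolodchikov k H a1 a2 Zuniv T W miura" "simple_quotient Zuniv Zk pZ"
    and half: "half_lattice Q c d e"
    and L_11_12: "zam_irreducible_hw Zk (pZ T) (pZ W) ((4 * k + 9) / 3)
          (- ((k + 3) * (4 * k + 9) * (5 * k + 12) / 27)) actL hw"
    and Pi_i: "half_lattice_module Q c d e (- ((2 * k + 3) / 6)) 1 actI EI"
    and iota: "bp_embedding k Wk (pW J) (pW Gp) (pW Gm) Zk (pZ T) (pZ W) Q c d e iota"
    and ghost: "beta_gamma S b g"
    and P_s: "ghost_projective_cover S b g s actP"
    and P_s_rank: "has_nilpotent_rank (actP (nop S (der S g) b) 1) 2"
    and Pi_r: "half_lattice_module Q c d e lam r actF EF"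
    and phi: "affine_embedding k Lk (pL \<circ> x) Wk (pW J) (pW Gp) (pW Gm) (pW LBP) S b g Q c d e phi"
  shows
    "let V = calV Zk (pZ T) Q c d (tensor_act actL actI);
         s0 = (0, hw \<otimes> EI 0);
         actV = (\<lambda>a. delta_act V s0 (iota a, 0));
         actM = (\<lambda>a. tensor_act (tensor_act actV actP) actF (phi a));
         Lsug = sugawara k Lk (pL \<circ> x)
     in (\<forall>a. delta_log_free V s0 (iota a, 0)) \<and>
        logarithmic_module Lk Lsug actM \<and>
        has_nilpotent_rank (actM Lsug 1) 3"
proof -
  have "k + 3 \<noteq> 0" using level by simp
  then interpret B: bp_screening Zk "pZ T" "pZ W" "- (2 * (3 * k + 5) * (4 * k + 9) / (k + 3))" Q c d e k actL hw
    "(4 * k + 9) / 3" "- ((k + 3) * (4 * k + 9) * (5 * k + 12) / 27)" actI EI Wk "pW J" "pW Gp" "pW Gm" "pW LBP" iota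
    by (rule bp_screeningI[OF _ bp zam half L_11_12 Pi_i iota])
  define V where "V = calV Zk (pZ T) Q c d (tensor_act actL actI)"
  have V: "V = extension_va (tensor_va Zk Q) B.actE (B.actE B.omega 0)"
    by (simp add: V_def calV_def B.omega_def)
  have actV: "(\<lambda>a. delta_act V (0, hw \<otimes> EI 0) (iota a, 0)) = B.li.dact"
    unfolding V by (intro ext) (rule B.li.delta_act_eq)
  have log_free: "\<forall>a. delta_log_free V (0, hw \<otimes> EI 0) (iota a, 0)"
    unfolding V by (intro allI) (rule B.li.delta_log_free)
  have SP: "vertex_algebra S" "va_module S actP"
    using ghost P_s by (auto simp: beta_gamma_def ghost_projective_cover_def ghost_projective_def ghost_module_def)
  interpret F: half_lattice_mod Q c d e lam r actF EF
    by unfold_locales (rule Pi_r)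
  interpret S: vertex_alg S by (rule vertex_alg.intro[OF SP(1)])
  interpret D: vmod Wk B.li.dact by (rule vmod.intro[OF B.li.dact_module])
  interpret P: vmod S actP by (rule vmod.intro[OF SP(2)])
  interpret DP: tensor_mod Wk B.li.dact S actP ..
  interpret WS: tensor_alg Wk S ..
  interpret M: tensor_mod "tensor_va Wk S" "tensor_act B.li.dact actP" Q actF ..
  define actM where "actM a = tensor_act (tensor_act B.li.dact actP) actF (phi a)" for a
  define Lsug where "Lsug = sugawara k Lk (pL \<circ> x)"
  have hom: "va_hom Lk (tensor_va (tensor_va Wk S) Q) phi"
    using phi by (simp add: affine_embedding_def)
  have module: "va_module Lk actM"
    unfolding actM_def[abs_def] by (rule va_module_pullback[OF hom M.tensor_va_module])
  define q where "q = (1 / 2) *\<^sub>C nop Q c d + (k / 3) *\<^sub>C der Q c - (1 / 2) *\<^sub>C der Q d"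
  let ?gb = "nop S (der S g) b"
  have "phi Lsug = (B.X \<otimes> vacuum S + vacuum Wk \<otimes> ?gb) \<otimes> vacuum Q + (vacuum Wk \<otimes> vacuum S) \<otimes> q"
    using phi unfolding affine_embedding_def Let_def Lsug_def
    by (simp add: B.X_def q_def tensor_add_left tensor_scale_left add.assoc)
  moreover have vacuum_WS: "vacuum (tensor_va Wk S) = vacuum Wk \<otimes> vacuum S" by (simp add: tensor_va_def)
  ultimately have pure: "actM Lsug 1 (t \<otimes> z) = tensor_act B.li.dact actP (B.X \<otimes> vacuum S + vacuum Wk \<otimes> ?gb) 1 t \<otimes> z + t \<otimes> actF q 1 z" for t z
    using M.act_vacuum_left[of q 1 t z] by (simp add: actM_def M.T.act_add_left M.act_vacuum_right vacuum_WS)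
  \<comment> \<open>The ranks two of the deformed module and of P_s combine to 2 + 2 - 1 = 3. The
    last factor is diagonalizable, hence of rank one, and leaves the rank unchanged.\<close>
  have "has_nilpotent_rank (tensor_act B.li.dact actP (B.X \<otimes> vacuum S + vacuum Wk \<otimes> ?gb) 1) (2 + 2 - 1)"
    by (rule has_nilpotent_rank_tensor[OF B.has_nilpotent_rank_X P_s_rank DP.act_linear_right])
      (simp add: DP.T.act_add_left DP.act_vacuum_left DP.act_vacuum_right)
  moreover have "has_nilpotent_rank (actF q 1) 1"
  proof (rule diagonalizable_has_nilpotent_rank[OF F.M.act_linear_right _ F.E_nonzero])
    \<comment> \<open>The sign of k/3 changes because mode 1 of \<open>der c\<close> is minus mode 0
      of \<open>c\<close>; likewise for \<open>d\<close>.\<close>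
    have "actF q 1 = F.grading (- (k / 3)) (1 / 2)"
      by (intro ext) (simp add: q_def F.grading_def F.M.act_lin F.M.act_der)
    then show "diagonalizable (actF q 1)" using F.grading_diagonalizable by simp
  qed
  ultimately have "has_nilpotent_rank (actM Lsug 1) (2 + 2 - 1 + 1 - 1)"
    by (rule has_nilpotent_rank_tensor[OF _ _ _ pure]) (simp add: actM_def M.act_linear_right)
  then have rank: "has_nilpotent_rank (actM Lsug 1) 3" by simp
  moreover have "\<not> diagonalizable (actM Lsug 1)"
    by (rule has_nilpotent_rank_not_diagonalizable[OF rank]) simp
  ultimately have "(\<forall>a. delta_log_free V (0, hw \<otimes> EI 0) (iota a, 0)) \<and> logarithmic_module Lk Lsug actM \<and> has_nilpotent_rank (actM Lsug 1) 3"
    using log_free module by (simp add: logarithmic_module_def)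
  then show ?thesis
    unfolding Let_def V_def[symmetric] actV actM_def[abs_def] Lsug_def .
qed

end
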